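(* Let $(E,\mu,\Gamma)$ be a Markov triple with algebra $\mathcal{A}$ and semigroup $(P_t)_{t\ge0}$. Let $\rho\in\mathbb{R}$, let $I\subseteq\mathbb{R}$ be an interval, and let $M\colon I\times\mathbb{R}^+\to\mathbb{R}$, $(x,y)\mapsto M(x,y)$, be of class $\mathcal{C}^2$ with $M_y\ge0$ on its domain. For $t,\alpha\ge0$ and $s\in[0,t]$ define $$h_\alpha(s)=\frac{e^{2\rho(t-s)}-1}{\rho}+\alpha e^{2\rho(t-s)}\qquad(=2(t-s)+\alpha\text{ when }\rho=0),$$ and consider the inequality $$(\ast)\qquad M\big(P_tf,h_\alpha(0)\Gamma(P_tf)\big)\le P_t\,M\big(f,\alpha\Gamma(f)\big)\qquad\text{for all } f\in\mathcal{A}\text{ with values in }I.$$ (i) Assume that $\Gamma_2(f)\ge\rho\,\Gamma(f)$ for all $f\in\mathcal{A}$ and that the matrix $$B=\begin{pmatrix} M_{xx}-2M_y & M_{xy}\\ M_{xy} & M_{yy}+\frac{M_y}{2y}\end{pmatrix}$$ is positive semi-definite (at every point $(x,y)$ of the domain, $y>0$). Then for every $t\ge0$, $\alpha\ge 0$ and every $f\in\mathcal{A}$ with values in $I$, the map $$s\in[0,t]\mapsto H(s)=P_s\,M\big(P_{t-s}f,h_\alpha(s)\Gamma(P_{t-s}f)\big)$$ is non-decreasing. In particular $(\ast)$ holds for all $t,\alpha\ge0$. (ii) Assume that there exist $t_o>0$ and $C\ge0$ such that $(\ast)$ holds for every $\alpha\ge C$ and every $t\in[0,t_o]$. Assume also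 that $M_y$ is not identically $0$. Then $\Gamma_2(f)\ge\rho\,\Gamma(f)$ for all $f\in\mathcal{A}$.
   Context: Markov triple $(E,\mu,\Gamma)$ (in the sense of the Bakry–Gentil–Ledoux monograph "Analysis and Geometry of Markov Diffusion Operators", Ch. 3): $(E,\mathcal{E},\mu)$ is a probability space; $\mathcal{A}$ is an algebra of bounded real-valued functions on $E$, dense in every $L^p(\mu)$, $1\le p<\infty$, containing the constant $1$ and stable under smooth functions: $f_i\in\mathcal{A}$ and $\Psi\in\mathcal{C}^\infty(\mathbb{R}^k)$ with $\Psi(0)=0$ imply $\Psi(f_1,\dots,f_k)\in\mathcal{A}$. The carré du champ $\Gamma\colon\mathcal{A}\times\mathcal{A}\to\mathcal{A}$ is symmetric bilinear, $\Gamma(f):=\Gamma(f,f)\ge 0$, and satisfies the diffusion property $\Gamma(\Psi(f_1,\dots,f_k),g)=\sum_i\partial_i\Psi(f_1,\dots,f_k)\Gamma(f_i,g)$. For every $f\in\mathcal{A}$ there is $C(f)$ with $|\int\Gamma(f,g)d\mu|\le C(f)\|g\|_2$ for all $g\in\mathcal{A}$. The symmetric diffusion operator $L$ is defined by $\int gLf\,d\mu=-\int\Gamma(f,g)d\mu$, and $Lf\in\mathcal{A}$ for $f\in\mathcal{A}$; it satisfies $L\Psi(f_1,\dots,f_k)=\sum_i\partial_i\Psi\,Lf_i+\sum_{i,j}\partial^2_{ij}\Psi\,\Gamma(f_i,f_j)$. $(P_t)_{t\ge0}$ is the semigroup with generator $L$ ($\partial_tP_t=LP_t=P_tL$); it preserves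 positivity, $P_t1=1$, and $L$ is ergodic ($Lf=0$ for $f$ in the domain of $L$ implies $f$ constant). The iterated operator is $\Gamma_2(f,g)=\frac12\big(L\Gamma(f,g)-\Gamma(f,Lg)-\Gamma(Lf,g)\big)$, $\Gamma_2(f)=\Gamma_2(f,f)$. $M_x,M_y,M_{xx},M_{xy},M_{yy}$ denote partial derivatives of $M$. *)

theory Defs
  imports "HOL-Probability.Probability"
begin

text \<open>
  Smooth functions on \<open>\<real>\<^sup>k\<close> with arbitrary \<open>k :: nat\<close> are represented as functions on
  \<open>nat \<Rightarrow> real\<close> depending on the coordinates below \<open>k\<close> only. For such functions, continuity
  in the product topology of \<open>nat \<Rightarrow> real\<close> is continuity on \<open>\<real>\<^sup>k\<close>.
\<close>

definition partial_deriv :: "nat \<Rightarrow> ((nat \<Rightarrow> real) \<Rightarrow> real) \<Rightarrow> (nat \<Rightarrow> real) \<Rightarrow> real" where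
  "partial_deriv i \<Psi> v = deriv (\<lambda>s. \<Psi> (v(i := s))) (v i)"

definition smooth_fun :: "nat \<Rightarrow> ((nat \<Rightarrow> real) \<Rightarrow> real) \<Rightarrow> bool" where
  "smooth_fun k \<Psi> \<longleftrightarrow>
     (\<forall>u v. (\<forall>i<k. u i = v i) \<longrightarrow> \<Psi> u = \<Psi> v) \<and>
     (\<forall>js. set js \<subseteq> {..<k} \<longrightarrow>
        continuous_on UNIV (foldr partial_deriv js \<Psi>) \<and>
        (\<forall>i<k. \<forall>v. (\<lambda>s. foldr partial_deriv js \<Psi> (v(i := s))) differentiable (at (v i))))"

definition square_int :: "'a measure \<Rightarrow> ('a \<Rightarrow> real) \<Rightarrow> bool" where
  "square_int \<mu> f \<longleftrightarrow> f \<in> borel_measurable \<mu> \<and> integrable \<mu> (\<lambda>z. (f z)\<^sup>2)"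

definition L2_norm :: "'a measure \<Rightarrow> ('a \<Rightarrow> real) \<Rightarrow> real" where
  "L2_norm \<mu> f = sqrt (\<integral>z. (f z)\<^sup>2 \<partial>\<mu>)"

text \<open>\<open>f\<close> lies in the domain of the \<open>L\<^sup>2(\<mu>)\<close>-generator of \<open>P\<close>, and the generator maps \<open>f\<close> to \<open>g\<close>.\<close>

definition in_generator ::
    "'a measure \<Rightarrow> (real \<Rightarrow> ('a \<Rightarrow> real) \<Rightarrow> 'a \<Rightarrow> real) \<Rightarrow> ('a \<Rightarrow> real) \<Rightarrow> ('a \<Rightarrow> real) \<Rightarrow> bool" where
  "in_generator \<mu> P f g \<longleftrightarrow> square_int \<mu> f \<and> square_int \<mu> g \<and>
     ((\<lambda>t. L2_norm \<mu> (\<lambda>z. (P t f z - f z) / t - g z)) \<longlongrightarrow> 0) (at_right 0)"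

text \<open>
  Markov triples. Elements of \<open>A\<close>, and the results of \<open>\<Gamma>\<close>, \<open>L\<close> and \<open>P\<close>, are functions on
  \<open>space \<mu>\<close>, but as usual all identities and inequalities between them hold \<open>\<mu>\<close>-almost everywhere.
  The operators \<open>L\<close> and \<open>P t\<close> are parameters; the axioms determine them almost everywhere.

  The semigroup acts on \<open>L\<^sup>2(\<mu>)\<close>. Its generator extends \<open>L\<close> from \<open>A\<close>, and \<open>A\<close> is stable under the
  semigroup (which is what gives a meaning to \<open>\<Gamma> (P t f) (P t f)\<close>); by the semigroup law these two
  facts are the equations \<open>\<partial>\<^sub>t P\<^sub>t f = L P\<^sub>t f = P\<^sub>t L f\<close> for \<open>f \<in> A\<close>. Ergodicity concerns all of the
  \<open>L\<^sup>2\<close>-domain of the generator.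
\<close>

locale markov_triple = prob_space \<mu>
  for \<mu> :: "'a measure"
    and A :: "('a \<Rightarrow> real) set"
    and \<Gamma> :: "('a \<Rightarrow> real) \<Rightarrow> ('a \<Rightarrow> real) \<Rightarrow> 'a \<Rightarrow> real"
    and L :: "('a \<Rightarrow> real) \<Rightarrow> 'a \<Rightarrow> real"
    and P :: "real \<Rightarrow> ('a \<Rightarrow> real) \<Rightarrow> 'a \<Rightarrow> real" +
  assumes A_measurable: "f \<in> A \<Longrightarrow> f \<in> borel_measurable \<mu>"
    and A_bounded: "f \<in> A \<Longrightarrow> \<exists>c. \<forall>z\<in>space \<mu>. \<bar>f z\<bar> \<le> c"
    and A_one: "(\<lambda>_. 1) \<in> A"
    and A_lin: "f \<in> A \<Longrightarrow> g \<in> A \<Longrightarrow> (\<lambda>z. a * f z + b * g z) \<in> A"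
    and A_mult: "f \<in> A \<Longrightarrow> g \<in> A \<Longrightarrow> (\<lambda>z. f z * g z) \<in> A"
    and A_dense: "1 \<le> p \<Longrightarrow> f \<in> borel_measurable \<mu> \<Longrightarrow> integrable \<mu> (\<lambda>z. \<bar>f z\<bar> powr p) \<Longrightarrow> 0 < \<epsilon> \<Longrightarrow>
      \<exists>g\<in>A. (\<integral>z. \<bar>f z - g z\<bar> powr p \<partial>\<mu>) < \<epsilon>"
    and A_smooth: "smooth_fun k \<Psi> \<Longrightarrow> \<Psi> (\<lambda>_. 0) = 0 \<Longrightarrow> (\<And>i. i < k \<Longrightarrow> F i \<in> A) \<Longrightarrow>
      (\<lambda>z. \<Psi> (\<lambda>i. F i z)) \<in> A"
    and \<Gamma>_closed: "f \<in> A \<Longrightarrow> g \<in> A \<Longrightarrow> \<Gamma> f g \<in> A"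
    and \<Gamma>_sym: "f \<in> A \<Longrightarrow> g \<in> A \<Longrightarrow> AE z in \<mu>. \<Gamma> f g z = \<Gamma> g f z"
    and \<Gamma>_lin: "f \<in> A \<Longrightarrow> g \<in> A \<Longrightarrow> h \<in> A \<Longrightarrow>
      AE z in \<mu>. \<Gamma> (\<lambda>z. a * f z + b * g z) h z = a * \<Gamma> f h z + b * \<Gamma> g h z"
    and \<Gamma>_nonneg: "f \<in> A \<Longrightarrow> AE z in \<mu>. 0 \<le> \<Gamma> f f z"
    and \<Gamma>_diffusion: "smooth_fun k \<Psi> \<Longrightarrow> \<Psi> (\<lambda>_. 0) = 0 \<Longrightarrow> (\<And>i. i < k \<Longrightarrow> F i \<in> A) \<Longrightarrow> g \<in> A \<Longrightarrow>
      AE z in \<mu>. \<Gamma> (\<lambda>z. \<Psi> (\<lambda>i. F i z)) g z = (\<Sum>i<k. partial_deriv i \<Psi> (\<lambda>i. F i z) * \<Gamma> (F i) g z)"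
    and \<Gamma>_L2_bound: "f \<in> A \<Longrightarrow> \<exists>c. \<forall>g\<in>A. \<bar>\<integral>z. \<Gamma> f g z \<partial>\<mu>\<bar> \<le> c * L2_norm \<mu> g"
    and L_closed: "f \<in> A \<Longrightarrow> L f \<in> A"
    and L_by_parts: "f \<in> A \<Longrightarrow> g \<in> A \<Longrightarrow> (\<integral>z. g z * L f z \<partial>\<mu>) = - (\<integral>z. \<Gamma> f g z \<partial>\<mu>)"
    and L_diffusion: "smooth_fun k \<Psi> \<Longrightarrow> \<Psi> (\<lambda>_. 0) = 0 \<Longrightarrow> (\<And>i. i < k \<Longrightarrow> F i \<in> A) \<Longrightarrow>
      AE z in \<mu>. L (\<lambda>z. \<Psi> (\<lambda>i. F i z)) z =
        (\<Sum>i<k. partial_deriv i \<Psi> (\<lambda>i. F i z) * L (F i) z) +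
        (\<Sum>i<k. \<Sum>j<k. partial_deriv i (partial_deriv j \<Psi>) (\<lambda>i. F i z) * \<Gamma> (F i) (F j) z)"
    and P_L2: "0 \<le> t \<Longrightarrow> square_int \<mu> f \<Longrightarrow> square_int \<mu> (P t f)"
    and P_lin: "0 \<le> t \<Longrightarrow> square_int \<mu> f \<Longrightarrow> square_int \<mu> g \<Longrightarrow>
      AE z in \<mu>. P t (\<lambda>z. a * f z + b * g z) z = a * P t f z + b * P t g z"
    and P_contraction: "0 \<le> t \<Longrightarrow> square_int \<mu> f \<Longrightarrow> L2_norm \<mu> (P t f) \<le> L2_norm \<mu> f"
    and P_zero: "square_int \<mu> f \<Longrightarrow> AE z in \<mu>. P 0 f z = f z"
    and P_add: "0 \<le> s \<Longrightarrow> 0 \<le> t \<Longrightarrow> square_int \<mu> f \<Longrightarrow> AE z in \<mu>. P (s + t) f z = P s (P t f) z"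
    and P_strongly_continuous:
      "square_int \<mu> f \<Longrightarrow> ((\<lambda>t. L2_norm \<mu> (\<lambda>z. P t f z - f z)) \<longlongrightarrow> 0) (at_right 0)"
    and P_positive: "0 \<le> t \<Longrightarrow> square_int \<mu> f \<Longrightarrow> AE z in \<mu>. 0 \<le> f z \<Longrightarrow> AE z in \<mu>. 0 \<le> P t f z"
    and P_one: "0 \<le> t \<Longrightarrow> AE z in \<mu>. P t (\<lambda>_. 1) z = 1"
    and P_closed: "0 \<le> t \<Longrightarrow> f \<in> A \<Longrightarrow> P t f \<in> A"
    and P_generator: "f \<in> A \<Longrightarrow> in_generator \<mu> P f (L f)"
    and ergodic: "in_generator \<mu> P f (\<lambda>_. 0) \<Longrightarrow> \<exists>c. AE z in \<mu>. f z = c"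

definition Gamma2 ::
    "(('a \<Rightarrow> real) \<Rightarrow> ('a \<Rightarrow> real) \<Rightarrow> 'a \<Rightarrow> real) \<Rightarrow> (('a \<Rightarrow> real) \<Rightarrow> 'a \<Rightarrow> real) \<Rightarrow>
     ('a \<Rightarrow> real) \<Rightarrow> ('a \<Rightarrow> real) \<Rightarrow> 'a \<Rightarrow> real" where
  "Gamma2 \<Gamma> L f g z = (L (\<Gamma> f g) z - \<Gamma> f (L g) z - \<Gamma> (L f) g z) / 2"

text \<open>
  The usual extension of the positive operator \<open>P t\<close> to arbitrary measurable functions:
  \<open>P\<^sub>t g = P\<^sub>t g\<^sup>+ - P\<^sub>t g\<^sup>-\<close>, where \<open>P\<^sub>t\<close> of a nonnegative function is the monotone limit over its
  truncations. It is needed because \<open>M (f, \<alpha> \<Gamma> f)\<close> may be unbounded when \<open>I\<close> is not closed.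
  The convention \<open>\<infinity> - \<infinity> = \<infinity>\<close> of \<open>ereal\<close> has no effect where \<open>g\<close> is a.e. bounded below.
\<close>

definition semigroup_ext ::
    "(real \<Rightarrow> ('a \<Rightarrow> real) \<Rightarrow> 'a \<Rightarrow> real) \<Rightarrow> real \<Rightarrow> ('a \<Rightarrow> real) \<Rightarrow> 'a \<Rightarrow> ereal" where
  "semigroup_ext P t g x =
     (SUP n::nat. ereal (P t (\<lambda>z. min (real n) (max 0 (g z))) x)) -
     (SUP n::nat. ereal (P t (\<lambda>z. min (real n) (max 0 (- g z))) x))"

text \<open>
  \<open>M (u, v)\<close> as a function on the underlying space; the pair \<open>(u, v)\<close> lies in the domain
  \<open>I \<times> [0, \<infinity>)\<close> of \<open>M\<close> only almost everywhere, and the value 0 on the exceptional null set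
  makes the composition measurable.
\<close>

definition compose_on ::
    "real set \<Rightarrow> (real \<Rightarrow> real \<Rightarrow> real) \<Rightarrow> ('a \<Rightarrow> real) \<Rightarrow> ('a \<Rightarrow> real) \<Rightarrow> 'a \<Rightarrow> real" where
  "compose_on I M u v z = (if u z \<in> I \<and> 0 \<le> v z then M (u z) (v z) else 0)"

text \<open>
  \<open>M\<close> is of class \<open>C\<^sup>2\<close> on \<open>I \<times> [0, \<infinity>)\<close> with the given partial derivatives, which are one-sided
  at boundary points belonging to the domain. For an interval \<open>I\<close> with nonempty interior they are
  uniquely determined on the domain.
\<close>

definition C2_partials ::
    "real set \<Rightarrow> (real \<Rightarrow> real \<Rightarrow> real) \<Rightarrow> (real \<Rightarrow> real \<Rightarrow> real) \<Rightarrow> (real \<Rightarrow> real \<Rightarrow> real) \<Rightarrow>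
     (real \<Rightarrow> real \<Rightarrow> real) \<Rightarrow> (real \<Rightarrow> real \<Rightarrow> real) \<Rightarrow> (real \<Rightarrow> real \<Rightarrow> real) \<Rightarrow> bool" where
  "C2_partials I M Mx My Mxx Mxy Myy \<longleftrightarrow>
     (\<forall>x\<in>I. \<forall>y\<ge>0.
        ((\<lambda>s. M s y) has_real_derivative Mx x y) (at x within I) \<and>
        ((\<lambda>s. M x s) has_real_derivative My x y) (at y within {0..}) \<and>
        ((\<lambda>s. Mx s y) has_real_derivative Mxx x y) (at x within I) \<and>
        ((\<lambda>s. Mx x s) has_real_derivative Mxy x y) (at y within {0..}) \<and>
        ((\<lambda>s. My s y) has_real_derivative Mxy x y) (at x within I) \<and>
        ((\<lambda>s. My x s) has_real_derivative Myy x y) (at y within {0..})) \<and>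
     (\<forall>D\<in>{Mx, My, Mxx, Mxy, Myy}. continuous_on (I \<times> {0..}) (\<lambda>(x, y). D x y))"

definition pos_semidef :: "real^'n^'n \<Rightarrow> bool" where
  "pos_semidef B \<longleftrightarrow> transpose B = B \<and> (\<forall>v. 0 \<le> v \<bullet> (B *v v))"

definition h_fun :: "real \<Rightarrow> real \<Rightarrow> real \<Rightarrow> real \<Rightarrow> real" where
  "h_fun \<rho> t \<alpha> s =
     (if \<rho> = 0 then 2 * (t - s) + \<alpha>
      else (exp (2 * \<rho> * (t - s)) - 1) / \<rho> + \<alpha> * exp (2 * \<rho> * (t - s)))"

definition H_fun ::
    "(('a \<Rightarrow> real) \<Rightarrow> ('a \<Rightarrow> real) \<Rightarrow> 'a \<Rightarrow> real) \<Rightarrow> (real \<Rightarrow> ('a \<Rightarrow> real) \<Rightarrow> 'a \<Rightarrow> real) \<Rightarrow>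
     real set \<Rightarrow> (real \<Rightarrow> real \<Rightarrow> real) \<Rightarrow> real \<Rightarrow> real \<Rightarrow> real \<Rightarrow> ('a \<Rightarrow> real) \<Rightarrow> real \<Rightarrow> 'a \<Rightarrow> ereal" where
  "H_fun \<Gamma> P I M \<rho> t \<alpha> f s =
     semigroup_ext P s
       (compose_on I M (P (t - s) f) (\<lambda>z. h_fun \<rho> t \<alpha> s * \<Gamma> (P (t - s) f) (P (t - s) f) z))"

definition star_ineq ::
    "'a measure \<Rightarrow> ('a \<Rightarrow> real) set \<Rightarrow> (('a \<Rightarrow> real) \<Rightarrow> ('a \<Rightarrow> real) \<Rightarrow> 'a \<Rightarrow> real) \<Rightarrow>
     (real \<Rightarrow> ('a \<Rightarrow> real) \<Rightarrow> 'a \<Rightarrow> real) \<Rightarrow> real set \<Rightarrow> (real \<Rightarrow> real \<Rightarrow> real) \<Rightarrow> real \<Rightarrow> real \<Rightarrow> real \<Rightarrow> bool" where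
  "star_ineq \<mu> A \<Gamma> P I M \<rho> t \<alpha> \<longleftrightarrow>
     (\<forall>f\<in>A. f ` space \<mu> \<subseteq> I \<longrightarrow>
       (AE z in \<mu>. ereal (M (P t f z) (h_fun \<rho> t \<alpha> 0 * \<Gamma> (P t f) (P t f) z))
          \<le> semigroup_ext P t (compose_on I M f (\<lambda>w. \<alpha> * \<Gamma> f f w)) z))"

end

theory Submission
  imports Defs
begin

text \<open>
  (i) Tested against a nonnegative \<open>g \<in> A\<close>, the derivative of \<open>H\<close> is the integral of \<open>P s g\<close> against a quadratic
  expression in \<open>\<Gamma> u\<close>, \<open>\<Gamma> (u, \<Gamma> u)\<close>, \<open>\<Gamma> (\<Gamma> u)\<close> and \<open>\<Gamma>\<^sub>2 u - \<rho> \<Gamma> u\<close> with \<open>u = P (t - s) f\<close>. It is nonnegative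
  by the hypothesis on \<open>B\<close> and the reinforced curvature condition \<open>\<Gamma> (\<Gamma> u) \<le> 4 \<Gamma> u (\<Gamma>\<^sub>2 u - \<rho> \<Gamma> u)\<close>. As \<open>M\<close> is
  only \<open>C\<^sup>2\<close> on a domain with boundary, the computation is done for polynomials, where the product rule for \<open>\<Gamma>\<close>
  and \<open>L\<close> suffices, and transferred to \<open>M\<close> by Bernstein approximation in \<open>C\<^sup>2\<close>. If the values of \<open>f\<close> come close
  to an end point missing from \<open>I\<close>, replace \<open>f\<close> by \<open>(1 - e) f + e x\<close> with \<open>x\<close> in the interior and let \<open>e \<rightarrow> 0\<close>,
  using that \<open>M\<close> is convex in its first argument.

  (ii) Differentiate \<open>(\<ast>)\<close> at \<open>t = 0\<close> for \<open>f = x + e \<phi>\<close> and \<open>\<alpha> = \<beta> / e\<^sup>2\<close>, and let \<open>e \<rightarrow> 0\<close>. Choosing \<open>x\<close>, \<open>y\<close> with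
  \<open>M\<^sub>y (x, y) > 0\<close> gives \<open>0 \<le> (\<Gamma>\<^sub>2 \<phi> - \<rho> \<Gamma> \<phi>) \<Gamma> \<phi> + \<kappa> \<Gamma> (\<Gamma> \<phi>)\<close> for all \<open>\<phi>\<close>, with a constant \<open>\<kappa>\<close>. Inserting
  \<open>\<phi> = f + a (f - c) (g - d)\<close> with \<open>g = \<Gamma> f + r f\<close>, evaluated where \<open>f = c\<close> and \<open>g = d\<close>, one can choose \<open>a\<close>, \<open>r\<close>
  so that the \<open>\<kappa>\<close>-term vanishes; what remains is the reinforced curvature condition. It implies \<open>\<Gamma>\<^sub>2 f \<ge> \<rho> \<Gamma> f\<close>
  where \<open>\<Gamma> f > 0\<close>, and where \<open>\<Gamma> f = 0\<close>, the minimum principle for \<open>L\<close> gives \<open>\<Gamma>\<^sub>2 f \<ge> 0\<close>. The same argument with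
  \<open>\<kappa> = 0\<close> derives the reinforced condition from \<open>\<Gamma>\<^sub>2 \<ge> \<rho> \<Gamma>\<close>, as needed in (i).
\<close>

text \<open>The axioms control the semigroup only in the L2 norm, whereas the inequalities are
  pointwise and nonlinear. They are therefore tested against squares \<open>k * k\<close> with
  \<open>k \<in> A\<close>, which stay in \<open>A\<close>, remain nonnegative under the semigroup
  and approximate indicators in L1. By symmetry the test function carries the outer semigroup, so
  only curves built from \<open>P (t - s) f\<close> are differentiated, in L1, through products of
  bounded functions.

  Replacing \<open>M\<close> by a polynomial costs an error of order \<epsilon> times
  \<open>Gamma2 \<Gamma> L u u\<close>, for which no pointwise bound uniform in time is at hand. Its
  integral is that of the square of \<open>L u\<close>, which the semigroup contracts, and this
  suffices.

  In (i) the gradient bound keeps the arguments of \<open>M\<close> in one rectangle for all times.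
  In (ii) that bound would presuppose the conclusion. Moreover, (ii) divides by a small time, so
  there the approximation has to be close in its first derivatives and not merely in its values.

  The constant \<kappa> of (ii) is \<open>y * Myy x y / (2 * My x y)\<close>, of no prescribed sign;
  what matters is that it depends neither on \<phi> nor on the point.\<close>

context prob_space
begin

text \<open>Boundedness almost everywhere is what \<open>P t\<close> preserves, and what
  \<open>compose_on\<close> inherits when its arguments lie in a rectangle only almost
  everywhere.\<close>

definition ess_bdd :: "('a \<Rightarrow> real) \<Rightarrow> bool" where
  "ess_bdd f \<longleftrightarrow> f \<in> borel_measurable M \<and> (\<exists>K. AE z in M. \<bar>f z\<bar> \<le> K)"

lemma ess_bddI: "f \<in> borel_measurable M \<Longrightarrow> AE z in M. \<bar>f z\<bar> \<le> K \<Longrightarrow> ess_bdd f"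
  unfolding ess_bdd_def by blast

lemma ess_bddE:
  assumes "ess_bdd f"
  obtains K where "0 \<le> K" "AE z in M. \<bar>f z\<bar> \<le> K"
proof -
  from assms obtain K where K: "AE z in M. \<bar>f z\<bar> \<le> K" unfolding ess_bdd_def by blast
  have "AE z in M. \<bar>f z\<bar> \<le> \<bar>K\<bar>" using K by eventually_elim linarith
  then show ?thesis using that[of "\<bar>K\<bar>"] by simp
qed

lemma ess_bdd_measurable: "ess_bdd f \<Longrightarrow> f \<in> borel_measurable M"
  unfolding ess_bdd_def by blast

lemma ess_bdd_integrable: assumes "ess_bdd f" shows "integrable M f"
proof -
  obtain K where "0 \<le> K" "AE z in M. \<bar>f z\<bar> \<le> K" using assms by (rule ess_bddE)
  then show ?thesis using assms unfolding ess_bdd_def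
    by (intro integrable_const_bound[of f K]) auto
qed

lemma ess_bdd_const: "ess_bdd (\<lambda>_. c)"
  by (rule ess_bddI[of _ "\<bar>c\<bar>"]) auto

lemma ess_bdd_add: assumes "ess_bdd f" "ess_bdd g" shows "ess_bdd (\<lambda>z. f z + g z)"
proof -
  note [measurable] = assms[THEN ess_bdd_measurable]
  obtain K where K: "AE z in M. \<bar>f z\<bar> \<le> K" using assms(1) by (rule ess_bddE)
  obtain K' where K': "AE z in M. \<bar>g z\<bar> \<le> K'" using assms(2) by (rule ess_bddE)
  show ?thesis by (rule ess_bddI[of _ "K + K'"]) (measurable, use K K' in \<open>eventually_elim, linarith\<close>)
qed

lemma ess_bdd_mult: assumes "ess_bdd f" "ess_bdd g" shows "ess_bdd (\<lambda>z. f z * g z)"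
proof -
  note [measurable] = assms[THEN ess_bdd_measurable]
  obtain K where K: "0 \<le> K" "AE z in M. \<bar>f z\<bar> \<le> K" using assms(1) by (rule ess_bddE)
  obtain K' where K': "AE z in M. \<bar>g z\<bar> \<le> K'" using assms(2) by (rule ess_bddE)
  have "AE z in M. \<bar>f z * g z\<bar> \<le> K * K'"
    using K(2) K' by eventually_elim (simp add: abs_mult K mult_mono)
  then show ?thesis by (intro ess_bddI[of _ "K * K'"]) measurable
qed

lemma ess_bdd_dom:
  assumes "f \<in> borel_measurable M" "ess_bdd g" "AE z in M. \<bar>f z\<bar> \<le> \<bar>g z\<bar>" shows "ess_bdd f"
proof -
  obtain K where K: "0 \<le> K" "AE z in M. \<bar>g z\<bar> \<le> K" using assms(2) by (rule ess_bddE)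
  have "AE z in M. \<bar>f z\<bar> \<le> K" using K(2) assms(3) by eventually_elim linarith
  then show ?thesis by (intro ess_bddI assms)
qed

lemma ess_bdd_uminus: "ess_bdd f \<Longrightarrow> ess_bdd (\<lambda>z. - f z)"
  by (rule ess_bdd_dom[of _ f]) (auto intro: ess_bdd_measurable borel_measurable_uminus)

lemma ess_bdd_abs: "ess_bdd f \<Longrightarrow> ess_bdd (\<lambda>z. \<bar>f z\<bar>)"
  by (rule ess_bdd_dom[of _ f]) (auto intro: ess_bdd_measurable borel_measurable_abs)

lemma ess_bdd_diff: "ess_bdd f \<Longrightarrow> ess_bdd g \<Longrightarrow> ess_bdd (\<lambda>z. f z - g z)"
  using ess_bdd_add[OF _ ess_bdd_uminus, of f g] by simp

lemma ess_bdd_power: "ess_bdd f \<Longrightarrow> ess_bdd (\<lambda>z. f z ^ n)"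
  by (induction n) (auto intro: ess_bdd_const ess_bdd_mult)

lemma ess_bdd_divide: "ess_bdd f \<Longrightarrow> ess_bdd (\<lambda>z. f z / c)"
  using ess_bdd_mult[OF _ ess_bdd_const, of f "1 / c"] by simp

lemma ess_bdd_min: "ess_bdd f \<Longrightarrow> ess_bdd g \<Longrightarrow> ess_bdd (\<lambda>z. min (f z) (g z))"
  by (rule ess_bdd_dom[of _ "\<lambda>z. \<bar>f z\<bar> + \<bar>g z\<bar>"]) (auto intro!: ess_bdd_add ess_bdd_abs borel_measurable_min
    borel_measurable_max dest: ess_bdd_measurable)

lemma ess_bdd_max: "ess_bdd f \<Longrightarrow> ess_bdd g \<Longrightarrow> ess_bdd (\<lambda>z. max (f z) (g z))"
  by (rule ess_bdd_dom[of _ "\<lambda>z. \<bar>f z\<bar> + \<bar>g z\<bar>"]) (auto intro!: ess_bdd_add ess_bdd_abs borel_measurable_min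
    borel_measurable_max dest: ess_bdd_measurable)

lemmas ess_bdd_intros = ess_bdd_const ess_bdd_add ess_bdd_mult ess_bdd_uminus ess_bdd_abs
  ess_bdd_diff ess_bdd_power ess_bdd_divide ess_bdd_min ess_bdd_max

section \<open>Square integrable functions\<close>

lemma square_int_ess_bdd: "ess_bdd f \<Longrightarrow> square_int M f"
  unfolding square_int_def by (auto intro: ess_bdd_integrable ess_bdd_power ess_bdd_measurable)

lemma square_int_mult:
  assumes "square_int M f" "square_int M g" shows "integrable M (\<lambda>z. f z * g z)"
proof (rule Bochner_Integration.integrable_bound[of M "\<lambda>z. (f z)\<^sup>2 + (g z)\<^sup>2"])
  have "\<bar>f z * g z\<bar> \<le> (f z)\<^sup>2 + (g z)\<^sup>2" for z
    using sum_squares_bound[of "\<bar>f z\<bar>" "\<bar>g z\<bar>"] mult_nonneg_nonneg[of "\<bar>f z\<bar>" "\<bar>g z\<bar>"]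
    unfolding abs_mult power2_abs by linarith
  then show "AE z in M. norm (f z * g z) \<le> norm ((f z)\<^sup>2 + (g z)\<^sup>2)" by simp
qed (use assms in \<open>auto simp: square_int_def\<close>)

lemma square_int_lin:
  assumes "square_int M f" "square_int M g" shows "square_int M (\<lambda>z. a * f z + b * g z)"
proof -
  have "(\<lambda>z. (a * f z + b * g z)\<^sup>2) = (\<lambda>z. a\<^sup>2 * (f z)\<^sup>2 + b\<^sup>2 * (g z)\<^sup>2 + 2 * a * b * (f z * g z))"
    by (auto simp: power2_eq_square algebra_simps)
  then show ?thesis using assms square_int_mult[OF assms] unfolding square_int_def by auto
qed

lemma square_int_add: "square_int M f \<Longrightarrow> square_int M g \<Longrightarrow> square_int M (\<lambda>z. f z + g z)"
  using square_int_lin[of f g 1 1] by simp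

lemma square_int_diff: "square_int M f \<Longrightarrow> square_int M g \<Longrightarrow> square_int M (\<lambda>z. f z - g z)"
  using square_int_lin[of f g 1 "-1"] by simp

lemma square_int_scale: "square_int M f \<Longrightarrow> square_int M (\<lambda>z. a * f z)"
  using square_int_lin[of f f a 0] by simp

lemma square_int_integrable: "square_int M f \<Longrightarrow> integrable M f"
  using square_int_mult[of f "\<lambda>_. 1"] square_int_ess_bdd[OF ess_bdd_const] by simp

lemma Cauchy_Schwarz_integral:
  assumes f: "square_int M f" and g: "square_int M g"
  shows "(\<integral>z. \<bar>f z * g z\<bar> \<partial>M) \<le> sqrt (\<integral>z. (f z)\<^sup>2 \<partial>M) * sqrt (\<integral>z. (g z)\<^sup>2 \<partial>M)"
proof -
  let ?F = "\<integral>z. (f z)\<^sup>2 \<partial>M" and ?G = "\<integral>z. (g z)\<^sup>2 \<partial>M" and ?X = "\<integral>z. \<bar>f z * g z\<bar> \<partial>M"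
  note [simp] = square_int_mult[OF f g]
  have i: "integrable M (\<lambda>z. (f z)\<^sup>2)" "integrable M (\<lambda>z. (g z)\<^sup>2)" using f g by (auto simp: square_int_def)
  have *: "0 \<le> ?F - 2 * l * ?X + l\<^sup>2 * ?G" for l
  proof -
    have "0 \<le> (\<integral>z. (\<bar>f z\<bar> - l * \<bar>g z\<bar>)\<^sup>2 \<partial>M)" by simp
    also have "\<dots> = (\<integral>z. (f z)\<^sup>2 - 2 * l * \<bar>f z * g z\<bar> + l\<^sup>2 * (g z)\<^sup>2 \<partial>M)"
      by (intro Bochner_Integration.integral_cong)
         (auto simp: power2_diff power_mult_distrib abs_mult algebra_simps)
    also have "\<dots> = ?F - 2 * l * ?X + l\<^sup>2 * ?G" using i by simp
    finally show ?thesis .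
  qed
  have X: "0 \<le> ?X" by simp
  have F: "0 \<le> ?F" and G: "0 \<le> ?G" by simp_all
  have "?X\<^sup>2 \<le> ?F * ?G"
  proof (cases "?G = 0")
    case True
    have "?X = 0"
    proof (rule ccontr)
      assume "?X \<noteq> 0"
      \<comment> \<open>For \<open>?G = 0\<close> the quadratic is affine in \<open>l\<close>; this
        \<open>l\<close> is chosen to give it the value -1.\<close>
      with *[of "(?F + 1) / (2 * ?X)"] True show False by (simp add: field_simps)
    qed
    then show ?thesis using F G by simp
  next
    case False
    have "?F - 2 * (?X / ?G) * ?X + (?X / ?G)\<^sup>2 * ?G = ?F - ?X\<^sup>2 / ?G"
      using False by (simp add: power2_eq_square)
    with *[of "?X / ?G"] have "?X\<^sup>2 / ?G \<le> ?F" by simp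
    then show ?thesis using False G by (simp add: pos_divide_le_eq)
  qed
  then have "sqrt (?X\<^sup>2) \<le> sqrt (?F * ?G)" by (rule real_sqrt_le_mono)
  then show ?thesis using X by (simp add: real_sqrt_mult)
qed

lemma integral_abs_le_L2:
  assumes "square_int M f" shows "(\<integral>z. \<bar>f z\<bar> \<partial>M) \<le> sqrt (\<integral>z. (f z)\<^sup>2 \<partial>M)"
  using Cauchy_Schwarz_integral[OF assms square_int_ess_bdd[OF ess_bdd_const[of 1]]]
  by (simp add: prob_space)

lemma L1_of_L2_tendsto:
  assumes "\<forall>\<^sub>F r in F. square_int M (f r)" "((\<lambda>r. \<integral>z. (f r z)\<^sup>2 \<partial>M) \<longlongrightarrow> 0) F"
  shows "((\<lambda>r. \<integral>z. \<bar>f r z\<bar> \<partial>M) \<longlongrightarrow> 0) F"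
proof (rule tendsto_sandwich[of "\<lambda>_. 0" _ _ "\<lambda>r. sqrt (\<integral>z. (f r z)\<^sup>2 \<partial>M)"])
  show "\<forall>\<^sub>F r in F. (\<integral>z. \<bar>f r z\<bar> \<partial>M) \<le> sqrt (\<integral>z. (f r z)\<^sup>2 \<partial>M)"
    using assms(1) by eventually_elim (rule integral_abs_le_L2)
  show "((\<lambda>r. sqrt (\<integral>z. (f r z)\<^sup>2 \<partial>M)) \<longlongrightarrow> 0) F"
    using tendsto_real_sqrt[OF assms(2)] by simp
qed auto

lemma integral_square_add_le:
  assumes "square_int M f" "square_int M g"
  shows "(\<integral>z. (f z + g z)\<^sup>2 \<partial>M) \<le> 2 * (\<integral>z. (f z)\<^sup>2 \<partial>M) + 2 * (\<integral>z. (g z)\<^sup>2 \<partial>M)"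
proof -
  have "(\<integral>z. (f z + g z)\<^sup>2 \<partial>M) \<le> (\<integral>z. 2 * (f z)\<^sup>2 + 2 * (g z)\<^sup>2 \<partial>M)"
  proof (rule integral_mono)
    show "integrable M (\<lambda>z. (f z + g z)\<^sup>2)"
      using square_int_add[OF assms] by (simp add: square_int_def)
    show "integrable M (\<lambda>z. 2 * (f z)\<^sup>2 + 2 * (g z)\<^sup>2)" using assms by (simp add: square_int_def)
    show "(f z + g z)\<^sup>2 \<le> 2 * (f z)\<^sup>2 + 2 * (g z)\<^sup>2" for z
      using sum_squares_bound[of "f z" "g z"] by (simp add: power2_sum)
  qed
  also have "\<dots> = 2 * (\<integral>z. (f z)\<^sup>2 \<partial>M) + 2 * (\<integral>z. (g z)\<^sup>2 \<partial>M)"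
    using assms by (simp add: square_int_def)
  finally show ?thesis .
qed

lemma integral_square_zero_AE:
  assumes "square_int M f" "(\<integral>z. (f z)\<^sup>2 \<partial>M) \<le> 0" shows "AE z in M. f z = 0"
proof -
  have "(\<integral>z. (f z)\<^sup>2 \<partial>M) = 0" using assms(2) by (simp add: order_antisym)
  then have "AE z in M. (f z)\<^sup>2 = 0"
    using assms(1) by (subst (asm) integral_nonneg_eq_0_iff_AE) (auto simp: square_int_def)
  then show ?thesis by simp
qed

lemma integral_abs_mult_le:
  assumes "ess_bdd f" "integrable M g" "AE z in M. \<bar>f z\<bar> \<le> K"
  shows "(\<integral>z. \<bar>f z * g z\<bar> \<partial>M) \<le> K * (\<integral>z. \<bar>g z\<bar> \<partial>M)" "integrable M (\<lambda>z. f z * g z)"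
proof -
  note [measurable] = ess_bdd_measurable[OF assms(1)] borel_measurable_integrable[OF assms(2)]
  have *: "AE z in M. \<bar>f z * g z\<bar> \<le> K * \<bar>g z\<bar>"
    using assms(3) by eventually_elim (simp add: abs_mult mult_right_mono)
  have "AE z in M. \<bar>f z * g z\<bar> \<le> \<bar>K * g z\<bar>"
    using assms(3) by eventually_elim (simp add: abs_mult mult_right_mono)
  then have "AE z in M. norm (f z * g z) \<le> norm (K * g z)" by simp
  moreover have "integrable M (\<lambda>z. K * g z)" using assms(2) by simp
  moreover have "(\<lambda>z. f z * g z) \<in> borel_measurable M" by measurable
  ultimately show i: "integrable M (\<lambda>z. f z * g z)"
    by (metis Bochner_Integration.integrable_bound)
  have "(\<integral>z. \<bar>f z * g z\<bar> \<partial>M) \<le> (\<integral>z. K * \<bar>g z\<bar> \<partial>M)"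
    using i assms(2) by (intro integral_mono_AE *) simp_all
  then show "(\<integral>z. \<bar>f z * g z\<bar> \<partial>M) \<le> K * (\<integral>z. \<bar>g z\<bar> \<partial>M)" by simp
qed

text \<open>Differentiability in the L1 norm, within a set of times so that one-sided derivatives at
  end points are included. L1 rather than L2, because quadratic expressions such as
  \<open>\<Gamma> (P r f) (P r f)\<close> are controlled only in L1.\<close>

definition L1_deriv :: "real set \<Rightarrow> (real \<Rightarrow> 'a \<Rightarrow> real) \<Rightarrow> ('a \<Rightarrow> real) \<Rightarrow> real \<Rightarrow> bool" where
  "L1_deriv T a a' s \<longleftrightarrow>
     ((\<lambda>r. \<integral>z. \<bar>(a r z - a s z) / (r - s) - a' z\<bar> \<partial>M) \<longlongrightarrow> 0) (at s within T)"

lemma L1_deriv_const: "L1_deriv T (\<lambda>_. f) (\<lambda>_. 0) s"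
  unfolding L1_deriv_def by simp

lemma L1_deriv_scalar:
  assumes "(h has_real_derivative h') (at s within T)"
  shows "L1_deriv T (\<lambda>r _. h r) (\<lambda>_. h') s"
proof -
  have "((\<lambda>r. \<bar>(h r - h s) / (r - s) - h'\<bar>) \<longlongrightarrow> 0) (at s within T)"
    using assms tendsto_rabs_zero LIM_zero unfolding has_field_derivative_iff by blast
  then show ?thesis unfolding L1_deriv_def by (simp add: prob_space)
qed

lemma L1_deriv_continuous:
  assumes "L1_deriv T a a' s" "s \<in> T" "\<And>r. r \<in> T \<Longrightarrow> integrable M (a r)" "integrable M a'"
  shows "((\<lambda>r. \<integral>z. \<bar>a r z - a s z\<bar> \<partial>M) \<longlongrightarrow> 0) (at s within T)"
proof (rule tendsto_sandwich[of "\<lambda>_. 0" _ _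
      "\<lambda>r. \<bar>r - s\<bar> * ((\<integral>z. \<bar>(a r z - a s z) / (r - s) - a' z\<bar> \<partial>M) + (\<integral>z. \<bar>a' z\<bar> \<partial>M))"])
  show "\<forall>\<^sub>F r in at s within T. (\<integral>z. \<bar>a r z - a s z\<bar> \<partial>M) \<le>
      \<bar>r - s\<bar> * ((\<integral>z. \<bar>(a r z - a s z) / (r - s) - a' z\<bar> \<partial>M) + (\<integral>z. \<bar>a' z\<bar> \<partial>M))"
    unfolding eventually_at_filter
  proof (rule always_eventually, intro allI impI)
    fix r assume r: "r \<noteq> s" "r \<in> T"
    note i = assms(3)[OF r(2)] assms(3)[OF assms(2)] assms(4)
    have "(\<integral>z. \<bar>a r z - a s z\<bar> \<partial>M) \<le> (\<integral>z. \<bar>r - s\<bar> * (\<bar>(a r z - a s z) / (r - s) - a' z\<bar> + \<bar>a' z\<bar>) \<partial>M)"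
    proof (rule integral_mono)
      fix z
      have "a r z - a s z = (r - s) * (((a r z - a s z) / (r - s) - a' z) + a' z)" using r by simp
      then have "\<bar>a r z - a s z\<bar> = \<bar>r - s\<bar> * \<bar>((a r z - a s z) / (r - s) - a' z) + a' z\<bar>" by (metis abs_mult)
      also have "\<dots> \<le> \<bar>r - s\<bar> * (\<bar>(a r z - a s z) / (r - s) - a' z\<bar> + \<bar>a' z\<bar>)"
        by (intro mult_left_mono abs_triangle_ineq) simp
      finally show "\<bar>a r z - a s z\<bar> \<le> \<bar>r - s\<bar> * (\<bar>(a r z - a s z) / (r - s) - a' z\<bar> + \<bar>a' z\<bar>)" .
    qed (use i in auto)
    also have "\<dots> = \<bar>r - s\<bar> * ((\<integral>z. \<bar>(a r z - a s z) / (r - s) - a' z\<bar> \<partial>M) + (\<integral>z. \<bar>a' z\<bar> \<partial>M))"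
      using i by simp
    finally show "(\<integral>z. \<bar>a r z - a s z\<bar> \<partial>M) \<le>
      \<bar>r - s\<bar> * ((\<integral>z. \<bar>(a r z - a s z) / (r - s) - a' z\<bar> \<partial>M) + (\<integral>z. \<bar>a' z\<bar> \<partial>M))" .
  qed
  have "((\<lambda>r. \<bar>r - s\<bar> * ((\<integral>z. \<bar>(a r z - a s z) / (r - s) - a' z\<bar> \<partial>M) + (\<integral>z. \<bar>a' z\<bar> \<partial>M)))
     \<longlongrightarrow> \<bar>s - s\<bar> * (0 + (\<integral>z. \<bar>a' z\<bar> \<partial>M))) (at s within T)"
    using assms(1) unfolding L1_deriv_def by (intro tendsto_intros)
  then show "((\<lambda>r. \<bar>r - s\<bar> * ((\<integral>z. \<bar>(a r z - a s z) / (r - s) - a' z\<bar> \<partial>M) + (\<integral>z. \<bar>a' z\<bar> \<partial>M)))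
     \<longlongrightarrow> 0) (at s within T)" by simp
qed auto

lemma L1_deriv_add:
  assumes "L1_deriv T a a' s" "L1_deriv T b b' s" "s \<in> T"
    and "\<And>r. r \<in> T \<Longrightarrow> integrable M (a r)" "\<And>r. r \<in> T \<Longrightarrow> integrable M (b r)" "integrable M a'" "integrable M b'"
  shows "L1_deriv T (\<lambda>r z. a r z + b r z) (\<lambda>z. a' z + b' z) s"
  unfolding L1_deriv_def
proof (rule tendsto_sandwich[of "\<lambda>_. 0" _ _
      "\<lambda>r. (\<integral>z. \<bar>(a r z - a s z) / (r - s) - a' z\<bar> \<partial>M) + (\<integral>z. \<bar>(b r z - b s z) / (r - s) - b' z\<bar> \<partial>M)"])
  show "\<forall>\<^sub>F r in at s within T. (\<integral>z. \<bar>((a r z + b r z) - (a s z + b s z)) / (r - s) - (a' z + b' z)\<bar> \<partial>M) \<le>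
      (\<integral>z. \<bar>(a r z - a s z) / (r - s) - a' z\<bar> \<partial>M) + (\<integral>z. \<bar>(b r z - b s z) / (r - s) - b' z\<bar> \<partial>M)"
    unfolding eventually_at_filter
  proof (rule always_eventually, intro allI impI)
    fix r assume r: "r \<noteq> s" "r \<in> T"
    note i = assms(4,5)[OF r(2)] assms(4,5)[OF assms(3)] assms(6,7)
    have "(\<integral>z. \<bar>((a r z + b r z) - (a s z + b s z)) / (r - s) - (a' z + b' z)\<bar> \<partial>M) \<le>
       (\<integral>z. \<bar>(a r z - a s z) / (r - s) - a' z\<bar> + \<bar>(b r z - b s z) / (r - s) - b' z\<bar> \<partial>M)"
    proof (rule integral_mono)
      fix z
      have "((a r z + b r z) - (a s z + b s z)) / (r - s) - (a' z + b' z) =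
          ((a r z - a s z) / (r - s) - a' z) + ((b r z - b s z) / (r - s) - b' z)"
        by (simp add: add_divide_distrib diff_divide_distrib)
      then show "\<bar>((a r z + b r z) - (a s z + b s z)) / (r - s) - (a' z + b' z)\<bar> \<le>
         \<bar>(a r z - a s z) / (r - s) - a' z\<bar> + \<bar>(b r z - b s z) / (r - s) - b' z\<bar>"
        by (metis abs_triangle_ineq)
    qed (use i in auto)
    then show "(\<integral>z. \<bar>((a r z + b r z) - (a s z + b s z)) / (r - s) - (a' z + b' z)\<bar> \<partial>M) \<le>
      (\<integral>z. \<bar>(a r z - a s z) / (r - s) - a' z\<bar> \<partial>M) + (\<integral>z. \<bar>(b r z - b s z) / (r - s) - b' z\<bar> \<partial>M)"
      using i by simp
  qed
  show "((\<lambda>r. (\<integral>z. \<bar>(a r z - a s z) / (r - s) - a' z\<bar> \<partial>M) +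
      (\<integral>z. \<bar>(b r z - b s z) / (r - s) - b' z\<bar> \<partial>M)) \<longlongrightarrow> 0) (at s within T)"
    using tendsto_add[OF assms(1,2)[unfolded L1_deriv_def]] by simp
qed auto

text \<open>From \<open>a r * b r - a s * b s = a r * (b r - b s) + b s * (a r - a s)\<close>. The
  uniform bound in \<open>r\<close> is asked of the first factor only; the second may be a gradient,
  for which no such bound is known in general.\<close>

lemma L1_deriv_mult:
  assumes "L1_deriv T a a' s" "L1_deriv T b b' s" "s \<in> T"
    and a: "\<And>r. r \<in> T \<Longrightarrow> ess_bdd (a r)" and b: "\<And>r. r \<in> T \<Longrightarrow> ess_bdd (b r)"
    and a': "ess_bdd a'" and b': "ess_bdd b'"
    and K: "\<And>r. r \<in> T \<Longrightarrow> AE z in M. \<bar>a r z\<bar> \<le> K"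
  shows "L1_deriv T (\<lambda>r z. a r z * b r z) (\<lambda>z. a' z * b s z + a s z * b' z) s"
proof -
  obtain B where B: "AE z in M. \<bar>b s z\<bar> \<le> B" using b[OF assms(3)] by (rule ess_bddE)
  obtain B' where B': "AE z in M. \<bar>b' z\<bar> \<le> B'" using b' by (rule ess_bddE)
  let ?a = "\<lambda>r z. (a r z - a s z) / (r - s) - a' z" and ?b = "\<lambda>r z. (b r z - b s z) / (r - s) - b' z"
  let ?U = "\<lambda>r. K * (\<integral>z. \<bar>?b r z\<bar> \<partial>M) + B' * (\<integral>z. \<bar>a r z - a s z\<bar> \<partial>M) + B * (\<integral>z. \<bar>?a r z\<bar> \<partial>M)"
  show ?thesis
    unfolding L1_deriv_def
  proof (rule tendsto_sandwich[of "\<lambda>_. 0" _ _ ?U])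
    show "\<forall>\<^sub>F r in at s within T. (\<integral>z. \<bar>(a r z * b r z - a s z * b s z) / (r - s) - (a' z * b s z
      + a s z * b' z)\<bar> \<partial>M) \<le> ?U r"
      unfolding eventually_at_filter
    proof (rule always_eventually, intro allI impI)
      fix r assume r: "r \<noteq> s" "r \<in> T"
      note e = a[OF r(2)] a[OF assms(3)] b[OF r(2)] b[OF assms(3)] a' b'
      have e1: "ess_bdd (?b r)" "ess_bdd (?a r)" "ess_bdd (\<lambda>z. a r z - a s z)" using e
        by (auto intro!: ess_bdd_intros)
      note i1 = integral_abs_mult_le[OF e(1) ess_bdd_integrable[OF e1(1)] K[OF r(2)]]
      note i2 = integral_abs_mult_le[OF e(6) ess_bdd_integrable[OF e1(3)] B']
      note i3 = integral_abs_mult_le[OF e(4) ess_bdd_integrable[OF e1(2)] B]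
      have "(\<integral>z. \<bar>(a r z * b r z - a s z * b s z) / (r - s) - (a' z * b s z + a s z * b' z)\<bar> \<partial>M)
         \<le> (\<integral>z. \<bar>a r z * ?b r z\<bar> + \<bar>b' z * (a r z - a s z)\<bar> + \<bar>b s z * ?a r z\<bar> \<partial>M)"
      proof (rule integral_mono)
        fix z
        have "(a r z * b r z - a s z * b s z) / (r - s) - (a' z * b s z + a s z * b' z)
          = a r z * ?b r z + b' z * (a r z - a s z) + b s z * ?a r z"
        proof -
          have "(a r z * b r z - a s z * b s z) / (r - s) = a r z * ((b r z - b s z) / (r - s))
            + b s z * ((a r z - a s z) / (r - s))"
            by (simp add: add_divide_distrib[symmetric] algebra_simps)
          then show ?thesis by (simp add: algebra_simps)
        qed
        then show "\<bar>(a r z * b r z - a s z * b s z) / (r - s) - (a' z * b s z + a s z * b' z)\<bar>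
           \<le> \<bar>a r z * ?b r z\<bar> + \<bar>b' z * (a r z - a s z)\<bar> + \<bar>b s z * ?a r z\<bar>"
          by (simp only:)
      qed (use e e1 in \<open>auto intro!: ess_bdd_integrable ess_bdd_intros\<close>)
      also have "\<dots> = (\<integral>z. \<bar>a r z * ?b r z\<bar> \<partial>M) + (\<integral>z. \<bar>b' z * (a r z - a s z)\<bar> \<partial>M) + (\<integral>z. \<bar>b s z * ?a r z\<bar>
        \<partial>M)"
        using i1(2) i2(2) i3(2) by simp
      also have "\<dots> \<le> ?U r" using i1(1) i2(1) i3(1) by linarith
      finally show "(\<integral>z. \<bar>(a r z * b r z - a s z * b s z) / (r - s) - (a' z * b s z + a s z * b' z)\<bar> \<partial>M)
        \<le> ?U r" .
    qed
    have "(?U \<longlongrightarrow> K * 0 + B' * 0 + B * 0) (at s within T)"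
      using assms(1,2) L1_deriv_continuous[OF assms(1,3) ess_bdd_integrable[OF a] ess_bdd_integrable[OF a']]
      unfolding L1_deriv_def by (intro tendsto_intros)
    then show "(?U \<longlongrightarrow> 0) (at s within T)" by simp
  qed auto
qed

lemma L1_deriv_integral:
  assumes "L1_deriv T a a' s" "s \<in> T" "\<And>r. r \<in> T \<Longrightarrow> integrable M (a r)" "integrable M a'"
  shows "((\<lambda>r. \<integral>z. a r z \<partial>M) has_real_derivative (\<integral>z. a' z \<partial>M)) (at s within T)"
  unfolding has_field_derivative_iff
proof (rule LIM_zero_cancel, rule tendsto_rabs_zero_cancel,
    rule tendsto_sandwich[of "\<lambda>_. 0" _ _ "\<lambda>r. \<integral>z. \<bar>(a r z - a s z) / (r - s) - a' z\<bar> \<partial>M"])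
  show "\<forall>\<^sub>F r in at s within T. \<bar>((\<integral>z. a r z \<partial>M) - (\<integral>z. a s z \<partial>M)) / (r - s) - (\<integral>z. a' z \<partial>M)\<bar>
     \<le> (\<integral>z. \<bar>(a r z - a s z) / (r - s) - a' z\<bar> \<partial>M)"
    unfolding eventually_at_filter
  proof (rule always_eventually, intro allI impI)
    fix r assume r: "r \<noteq> s" "r \<in> T"
    have "((\<integral>z. a r z \<partial>M) - (\<integral>z. a s z \<partial>M)) / (r - s) - (\<integral>z. a' z \<partial>M) = (\<integral>z. (a r z - a s z) / (r - s)
      - a' z \<partial>M)"
      using assms(3)[OF r(2)] assms(3)[OF assms(2)] assms(4) by simp
    then show "\<bar>((\<integral>z. a r z \<partial>M) - (\<integral>z. a s z \<partial>M)) / (r - s) - (\<integral>z. a' z \<partial>M)\<bar>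
     \<le> (\<integral>z. \<bar>(a r z - a s z) / (r - s) - a' z\<bar> \<partial>M)"
      by (simp add: integral_abs_bound)
  qed
qed (use assms(1) in \<open>auto simp: L1_deriv_def\<close>)

end

text \<open>Passes from parameters in a countable dense set, where one null set suffices, to all
  real parameters.\<close>

lemma nonneg_on_Rats_imp_nonneg:
  fixes f :: "real \<Rightarrow> real"
  assumes "continuous_on UNIV f" "\<And>q. q \<in> \<rat> \<Longrightarrow> 0 \<le> f q" shows "0 \<le> f x"
  using continuous_ge_on_closure[of "\<rat>" f x 0] assms by (simp add: Rats_closure_real)

lemma discriminant_of_nonneg:
  fixes a b c :: real
  assumes "\<And>q. 0 \<le> a + 2 * q * b + q\<^sup>2 * c" "0 \<le> c" shows "b\<^sup>2 \<le> a * c"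
proof (cases "c = 0")
  case True
  have "b = 0"
  proof (rule ccontr)
    assume "b \<noteq> 0"
    \<comment> \<open>A nonnegative affine function has slope 0; with slope \<open>2 * b\<close> it
      would equal -1 at this point.\<close>
    with assms(1)[of "- (a + 1) / (2 * b)"] True show False by (simp add: field_simps)
  qed
  then show ?thesis using True by simp
next
  case False
  then have "a + 2 * (- b / c) * b + (- b / c)\<^sup>2 * c = a - b\<^sup>2 / c"
    by (simp add: power2_eq_square)
  with assms(1)[of "- b / c"] have "b\<^sup>2 / c \<le> a" by simp
  then show ?thesis using False assms(2) by (simp add: pos_divide_le_eq)
qed

text \<open>Together with bilinearity, the chain rules for this one function yield the calculus for
  all polynomials.\<close>

lemma smooth_fun_mult: "smooth_fun 2 (\<lambda>v. v 0 * v 1)"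
  and partial_deriv_mult:
    "partial_deriv 0 (\<lambda>v. v 0 * v 1) = (\<lambda>v. v 1)" "partial_deriv 1 (\<lambda>v. v 0 * v 1) = (\<lambda>v. v 0)"
    "partial_deriv 0 (\<lambda>v. v 0) = (\<lambda>v. 1)" "partial_deriv 1 (\<lambda>v. v 0) = (\<lambda>v. 0)"
    "partial_deriv 0 (\<lambda>v. v 1) = (\<lambda>v. 0)" "partial_deriv 1 (\<lambda>v. v 1) = (\<lambda>v. 1)"
proof -
  \<comment> \<open>\<open>smooth_fun\<close> quantifies over all iterated partial derivatives; this
    finite set contains the product and is closed under both of them.\<close>
  let ?S = "{\<lambda>v. v 0 * v 1, \<lambda>v. v 1, \<lambda>v. v 0, \<lambda>v. 1, \<lambda>v. 0} :: ((nat \<Rightarrow> real) \<Rightarrow> real) set"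
  show d: "partial_deriv 0 (\<lambda>v. v 0 * v 1) = (\<lambda>v. v 1)" "partial_deriv 1 (\<lambda>v. v 0 * v 1) = (\<lambda>v. v 0)"
    "partial_deriv 0 (\<lambda>v. v 0) = (\<lambda>v. 1)" "partial_deriv 1 (\<lambda>v. v 0) = (\<lambda>v. 0)"
    "partial_deriv 0 (\<lambda>v. v 1) = (\<lambda>v. 0)" "partial_deriv 1 (\<lambda>v. v 1) = (\<lambda>v. 1)"
    unfolding partial_deriv_def by (auto intro!: ext DERIV_imp_deriv derivative_eq_intros)
  have c: "partial_deriv i (\<lambda>v. c) = (\<lambda>v. 0)" for i c
    unfolding partial_deriv_def by (auto intro!: ext DERIV_imp_deriv derivative_eq_intros)
  have step: "partial_deriv i \<Psi> \<in> ?S" if "i < 2" "\<Psi> \<in> ?S" for i \<Psi>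
  proof -
    have "i = 0 \<or> i = 1" using that(1) by auto
    then show ?thesis using that(2) by (elim disjE insertE emptyE) (simp_all add: d d[simplified] c)
  qed
  have S: "foldr partial_deriv js (\<lambda>v. v 0 * v 1) \<in> ?S" if "set js \<subseteq> {..<2}" for js
    using that
  proof (induction js)
    case (Cons a js)
    then have "a < 2" "foldr partial_deriv js (\<lambda>v. v 0 * v 1) \<in> ?S" by auto
    then show ?case using step by (simp only: foldr_Cons comp_apply)
  qed simp
  have cont: "continuous_on UNIV \<Psi> \<and> (\<forall>i<2. \<forall>v. (\<lambda>s. \<Psi> (v(i := s))) differentiable (at (v i)))"
    if "\<Psi> \<in> ?S" for \<Psi>
  proof
    show "continuous_on UNIV \<Psi>"
      using that by (elim insertE emptyE) (auto intro!: continuous_intros)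
    show "\<forall>i<2. \<forall>v. (\<lambda>s. \<Psi> (v(i := s))) differentiable (at (v i))"
    proof (intro allI impI)
      fix i :: nat and v :: "nat \<Rightarrow> real" assume "i < 2"
      then have "i = 0 \<or> i = 1" by auto
      then show "(\<lambda>s. \<Psi> (v(i := s))) differentiable (at (v i))"
        using that by (elim disjE insertE emptyE) (auto intro!: derivative_intros)
    qed
  qed
  show "smooth_fun 2 (\<lambda>v. v 0 * v 1)"
    unfolding smooth_fun_def using cont[OF S] by auto
qed

section \<open>Calculus of \<open>\<Gamma>\<close> and \<open>L\<close>\<close>

context markov_triple
begin

lemma A_ess_bdd: "f \<in> A \<Longrightarrow> ess_bdd f"
  using A_measurable A_bounded unfolding ess_bdd_def by (metis AE_I2)

lemma A_square_int: "f \<in> A \<Longrightarrow> square_int \<mu> f"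
  by (simp add: A_ess_bdd square_int_ess_bdd)

lemma A_const: "(\<lambda>_. c) \<in> A" using A_lin[OF A_one A_one, of c 0] by simp
lemma A_add: "f \<in> A \<Longrightarrow> g \<in> A \<Longrightarrow> (\<lambda>z. f z + g z) \<in> A" using A_lin[of f g 1 1] by simp
lemma A_diff: "f \<in> A \<Longrightarrow> g \<in> A \<Longrightarrow> (\<lambda>z. f z - g z) \<in> A" using A_lin[of f g 1 "-1"] by simp
lemma A_scale: "f \<in> A \<Longrightarrow> (\<lambda>z. c * f z) \<in> A" using A_lin[of f f c 0] by simp

lemmas A_intros = A_const A_add A_diff A_scale A_mult \<Gamma>_closed L_closed

lemma \<Gamma>_mult:
  assumes "f \<in> A" "g \<in> A" "h \<in> A"
  shows "AE z in \<mu>. \<Gamma> (\<lambda>z. f z * g z) h z = f z * \<Gamma> g h z + g z * \<Gamma> f h z"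
  using \<Gamma>_diffusion[OF smooth_fun_mult _ _ assms(3), of "\<lambda>i. if i = 0 then f else g"] assms
  by (simp add: numeral_2_eq_2 partial_deriv_mult partial_deriv_mult[simplified] algebra_simps)

lemma L_mult:
  assumes "f \<in> A" "g \<in> A"
  shows "AE z in \<mu>. L (\<lambda>z. f z * g z) z = f z * L g z + g z * L f z + 2 * \<Gamma> f g z"
proof -
  have "AE z in \<mu>. L (\<lambda>z. f z * g z) z = f z * L g z + g z * L f z + (\<Gamma> f g z + \<Gamma> g f z)"
    using L_diffusion[OF smooth_fun_mult, of "\<lambda>i. if i = 0 then f else g"] assms
    by (simp add: numeral_2_eq_2 partial_deriv_mult partial_deriv_mult[simplified] algebra_simps)
  with \<Gamma>_sym[OF assms] show ?thesis by eventually_elim simp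
qed

lemma \<Gamma>_lin_right:
  assumes "f \<in> A" "g \<in> A" "h \<in> A"
  shows "AE z in \<mu>. \<Gamma> h (\<lambda>z. a * f z + b * g z) z = a * \<Gamma> h f z + b * \<Gamma> h g z"
  using \<Gamma>_lin[OF assms, of a b] \<Gamma>_sym[OF assms(1,3)] \<Gamma>_sym[OF assms(2,3)] \<Gamma>_sym[OF assms(3) A_lin[OF
    assms(1,2), of a b]]
  by eventually_elim simp

text \<open>The product rule for \<open>1 * 1\<close> makes \<open>\<Gamma> 1 f\<close> equal to
  twice itself.\<close>

lemma \<Gamma>_const: assumes "f \<in> A" shows "AE z in \<mu>. \<Gamma> (\<lambda>_. c) f z = 0"
  using \<Gamma>_mult[OF A_one A_one assms] \<Gamma>_lin[OF A_one A_one assms, of c 0]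
  by eventually_elim simp

lemma integral_\<Gamma>: "f \<in> A \<Longrightarrow> g \<in> A \<Longrightarrow> (\<integral>z. \<Gamma> f g z \<partial>\<mu>) = - (\<integral>z. f z * L g z \<partial>\<mu>)"
  using L_by_parts[of g f] integral_cong_AE[OF _ _ \<Gamma>_sym[of f g]]
  by (simp add: A_measurable \<Gamma>_closed)

lemma L_symmetric: "f \<in> A \<Longrightarrow> g \<in> A \<Longrightarrow> (\<integral>z. g z * L f z \<partial>\<mu>) = (\<integral>z. f z * L g z \<partial>\<mu>)"
  using L_by_parts[of f g] integral_\<Gamma>[of f g] by simp

lemma integrable_A: "f \<in> A \<Longrightarrow> integrable \<mu> f"
  by (simp add: A_ess_bdd ess_bdd_integrable)

lemma A_weak_zero:
  assumes "D \<in> A" "\<And>h. h \<in> A \<Longrightarrow> (\<integral>z. h z * D z \<partial>\<mu>) = 0" shows "AE z in \<mu>. D z = 0"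
  using integral_square_zero_AE[OF A_square_int[OF assms(1)]] assms(2)[OF assms(1)]
  by (simp add: power2_eq_square)

text \<open>By symmetry, the integral of \<open>h * L f\<close> is linear in \<open>f\<close> for
  each test function \<open>h\<close>. The difference of the two sides lies in \<open>A\<close>, so
  it may be tested against itself.\<close>

lemma L_lin:
  assumes "f \<in> A" "g \<in> A"
  shows "AE z in \<mu>. L (\<lambda>z. a * f z + b * g z) z = a * L f z + b * L g z"
proof -
  let ?D = "\<lambda>z. L (\<lambda>z. a * f z + b * g z) z - (a * L f z + b * L g z)"
  have l: "(\<lambda>z. a * f z + b * g z) \<in> A" using assms by (rule A_lin)
  have "AE z in \<mu>. ?D z = 0"
  proof (rule A_weak_zero)
    show "?D \<in> A" using assms by (intro A_intros A_lin)
    fix h assume h: "h \<in> A"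
    note i = integrable_A[OF A_mult[OF h L_closed[OF l]]] integrable_A[OF A_mult[OF h L_closed[OF assms(1)]]]
       integrable_A[OF A_mult[OF h L_closed[OF assms(2)]]]
       integrable_A[OF A_mult[OF assms(1) L_closed[OF h]]] integrable_A[OF A_mult[OF assms(2) L_closed[OF h]]]
    have "(\<integral>z. h z * ?D z \<partial>\<mu>) = (\<integral>z. h z * L (\<lambda>z. a * f z + b * g z) z - (a * (h z * L f z) + b * (h z * L g
      z)) \<partial>\<mu>)"
      by (simp add: algebra_simps)
    also have "\<dots> = (\<integral>z. h z * L (\<lambda>z. a * f z + b * g z) z \<partial>\<mu>) - (a * (\<integral>z. h z * L f z \<partial>\<mu>) + b * (\<integral>z. h z * L
      g z \<partial>\<mu>))"
      using i by simp
    also have "(\<integral>z. h z * L (\<lambda>z. a * f z + b * g z) z \<partial>\<mu>) = (\<integral>z. (a * f z + b * g z) * L h z \<partial>\<mu>)"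
      by (rule L_symmetric[OF l h])
    also have "\<dots> = (\<integral>z. a * (f z * L h z) + b * (g z * L h z) \<partial>\<mu>)" by (simp add: algebra_simps)
    also have "\<dots> = a * (\<integral>z. f z * L h z \<partial>\<mu>) + b * (\<integral>z. g z * L h z \<partial>\<mu>)" using i by simp
    finally show "(\<integral>z. h z * ?D z \<partial>\<mu>) = 0"
      using L_symmetric[OF assms(1) h] L_symmetric[OF assms(2) h] by simp
  qed
  then show ?thesis by simp
qed

lemma L_const: "AE z in \<mu>. L (\<lambda>_. c) z = 0"
  using L_mult[OF A_one A_one] \<Gamma>_const[OF A_one, of 1] L_lin[OF A_one A_one, of c 0]
  by eventually_elim simp

lemma integral_L: assumes "f \<in> A" shows "(\<integral>z. L f z \<partial>\<mu>) = 0"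
proof -
  have "AE z in \<mu>. f z * L (\<lambda>_. 1) z = 0" using L_const[of 1] by eventually_elim simp
  then have "(\<integral>z. f z * L (\<lambda>_. 1) z \<partial>\<mu>) = (\<integral>z. 0 \<partial>\<mu>)"
    using A_measurable[OF A_mult[OF assms L_closed[OF A_one]]] by (intro integral_cong_AE) simp_all
  then show ?thesis using L_symmetric[OF assms A_one] by simp
qed

text \<open>The operators act on functions rather than on classes. That \<open>L\<close> respects
  null sets follows by moving it to the test function.\<close>

lemma L_cong:
  assumes "f \<in> A" "g \<in> A" "AE z in \<mu>. f z = g z" shows "AE z in \<mu>. L f z = L g z"
proof -
  let ?D = "\<lambda>z. L (\<lambda>z. 1 * f z + (-1) * g z) z"
  have l: "(\<lambda>z. 1 * f z + (-1) * g z) \<in> A" using assms(1,2) by (rule A_lin)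
  have "AE z in \<mu>. ?D z = 0"
  proof (rule A_weak_zero)
    show "?D \<in> A" using l by (rule L_closed)
    fix h assume h: "h \<in> A"
    have "(\<integral>z. h z * ?D z \<partial>\<mu>) = (\<integral>z. (1 * f z + (-1) * g z) * L h z \<partial>\<mu>)"
      by (rule L_symmetric[OF l h])
    also have "\<dots> = (\<integral>z. 0 \<partial>\<mu>)"
    proof (rule integral_cong_AE)
      show "AE z in \<mu>. (1 * f z + (-1) * g z) * L h z = 0" using assms(3) by eventually_elim simp
    qed (use A_measurable[OF A_mult[OF l L_closed[OF h]]] in simp_all)
    finally show "(\<integral>z. h z * ?D z \<partial>\<mu>) = 0" by simp
  qed
  with L_lin[OF assms(1,2), of 1 "-1"] show ?thesis by eventually_elim simp
qed

lemma \<Gamma>_square_lin: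
  assumes "f \<in> A" "g \<in> A"
  shows "AE z in \<mu>. \<Gamma> (\<lambda>z. a * f z + b * g z) (\<lambda>z. a * f z + b * g z) z =
     a\<^sup>2 * \<Gamma> f f z + 2 * a * b * \<Gamma> f g z + b\<^sup>2 * \<Gamma> g g z"
  using \<Gamma>_lin[OF assms A_lin[OF assms], of a b a b] \<Gamma>_lin_right[OF assms assms(1), of a b]
    \<Gamma>_lin_right[OF assms assms(2), of a b] \<Gamma>_sym[OF assms]
  by eventually_elim (simp add: power2_eq_square algebra_simps)

text \<open>\<open>\<Gamma>\<close> of \<open>f + q g\<close> is a nonnegative quadratic in
  \<open>q\<close>. Rational \<open>q\<close> come first, so that one null set serves for
  all.\<close>

lemma \<Gamma>_Cauchy_Schwarz:
  assumes "f \<in> A" "g \<in> A" shows "AE z in \<mu>. (\<Gamma> f g z)\<^sup>2 \<le> \<Gamma> f f z * \<Gamma> g g z"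
proof -
  have "AE z in \<mu>. \<forall>q\<in>\<rat>. 0 \<le> \<Gamma> f f z + 2 * q * \<Gamma> f g z + q\<^sup>2 * \<Gamma> g g z"
  proof (rule AE_ball_countable'[OF _ countable_rat])
    fix q :: real
    show "AE z in \<mu>. 0 \<le> \<Gamma> f f z + 2 * q * \<Gamma> f g z + q\<^sup>2 * \<Gamma> g g z"
      using \<Gamma>_square_lin[OF assms, of 1 q] \<Gamma>_nonneg[OF A_lin[OF assms, of 1 q]]
      by eventually_elim simp
  qed
  with \<Gamma>_nonneg[OF assms(2)] show ?thesis
  proof eventually_elim
    case (elim z)
    have "0 \<le> \<Gamma> f f z + 2 * x * \<Gamma> f g z + x\<^sup>2 * \<Gamma> g g z" for x
      by (rule nonneg_on_Rats_imp_nonneg[where f = "\<lambda>x. \<Gamma> f f z + 2 * x * \<Gamma> f g z + x\<^sup>2 * \<Gamma> g g z"])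
         (use elim in \<open>auto intro!: continuous_intros\<close>)
    then show ?case using elim(1) by (rule discriminant_of_nonneg)
  qed
qed

text \<open>If \<open>d = f - f'\<close> vanishes almost everywhere, the integral of
  \<open>\<Gamma> d d\<close> is minus that of \<open>d * L d\<close>, hence 0. So
  \<open>\<Gamma> d d\<close> vanishes, and Cauchy-Schwarz gives \<open>\<Gamma> d h = 0\<close> for
  every \<open>h\<close>.\<close>

lemma \<Gamma>_cong:
  assumes "f \<in> A" "f' \<in> A" "g \<in> A" "g' \<in> A" "AE z in \<mu>. f z = f' z" "AE z in \<mu>. g z = g' z"
  shows "AE z in \<mu>. \<Gamma> f g z = \<Gamma> f' g' z"
proof -
  have *: "AE z in \<mu>. \<Gamma> f h z = \<Gamma> f' h z"
    if "f \<in> A" "f' \<in> A" "h \<in> A" "AE z in \<mu>. f z = f' z" for f f' h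
  proof -
    let ?d = "\<lambda>z. 1 * f z + (-1) * f' z"
    have d: "?d \<in> A" using that(1,2) by (rule A_lin)
    have "(\<integral>z. \<Gamma> ?d ?d z \<partial>\<mu>) = - (\<integral>z. ?d z * L ?d z \<partial>\<mu>)" by (rule integral_\<Gamma>[OF d d])
    also have "(\<integral>z. ?d z * L ?d z \<partial>\<mu>) = (\<integral>z. 0 \<partial>\<mu>)"
    proof (rule integral_cong_AE)
      show "AE z in \<mu>. ?d z * L ?d z = 0" using that(4) by eventually_elim simp
    qed (use A_measurable[OF A_mult[OF d L_closed[OF d]]] in simp_all)
    finally have "(\<integral>z. \<Gamma> ?d ?d z \<partial>\<mu>) = 0" by simp
    then have "AE z in \<mu>. \<Gamma> ?d ?d z = 0"
      by (subst (asm) integral_nonneg_eq_0_iff_AE) (use \<Gamma>_nonneg[OF d] integrable_A[OF \<Gamma>_closed[OF d d]] in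
        auto)
    then show ?thesis using \<Gamma>_Cauchy_Schwarz[OF d that(3)] \<Gamma>_lin[OF that(1-3), of 1 "-1"]
      by eventually_elim simp
  qed
  from *[OF assms(1-3,5)] *[OF assms(3,4,2,6)] \<Gamma>_sym[OF assms(2,3)] \<Gamma>_sym[OF assms(2,4)]
  show ?thesis using assms(6) by eventually_elim simp
qed

text \<open>Cauchy-Schwarz twice, pointwise for \<open>\<Gamma>\<close> and then for the integral. A
  small energy thus makes mixed terms small in L1.\<close>

lemma integral_abs_\<Gamma>_le:
  assumes "f \<in> A" "g \<in> A"
  shows "(\<integral>z. \<bar>\<Gamma> f g z\<bar> \<partial>\<mu>) \<le> sqrt (\<integral>z. \<Gamma> f f z \<partial>\<mu>) * sqrt (\<integral>z. \<Gamma> g g z \<partial>\<mu>)"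
proof -
  note \<Gamma>_closed[THEN A_measurable, measurable]
  have m: "\<Gamma> f f \<in> borel_measurable \<mu>" if "f \<in> A" for f using that by (simp add: A_measurable \<Gamma>_closed)
  \<comment> \<open>\<open>\<Gamma> f f\<close> is nonnegative only almost everywhere, hence the
    absolute value under the root.\<close>
  have s: "square_int \<mu> (\<lambda>z. sqrt \<bar>\<Gamma> f f z\<bar>)" if "f \<in> A" for f
    using m[OF that] integrable_A[OF \<Gamma>_closed[OF that that]] by (simp add: square_int_def)
  have e: "(\<integral>z. (sqrt \<bar>\<Gamma> f f z\<bar>)\<^sup>2 \<partial>\<mu>) = (\<integral>z. \<Gamma> f f z \<partial>\<mu>)" if "f \<in> A" for f
  proof (rule integral_cong_AE)
    show "AE z in \<mu>. (sqrt \<bar>\<Gamma> f f z\<bar>)\<^sup>2 = \<Gamma> f f z" using \<Gamma>_nonneg[OF that] by eventually_elim simp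
  qed (use m[OF that] in simp_all)
  have "(\<integral>z. \<bar>\<Gamma> f g z\<bar> \<partial>\<mu>) \<le> (\<integral>z. \<bar>sqrt \<bar>\<Gamma> f f z\<bar> * sqrt \<bar>\<Gamma> g g z\<bar>\<bar> \<partial>\<mu>)"
  proof (rule integral_mono_AE)
    show "AE z in \<mu>. \<bar>\<Gamma> f g z\<bar> \<le> \<bar>sqrt \<bar>\<Gamma> f f z\<bar> * sqrt \<bar>\<Gamma> g g z\<bar>\<bar>"
      using \<Gamma>_Cauchy_Schwarz[OF assms] \<Gamma>_nonneg[OF assms(1)] \<Gamma>_nonneg[OF assms(2)]
    proof eventually_elim
      case (elim z)
      then show ?case by (metis abs_of_nonneg real_sqrt_abs real_sqrt_le_mono real_sqrt_mult abs_ge_zero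
        real_sqrt_ge_zero zero_le_mult_iff)
    qed
  qed (use integrable_A[OF \<Gamma>_closed[OF assms]] square_int_mult[OF s[OF assms(1)] s[OF assms(2)]] in auto)
  also have "\<dots> \<le> sqrt (\<integral>z. (sqrt \<bar>\<Gamma> f f z\<bar>)\<^sup>2 \<partial>\<mu>) * sqrt (\<integral>z. (sqrt \<bar>\<Gamma> g g z\<bar>)\<^sup>2 \<partial>\<mu>)"
    by (rule Cauchy_Schwarz_integral[OF s[OF assms(1)] s[OF assms(2)]])
  finally show ?thesis using e assms by simp
qed

subsection \<open>The semigroup\<close>

lemma P_sq_contraction: "0 \<le> t \<Longrightarrow> square_int \<mu> f \<Longrightarrow> (\<integral>z. (P t f z)\<^sup>2 \<partial>\<mu>) \<le> (\<integral>z. (f z)\<^sup>2 \<partial>\<mu>)"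
  using P_contraction[of t f] by (simp add: L2_norm_def)

lemma P_measurable: "0 \<le> t \<Longrightarrow> square_int \<mu> f \<Longrightarrow> P t f \<in> borel_measurable \<mu>"
  using P_L2 by (auto simp: square_int_def)

lemma P_diff:
  assumes "0 \<le> t" "square_int \<mu> f" "square_int \<mu> g"
  shows "AE z in \<mu>. P t (\<lambda>z. f z - g z) z = P t f z - P t g z"
  using P_lin[OF assms, of 1 "-1"] by simp

lemma P_mono:
  assumes "0 \<le> t" "square_int \<mu> f" "square_int \<mu> g" "AE z in \<mu>. f z \<le> g z"
  shows "AE z in \<mu>. P t f z \<le> P t g z"
proof -
  have "AE z in \<mu>. 0 \<le> P t (\<lambda>z. g z - f z) z"
    by (rule P_positive) (use assms square_int_diff in auto)
  with P_diff[OF assms(1,3,2)] show ?thesis by eventually_elim simp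
qed

lemma P_cong:
  assumes "0 \<le> t" "square_int \<mu> f" "square_int \<mu> g" "AE z in \<mu>. f z = g z"
  shows "AE z in \<mu>. P t f z = P t g z"
proof -
  have "AE z in \<mu>. f z \<le> g z" "AE z in \<mu>. g z \<le> f z" using assms(4) by auto
  from P_mono[OF assms(1-3) this(1)] P_mono[OF assms(1,3,2) this(2)] show ?thesis
    by eventually_elim simp
qed

lemma P_const: assumes "0 \<le> t" shows "AE z in \<mu>. P t (\<lambda>_. c) z = c"
proof -
  have s: "square_int \<mu> (\<lambda>_. 1 :: real)" by (simp add: square_int_ess_bdd ess_bdd_const)
  show ?thesis using P_lin[OF assms s s, of c 0] P_one[OF assms] by eventually_elim simp
qed

lemma P_le_const:
  assumes "0 \<le> t" "square_int \<mu> f" "AE z in \<mu>. f z \<le> c" shows "AE z in \<mu>. P t f z \<le> c"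
  using P_mono[OF assms(1,2) square_int_ess_bdd[OF ess_bdd_const] assms(3)] P_const[OF assms(1), of c]
  by eventually_elim simp

lemma P_ge_const:
  assumes "0 \<le> t" "square_int \<mu> f" "AE z in \<mu>. c \<le> f z" shows "AE z in \<mu>. c \<le> P t f z"
  using P_mono[OF assms(1) square_int_ess_bdd[OF ess_bdd_const] assms(2,3)] P_const[OF assms(1), of c]
  by eventually_elim simp

lemma P_abs_bound:
  assumes "0 \<le> t" "square_int \<mu> f" "AE z in \<mu>. \<bar>f z\<bar> \<le> c" shows "AE z in \<mu>. \<bar>P t f z\<bar> \<le> c"
proof -
  have "AE z in \<mu>. f z \<le> c" "AE z in \<mu>. - c \<le> f z" using assms(3) by (auto elim: eventually_mono)
  from P_le_const[OF assms(1,2) this(1)] P_ge_const[OF assms(1,2) this(2)] show ?thesis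
    by eventually_elim simp
qed

lemma P_ess_bdd: assumes "0 \<le> t" "ess_bdd f" shows "ess_bdd (P t f)"
proof -
  obtain K where "AE z in \<mu>. \<bar>f z\<bar> \<le> K" using assms(2) by (rule ess_bddE)
  from P_abs_bound[OF assms(1) square_int_ess_bdd[OF assms(2)] this] show ?thesis
    by (rule ess_bddI[OF P_measurable[OF assms(1) square_int_ess_bdd[OF assms(2)]]])
qed

lemma P_at_zero:
  assumes "square_int \<mu> f" shows "((\<lambda>r. \<integral>z. (P r f z - f z)\<^sup>2 \<partial>\<mu>) \<longlongrightarrow> 0) (at_right 0)"
  using tendsto_power[OF P_strongly_continuous[OF assms], of 2] unfolding L2_norm_def
  by (simp add: real_sqrt_pow2)

lemma generator_limit:
  assumes "f \<in> A"
  shows "((\<lambda>r. \<integral>z. ((P r f z - f z) / r - L f z)\<^sup>2 \<partial>\<mu>) \<longlongrightarrow> 0) (at_right 0)"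
  using tendsto_power[OF P_generator[OF assms, unfolded in_generator_def L2_norm_def, THEN conjunct2, THEN
    conjunct2], of 2]
  by (simp add: real_sqrt_pow2)

lemma P_diff_quotient:
  assumes "0 \<le> t" "0 \<le> r" "f \<in> A"
  shows "AE z in \<mu>. P t (\<lambda>z. (P r f z - f z) / r - L f z) z = (P (t + r) f z - P t f z) / r - P t (L f) z"
proof -
  note sq = A_square_int[OF assms(3)] A_square_int[OF L_closed[OF assms(3)]] P_L2[OF assms(2)
    A_square_int[OF assms(3)]]
  have 1: "AE z in \<mu>. P t (\<lambda>z. 1 / r * P r f z + (- 1 / r) * f z) z = 1 / r * P t (P r f) z + (- 1 / r) * P
    t f z"
    by (rule P_lin[OF assms(1) sq(3,1)])
  have 2: "AE z in \<mu>. P t (\<lambda>z. (1 / r * P r f z + (- 1 / r) * f z) - L f z) z =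
      P t (\<lambda>z. 1 / r * P r f z + (- 1 / r) * f z) z - P t (L f) z"
    by (rule P_diff[OF assms(1) square_int_lin[OF sq(3,1)] sq(2)])
  have eq: "(\<lambda>z. (1 / r * P r f z + (- 1 / r) * f z) - L f z) = (\<lambda>z. (P r f z - f z) / r - L f z)"
    by (auto simp: diff_divide_distrib)
  show ?thesis using 1 2 P_add[OF assms(1,2) sq(1)] unfolding eq
    by eventually_elim (simp add: diff_divide_distrib)
qed

text \<open>Differentiability at any time comes from the right derivative at 0. For
  \<open>r > s\<close> the error is \<open>P s\<close> applied to the error at 0. For
  \<open>r < s\<close> it is \<open>P r\<close> applied to that error plus \<open>P r\<close> of
  \<open>L f - P h (L f)\<close>, where \<open>h = s - r\<close>. Contraction removes
  \<open>P s\<close> and \<open>P r\<close>.\<close>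

lemma P_curve_bound:
  assumes "f \<in> A" "0 \<le> s" "0 \<le> r" "r \<noteq> s"
  shows "(\<integral>z. ((P r f z - P s f z) / (r - s) - P s (L f) z)\<^sup>2 \<partial>\<mu>) \<le>
     2 * (\<integral>z. ((P \<bar>r - s\<bar> f z - f z) / \<bar>r - s\<bar> - L f z)\<^sup>2 \<partial>\<mu>) + 2 * (\<integral>z. (P \<bar>r - s\<bar> (L f) z - L f z)\<^sup>2 \<partial>\<mu>)"
    (is "_ \<le> 2 * ?U + 2 * ?V")
proof -
  let ?h = "\<bar>r - s\<bar>"
  have h: "0 \<le> ?h" by simp
  let ?D = "\<lambda>z. (P ?h f z - f z) / ?h - L f z" and ?E = "\<lambda>z. L f z - P ?h (L f) z"
  note Lf = L_closed[OF assms(1)]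
  note [simp] = A_square_int[OF assms(1)] A_square_int[OF Lf] P_L2[OF h A_square_int[OF assms(1)]] P_L2[OF h
    A_square_int[OF Lf]]
     P_L2[OF assms(2) A_square_int[OF assms(1)]] P_L2[OF assms(2) A_square_int[OF Lf]] P_L2[OF assms(3)
       A_square_int[OF assms(1)]]
  have D: "square_int \<mu> ?D"
  proof -
    have "square_int \<mu> (\<lambda>z. (1 / ?h * P ?h f z + (- 1 / ?h) * f z) - L f z)"
      by (intro square_int_diff square_int_lin) simp_all
    then show ?thesis by (simp add: diff_divide_distrib)
  qed
  have E: "square_int \<mu> ?E" by (intro square_int_diff) simp_all
  have V: "(\<integral>z. (?E z)\<^sup>2 \<partial>\<mu>) = ?V" by (simp add: power2_commute)
  have V0: "0 \<le> ?V" "0 \<le> ?U" by simp_all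
  let ?Q = "\<lambda>z. (P r f z - P s f z) / (r - s) - P s (L f) z"
  have Q: "?Q \<in> borel_measurable \<mu>"
    using P_measurable[OF assms(2) A_square_int[OF assms(1)]] P_measurable[OF assms(3) A_square_int[OF
      assms(1)]]
      P_measurable[OF assms(2) A_square_int[OF Lf]] by measurable
  show ?thesis
  proof (cases "s < r")
    case True
    then have r: "r = s + ?h" by simp
    have "AE z in \<mu>. P s ?D z = (P (s + ?h) f z - P s f z) / ?h - P s (L f) z"
      by (rule P_diff_quotient[OF assms(2) h assms(1)])
    then have "AE z in \<mu>. P s ?D z = ?Q z" using True by simp
    then have "(\<integral>z. (?Q z)\<^sup>2 \<partial>\<mu>) = (\<integral>z. (P s ?D z)\<^sup>2 \<partial>\<mu>)"
      by (intro integral_cong_AE) (use Q P_measurable[OF assms(2) D] in \<open>auto elim!: eventually_mono\<close>)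
    also have "\<dots> \<le> ?U" by (rule P_sq_contraction[OF assms(2) D])
    finally show ?thesis using V0 by linarith
  next
    case False
    then have s: "r + ?h = s" using assms(4) by simp
    have 1: "AE z in \<mu>. P r ?D z = (P (r + ?h) f z - P r f z) / ?h - P r (L f) z"
      by (rule P_diff_quotient[OF assms(3) h assms(1)])
    have 2: "AE z in \<mu>. P r ?E z = P r (L f) z - P r (P ?h (L f)) z"
      by (rule P_diff[OF assms(3)]) simp_all
    have 3: "AE z in \<mu>. P (r + ?h) (L f) z = P r (P ?h (L f)) z" by (rule P_add[OF assms(3) h]) simp
    have "AE z in \<mu>. ?Q z = P r ?D z + P r ?E z"
      using 1 2 3 unfolding s
    proof eventually_elim
      case (elim z)
      have "(P r f z - P s f z) / (r - s) = (P s f z - P r f z) / ?h"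
        using False minus_divide_divide[of "P s f z - P r f z" "s - r"] by simp
      then show ?case using elim by simp
    qed
    then have "(\<integral>z. (?Q z)\<^sup>2 \<partial>\<mu>) = (\<integral>z. (P r ?D z + P r ?E z)\<^sup>2 \<partial>\<mu>)"
      by (intro integral_cong_AE) (use Q P_measurable[OF assms(3) D] P_measurable[OF assms(3) E] in \<open>auto
        elim!: eventually_mono\<close>)
    also have "\<dots> \<le> 2 * (\<integral>z. (P r ?D z)\<^sup>2 \<partial>\<mu>) + 2 * (\<integral>z. (P r ?E z)\<^sup>2 \<partial>\<mu>)"
      by (rule integral_square_add_le[OF P_L2[OF assms(3) D] P_L2[OF assms(3) E]])
    also have "\<dots> \<le> 2 * ?U + 2 * ?V"
      using P_sq_contraction[OF assms(3) D] P_sq_contraction[OF assms(3) E] V by linarith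
    finally show ?thesis .
  qed
qed

lemma P_curve:
  assumes "f \<in> A" "0 \<le> s"
  shows "((\<lambda>r. \<integral>z. ((P r f z - P s f z) / (r - s) - P s (L f) z)\<^sup>2 \<partial>\<mu>) \<longlongrightarrow> 0) (at s within {0..})"
proof -
  \<comment> \<open>Both sides of \<open>s\<close> are treated at once through the distance
    \<open>\<bar>r - s\<bar>\<close>.\<close>
  have abs: "filterlim (\<lambda>r. \<bar>r - s\<bar>) (at_right 0) (at s within {0..})"
    unfolding filterlim_at by (auto intro!: tendsto_eq_intros simp: eventually_at_filter)
  let ?U = "\<lambda>h. 2 * (\<integral>z. ((P h f z - f z) / h - L f z)\<^sup>2 \<partial>\<mu>) + 2 * (\<integral>z. (P h (L f) z - L f z)\<^sup>2 \<partial>\<mu>)"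
  have "(?U \<longlongrightarrow> 2 * 0 + 2 * 0) (at_right 0)"
    by (intro tendsto_intros generator_limit P_at_zero A_square_int L_closed assms)
  from filterlim_compose[OF this abs] have U: "((\<lambda>r. ?U \<bar>r - s\<bar>) \<longlongrightarrow> 0) (at s within {0..})" by simp
  show ?thesis
  proof (rule tendsto_sandwich[OF _ _ tendsto_const U])
    show "\<forall>\<^sub>F r in at s within {0..}. (\<integral>z. ((P r f z - P s f z) / (r - s) - P s (L f) z)\<^sup>2 \<partial>\<mu>) \<le> ?U \<bar>r - s\<bar>"
      unfolding eventually_at_filter using P_curve_bound[OF assms] by (intro always_eventually) auto
  qed auto
qed

end

lemma SUP_min_of_nat:
  assumes "0 \<le> (x::real)" shows "(SUP n::nat. ereal (min (real n) x)) = ereal x"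
proof (rule SUP_eqI)
  fix y assume y: "\<And>n. n \<in> UNIV \<Longrightarrow> ereal (min (real n) x) \<le> y"
  obtain n where "x \<le> real n" using real_arch_simple by blast
  then show "ereal x \<le> y" using y[of n] by (simp add: min_absorb2)
qed simp

text \<open>For the derivative of \<open>\<Gamma> (P r f) (P r f)\<close>: \<open>u\<close> is
  \<open>\<Gamma>\<close> at the base point, \<open>e\<close> pairs the base point with the
  derivative, \<open>d\<close> pairs it with the remainder of the difference quotient, and
  \<open>w\<close> is \<open>\<Gamma>\<close> of that quotient.\<close>

lemma quadratic_quotient_bound:
  fixes r s :: real
  assumes "r \<noteq> s" and p: "p = u + 2 * (r - s) * (d + e) + (r - s)\<^sup>2 * w" and "x = p" and "0 \<le> w" "w \<le> B"
  shows "\<bar>(x - u) / (r - s) - 2 * e\<bar> \<le> 2 * \<bar>d\<bar> + \<bar>r - s\<bar> * B"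
proof -
  have "p - u = (r - s) * (2 * (d + e) + (r - s) * w)" unfolding p
    by (simp add: power2_eq_square algebra_simps)
  then have "(x - u) / (r - s) - 2 * e = 2 * d + (r - s) * w" using assms(1,3) by simp
  also have "\<bar>\<dots>\<bar> \<le> 2 * \<bar>d\<bar> + \<bar>r - s\<bar> * w"
    using abs_triangle_ineq[of "2 * d" "(r - s) * w"] assms(4) by (simp add: abs_mult)
  also have "\<dots> \<le> 2 * \<bar>d\<bar> + \<bar>r - s\<bar> * B" using assms(5) by (intro add_left_mono mult_left_mono) simp_all
  finally show ?thesis .
qed

context prob_space
begin

lemma L1_deriv_subset: "L1_deriv T a a' s \<Longrightarrow> S \<subseteq> T \<Longrightarrow> L1_deriv S a a' s"
  unfolding L1_deriv_def by (rule tendsto_within_subset)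

lemma L1_deriv_reflect:
  assumes "L1_deriv {0..} a a' (t - s)"
  shows "L1_deriv {0..t} (\<lambda>r. a (t - r)) (\<lambda>z. - a' z) s"
proof -
  have f: "filterlim (\<lambda>r. t - r) (at (t - s) within {0..}) (at s within {0..t})"
    unfolding filterlim_at by (auto intro!: tendsto_eq_intros simp: eventually_at_filter)
  have "(\<lambda>r. \<integral>z. \<bar>(a (t - r) z - a (t - s) z) / (r - s) - - a' z\<bar> \<partial>M) =
        (\<lambda>r. \<integral>z. \<bar>(a (t - r) z - a (t - s) z) / ((t - r) - (t - s)) - a' z\<bar> \<partial>M)"
  proof (intro ext Bochner_Integration.integral_cong refl)
    fix r z
    have "(a (t - r) z - a (t - s) z) / ((t - r) - (t - s)) - a' z = - ((a (t - r) z - a (t - s) z) / (r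
      - s) - - a' z)"
      using minus_divide_right[of "a (t - r) z - a (t - s) z" "r - s"] by simp
    then show "\<bar>(a (t - r) z - a (t - s) z) / (r - s) - - a' z\<bar> =
       \<bar>(a (t - r) z - a (t - s) z) / ((t - r) - (t - s)) - a' z\<bar>" by (simp only: abs_minus_cancel)
  qed
  then show ?thesis using filterlim_compose[OF assms[unfolded L1_deriv_def] f] unfolding L1_deriv_def by simp
qed

end

section \<open>Commutation and symmetry of the semigroup, curves of gradients\<close>

context markov_triple
begin

lemma L_diff:
  assumes "f \<in> A" "g \<in> A" shows "AE z in \<mu>. L (\<lambda>z. f z - g z) z = L f z - L g z"
  using L_lin[OF assms, of 1 "-1"] by simp

text \<open>Both sides are the L2 limit of \<open>(P (t + h) f - P t f) / h\<close>: the left one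
  because \<open>P t f\<close> lies in \<open>A\<close> and hence in the domain of the generator,
  the right one by differentiating the curve at \<open>t\<close>.\<close>

lemma L_P:
  assumes "f \<in> A" "0 \<le> t" shows "AE z in \<mu>. L (P t f) z = P t (L f) z"
proof -
  let ?u = "P t f" let ?D = "\<lambda>z. L ?u z - P t (L f) z"
  have u: "?u \<in> A" "P t (L f) \<in> A" using assms by (auto intro: P_closed L_closed)
  have D: "?D \<in> A" using u by (intro A_intros)
  let ?X = "\<lambda>h. (\<integral>z. ((P h ?u z - ?u z) / h - L ?u z)\<^sup>2 \<partial>\<mu>)"
  let ?Y = "\<lambda>h. (\<integral>z. ((P (t + h) f z - P t f z) / (t + h - t) - P t (L f) z)\<^sup>2 \<partial>\<mu>)"
  have "filterlim (\<lambda>h. t + h) (at t within {0..}) (at_right 0)"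
    unfolding filterlim_at using assms(2) by (auto intro!: tendsto_eq_intros simp: eventually_at_filter)
  from filterlim_compose[OF P_curve[OF assms] this] have Y: "(?Y \<longlongrightarrow> 0) (at_right 0)" .
  have "((\<lambda>h. 2 * ?X h + 2 * ?Y h) \<longlongrightarrow> 2 * 0 + 2 * 0) (at_right 0)"
    by (intro tendsto_intros Y generator_limit u)
  then have lim: "((\<lambda>h. 2 * ?X h + 2 * ?Y h) \<longlongrightarrow> 0) (at_right 0)" by simp
  have "(\<integral>z. (?D z)\<^sup>2 \<partial>\<mu>) \<le> 0"
  proof (rule tendsto_le[OF _ lim tendsto_const])
    show "\<forall>\<^sub>F h in at_right 0. (\<integral>z. (?D z)\<^sup>2 \<partial>\<mu>) \<le> 2 * ?X h + 2 * ?Y h"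
      unfolding eventually_at_filter
    proof (rule always_eventually, intro allI impI)
      fix h :: real assume "h \<in> {0<..}"
      then have h: "0 < h" "0 \<le> h" by auto
      let ?a = "\<lambda>z. L ?u z - (P h ?u z - ?u z) / h"
      let ?b = "\<lambda>z. (P h ?u z - ?u z) / h - P t (L f) z"
      have ab: "?a \<in> A" "?b \<in> A"
        using A_diff[OF L_closed[OF u(1)] A_scale[OF A_diff[OF P_closed[OF h(2) u(1)] u(1)], of "1 / h"]]
          A_diff[OF A_scale[OF A_diff[OF P_closed[OF h(2) u(1)] u(1)], of "1 / h"] u(2)] by auto
      have "(\<integral>z. (?D z)\<^sup>2 \<partial>\<mu>) = (\<integral>z. (?a z + ?b z)\<^sup>2 \<partial>\<mu>)" by (simp add: algebra_simps)
      also have "\<dots> \<le> 2 * (\<integral>z. (?a z)\<^sup>2 \<partial>\<mu>) + 2 * (\<integral>z. (?b z)\<^sup>2 \<partial>\<mu>)"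
        by (rule integral_square_add_le) (use ab in \<open>auto intro: A_square_int\<close>)
      also have "(\<integral>z. (?a z)\<^sup>2 \<partial>\<mu>) = ?X h" by (simp add: power2_commute)
      also have "(\<integral>z. (?b z)\<^sup>2 \<partial>\<mu>) = ?Y h"
      proof (rule integral_cong_AE)
        have "AE z in \<mu>. P (h + t) f z = P h (P t f) z"
          by (rule P_add[OF h(2) assms(2) A_square_int[OF assms(1)]])
        then show "AE z in \<mu>. (?b z)\<^sup>2 = ((P (t + h) f z - P t f z) / (t + h - t) - P t (L f) z)\<^sup>2"
          by eventually_elim (simp add: add.commute)
        have "P (t + h) f \<in> A" using h assms by (intro P_closed) auto
        note [measurable] = this[THEN A_measurable] u(1)[THEN A_measurable] u(2)[THEN A_measurable]
        show "(\<lambda>z. ((P (t + h) f z - P t f z) / (t + h - t) - P t (L f) z)\<^sup>2) \<in> borel_measurable \<mu>"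
          by measurable
        show "(\<lambda>z. (?b z)\<^sup>2) \<in> borel_measurable \<mu>" using ab(2)[THEN A_measurable] by measurable
      qed
      finally show "(\<integral>z. (?D z)\<^sup>2 \<partial>\<mu>) \<le> 2 * ?X h + 2 * ?Y h" .
    qed
  qed simp
  from integral_square_zero_AE[OF A_square_int[OF D] this] show ?thesis by simp
qed

lemma P_curve_L1:
  assumes "f \<in> A" "0 \<le> s" shows "L1_deriv {0..} (\<lambda>r. P r f) (P s (L f)) s"
  unfolding L1_deriv_def
proof (rule L1_of_L2_tendsto[OF _ P_curve[OF assms]])
  show "\<forall>\<^sub>F r in at s within {0..}. square_int \<mu> (\<lambda>z. (P r f z - P s f z) / (r - s) - P s (L f) z)"
    unfolding eventually_at_filter
  proof (rule always_eventually, intro allI impI)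
    fix r :: real assume "r \<in> {0..}"
    then have "(\<lambda>z. 1 / (r - s) * (P r f z - P s f z) - P s (L f) z) \<in> A"
      using assms by (intro A_intros P_closed) auto
    then show "square_int \<mu> (\<lambda>z. (P r f z - P s f z) / (r - s) - P s (L f) z)"
      using A_square_int by simp
  qed
qed

lemma square_int_dense:
  assumes "square_int \<mu> f" "0 < \<epsilon>" shows "\<exists>g\<in>A. (\<integral>z. (f z - g z)\<^sup>2 \<partial>\<mu>) < \<epsilon>"
proof -
  have "\<exists>g\<in>A. (\<integral>z. \<bar>f z - g z\<bar> powr 2 \<partial>\<mu>) < \<epsilon>"
    by (rule A_dense) (use assms in \<open>auto simp: square_int_def\<close>)
  then show ?thesis by simp
qed

text \<open>\<open>?J\<close> interpolates between the two sides and is constant, since symmetry of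
  \<open>L\<close> makes its derivative vanish.\<close>

lemma P_symmetric_A:
  assumes "f \<in> A" "g \<in> A" "0 \<le> t" shows "(\<integral>z. g z * P t f z \<partial>\<mu>) = (\<integral>z. P t g z * f z \<partial>\<mu>)"
proof -
  let ?J = "\<lambda>r. \<integral>z. P r g z * P (t - r) f z \<partial>\<mu>"
  obtain K where K: "AE z in \<mu>. \<bar>g z\<bar> \<le> K" using A_ess_bdd[OF assms(2)] by (rule ess_bddE)
  have "(?J has_real_derivative 0) (at s within {0..t})" if s: "s \<in> {0..t}" for s
  proof -
    have u: "f \<in> A" "L f \<in> A" "P r f \<in> A" "P r (L f) \<in> A" "P r g \<in> A" "P r (L g) \<in> A" if "0 \<le> r" for r
      using that assms by (auto intro: P_closed L_closed)
    have 1: "L1_deriv {0..t} (\<lambda>r. P r g) (P s (L g)) s"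
      by (rule L1_deriv_subset[OF P_curve_L1]) (use assms s in auto)
    have 2: "L1_deriv {0..t} (\<lambda>r. P (t - r) f) (\<lambda>z. - P (t - s) (L f) z) s"
      by (rule L1_deriv_reflect[OF P_curve_L1]) (use assms s in auto)
    have 3: "L1_deriv {0..t} (\<lambda>r z. P r g z * P (t - r) f z)
       (\<lambda>z. P s (L g) z * P (t - s) f z + P s g z * - P (t - s) (L f) z) s"
      by (rule L1_deriv_mult[OF 1 2 s])
         (use s assms in \<open>auto intro!: A_ess_bdd ess_bdd_uminus u P_abs_bound[OF _ _ K] A_square_int\<close>)
    have "(?J has_real_derivative (\<integral>z. P s (L g) z * P (t - s) f z + P s g z * - P (t - s) (L f) z \<partial>\<mu>)) (at
      s within {0..t})"
      by (rule L1_deriv_integral[OF 3 s])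
         (use s in \<open>auto intro!: integrable_A A_diff A_mult u\<close>)
    moreover have "(\<integral>z. P s (L g) z * P (t - s) f z + P s g z * - P (t - s) (L f) z \<partial>\<mu>) = 0"
    proof -
      have c: "0 \<le> s" "0 \<le> t - s" using s by auto
      note m = u(3)[OF c(1)] u(3)[OF c(2)] u(4)[OF c(2)] u(5)[OF c(1)] u(6)[OF c(1)]
      have "(\<integral>z. P s (L g) z * P (t - s) f z + P s g z * - P (t - s) (L f) z \<partial>\<mu>) =
         (\<integral>z. P (t - s) f z * L (P s g) z - P s g z * L (P (t - s) f) z \<partial>\<mu>)"
      proof (rule integral_cong_AE)
        show "AE z in \<mu>. P s (L g) z * P (t - s) f z + P s g z * - P (t - s) (L f) z =
           P (t - s) f z * L (P s g) z - P s g z * L (P (t - s) f) z"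
          using L_P[OF assms(2) c(1)] L_P[OF assms(1) c(2)] by eventually_elim simp
      qed (use m in \<open>auto intro!: A_measurable A_diff A_mult L_closed\<close>)
      also have "\<dots> = (\<integral>z. P (t - s) f z * L (P s g) z \<partial>\<mu>) - (\<integral>z. P s g z * L (P (t - s) f) z \<partial>\<mu>)"
        using m by (intro Bochner_Integration.integral_diff integrable_A A_intros)
      also have "\<dots> = 0" using L_symmetric[OF m(4) m(2)] by simp
      finally show ?thesis .
    qed
    ultimately show ?thesis by simp
  qed
  then have "\<exists>c. \<forall>x\<in>{0..t}. ?J x = c"
    by (intro has_field_derivative_zero_constant) auto
  then obtain c where "\<And>x. x \<in> {0..t} \<Longrightarrow> ?J x = c" by blast
  from this[of 0] this[of t] have "?J 0 = ?J t" using assms(3) by simp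
  moreover have "?J 0 = (\<integral>z. g z * P t f z \<partial>\<mu>)"
    by (rule integral_cong_AE) (use P_zero[OF A_square_int[OF assms(2)]] in
      \<open>auto elim!: eventually_mono intro!: A_measurable A_mult P_closed assms\<close>)
  moreover have "?J t = (\<integral>z. P t g z * f z \<partial>\<mu>)"
    by (rule integral_cong_AE) (use P_zero[OF A_square_int[OF assms(1)]] in
      \<open>auto elim!: eventually_mono intro!: A_measurable A_mult P_closed assms\<close>)
  ultimately show ?thesis by simp
qed

text \<open>Both sides are continuous in \<open>f\<close> for the L2 norm, and \<open>A\<close> is
  dense. The identity on \<open>A\<close> is a hypothesis so that the extension can be carried out
  first in one argument and then in the other.\<close>

lemma P_symmetric_extend:
  assumes t: "0 \<le> t" and g: "square_int \<mu> g"
    and eq: "\<And>f. f \<in> A \<Longrightarrow> (\<integral>z. g z * P t f z \<partial>\<mu>) = (\<integral>z. P t g z * f z \<partial>\<mu>)"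
    and f: "square_int \<mu> f"
  shows "(\<integral>z. g z * P t f z \<partial>\<mu>) = (\<integral>z. P t g z * f z \<partial>\<mu>)"
proof -
  let ?d = "\<bar>(\<integral>z. g z * P t f z \<partial>\<mu>) - (\<integral>z. P t g z * f z \<partial>\<mu>)\<bar>" and ?G = "sqrt (\<integral>z. (g z)\<^sup>2 \<partial>\<mu>)"
  note Pg = P_L2[OF t g]
  have bound: "?d \<le> 2 * ?G * sqrt (\<integral>z. (f z - h z)\<^sup>2 \<partial>\<mu>)" if h: "h \<in> A" for h
  proof -
    let ?e = "\<lambda>z. f z - h z"
    have e: "square_int \<mu> ?e" by (rule square_int_diff[OF f A_square_int[OF h]])
    note Pe = P_L2[OF t e]
    have 1: "(\<integral>z. g z * P t f z \<partial>\<mu>) = (\<integral>z. g z * P t ?e z \<partial>\<mu>) + (\<integral>z. g z * P t h z \<partial>\<mu>)"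
    proof -
      have "(\<integral>z. g z * P t f z \<partial>\<mu>) = (\<integral>z. g z * P t ?e z + g z * P t h z \<partial>\<mu>)"
      proof (rule integral_cong_AE)
        show "AE z in \<mu>. g z * P t f z = g z * P t ?e z + g z * P t h z"
          using P_diff[OF t f A_square_int[OF h]] by eventually_elim (simp add: distrib_left[symmetric])
      qed (use g P_measurable[OF t f] P_measurable[OF t e] P_measurable[OF t A_square_int[OF h]] in
          \<open>auto simp: square_int_def\<close>)
      then show ?thesis using square_int_mult[OF g Pe] square_int_mult[OF g P_L2[OF t A_square_int[OF h]]]
        by simp
    qed
    have 2: "(\<integral>z. P t g z * f z \<partial>\<mu>) = (\<integral>z. P t g z * ?e z \<partial>\<mu>) + (\<integral>z. P t g z * h z \<partial>\<mu>)"
      using square_int_mult[OF Pg e] square_int_mult[OF Pg A_square_int[OF h]]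
      by (subst Bochner_Integration.integral_add[symmetric]) (auto simp: algebra_simps)
    have "\<bar>\<integral>z. g z * P t ?e z \<partial>\<mu>\<bar> \<le> (\<integral>z. \<bar>g z * P t ?e z\<bar> \<partial>\<mu>)" by (rule integral_abs_bound)
    also have "\<dots> \<le> ?G * sqrt (\<integral>z. (P t ?e z)\<^sup>2 \<partial>\<mu>)" by (rule Cauchy_Schwarz_integral[OF g Pe])
    also have "\<dots> \<le> ?G * sqrt (\<integral>z. (?e z)\<^sup>2 \<partial>\<mu>)"
      by (intro mult_left_mono real_sqrt_le_mono P_sq_contraction t e) simp
    finally have a: "\<bar>\<integral>z. g z * P t ?e z \<partial>\<mu>\<bar> \<le> ?G * sqrt (\<integral>z. (?e z)\<^sup>2 \<partial>\<mu>)" .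
    have "\<bar>\<integral>z. P t g z * ?e z \<partial>\<mu>\<bar> \<le> (\<integral>z. \<bar>P t g z * ?e z\<bar> \<partial>\<mu>)" by (rule integral_abs_bound)
    also have "\<dots> \<le> sqrt (\<integral>z. (P t g z)\<^sup>2 \<partial>\<mu>) * sqrt (\<integral>z. (?e z)\<^sup>2 \<partial>\<mu>)"
      by (rule Cauchy_Schwarz_integral[OF Pg e])
    also have "\<dots> \<le> ?G * sqrt (\<integral>z. (?e z)\<^sup>2 \<partial>\<mu>)"
      by (intro mult_right_mono real_sqrt_le_mono P_sq_contraction t g) simp
    finally have b: "\<bar>\<integral>z. P t g z * ?e z \<partial>\<mu>\<bar> \<le> ?G * sqrt (\<integral>z. (?e z)\<^sup>2 \<partial>\<mu>)" .
    from 1 2 a b eq[OF h] show ?thesis by linarith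
  qed
  have G: "0 \<le> ?G" by simp
  have "?d \<le> 0"
  proof (rule field_le_epsilon)
    fix \<eta> :: real assume \<eta>: "0 < \<eta>"
    let ?\<epsilon> = "\<eta> / (2 * ?G + 1)"
    have \<epsilon>: "0 < ?\<epsilon>" using \<eta> G by (intro divide_pos_pos) linarith+
    obtain h where h: "h \<in> A" "(\<integral>z. (f z - h z)\<^sup>2 \<partial>\<mu>) < ?\<epsilon>\<^sup>2"
      using square_int_dense[OF f zero_less_power[OF \<epsilon>, of 2]] by blast
    have "sqrt (\<integral>z. (f z - h z)\<^sup>2 \<partial>\<mu>) \<le> ?\<epsilon>"
      using real_sqrt_le_mono[OF less_imp_le[OF h(2)]] \<epsilon> by simp
    then have "?d \<le> 2 * ?G * ?\<epsilon>" using bound[OF h(1)] G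
      by (meson mult_left_mono order_trans mult_nonneg_nonneg zero_le_numeral)
    also have "\<dots> \<le> \<eta>"
    proof -
      have "x * (\<eta> / (x + 1)) \<le> \<eta>" if "0 \<le> x" for x
        using that \<eta> by (simp add: pos_divide_le_eq algebra_simps)
      from this[of "2 * ?G"] G show ?thesis by simp
    qed
    finally show "?d \<le> 0 + \<eta>" by simp
  qed
  then show ?thesis by simp
qed

lemma P_symmetric:
  assumes "0 \<le> t" "square_int \<mu> f" "square_int \<mu> g"
  shows "(\<integral>z. g z * P t f z \<partial>\<mu>) = (\<integral>z. P t g z * f z \<partial>\<mu>)"
proof (rule P_symmetric_extend[OF assms(1,3) _ assms(2)])
  fix f assume f: "f \<in> A"
  have "(\<integral>z. f z * P t g z \<partial>\<mu>) = (\<integral>z. P t f z * g z \<partial>\<mu>)"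
    by (rule P_symmetric_extend[OF assms(1) A_square_int[OF f] _ assms(3)]) (rule P_symmetric_A[OF _ f
      assms(1)])
  then show "(\<integral>z. g z * P t f z \<partial>\<mu>) = (\<integral>z. P t g z * f z \<partial>\<mu>)" by (simp add: mult.commute)
qed

text \<open>If \<open>k\<close> is L2-close to the indicator \<open>i\<close> of the set where
  \<open>D\<close> is negative, then \<open>k * k\<close> is L1-close to \<open>i\<close>, since
  \<open>k * k - i = (k - i) * (k + i)\<close>. So the hypothesis passes to \<open>i\<close> in the
  limit. Squares serve as test functions because they are nonnegative elements of
  \<open>A\<close>.\<close>

lemma AE_nonneg_test:
  assumes D: "ess_bdd D" and pos: "\<And>k. k \<in> A \<Longrightarrow> 0 \<le> (\<integral>z. (k z * k z) * D z \<partial>\<mu>)"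
  shows "AE z in \<mu>. 0 \<le> D z"
proof -
  note [measurable] = ess_bdd_measurable[OF D]
  obtain K where K: "0 \<le> K" "AE z in \<mu>. \<bar>D z\<bar> \<le> K" using D by (rule ess_bddE)
  let ?N = "{z \<in> space \<mu>. D z < 0}"
  let ?i = "\<lambda>z. indicator ?N z :: real"
  have [measurable]: "?N \<in> sets \<mu>" by measurable
  have i: "ess_bdd ?i" by (rule ess_bddI[of _ 1]) auto
  note si = square_int_ess_bdd[OF i]
  have "0 \<le> (\<integral>z. ?i z * D z \<partial>\<mu>)"
  proof (rule field_le_epsilon)
    fix \<eta> :: real assume \<eta>: "0 < \<eta>"
    \<comment> \<open>The bound 1 keeps the L2 norm of \<open>k + i\<close> below 4; the other entry
      makes \<open>4 * K\<close> times the norm of \<open>k - i\<close> at most \<eta>.\<close>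
    let ?\<epsilon> = "min 1 ((\<eta> / (4 * K + 1))\<^sup>2)"
    have \<epsilon>: "0 < ?\<epsilon>" using \<eta> K(1) by simp
    obtain k where k: "k \<in> A" "(\<integral>z. (?i z - k z)\<^sup>2 \<partial>\<mu>) < ?\<epsilon>"
      using square_int_dense[OF si \<epsilon>] by blast
    note sk = A_square_int[OF k(1)]
    let ?d = "\<lambda>z. k z - ?i z" and ?p = "\<lambda>z. k z + ?i z"
    have d: "square_int \<mu> ?d" by (rule square_int_diff[OF sk si])
    have p: "square_int \<mu> ?p" by (rule square_int_add[OF sk si])
    have nd: "(\<integral>z. (?d z)\<^sup>2 \<partial>\<mu>) < ?\<epsilon>" using k(2) by (simp add: power2_commute)
    have np: "(\<integral>z. (?p z)\<^sup>2 \<partial>\<mu>) \<le> 10"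
    proof -
      have "(\<integral>z. (?p z)\<^sup>2 \<partial>\<mu>) = (\<integral>z. (?d z + 2 * ?i z)\<^sup>2 \<partial>\<mu>)" by (simp add: add.commute)
      also have "\<dots> \<le> 2 * (\<integral>z. (?d z)\<^sup>2 \<partial>\<mu>) + 2 * (\<integral>z. (2 * ?i z)\<^sup>2 \<partial>\<mu>)"
        by (rule integral_square_add_le[OF d square_int_scale[OF si]])
      also have "(\<integral>z. (2 * ?i z)\<^sup>2 \<partial>\<mu>) \<le> (\<integral>z. 4 \<partial>\<mu>)"
        using square_int_scale[OF si, of 2] by (intro integral_mono) (auto simp: square_int_def indicator_def)
      finally show ?thesis using nd by (simp add: prob_space)
    qed
    have dpD: "ess_bdd (\<lambda>z. (k z * k z) * D z)" "ess_bdd (\<lambda>z. ?i z * D z)" "ess_bdd (\<lambda>z. ?d z * ?p z)"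
      using A_ess_bdd[OF k(1)] i D by (auto intro!: ess_bdd_intros)
    have "(\<integral>z. (k z * k z) * D z \<partial>\<mu>) - (\<integral>z. ?i z * D z \<partial>\<mu>) = (\<integral>z. D z * (?d z * ?p z) \<partial>\<mu>)"
    proof -
      have "D z * (?d z * ?p z) = (k z * k z) * D z - ?i z * D z" for z
        by (cases "z \<in> ?N") (auto simp: algebra_simps)
      then show ?thesis using dpD(1,2)[THEN ess_bdd_integrable] by simp
    qed
    also have "\<dots> \<le> (\<integral>z. \<bar>D z * (?d z * ?p z)\<bar> \<partial>\<mu>)" using integral_abs_bound[of \<mu> "\<lambda>z. D z * (?d z * ?p z)"]
      by linarith
    also have "\<dots> \<le> K * (\<integral>z. \<bar>?d z * ?p z\<bar> \<partial>\<mu>)"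
      by (rule integral_abs_mult_le(1)[OF D ess_bdd_integrable[OF dpD(3)] K(2)])
    also have "\<dots> \<le> K * (sqrt (\<integral>z. (?d z)\<^sup>2 \<partial>\<mu>) * sqrt (\<integral>z. (?p z)\<^sup>2 \<partial>\<mu>))"
      by (intro mult_left_mono Cauchy_Schwarz_integral d p K)
    also have "\<dots> \<le> K * ((\<eta> / (4 * K + 1)) * 4)"
    proof (intro mult_left_mono mult_mono K)
      have "sqrt (\<integral>z. (?d z)\<^sup>2 \<partial>\<mu>) \<le> sqrt ((\<eta> / (4 * K + 1))\<^sup>2)" using nd by (intro real_sqrt_le_mono) simp
      then show "sqrt (\<integral>z. (?d z)\<^sup>2 \<partial>\<mu>) \<le> \<eta> / (4 * K + 1)" using \<eta> K(1) by simp
      have "sqrt (\<integral>z. (?p z)\<^sup>2 \<partial>\<mu>) \<le> sqrt 16" using np by (intro real_sqrt_le_mono) simp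
      then show "sqrt (\<integral>z. (?p z)\<^sup>2 \<partial>\<mu>) \<le> 4" by simp
    qed (use \<eta> K(1) in simp_all)
    also have "\<dots> \<le> \<eta>" using \<eta> K(1) by (simp add: field_simps)
    finally show "0 \<le> (\<integral>z. ?i z * D z \<partial>\<mu>) + \<eta>" using pos[OF k(1)] by linarith
  qed
  moreover have "AE z in \<mu>. 0 \<le> - (?i z * D z)" by (rule AE_I2) (auto simp: indicator_def)
  moreover have int: "integrable \<mu> (\<lambda>z. - (?i z * D z))"
    using ess_bdd_integrable[OF ess_bdd_mult[OF i D]] by simp
  ultimately have "(\<integral>z. - (?i z * D z) \<partial>\<mu>) = 0" using integral_nonneg_AE[of "\<lambda>z. - (?i z * D z)" \<mu>] by simp
  then have "AE z in \<mu>. - (?i z * D z) = 0"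
    using integral_nonneg_eq_0_iff_AE[OF int] by (auto simp: indicator_def)
  then show ?thesis by (rule AE_mp) (auto intro!: AE_I2 simp: indicator_def split: if_splits)
qed

text \<open>Let \<open>D r\<close> be the error of the difference quotient of \<open>P r f\<close>.
  Its energy, the integral of \<open>\<Gamma> (D r) (D r)\<close>, is at most the product of the L2
  norms of \<open>D r\<close> and \<open>L (D r)\<close>. As \<open>L\<close> commutes with the
  semigroup, \<open>L (D r)\<close> is the same error with \<open>L f\<close> in place of
  \<open>f\<close>, so both norms tend to 0.\<close>

lemma \<Gamma>_curve:
  assumes f: "f \<in> A" and s: "0 \<le> s"
  shows "L1_deriv {0..} (\<lambda>r. \<Gamma> (P r f) (P r f)) (\<lambda>z. 2 * \<Gamma> (P s f) (P s (L f)) z) s"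
proof -
  let ?u = "P s f" let ?u' = "P s (L f)"
  define D where "D r = (\<lambda>z. 1 / (r - s) * (P r f z - ?u z) + (-1) * ?u' z)" for r
  let ?G = "\<lambda>f. \<integral>z. \<Gamma> f f z \<partial>\<mu>"
  have u: "?u \<in> A" "?u' \<in> A" using f s by (auto intro: P_closed L_closed)
  have D: "D r \<in> A" if "0 \<le> r" for r unfolding D_def
    by (rule A_lin[OF A_diff[OF P_closed[OF that f] u(1)] u(2)])
  have G0: "0 \<le> ?G h" if "h \<in> A" for h by (rule integral_nonneg_AE[OF \<Gamma>_nonneg[OF that]])
  let ?X = "\<lambda>r. \<integral>z. ((P r f z - P s f z) / (r - s) - P s (L f) z)\<^sup>2 \<partial>\<mu>"
  let ?Y = "\<lambda>r. \<integral>z. ((P r (L f) z - P s (L f) z) / (r - s) - P s (L (L f)) z)\<^sup>2 \<partial>\<mu>"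
  have GD_le: "?G (D r) \<le> sqrt (?X r) * sqrt (?Y r)" if r: "0 \<le> r" for r
  proof -
    have LD: "AE z in \<mu>. L (D r) z = (P r (L f) z - P s (L f) z) / (r - s) - P s (L (L f)) z"
      using L_lin[OF A_diff[OF P_closed[OF r f] u(1)] u(2), of "1 / (r - s)" "-1"]
        L_diff[OF P_closed[OF r f] u(1)] L_P[OF f r] L_P[OF f s] L_P[OF L_closed[OF f] s]
    proof eventually_elim
      case (elim z)
      show ?case unfolding D_def elim(1) unfolding elim(2) elim(3-5) by simp
    qed
    have "?G (D r) = - (\<integral>z. D r z * L (D r) z \<partial>\<mu>)" by (rule integral_\<Gamma>[OF D[OF r] D[OF r]])
    also have "\<dots> \<le> (\<integral>z. \<bar>D r z * L (D r) z\<bar> \<partial>\<mu>)"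
      using integral_abs_bound[of \<mu> "\<lambda>z. D r z * L (D r) z"] by linarith
    also have "\<dots> \<le> sqrt (\<integral>z. (D r z)\<^sup>2 \<partial>\<mu>) * sqrt (\<integral>z. (L (D r) z)\<^sup>2 \<partial>\<mu>)"
      by (rule Cauchy_Schwarz_integral) (use D[OF r] in \<open>auto intro: A_square_int L_closed\<close>)
    also have "(\<integral>z. (L (D r) z)\<^sup>2 \<partial>\<mu>) = ?Y r"
    proof (rule integral_cong_AE)
      show "AE z in \<mu>. (L (D r) z)\<^sup>2 = ((P r (L f) z - P s (L f) z) / (r - s) - P s (L (L f)) z)\<^sup>2"
        using LD by eventually_elim simp
      have "P r (L f) \<in> A" "P s (L (L f)) \<in> A" using f r s by (auto intro: P_closed L_closed)
      note [measurable] = this[THEN A_measurable] u(2)[THEN A_measurable] A_measurable[OF L_closed[OF D[OF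
        r]]]
      show "(\<lambda>z. (L (D r) z)\<^sup>2) \<in> borel_measurable \<mu>" by measurable
      show "(\<lambda>z. ((P r (L f) z - P s (L f) z) / (r - s) - P s (L (L f)) z)\<^sup>2) \<in> borel_measurable \<mu>"
        by measurable
    qed
    finally show ?thesis by (simp add: D_def)
  qed
  have GD: "((\<lambda>r. ?G (D r)) \<longlongrightarrow> 0) (at s within {0..})"
  proof (rule tendsto_sandwich[of "\<lambda>_. 0" _ _ "\<lambda>r. sqrt (?X r) * sqrt (?Y r)"])
    have "((\<lambda>r. sqrt (?X r) * sqrt (?Y r)) \<longlongrightarrow> sqrt 0 * sqrt 0) (at s within {0..})"
      by (intro tendsto_intros P_curve f s L_closed)
    then show "((\<lambda>r. sqrt (?X r) * sqrt (?Y r)) \<longlongrightarrow> 0) (at s within {0..})" by simp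
    show "\<forall>\<^sub>F r in at s within {0..}. 0 \<le> ?G (D r)"
      unfolding eventually_at_filter by (rule always_eventually) (simp add: G0[OF D])
    show "\<forall>\<^sub>F r in at s within {0..}. ?G (D r) \<le> sqrt (?X r) * sqrt (?Y r)"
      unfolding eventually_at_filter by (rule always_eventually) (simp add: GD_le)
  qed (rule tendsto_const)
  \<comment> \<open>The first summand bounds the term with \<open>\<Gamma> ?u (D r)\<close> by
    Cauchy-Schwarz; the second bounds the quadratic remainder, which carries a factor
    \<open>\<bar>r - s\<bar>\<close>.\<close>
  let ?B = "\<lambda>r. 2 * (sqrt (?G ?u) * sqrt (?G (D r))) + \<bar>r - s\<bar> * (2 * ?G (D r) + 2 * ?G ?u')"
  show ?thesis
    unfolding L1_deriv_def
  proof (rule tendsto_sandwich[of "\<lambda>_. 0" _ _ ?B])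
    have "(?B \<longlongrightarrow> 2 * (sqrt (?G ?u) * sqrt 0) + \<bar>s - s\<bar> * (2 * 0 + 2 * ?G ?u')) (at s within {0..})"
      by (intro tendsto_intros GD)
    then show "(?B \<longlongrightarrow> 0) (at s within {0..})" by simp
    show "\<forall>\<^sub>F r in at s within {0..}. (\<integral>z. \<bar>(\<Gamma> (P r f) (P r f) z - \<Gamma> ?u ?u z) / (r - s) - 2 * \<Gamma> ?u ?u' z\<bar>
      \<partial>\<mu>) \<le> ?B r"
      unfolding eventually_at_filter
    proof (rule always_eventually, intro allI impI)
      fix r :: real assume r: "r \<noteq> s" "r \<in> {0..}"
      then have r0: "0 \<le> r" by simp
      let ?w = "\<lambda>z. 1 * D r z + 1 * ?u' z"
      note Dr = D[OF r0]
      have w: "?w \<in> A" by (rule A_lin[OF Dr u(2)])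
      have Pr: "P r f = (\<lambda>z. 1 * ?u z + (r - s) * ?w z)"
      proof
        fix z
        have "?w z = (P r f z - ?u z) / (r - s)" by (simp add: D_def)
        then have "(r - s) * ?w z = P r f z - ?u z" using r(1) by simp
        then show "P r f z = 1 * ?u z + (r - s) * ?w z" by simp
      qed
      have 1: "AE z in \<mu>. \<Gamma> (P r f) (P r f) z = 1\<^sup>2 * \<Gamma> ?u ?u z + 2 * 1 * (r - s) * \<Gamma> ?u ?w z + (r
        - s)\<^sup>2 * \<Gamma> ?w ?w z"
        using \<Gamma>_square_lin[OF u(1) w, of 1 "r - s"] unfolding Pr[symmetric] .
      \<comment> \<open>Parallelogram identity, together with nonnegativity of
        \<open>\<Gamma>\<close> at \<open>D r - ?u'\<close>.\<close>
      have 2: "AE z in \<mu>. \<Gamma> ?w ?w z \<le> 2 * \<Gamma> (D r) (D r) z + 2 * \<Gamma> ?u' ?u' z"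
        using \<Gamma>_square_lin[OF Dr u(2), of 1 1] \<Gamma>_square_lin[OF Dr u(2), of 1 "-1"] \<Gamma>_nonneg[OF A_lin[OF Dr
          u(2), of 1 "-1"]]
        by eventually_elim simp
      have 3: "AE z in \<mu>. \<bar>(\<Gamma> (P r f) (P r f) z - \<Gamma> ?u ?u z) / (r - s) - 2 * \<Gamma> ?u ?u' z\<bar> \<le>
         2 * \<bar>\<Gamma> ?u (D r) z\<bar> + \<bar>r - s\<bar> * (2 * \<Gamma> (D r) (D r) z + 2 * \<Gamma> ?u' ?u' z)"
        using 1 2 \<Gamma>_lin_right[OF Dr u(2) u(1), of 1 1] \<Gamma>_nonneg[OF w]
      proof eventually_elim
        case (elim z)
        show ?case by (rule quadratic_quotient_bound[OF r(1) _ elim(1,4,2)]) (unfold elim(3), simp)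
      qed
      note i = integrable_A[OF \<Gamma>_closed[OF u(1) Dr]] integrable_A[OF \<Gamma>_closed[OF Dr Dr]] integrable_A[OF
        \<Gamma>_closed[OF u(2) u(2)]]
        integrable_A[OF \<Gamma>_closed[OF u(1) u(2)]] integrable_A[OF \<Gamma>_closed[OF u(1) u(1)]]
        integrable_A[OF \<Gamma>_closed[OF P_closed[OF r0 f] P_closed[OF r0 f]]]
      have "(\<integral>z. \<bar>(\<Gamma> (P r f) (P r f) z - \<Gamma> ?u ?u z) / (r - s) - 2 * \<Gamma> ?u ?u' z\<bar> \<partial>\<mu>) \<le>
        (\<integral>z. 2 * \<bar>\<Gamma> ?u (D r) z\<bar> + \<bar>r - s\<bar> * (2 * \<Gamma> (D r) (D r) z + 2 * \<Gamma> ?u' ?u' z) \<partial>\<mu>)"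
        by (rule integral_mono_AE[OF _ _ 3]) (use i in simp_all)
      also have "\<dots> = 2 * (\<integral>z. \<bar>\<Gamma> ?u (D r) z\<bar> \<partial>\<mu>) + \<bar>r - s\<bar> * (2 * ?G (D r) + 2 * ?G ?u')"
        using i by simp
      also have "\<dots> \<le> ?B r" using integral_abs_\<Gamma>_le[OF u(1) Dr] by simp
      finally show "(\<integral>z. \<bar>(\<Gamma> (P r f) (P r f) z - \<Gamma> ?u ?u z) / (r - s) - 2 * \<Gamma> ?u ?u' z\<bar> \<partial>\<mu>) \<le> ?B r" .
    qed
  qed auto
qed

subsection \<open>The extended semigroup\<close>

lemma semigroup_ext_cong:
  assumes "0 \<le> t" and [measurable]: "\<phi> \<in> borel_measurable \<mu>" "\<psi> \<in> borel_measurable \<mu>"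
    and "AE z in \<mu>. \<phi> z = \<psi> z"
  shows "AE z in \<mu>. semigroup_ext P t \<phi> z = semigroup_ext P t \<psi> z"
proof -
  have b: "square_int \<mu> (\<lambda>z. min (real n) (max 0 (\<phi> z)))" if [measurable]: "\<phi> \<in> borel_measurable \<mu>" for \<phi> n
    by (intro square_int_ess_bdd ess_bddI[of _ "real n"]) auto
  have "AE z in \<mu>. \<forall>n. P t (\<lambda>z. min (real n) (max 0 (\<phi> z))) z = P t (\<lambda>z. min (real n) (max 0 (\<psi> z))) z"
    unfolding AE_all_countable
    by (intro allI P_cong assms(1) b) (use assms(4) in \<open>auto elim: eventually_mono\<close>)
  moreover have "AE z in \<mu>. \<forall>n. P t (\<lambda>z. min (real n) (max 0 (- \<phi> z))) z = P t (\<lambda>z. min (real n) (max 0 (- \<psi>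
    z))) z"
    unfolding AE_all_countable
    by (intro allI P_cong assms(1) b) (use assms(4) in \<open>auto elim: eventually_mono\<close>)
  ultimately show ?thesis unfolding semigroup_ext_def by eventually_elim simp
qed

text \<open>A lower bound makes the negative part bounded, so its truncations stabilise and
  \<open>P t\<close> of it is finite. It may then be subtracted inside the supremum, where
  \<open>min n (max 0 \<phi>) - max 0 (- \<phi>)\<close> is \<open>min n \<phi>\<close>.\<close>

lemma semigroup_ext_bdd_below:
  assumes t: "0 \<le> t" and [measurable]: "\<phi> \<in> borel_measurable \<mu>" and K: "AE z in \<mu>. - K \<le> \<phi> z"
  shows "AE z in \<mu>. semigroup_ext P t \<phi> z = (SUP n::nat. ereal (P t (\<lambda>z. min (real n) (\<phi> z)) z))"
proof -
  let ?m = "\<lambda>z. max 0 (- \<phi> z)"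
  let ?p = "\<lambda>n z. min (real n) (max 0 (\<phi> z))"
  have p: "square_int \<mu> (?p n)" for n by (intro square_int_ess_bdd ess_bddI[of _ "real n"]) auto
  have mK: "AE z in \<mu>. \<bar>?m z\<bar> \<le> max 0 K" using K by eventually_elim auto
  have m: "square_int \<mu> ?m" by (rule square_int_ess_bdd[OF ess_bddI[OF _ mK]]) simp
  have mn: "square_int \<mu> (\<lambda>z. min (real n) (?m z))" for n
    by (intro square_int_ess_bdd ess_bddI[of _ "real n"]) auto
  have neg: "AE z in \<mu>. (SUP n::nat. ereal (P t (\<lambda>z. min (real n) (?m z)) z)) = ereal (P t ?m z)"
  proof -
    obtain N :: nat where N: "max 0 K \<le> real N" using real_arch_simple by blast
    have "AE z in \<mu>. \<forall>n. P t (\<lambda>z. min (real n) (?m z)) z \<le> P t ?m z"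
      unfolding AE_all_countable by (intro allI P_mono t mn m) simp
    moreover have "AE z in \<mu>. P t (\<lambda>z. min (real N) (?m z)) z = P t ?m z"
      by (rule P_cong[OF t mn m]) (use mK in eventually_elim, use N in auto)
    ultimately show ?thesis
    proof eventually_elim
      case (elim z)
      show ?case
      proof (rule SUP_eqI)
        fix y assume "\<And>n. n \<in> UNIV \<Longrightarrow> ereal (P t (\<lambda>z. min (real n) (?m z)) z) \<le> y"
        from this[of N] show "ereal (P t ?m z) \<le> y" using elim(2) by simp
      qed (use elim(1) in simp)
    qed
  qed
  have split: "AE z in \<mu>. \<forall>n. P t (\<lambda>z. min (real n) (\<phi> z)) z = P t (?p n) z - P t ?m z"
    unfolding AE_all_countable
  proof
    fix n
    have "(\<lambda>z. ?p n z - ?m z) = (\<lambda>z. min (real n) (\<phi> z))" by (auto simp: min_def max_def)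
    with P_diff[OF t p m, of n] show "AE z in \<mu>. P t (\<lambda>z. min (real n) (\<phi> z)) z = P t (?p n) z - P t ?m z"
      by simp
  qed
  show ?thesis using neg split
  proof eventually_elim
    case (elim z)
    have "(SUP n::nat. ereal (P t (\<lambda>z. min (real n) (\<phi> z)) z)) = (SUP n. ereal (P t (?p n) z) + ereal (- P t
      ?m z))"
      using elim(2) by simp
    also have "\<dots> = (SUP n. ereal (P t (?p n) z)) + ereal (- P t ?m z)"
      by (rule SUP_ereal_add_left) simp_all
    also have "\<dots> = semigroup_ext P t \<phi> z"
      unfolding semigroup_ext_def elim(1) by (simp add: minus_ereal_def)
    finally show ?case by simp
  qed
qed

lemma semigroup_ext_ess_bdd:
  assumes t: "0 \<le> t" and \<phi>: "ess_bdd \<phi>"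
  shows "AE z in \<mu>. semigroup_ext P t \<phi> z = ereal (P t \<phi> z)"
proof -
  note [measurable] = ess_bdd_measurable[OF \<phi>]
  obtain K where K: "0 \<le> K" "AE z in \<mu>. \<bar>\<phi> z\<bar> \<le> K" using \<phi> by (rule ess_bddE)
  have "AE z in \<mu>. - K \<le> \<phi> z" using K(2) by eventually_elim simp
  note 1 = semigroup_ext_bdd_below[OF t _ this]
  obtain N :: nat where N: "K \<le> real N" using real_arch_simple by blast
  have s: "square_int \<mu> (\<lambda>z. min (real n) (\<phi> z))" for n
    by (intro square_int_ess_bdd ess_bdd_min ess_bdd_const \<phi>)
  have "AE z in \<mu>. \<forall>n. P t (\<lambda>z. min (real n) (\<phi> z)) z \<le> P t \<phi> z"
    unfolding AE_all_countable by (intro allI P_mono t s square_int_ess_bdd \<phi>) simp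
  moreover have "AE z in \<mu>. P t (\<lambda>z. min (real N) (\<phi> z)) z = P t \<phi> z"
    by (rule P_cong[OF t s square_int_ess_bdd[OF \<phi>]]) (use K(2) in eventually_elim, use N in auto)
  moreover have "AE z in \<mu>. semigroup_ext P t \<phi> z = (SUP n::nat. ereal (P t (\<lambda>z. min (real n) (\<phi> z)) z))"
    by (rule 1) measurable
  ultimately show ?thesis
  proof eventually_elim
    case (elim z)
    show ?case unfolding elim(3)
    proof (rule SUP_eqI)
      fix y assume "\<And>n. n \<in> UNIV \<Longrightarrow> ereal (P t (\<lambda>z. min (real n) (\<phi> z)) z) \<le> y"
      from this[of N] show "ereal (P t \<phi> z) \<le> y" using elim(2) by simp
    qed (use elim(1) in simp)
  qed
qed

lemma semigroup_ext_zero: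
  assumes [measurable]: "\<phi> \<in> borel_measurable \<mu>"
  shows "AE z in \<mu>. semigroup_ext P 0 \<phi> z = ereal (\<phi> z)"
proof -
  have b: "square_int \<mu> (\<lambda>z. min (real n) (max 0 (\<phi> z)))" if [measurable]: "\<phi> \<in> borel_measurable \<mu>" for \<phi> n
    by (intro square_int_ess_bdd ess_bddI[of _ "real n"]) auto
  have "AE z in \<mu>. \<forall>n. P 0 (\<lambda>z. min (real n) (max 0 (\<phi> z))) z = min (real n) (max 0 (\<phi> z))"
    unfolding AE_all_countable by (intro allI P_zero b) measurable
  moreover have "AE z in \<mu>. \<forall>n. P 0 (\<lambda>z. min (real n) (max 0 (- \<phi> z))) z = min (real n) (max 0 (- \<phi> z))"
    unfolding AE_all_countable by (intro allI P_zero b) measurable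
  ultimately show ?thesis
  proof eventually_elim
    case (elim z)
    have "(SUP n::nat. ereal (min (real n) (max 0 (\<phi> z)))) = ereal (max 0 (\<phi> z))"
      "(SUP n::nat. ereal (min (real n) (max 0 (- \<phi> z)))) = ereal (max 0 (- \<phi> z))"
      by (rule SUP_min_of_nat, simp)+
    then show ?case using elim unfolding semigroup_ext_def by (simp del: ereal_min ereal_max add: max_def)
  qed
qed

section \<open>Product rules and the iterated operator\<close>

lemma \<Gamma>_add:
  assumes "f \<in> A" "g \<in> A" "h \<in> A"
  shows "AE z in \<mu>. \<Gamma> (\<lambda>z. f z + g z) h z = \<Gamma> f h z + \<Gamma> g h z"
  using \<Gamma>_lin[OF assms, of 1 1] by simp

lemma \<Gamma>_scale:
  assumes "f \<in> A" "h \<in> A" shows "AE z in \<mu>. \<Gamma> (\<lambda>z. c * f z) h z = c * \<Gamma> f h z"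
  using \<Gamma>_lin[OF assms(1,1,2), of c 0] by simp

lemma \<Gamma>_shift:
  assumes "f \<in> A" "h \<in> A" shows "AE z in \<mu>. \<Gamma> (\<lambda>z. f z - c) h z = \<Gamma> f h z"
  using \<Gamma>_lin[OF assms(1) A_const assms(2), of 1 "-1" c] \<Gamma>_const[OF assms(2), of c]
  by eventually_elim simp

lemma L_add:
  assumes "f \<in> A" "g \<in> A" shows "AE z in \<mu>. L (\<lambda>z. f z + g z) z = L f z + L g z"
  using L_lin[OF assms, of 1 1] by simp

lemma L_scale: assumes "f \<in> A" shows "AE z in \<mu>. L (\<lambda>z. c * f z) z = c * L f z"
  using L_lin[OF assms assms, of c 0] by simp

lemma L_shift: assumes "f \<in> A" shows "AE z in \<mu>. L (\<lambda>z. f z - c) z = L f z"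
  using L_diff[OF assms A_const, of c] L_const[of c] by eventually_elim simp

lemma L_mult3:
  assumes "u \<in> A" "v \<in> A" "w \<in> A"
  shows "AE z in \<mu>. L (\<lambda>z. (u z * v z) * w z) z = u z * v z * L w z + u z * w z * L v z + v z * w z * L u z
     + 2 * u z * \<Gamma> v w z + 2 * v z * \<Gamma> u w z + 2 * w z * \<Gamma> u v z"
  using L_mult[OF A_mult[OF assms(1,2)] assms(3)] L_mult[OF assms(1,2)] \<Gamma>_mult[OF assms]
  by eventually_elim (simp add: algebra_simps)

lemma \<Gamma>_mult3:
  assumes "u \<in> A" "v \<in> A" "w \<in> A" "h \<in> A"
  shows "AE z in \<mu>. \<Gamma> (\<lambda>z. (u z * v z) * w z) h z = u z * v z * \<Gamma> w h z + u z * w z * \<Gamma> v h z + v z * w z *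
    \<Gamma> u h z"
  using \<Gamma>_mult[OF A_mult[OF assms(1,2)] assms(3,4)] \<Gamma>_mult[OF assms(1,2,4)]
  by eventually_elim (simp add: algebra_simps)

lemma Gamma2_closed: "f \<in> A \<Longrightarrow> Gamma2 \<Gamma> L f f \<in> A"
  unfolding Gamma2_def[abs_def]
  using A_scale[OF A_diff[OF A_diff[OF L_closed[OF \<Gamma>_closed] \<Gamma>_closed] \<Gamma>_closed], of f f f "L f" "L f" f
    "1/2"]
  by (simp add: L_closed)

lemma Gamma2_eq:
  assumes "f \<in> A" shows "AE z in \<mu>. Gamma2 \<Gamma> L f f z = L (\<Gamma> f f) z / 2 - \<Gamma> f (L f) z"
  using \<Gamma>_sym[OF assms L_closed[OF assms]] by eventually_elim (simp add: Gamma2_def field_simps)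

text \<open>Controls the mean of \<open>Gamma2\<close> by a quantity that the semigroup contracts,
  as \<open>L\<close> commutes with \<open>P t\<close>.\<close>

lemma integral_Gamma2: assumes "f \<in> A" shows "(\<integral>z. Gamma2 \<Gamma> L f f z \<partial>\<mu>) = (\<integral>z. (L f z)\<^sup>2 \<partial>\<mu>)"
proof -
  note a = \<Gamma>_closed[OF assms assms] L_closed[OF assms]
  have "(\<integral>z. Gamma2 \<Gamma> L f f z \<partial>\<mu>) = (\<integral>z. L (\<Gamma> f f) z / 2 - \<Gamma> f (L f) z \<partial>\<mu>)"
    by (rule integral_cong_AE[OF _ _ Gamma2_eq[OF assms]])
       (use A_measurable[OF Gamma2_closed[OF assms]] A_measurable[OF L_closed[OF a(1)]]
         A_measurable[OF \<Gamma>_closed[OF assms a(2)]] in measurable)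
  also have "\<dots> = (\<integral>z. L (\<Gamma> f f) z \<partial>\<mu>) / 2 - (\<integral>z. \<Gamma> f (L f) z \<partial>\<mu>)"
    using integrable_A[OF L_closed[OF a(1)]] integrable_A[OF \<Gamma>_closed[OF assms a(2)]] by simp
  also have "\<dots> = (\<integral>z. L f z * L f z \<partial>\<mu>)" using integral_L[OF a(1)] L_by_parts[OF assms a(2)] by simp
  finally show ?thesis by (simp add: power2_eq_square)
qed

subsection \<open>The minimum principle\<close>

text \<open>Where \<open>v\<close> vanishes, the quotient \<open>(P r v - v) / r\<close> is
  \<open>P r v / r\<close> and hence nonnegative. It tends to \<open>L v\<close> only in the mean,
  so it is integrated over the set where the conclusion fails.\<close>

lemma L_nonneg_at_zero:
  assumes v: "v \<in> A" and v0: "AE z in \<mu>. 0 \<le> v z"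
  shows "AE z in \<mu>. v z = 0 \<longrightarrow> 0 \<le> L v z"
proof -
  note [measurable] = A_measurable[OF v] A_measurable[OF L_closed[OF v]]
  let ?i = "\<lambda>z. indicator {z \<in> space \<mu>. v z = 0 \<and> L v z < 0} z :: real"
  have i: "ess_bdd ?i" by (rule ess_bddI[of _ 1]) auto
  have i1: "AE z in \<mu>. \<bar>?i z\<bar> \<le> 1" by (auto simp: indicator_def)
  let ?d = "\<lambda>r z. (P r v z - v z) / r - L v z"
  have dA: "?d r \<in> A" if "0 \<le> r" for r
    using A_diff[OF A_scale[OF A_diff[OF P_closed[OF that v] v], of "1 / r"] L_closed[OF v]] by simp
  have lim: "((\<lambda>r. \<integral>z. \<bar>?d r z\<bar> \<partial>\<mu>) \<longlongrightarrow> 0) (at_right 0)"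
  proof (rule L1_of_L2_tendsto[OF _ generator_limit[OF v]])
    show "\<forall>\<^sub>F r in at_right 0. square_int \<mu> (?d r)"
      unfolding eventually_at_filter by (rule always_eventually) (use A_square_int[OF dA] in auto)
  qed
  have iL: "ess_bdd (\<lambda>z. ?i z * L v z)" by (intro ess_bdd_mult i A_ess_bdd L_closed v)
  have "- (\<integral>z. ?i z * L v z \<partial>\<mu>) \<le> 0"
  proof (rule tendsto_le[OF _ lim tendsto_const])
    show "\<forall>\<^sub>F r in at_right 0. - (\<integral>z. ?i z * L v z \<partial>\<mu>) \<le> (\<integral>z. \<bar>?d r z\<bar> \<partial>\<mu>)"
      unfolding eventually_at_filter
    proof (rule always_eventually, intro allI impI)
      fix r :: real assume "r \<in> {0<..}"
      then have r: "0 < r" "0 \<le> r" by auto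
      have id: "integrable \<mu> (\<lambda>z. ?i z * ?d r z)" by (intro ess_bdd_integrable ess_bdd_mult i A_ess_bdd dA r)
      have "- (\<integral>z. ?i z * L v z \<partial>\<mu>) = (\<integral>z. - (?i z * L v z) \<partial>\<mu>)" by simp
      also have "\<dots> \<le> (\<integral>z. ?i z * ?d r z \<partial>\<mu>)"
      proof (rule integral_mono_AE)
        show "AE z in \<mu>. - (?i z * L v z) \<le> ?i z * ?d r z"
          using P_positive[OF r(2) A_square_int[OF v] v0]
        proof eventually_elim
          case (elim z)
          show ?case using elim r(1) by (cases "v z = 0 \<and> L v z < 0") (auto simp: indicator_def)
        qed
      qed (use ess_bdd_integrable[OF iL] id in simp_all)
      also have "\<dots> \<le> (\<integral>z. \<bar>?i z * ?d r z\<bar> \<partial>\<mu>)" using integral_abs_bound[of \<mu> "\<lambda>z. ?i z * ?d r z"] by linarith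
      also have "\<dots> \<le> 1 * (\<integral>z. \<bar>?d r z\<bar> \<partial>\<mu>)" by (rule integral_abs_mult_le(1)[OF i integrable_A[OF dA[OF
        r(2)]] i1])
      finally show "- (\<integral>z. ?i z * L v z \<partial>\<mu>) \<le> (\<integral>z. \<bar>?d r z\<bar> \<partial>\<mu>)" by simp
    qed
  qed simp
  moreover have "AE z in \<mu>. 0 \<le> - (?i z * L v z)" by (auto simp: indicator_def)
  moreover have int: "integrable \<mu> (\<lambda>z. - (?i z * L v z))" using ess_bdd_integrable[OF iL] by simp
  ultimately have "(\<integral>z. - (?i z * L v z) \<partial>\<mu>) = 0" using integral_nonneg_AE[of "\<lambda>z. - (?i z * L v z)" \<mu>]
    by simp
  then have "AE z in \<mu>. - (?i z * L v z) = 0"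
    using integral_nonneg_eq_0_iff_AE[OF int] by (auto simp: indicator_def)
  then show ?thesis by (rule AE_mp) (auto intro!: AE_I2 simp: indicator_def split: if_splits)
qed

text \<open>The minimum principle for \<open>v (1 - k v)\<^sup>2\<close>, as \<open>k \<rightarrow> \<infinity>\<close>.\<close>

lemma \<Gamma>_zero_at_zero:
  assumes v: "v \<in> A" and v0: "AE z in \<mu>. 0 \<le> v z"
  shows "AE z in \<mu>. v z = 0 \<longrightarrow> \<Gamma> v v z = 0"
proof -
  have "AE z in \<mu>. \<forall>n::nat. v z = 0 \<longrightarrow> 4 * real n * \<Gamma> v v z \<le> L v z"
    unfolding AE_all_countable
  proof
    fix n :: nat
    let ?w = "\<lambda>z. 1 + (- real n) * v z"
    have s: "(\<lambda>z. (- real n) * v z) \<in> A" using v by (rule A_scale)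
    have w: "?w \<in> A" by (rule A_add[OF A_const s])
    have p: "(\<lambda>z. (?w z * ?w z) * v z) \<in> A" by (intro A_mult w v)
    have "AE z in \<mu>. 0 \<le> (?w z * ?w z) * v z" using v0 by eventually_elim simp
    from L_nonneg_at_zero[OF p this] L_mult3[OF w w v] \<Gamma>_add[OF A_const s v, of 1] \<Gamma>_scale[OF v v, of
      "- real n"] \<Gamma>_const[OF v, of 1]
    show "AE z in \<mu>. v z = 0 \<longrightarrow> 4 * real n * \<Gamma> v v z \<le> L v z"
    proof eventually_elim
      case (elim z)
      show ?case
      proof
        assume z: "v z = 0"
        have "0 \<le> L (\<lambda>z. (?w z * ?w z) * v z) z" using elim(1) z by simp
        also have "\<dots> = L v z + 4 * \<Gamma> ?w v z" unfolding elim(2) using z by simp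
        also have "\<Gamma> ?w v z = - real n * \<Gamma> v v z" unfolding elim(3-5) by simp
        finally show "4 * real n * \<Gamma> v v z \<le> L v z" by simp
      qed
    qed
  qed
  with \<Gamma>_nonneg[OF v] show ?thesis
  proof eventually_elim
    case (elim z)
    show ?case
    proof (rule impI, rule ccontr)
      assume "v z = 0" "\<Gamma> v v z \<noteq> 0"
      then have pos: "0 < \<Gamma> v v z" using elim(1) by simp
      obtain n :: nat where "L v z / \<Gamma> v v z < real n" using reals_Archimedean2 by blast
      then have "L v z < real n * \<Gamma> v v z" using pos by (simp add: pos_divide_less_eq)
      moreover have "4 * real n * \<Gamma> v v z \<le> L v z" using elim(2) \<open>v z = 0\<close> by blast
      moreover have "0 \<le> real n * \<Gamma> v v z" using pos by simp
      ultimately show False by linarith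
    qed
  qed
qed

text \<open>\<open>\<Gamma> f f\<close> is at its minimum where it vanishes, and there
  \<open>\<Gamma> f (L f)\<close> vanishes by Cauchy-Schwarz.\<close>

lemma Gamma2_nonneg_at_zero:
  assumes "f \<in> A" shows "AE z in \<mu>. \<Gamma> f f z = 0 \<longrightarrow> 0 \<le> Gamma2 \<Gamma> L f f z"
  using L_nonneg_at_zero[OF \<Gamma>_closed[OF assms assms] \<Gamma>_nonneg[OF assms]] Gamma2_eq[OF assms]
    \<Gamma>_Cauchy_Schwarz[OF assms L_closed[OF assms]]
  by eventually_elim auto

subsection \<open>Self-improvement of the curvature condition\<close>

text \<open>Meant for \<open>\<phi> = f + a (f - c) (g - d)\<close>:
  \<open>X = 1 + a (g - d)\<close> and \<open>Y = a (f - c)\<close> are its partial derivatives in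
  \<open>f\<close> and \<open>g\<close>, and \<open>a\<close> is the mixed second derivative. The
  results stay unsimplified, as polynomials in \<open>X\<close>, \<open>Y\<close> and data of
  \<open>f\<close> and \<open>g\<close>, so that they can be evaluated at a single point.\<close>

lemma perturbation_expansion:
  fixes f g X Y \<phi> :: "'a \<Rightarrow> real" and a :: real
  assumes fg: "f \<in> A" "g \<in> A" "X \<in> A" "Y \<in> A" "\<phi> \<in> A"
    and \<phi>': "\<forall>h\<in>A. AE z in \<mu>. \<Gamma> \<phi> h z = X z * \<Gamma> f h z + Y z * \<Gamma> g h z"
    and L\<phi>: "AE z in \<mu>. L \<phi> z = X z * L f z + Y z * L g z + 2 * a * \<Gamma> f g z"
    and X': "\<forall>h\<in>A. AE z in \<mu>. \<Gamma> X h z = a * \<Gamma> g h z" "AE z in \<mu>. L X z = a * L g z"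
    and Y': "\<forall>h\<in>A. AE z in \<mu>. \<Gamma> Y h z = a * \<Gamma> f h z" "AE z in \<mu>. L Y z = a * L f z"
  shows "AE z in \<mu>. \<Gamma> \<phi> \<phi> z = X z * X z * \<Gamma> f f z + 2 * (X z * Y z * \<Gamma> f g z) + Y z * Y z * \<Gamma> g g z"
    and "AE z in \<mu>. Gamma2 \<Gamma> L \<phi> \<phi> z =
       (X z * X z * L (\<Gamma> f f) z + 2 * X z * \<Gamma> f f z * (a * L g z) + 4 * X z * (a * \<Gamma> g (\<Gamma> f f) z)
         + 2 * \<Gamma> f f z * (a * a * \<Gamma> g g z)
        + 2 * (X z * Y z * L (\<Gamma> f g) z + X z * \<Gamma> f g z * (a * L f z) + Y z * \<Gamma> f g z * (a * L g z)
          + 2 * X z * (a * \<Gamma> f (\<Gamma> f g) z) + 2 * Y z * (a * \<Gamma> g (\<Gamma> f g) z) + 2 * \<Gamma> f g z * (a * a * \<Gamma> f g z))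
        + (Y z * Y z * L (\<Gamma> g g) z + 2 * Y z * \<Gamma> g g z * (a * L f z) + 4 * Y z * (a * \<Gamma> f (\<Gamma> g g) z)
          + 2 * \<Gamma> g g z * (a * a * \<Gamma> f f z))) / 2
       - (X z * (X z * \<Gamma> f (L f) z + L f z * (a * \<Gamma> f g z) + Y z * \<Gamma> f (L g) z + L g z * (a * \<Gamma> f f z)
         + 2 * a * \<Gamma> f (\<Gamma> f g) z)
        + Y z * (X z * \<Gamma> g (L f) z + L f z * (a * \<Gamma> g g z) + Y z * \<Gamma> g (L g) z + L g z * (a * \<Gamma> f g z)
          + 2 * a * \<Gamma> g (\<Gamma> f g) z))"
    and "AE z in \<mu>. \<Gamma> (\<Gamma> \<phi> \<phi>) (\<Gamma> \<phi> \<phi>) z =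
       (let T = (\<lambda>p q r s t. X z * X z * p + 2 * (X z * Y z) * q + Y z * Y z * r
           + 2 * a * (X z * \<Gamma> f f z + Y z * \<Gamma> f g z) * s + 2 * a * (X z * \<Gamma> f g z + Y z * \<Gamma> g g z) * t)
        in T (T (\<Gamma> (\<Gamma> f f) (\<Gamma> f f) z) (\<Gamma> (\<Gamma> f g) (\<Gamma> f f) z) (\<Gamma> (\<Gamma> g g) (\<Gamma> f f) z) (\<Gamma> g (\<Gamma> f f) z) (\<Gamma> f (\<Gamma> f
          f) z))
             (T (\<Gamma> (\<Gamma> f f) (\<Gamma> f g) z) (\<Gamma> (\<Gamma> f g) (\<Gamma> f g) z) (\<Gamma> (\<Gamma> g g) (\<Gamma> f g) z) (\<Gamma> g (\<Gamma> f g) z) (\<Gamma> f (\<Gamma> f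
               g) z))
             (T (\<Gamma> (\<Gamma> f f) (\<Gamma> g g) z) (\<Gamma> (\<Gamma> f g) (\<Gamma> g g) z) (\<Gamma> (\<Gamma> g g) (\<Gamma> g g) z) (\<Gamma> g (\<Gamma> g g) z) (\<Gamma> f (\<Gamma> g
               g) z))
             (T (\<Gamma> (\<Gamma> f f) g z) (\<Gamma> (\<Gamma> f g) g z) (\<Gamma> (\<Gamma> g g) g z) (\<Gamma> g g z) (\<Gamma> f g z))
             (T (\<Gamma> (\<Gamma> f f) f z) (\<Gamma> (\<Gamma> f g) f z) (\<Gamma> (\<Gamma> g g) f z) (\<Gamma> g f z) (\<Gamma> f f z)))"
proof -
  let ?\<gamma> = "\<Gamma> f f" and ?m = "\<Gamma> f g" and ?G = "\<Gamma> g g"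
  note \<phi> = bspec[OF \<phi>'] and X = bspec[OF X'(1)] X'(2) and Y = bspec[OF Y'(1)] Y'(2)
  note f = fg(1) and g = fg(2) and Xm = fg(3) and Ym = fg(4)
  have \<gamma>: "?\<gamma> \<in> A" and m: "?m \<in> A" and G: "?G \<in> A" and Lf: "L f \<in> A" and Lg: "L g \<in> A"
    by (simp_all add: \<Gamma>_closed L_closed fg)
  show E0: "AE z in \<mu>. \<Gamma> \<phi> \<phi> z = X z * X z * ?\<gamma> z + 2 * (X z * Y z * ?m z) + Y z * Y z * ?G z"
    using \<phi>[OF fg(5)] \<phi>[OF f] \<phi>[OF g] \<Gamma>_sym[OF f g] \<Gamma>_sym[OF fg(5) f] \<Gamma>_sym[OF fg(5) g]
    by eventually_elim (simp add: algebra_simps)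
  let ?u = "\<lambda>z. (X z * X z) * ?\<gamma> z" and ?v = "\<lambda>z. (X z * Y z) * ?m z" and ?w = "\<lambda>z. (Y z * Y z) * ?G z"
  let ?E = "\<lambda>z. (?u z + 2 * ?v z) + ?w z"
  have u: "?u \<in> A" and v: "?v \<in> A" and w: "?w \<in> A" by (intro A_mult \<gamma> m G fg)+
  have v2: "(\<lambda>z. 2 * ?v z) \<in> A" using v by (rule A_scale)
  have uv: "(\<lambda>z. ?u z + 2 * ?v z) \<in> A" by (rule A_add[OF u v2])
  have E: "?E \<in> A" by (rule A_add[OF uv w])
  have E1: "AE z in \<mu>. \<Gamma> \<phi> \<phi> z = ?E z" using E0 by simp
  have \<Gamma>\<phi>: "\<Gamma> \<phi> \<phi> \<in> A" by (simp add: \<Gamma>_closed fg)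
  \<comment> \<open>The derivation of \<open>\<Gamma> \<phi> \<phi>\<close> along \<open>h\<close>.
    The \<open>T\<close> of the third claim is this formula, with \<open>p\<close>,
    \<open>q\<close>, \<open>r\<close>, \<open>s\<close>, \<open>t\<close> for
    \<open>\<Gamma>\<close> between \<open>h\<close> and each of \<open>\<Gamma> f f\<close>,
    \<open>\<Gamma> f g\<close>, \<open>\<Gamma> g g\<close>, \<open>g\<close>, \<open>f\<close>; it
    is used once for each argument.\<close>
  have \<Gamma>E: "AE z in \<mu>. \<Gamma> ?E h z = X z * X z * \<Gamma> ?\<gamma> h z + 2 * (X z * Y z) * \<Gamma> ?m h z + Y z * Y z * \<Gamma> ?G h z
      + 2 * a * (X z * ?\<gamma> z + Y z * ?m z) * \<Gamma> g h z + 2 * a * (X z * ?m z + Y z * ?G z) * \<Gamma> f h z" if h: "h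
        \<in> A" for h
    using \<Gamma>_add[OF uv w h] \<Gamma>_add[OF u v2 h] \<Gamma>_scale[OF v h, of 2] \<Gamma>_mult3[OF Xm Xm \<gamma> h] \<Gamma>_mult3[OF Xm Ym m h]
      \<Gamma>_mult3[OF Ym Ym G h] X(1)[OF h] Y(1)[OF h]
  proof eventually_elim
    case (elim z)
    show ?case unfolding elim(1) unfolding elim(2) unfolding elim(3) unfolding elim(4-6) unfolding elim(7,8)
      by (simp add: algebra_simps)
  qed
  have LE: "AE z in \<mu>. L ?E z = L ?u z + 2 * L ?v z + L ?w z"
    using L_add[OF uv w] L_add[OF u v2] L_scale[OF v, of 2]
  proof eventually_elim
    case (elim z)
    show ?case unfolding elim(1) unfolding elim(2) unfolding elim(3) by (rule refl)
  qed
  have Lu: "AE z in \<mu>. L ?u z = X z * X z * L ?\<gamma> z + 2 * X z * ?\<gamma> z * (a * L g z) + 4 * X z * (a * \<Gamma> g ?\<gamma> z)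
    + 2 * ?\<gamma> z * (a * a * ?G z)"
    using L_mult3[OF Xm Xm \<gamma>] X(1)[OF \<gamma>] X(1)[OF Xm] X(2) X(1)[OF g] \<Gamma>_sym[OF Xm g]
    by eventually_elim (simp add: algebra_simps)
  have Lv: "AE z in \<mu>. L ?v z = X z * Y z * L ?m z + X z * ?m z * (a * L f z) + Y z * ?m z * (a * L g z)
          + 2 * X z * (a * \<Gamma> f ?m z) + 2 * Y z * (a * \<Gamma> g ?m z) + 2 * ?m z * (a * a * ?m z)"
    using L_mult3[OF Xm Ym m] X(1)[OF m] Y(1)[OF m] X(1)[OF Ym] X(2) Y(2) Y(1)[OF g] \<Gamma>_sym[OF Ym g]
    by eventually_elim (simp add: algebra_simps)
  have Lw: "AE z in \<mu>. L ?w z = Y z * Y z * L ?G z + 2 * Y z * ?G z * (a * L f z) + 4 * Y z * (a * \<Gamma> f ?G z)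
    + 2 * ?G z * (a * a * ?\<gamma> z)"
    using L_mult3[OF Ym Ym G] Y(1)[OF G] Y(1)[OF Ym] Y(2) Y(1)[OF f] \<Gamma>_sym[OF Ym f]
    by eventually_elim (simp add: algebra_simps)
  let ?l = "\<lambda>z. (X z * L f z + Y z * L g z) + 2 * a * ?m z"
  have x: "(\<lambda>z. X z * L f z) \<in> A" and y: "(\<lambda>z. Y z * L g z) \<in> A" by (intro A_mult fg Lf Lg)+
  have xy: "(\<lambda>z. X z * L f z + Y z * L g z) \<in> A" by (rule A_add[OF x y])
  have m2: "(\<lambda>z. 2 * a * ?m z) \<in> A" using m by (rule A_scale)
  have l: "?l \<in> A" by (rule A_add[OF xy m2])
  have \<Gamma>l: "AE z in \<mu>. \<Gamma> h (L \<phi>) z = X z * \<Gamma> h (L f) z + L f z * (a * \<Gamma> g h z) + Y z * \<Gamma> h (L g) z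
    + L g z * (a * \<Gamma> f h z) + 2 * a * \<Gamma> h ?m z"
    if h: "h \<in> A" for h
  proof -
    have 1: "AE z in \<mu>. \<Gamma> h (L \<phi>) z = \<Gamma> h ?l z"
      by (rule \<Gamma>_cong[OF h h L_closed[OF fg(5)] l _ L\<phi>]) simp
    show ?thesis
      using 1 \<Gamma>_sym[OF h l] \<Gamma>_add[OF xy m2 h] \<Gamma>_add[OF x y h] \<Gamma>_scale[OF m h, of "2 * a"] \<Gamma>_mult[OF Xm Lf h]
        \<Gamma>_mult[OF Ym Lg h]
        X(1)[OF h] Y(1)[OF h] \<Gamma>_sym[OF h Lf] \<Gamma>_sym[OF h Lg] \<Gamma>_sym[OF h m]
    proof eventually_elim
      case (elim z)
      show ?case unfolding elim(1) unfolding elim(2) unfolding elim(3) unfolding elim(4) unfolding elim(5-7)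
        unfolding elim(8-12)
        by (simp add: algebra_simps)
    qed
  qed
  show "AE z in \<mu>. Gamma2 \<Gamma> L \<phi> \<phi> z =
       (X z * X z * L (\<Gamma> f f) z + 2 * X z * \<Gamma> f f z * (a * L g z) + 4 * X z * (a * \<Gamma> g (\<Gamma> f f) z)
         + 2 * \<Gamma> f f z * (a * a * \<Gamma> g g z)
        + 2 * (X z * Y z * L (\<Gamma> f g) z + X z * \<Gamma> f g z * (a * L f z) + Y z * \<Gamma> f g z * (a * L g z)
          + 2 * X z * (a * \<Gamma> f (\<Gamma> f g) z) + 2 * Y z * (a * \<Gamma> g (\<Gamma> f g) z) + 2 * \<Gamma> f g z * (a * a * \<Gamma> f g z))
        + (Y z * Y z * L (\<Gamma> g g) z + 2 * Y z * \<Gamma> g g z * (a * L f z) + 4 * Y z * (a * \<Gamma> f (\<Gamma> g g) z)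
          + 2 * \<Gamma> g g z * (a * a * \<Gamma> f f z))) / 2
       - (X z * (X z * \<Gamma> f (L f) z + L f z * (a * \<Gamma> f g z) + Y z * \<Gamma> f (L g) z + L g z * (a * \<Gamma> f f z)
         + 2 * a * \<Gamma> f (\<Gamma> f g) z)
        + Y z * (X z * \<Gamma> g (L f) z + L f z * (a * \<Gamma> g g z) + Y z * \<Gamma> g (L g) z + L g z * (a * \<Gamma> f g z)
          + 2 * a * \<Gamma> g (\<Gamma> f g) z))"
    using Gamma2_eq[OF fg(5)] L_cong[OF \<Gamma>\<phi> E E1] LE Lu Lv Lw \<phi>[OF L_closed[OF fg(5)]] \<Gamma>l[OF fg(1)] \<Gamma>l[OF
      fg(2)] \<Gamma>_sym[OF fg(2,1)]
  proof eventually_elim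
    case (elim z)
    show ?case unfolding elim(1) elim(2) elim(7) unfolding elim(3) elim(8,9) unfolding elim(4-6) elim(10)
      by (rule refl)
  qed
  show "AE z in \<mu>. \<Gamma> (\<Gamma> \<phi> \<phi>) (\<Gamma> \<phi> \<phi>) z =
       (let T = (\<lambda>p q r s t. X z * X z * p + 2 * (X z * Y z) * q + Y z * Y z * r
           + 2 * a * (X z * \<Gamma> f f z + Y z * \<Gamma> f g z) * s + 2 * a * (X z * \<Gamma> f g z + Y z * \<Gamma> g g z) * t)
        in T (T (\<Gamma> (\<Gamma> f f) (\<Gamma> f f) z) (\<Gamma> (\<Gamma> f g) (\<Gamma> f f) z) (\<Gamma> (\<Gamma> g g) (\<Gamma> f f) z) (\<Gamma> g (\<Gamma> f f) z) (\<Gamma> f (\<Gamma> f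
          f) z))
             (T (\<Gamma> (\<Gamma> f f) (\<Gamma> f g) z) (\<Gamma> (\<Gamma> f g) (\<Gamma> f g) z) (\<Gamma> (\<Gamma> g g) (\<Gamma> f g) z) (\<Gamma> g (\<Gamma> f g) z) (\<Gamma> f (\<Gamma> f
               g) z))
             (T (\<Gamma> (\<Gamma> f f) (\<Gamma> g g) z) (\<Gamma> (\<Gamma> f g) (\<Gamma> g g) z) (\<Gamma> (\<Gamma> g g) (\<Gamma> g g) z) (\<Gamma> g (\<Gamma> g g) z) (\<Gamma> f (\<Gamma> g
               g) z))
             (T (\<Gamma> (\<Gamma> f f) g z) (\<Gamma> (\<Gamma> f g) g z) (\<Gamma> (\<Gamma> g g) g z) (\<Gamma> g g z) (\<Gamma> f g z))
             (T (\<Gamma> (\<Gamma> f f) f z) (\<Gamma> (\<Gamma> f g) f z) (\<Gamma> (\<Gamma> g g) f z) (\<Gamma> g f z) (\<Gamma> f f z)))"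
    using \<Gamma>_cong[OF \<Gamma>\<phi> E \<Gamma>\<phi> E E1 E1] \<Gamma>E[OF E] \<Gamma>E[OF fg(1)] \<Gamma>E[OF fg(2)] \<Gamma>E[OF \<gamma>] \<Gamma>E[OF m] \<Gamma>E[OF G]
      \<Gamma>_sym[OF \<gamma> E] \<Gamma>_sym[OF m E] \<Gamma>_sym[OF G E] \<Gamma>_sym[OF fg(1) E] \<Gamma>_sym[OF fg(2) E]
  proof eventually_elim
    case (elim z)
    show ?case unfolding Let_def elim(1) unfolding elim(2) unfolding elim(8-12) unfolding elim(3-7)
      by (rule refl)
  qed
qed

text \<open>With \<open>a\<close>, \<open>c\<close> and \<open>d\<close> rational, only countably many null sets are discarded before \<open>c\<close> and \<open>d\<close> are
  specialised to \<open>f z\<close> and \<open>g z\<close> at each point.\<close>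

lemma curvature_perturbation:
  assumes fg: "f \<in> A" "g \<in> A"
    and hyp: "\<forall>\<phi>\<in>A. AE z in \<mu>. 0 < \<Gamma> \<phi> \<phi> z \<longrightarrow>
      0 \<le> (Gamma2 \<Gamma> L \<phi> \<phi> z - \<rho> * \<Gamma> \<phi> \<phi> z) * \<Gamma> \<phi> \<phi> z + \<kappa> * \<Gamma> (\<Gamma> \<phi> \<phi>) (\<Gamma> \<phi> \<phi>) z"
  shows "AE z in \<mu>. 0 < \<Gamma> f f z \<longrightarrow> (\<forall>a.
    0 \<le> (Gamma2 \<Gamma> L f f z + 2 * a * \<Gamma> g (\<Gamma> f f) z + 2 * a\<^sup>2 * (\<Gamma> f f z * \<Gamma> g g z + (\<Gamma> f g z)\<^sup>2)
      - \<rho> * \<Gamma> f f z) * \<Gamma> f f z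
      + \<kappa> * (\<Gamma> (\<Gamma> f f) (\<Gamma> f f) z + 4 * a * (\<Gamma> f g z * \<Gamma> f (\<Gamma> f f) z + \<Gamma> f f z * \<Gamma> g (\<Gamma> f f) z)
           + 4 * a\<^sup>2 * \<Gamma> f f z * (3 * (\<Gamma> f g z)\<^sup>2 + \<Gamma> f f z * \<Gamma> g g z)))"
proof -
  let ?\<gamma> = "\<Gamma> f f" and ?m = "\<Gamma> f g" and ?G = "\<Gamma> g g"
  note f = fg(1) and g = fg(2)
  have \<gamma>: "?\<gamma> \<in> A" and m: "?m \<in> A" and G: "?G \<in> A" by (simp_all add: \<Gamma>_closed fg)
  \<comment> \<open>\<open>S\<close>, \<open>B\<close> and \<open>Q\<close> are
    \<open>\<Gamma> \<phi> \<phi>\<close>, \<open>Gamma2 \<Gamma> L \<phi> \<phi>\<close> and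
    \<open>\<Gamma> (\<Gamma> \<phi> \<phi>) (\<Gamma> \<phi> \<phi>)\<close> at \<open>z\<close>,
    with numbers \<open>x\<close> and \<open>y\<close> for the values of the two first derivatives.
    The point of interest is \<open>x = 1\<close>, \<open>y = 0\<close>, reached for
    \<open>c = f z\<close> and \<open>d = g z\<close>.\<close>
  define S where "S z x y = x * x * ?\<gamma> z + 2 * (x * y * ?m z) + y * y * ?G z" for z x y
  define B where "B a z x y = (x * x * L (\<Gamma> f f) z + 2 * x * \<Gamma> f f z * (a * L g z) + 4 * x * (a * \<Gamma> g (\<Gamma> f
    f) z) + 2 * \<Gamma> f f z * (a * a * \<Gamma> g g z)
        + 2 * (x * y * L (\<Gamma> f g) z + x * \<Gamma> f g z * (a * L f z) + y * \<Gamma> f g z * (a * L g z)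
          + 2 * x * (a * \<Gamma> f (\<Gamma> f g) z) + 2 * y * (a * \<Gamma> g (\<Gamma> f g) z) + 2 * \<Gamma> f g z * (a * a * \<Gamma> f g z))
        + (y * y * L (\<Gamma> g g) z + 2 * y * \<Gamma> g g z * (a * L f z) + 4 * y * (a * \<Gamma> f (\<Gamma> g g) z) + 2 * \<Gamma> g g z *
          (a * a * \<Gamma> f f z))) / 2
       - (x * (x * \<Gamma> f (L f) z + L f z * (a * \<Gamma> f g z) + y * \<Gamma> f (L g) z + L g z * (a * \<Gamma> f f z)
         + 2 * a * \<Gamma> f (\<Gamma> f g) z)
        + y * (x * \<Gamma> g (L f) z + L f z * (a * \<Gamma> g g z) + y * \<Gamma> g (L g) z + L g z * (a * \<Gamma> f g z)
          + 2 * a * \<Gamma> g (\<Gamma> f g) z))" for a z x y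
  define T where "T a z x y p q r s t = x * x * p + 2 * (x * y) * q + y * y * r
           + 2 * a * (x * \<Gamma> f f z + y * \<Gamma> f g z) * s + 2 * a * (x * \<Gamma> f g z + y * \<Gamma> g g z) *
             t" for a z x y p q r s t
  define Q where "Q a z x y = T a z x y (T a z x y (\<Gamma> (\<Gamma> f f) (\<Gamma> f f) z) (\<Gamma> (\<Gamma> f g) (\<Gamma> f f) z) (\<Gamma> (\<Gamma> g g) (\<Gamma>
    f f) z) (\<Gamma> g (\<Gamma> f f) z) (\<Gamma> f (\<Gamma> f f) z))
             (T a z x y (\<Gamma> (\<Gamma> f f) (\<Gamma> f g) z) (\<Gamma> (\<Gamma> f g) (\<Gamma> f g) z) (\<Gamma> (\<Gamma> g g) (\<Gamma> f g) z) (\<Gamma> g (\<Gamma> f g) z) (\<Gamma>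
               f (\<Gamma> f g) z))
             (T a z x y (\<Gamma> (\<Gamma> f f) (\<Gamma> g g) z) (\<Gamma> (\<Gamma> f g) (\<Gamma> g g) z) (\<Gamma> (\<Gamma> g g) (\<Gamma> g g) z) (\<Gamma> g (\<Gamma> g g) z) (\<Gamma>
               f (\<Gamma> g g) z))
             (T a z x y (\<Gamma> (\<Gamma> f f) g z) (\<Gamma> (\<Gamma> f g) g z) (\<Gamma> (\<Gamma> g g) g z) (\<Gamma> g g z) (\<Gamma> f g z))
             (T a z x y (\<Gamma> (\<Gamma> f f) f z) (\<Gamma> (\<Gamma> f g) f z) (\<Gamma> (\<Gamma> g g) f z) (\<Gamma> g f z) (\<Gamma> f f z))" for a z x y
  have "AE z in \<mu>. \<forall>a\<in>\<rat>. \<forall>c\<in>\<rat>. \<forall>d\<in>\<rat>. 0 < S z (1 + a * (g z - d)) (a * (f z - c)) \<longrightarrow>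
     0 \<le> (B a z (1 + a * (g z - d)) (a * (f z - c)) - \<rho> * S z (1 + a * (g z - d)) (a * (f z - c))) * S z (1
       + a * (g z - d)) (a * (f z - c))
       + \<kappa> * Q a z (1 + a * (g z - d)) (a * (f z - c))"
  proof (intro AE_ball_countable'[OF _ countable_rat])
    fix a c d :: real
    let ?F = "\<lambda>z. f z - c" and ?H = "\<lambda>z. g z - d"
    have F: "?F \<in> A" and H: "?H \<in> A" by (intro A_diff A_const fg)+
    have aH: "(\<lambda>z. a * ?H z) \<in> A" and Y: "(\<lambda>z. a * ?F z) \<in> A" using H F by (auto intro: A_scale)
    have X: "(\<lambda>z. 1 + a * ?H z) \<in> A" by (rule A_add[OF A_const aH])
    have FH: "(\<lambda>z. ?F z * ?H z) \<in> A" by (rule A_mult[OF F H])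
    have aFH: "(\<lambda>z. a * (?F z * ?H z)) \<in> A" by (rule A_scale[OF FH])
    have \<phi>: "(\<lambda>z. f z + a * (?F z * ?H z)) \<in> A" by (rule A_add[OF f aFH])
    have 1: "\<forall>h\<in>A. AE z in \<mu>. \<Gamma> (\<lambda>z. f z + a * (?F z * ?H z)) h z = (1 + a * ?H z) * \<Gamma> f h z + (a * ?F z) *
      \<Gamma> g h z"
    proof
      fix h assume h: "h \<in> A"
      show "AE z in \<mu>. \<Gamma> (\<lambda>z. f z + a * (?F z * ?H z)) h z = (1 + a * ?H z) * \<Gamma> f h z + (a * ?F z) * \<Gamma> g h z"
      using \<Gamma>_add[OF f aFH h] \<Gamma>_scale[OF FH h, of a] \<Gamma>_mult[OF F H h] \<Gamma>_shift[OF f h, of c] \<Gamma>_shift[OF g h,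
        of d]
    proof eventually_elim
      case (elim z)
      show ?case unfolding elim(1) unfolding elim(2) unfolding elim(3) unfolding elim(4,5)
        by (simp add: algebra_simps)
    qed
    qed
    have 2: "AE z in \<mu>. L (\<lambda>z. f z + a * (?F z * ?H z)) z = (1 + a * ?H z) * L f z + (a * ?F z) * L g z
      + 2 * a * \<Gamma> f g z"
      using L_add[OF f aFH] L_scale[OF FH, of a] L_mult[OF F H] L_shift[OF f, of c] L_shift[OF g, of d]
        \<Gamma>_shift[OF f H, of c] \<Gamma>_sym[OF f H] \<Gamma>_shift[OF g f, of d] \<Gamma>_sym[OF g f]
    proof eventually_elim
      case (elim z)
      show ?case unfolding elim(1) unfolding elim(2) unfolding elim(3)
        unfolding elim(4-6) elim(7) elim(8) elim(9) by (simp add: algebra_simps)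
    qed
    have 3: "\<forall>h\<in>A. AE z in \<mu>. \<Gamma> (\<lambda>z. 1 + a * ?H z) h z = a * \<Gamma> g h z"
    proof
      fix h assume h: "h \<in> A"
      show "AE z in \<mu>. \<Gamma> (\<lambda>z. 1 + a * ?H z) h z = a * \<Gamma> g h z"
      using \<Gamma>_add[OF A_const aH h, of 1] \<Gamma>_scale[OF H h, of a] \<Gamma>_shift[OF g h, of d] \<Gamma>_const[OF h, of 1]
    proof eventually_elim
      case (elim z)
      show ?case unfolding elim(1) unfolding elim(2) unfolding elim(3,4) by simp
    qed
    qed
    have 4: "AE z in \<mu>. L (\<lambda>z. 1 + a * ?H z) z = a * L g z"
      using L_add[OF A_const aH, of 1] L_scale[OF H, of a] L_shift[OF g, of d] L_const[of 1]
    proof eventually_elim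
      case (elim z)
      show ?case unfolding elim(1) unfolding elim(2) unfolding elim(3,4) by simp
    qed
    have 5: "\<forall>h\<in>A. AE z in \<mu>. \<Gamma> (\<lambda>z. a * ?F z) h z = a * \<Gamma> f h z"
    proof
      fix h assume h: "h \<in> A"
      show "AE z in \<mu>. \<Gamma> (\<lambda>z. a * ?F z) h z = a * \<Gamma> f h z"
      using \<Gamma>_scale[OF F h, of a] \<Gamma>_shift[OF f h, of c]
    proof eventually_elim
      case (elim z)
      show ?case unfolding elim(1) unfolding elim(2) by simp
    qed
    qed
    have 6: "AE z in \<mu>. L (\<lambda>z. a * ?F z) z = a * L f z"
      using L_scale[OF F, of a] L_shift[OF f, of c]
    proof eventually_elim
      case (elim z)
      show ?case unfolding elim(1) unfolding elim(2) by simp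
    qed
    note e = perturbation_expansion[OF f g X Y \<phi> 1 2 3 4 5 6]
    show "AE z in \<mu>. 0 < S z (1 + a * (g z - d)) (a * (f z - c)) \<longrightarrow>
     0 \<le> (B a z (1 + a * (g z - d)) (a * (f z - c)) - \<rho> * S z (1 + a * (g z - d)) (a * (f z - c))) * S z (1
       + a * (g z - d)) (a * (f z - c))
       + \<kappa> * Q a z (1 + a * (g z - d)) (a * (f z - c))"
      using bspec[OF hyp \<phi>] e(1)[folded S_def] e(2)[folded B_def] e(3)[unfolded Let_def, folded T_def,
        folded Q_def]
    proof eventually_elim
      case (elim z)
      show ?case using elim(1) unfolding elim(2-4) .
    qed
  qed
  with \<Gamma>_sym[OF g \<gamma>] \<Gamma>_sym[OF f \<gamma>] \<Gamma>_sym[OF f g] Gamma2_eq[OF f] show ?thesis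
  proof eventually_elim
    case (elim z)
    show ?case
    proof (intro impI allI)
      fix a :: real
      assume pos: "0 < ?\<gamma> z"
      let ?V = "\<lambda>a. (Gamma2 \<Gamma> L f f z + 2 * a * \<Gamma> g (\<Gamma> f f) z + 2 * a\<^sup>2 * (\<Gamma> f f z * \<Gamma> g g z + (\<Gamma> f g z)\<^sup>2)
        - \<rho> * \<Gamma> f f z) * \<Gamma> f f z
      + \<kappa> * (\<Gamma> (\<Gamma> f f) (\<Gamma> f f) z + 4 * a * (\<Gamma> f g z * \<Gamma> f (\<Gamma> f f) z + \<Gamma> f f z * \<Gamma> g (\<Gamma> f f) z)
           + 4 * a\<^sup>2 * \<Gamma> f f z * (3 * (\<Gamma> f g z)\<^sup>2 + \<Gamma> f f z * \<Gamma> g g z))"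
      have rat: "\<exists>c. (\<forall>n. c n \<in> \<rat>) \<and> c \<longlonglongrightarrow> x" for x :: real
        using Rats_closure_real closure_sequential[of x "\<rat> :: real set"] by auto
      obtain c where c: "\<And>n. c n \<in> \<rat>" "c \<longlonglongrightarrow> f z" using rat by blast
      obtain d where d: "\<And>n. d n \<in> \<rat>" "d \<longlonglongrightarrow> g z" using rat by blast
      show "0 \<le> ?V a"
      proof (rule nonneg_on_Rats_imp_nonneg[where f = ?V])
        show "continuous_on UNIV ?V" by (intro continuous_intros)
        fix a :: real assume a: "a \<in> \<rat>"
        let ?x = "\<lambda>n. 1 + a * (g z - d n)" and ?y = "\<lambda>n. a * (f z - c n)"
        have "?x \<longlonglongrightarrow> 1 + a * (g z - g z)" by (intro tendsto_intros d)
        then have x: "?x \<longlonglongrightarrow> 1" by simp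
        have "?y \<longlonglongrightarrow> a * (f z - f z)" by (intro tendsto_intros c)
        then have y: "?y \<longlonglongrightarrow> 0" by simp
        have S: "(\<lambda>n. S z (?x n) (?y n)) \<longlonglongrightarrow> S z 1 0" unfolding S_def by (intro tendsto_intros x y)
        have B: "(\<lambda>n. B a z (?x n) (?y n)) \<longlonglongrightarrow> B a z 1 0" unfolding B_def by (intro tendsto_intros x y) simp_all
        have Q: "(\<lambda>n. Q a z (?x n) (?y n)) \<longlonglongrightarrow> Q a z 1 0" unfolding Q_def T_def by (intro tendsto_intros x y)
        have lim: "(\<lambda>n. (B a z (?x n) (?y n) - \<rho> * S z (?x n) (?y n)) * S z (?x n) (?y n) + \<kappa> * Q a z (?x n)
          (?y n))
          \<longlonglongrightarrow> (B a z 1 0 - \<rho> * S z 1 0) * S z 1 0 + \<kappa> * Q a z 1 0"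
          by (intro tendsto_intros S B Q)
        \<comment> \<open>The hypothesis speaks only of points where
          \<open>\<Gamma> \<phi> \<phi>\<close> is positive; positivity in the limit provides this
          for all late approximants.\<close>
        have "0 < S z 1 0" using pos by (simp add: S_def)
        with S have "\<forall>\<^sub>F n in sequentially. 0 < S z (?x n) (?y n)" by (rule order_tendstoD(1))
        then have "\<forall>\<^sub>F n in sequentially. 0 \<le> (B a z (?x n) (?y n) - \<rho> * S z (?x n) (?y n)) * S z (?x n) (?y
          n) + \<kappa> * Q a z (?x n) (?y n)"
          by eventually_elim (use elim(5) a c(1) d(1) in blast)
        from tendsto_lowerbound[OF lim this] have "0 \<le> (B a z 1 0 - \<rho> * S z 1 0) * S z 1 0 + \<kappa> * Q a z 1 0"
          by simp
        also have "\<dots> = ?V a"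
        proof -
          have "S z 1 0 = ?\<gamma> z" by (simp add: S_def)
          moreover have "B a z 1 0 = Gamma2 \<Gamma> L f f z + 2 * a * \<Gamma> g (\<Gamma> f f) z + 2 * a\<^sup>2 * (\<Gamma> f f z * \<Gamma> g g z
            + (\<Gamma> f g z)\<^sup>2)"
            unfolding elim(4) by (simp add: B_def power2_eq_square field_simps)
          moreover have "Q a z 1 0 = \<Gamma> (\<Gamma> f f) (\<Gamma> f f) z + 4 * a * (\<Gamma> f g z * \<Gamma> f (\<Gamma> f f) z + \<Gamma> f f z * \<Gamma> g
            (\<Gamma> f f) z)
           + 4 * a\<^sup>2 * \<Gamma> f f z * (3 * (\<Gamma> f g z)\<^sup>2 + \<Gamma> f f z * \<Gamma> g g z)"
            using elim(1-3) by (simp add: Q_def T_def power2_eq_square algebra_simps)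
          ultimately show ?thesis by simp
        qed
        finally show "0 \<le> ?V a" .
      qed
    qed
  qed
qed

text \<open>For \<open>a = - 1 / (2 \<gamma>)\<close> the coefficient of \<open>\<kappa>\<close> is \<open>(p + 2 r \<gamma>)\<^sup>2 / \<gamma>\<close>, which vanishes for \<open>r = - p / (2 \<gamma>)\<close>.\<close>

lemma self_improvement_algebra:
  fixes \<gamma> :: real
  assumes "0 < \<gamma>" "p\<^sup>2 \<le> \<gamma> * q"
    and poly: "\<And>a r. r \<in> \<rat> \<Longrightarrow> 0 \<le> (G2 + 2 * a * (q + r * p) + 2 * a\<^sup>2 * (\<gamma> * (q + 2 * r * p + r\<^sup>2 * \<gamma>) + (p
      + r * \<gamma>)\<^sup>2) - \<rho> * \<gamma>) * \<gamma>
      + \<kappa> * (q + 4 * a * ((p + r * \<gamma>) * p + \<gamma> * (q + r * p)) + 4 * a\<^sup>2 * \<gamma> * (3 * (p + r * \<gamma>)\<^sup>2 + \<gamma> * (q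
        + 2 * r * p + r\<^sup>2 * \<gamma>)))"
  shows "q \<le> 4 * \<gamma> * (G2 - \<rho> * \<gamma>)"
proof -
  \<comment> \<open>Here \<open>\<gamma>\<close>, \<open>p\<close> and \<open>q\<close> stand for
    \<open>\<Gamma> f f\<close>, \<open>\<Gamma> f (\<Gamma> f f)\<close> and
    \<open>\<Gamma> (\<Gamma> f f) (\<Gamma> f f)\<close>. This \<open>r\<close> may be irrational,
    so the hypothesis is first extended to real \<open>r\<close> by continuity.\<close>
  define a r s where "a = - 1 / (2 * \<gamma>)" and "r = - p / (2 * \<gamma>)" and "s = p\<^sup>2 / \<gamma>"
  let ?V = "\<lambda>r. (G2 + 2 * a * (q + r * p) + 2 * a\<^sup>2 * (\<gamma> * (q + 2 * r * p + r\<^sup>2 * \<gamma>) + (p + r * \<gamma>)\<^sup>2)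
    - \<rho> * \<gamma>) * \<gamma>
      + \<kappa> * (q + 4 * a * ((p + r * \<gamma>) * p + \<gamma> * (q + r * p)) + 4 * a\<^sup>2 * \<gamma> * (3 * (p + r * \<gamma>)\<^sup>2 + \<gamma> * (q
        + 2 * r * p + r\<^sup>2 * \<gamma>)))"
  have V: "0 \<le> ?V r"
    by (rule nonneg_on_Rats_imp_nonneg[where f = ?V]) (intro continuous_intros, rule poly)
  have r1: "r * \<gamma> = - p / 2" and a1: "a * \<gamma> = - 1 / 2" and rp: "r * p = - s / 2" and ap: "a * p\<^sup>2 = - s / 2"
    using assms(1) by (simp_all add: r_def a_def s_def power2_eq_square)
  have s: "s \<le> q" using assms(1,2) by (simp add: s_def pos_divide_le_eq mult.commute)
  have m: "p + r * \<gamma> = p / 2" using r1 by simp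
  have "\<gamma> * (q + 2 * r * p + r\<^sup>2 * \<gamma>) = \<gamma> * q + 2 * (r * \<gamma>) * p + (r * \<gamma>)\<^sup>2"
    by (simp add: power2_eq_square algebra_simps)
  also have "\<dots> = \<gamma> * q - 3 / 4 * p\<^sup>2" unfolding r1 by (simp add: power2_eq_square)
  finally have G: "\<gamma> * (q + 2 * r * p + r\<^sup>2 * \<gamma>) = \<gamma> * q - 3 / 4 * p\<^sup>2" .
  have "(p + r * \<gamma>) * p + \<gamma> * (q + r * p) = p * p + 2 * (r * \<gamma>) * p + \<gamma> * q" by (simp add: algebra_simps)
  also have "\<dots> = \<gamma> * q" unfolding r1 by simp
  finally have K1: "(p + r * \<gamma>) * p + \<gamma> * (q + r * p) = \<gamma> * q" .
  have K2: "3 * (p + r * \<gamma>)\<^sup>2 + \<gamma> * (q + 2 * r * p + r\<^sup>2 * \<gamma>) = \<gamma> * q" unfolding m G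
    by (simp add: power2_eq_square)
  have "q + 4 * a * (\<gamma> * q) + 4 * a\<^sup>2 * \<gamma> * (\<gamma> * q) = q * (1 + 4 * (a * \<gamma>) + 4 * (a * \<gamma>)\<^sup>2)"
    by (simp add: power2_eq_square algebra_simps)
  also have "\<dots> = 0" unfolding a1 by (simp add: power2_eq_square)
  finally have K: "q + 4 * a * (\<gamma> * q) + 4 * a\<^sup>2 * \<gamma> * (\<gamma> * q) = 0" .
  have "(G2 + 2 * a * (q + r * p) + 2 * a\<^sup>2 * (\<gamma> * q - 3 / 4 * p\<^sup>2 + (p / 2)\<^sup>2) - \<rho> * \<gamma>) * \<gamma> =
    \<gamma> * (G2 - \<rho> * \<gamma>) + 2 * (a * \<gamma>) * (q + r * p) + 2 * (a * \<gamma>) * ((a * \<gamma>) * q - a * p\<^sup>2 / 2)"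
    by (simp add: power2_eq_square algebra_simps)
  also have "\<dots> = \<gamma> * (G2 - \<rho> * \<gamma>) - q / 2 + s / 4" unfolding a1 rp ap by (simp add: field_simps)
  finally have "0 \<le> \<gamma> * (G2 - \<rho> * \<gamma>) - q / 2 + s / 4" using V unfolding K1 K2 unfolding K unfolding G m
    by simp
  \<comment> \<open>As \<open>s \<le> q\<close>, the nonnegative quantity is at most
    \<open>\<gamma> * (G2 - \<rho> * \<gamma>) - q / 4\<close>.\<close>
  with s show ?thesis by simp
qed

lemma self_improvement:
  assumes f: "f \<in> A"
    and hyp: "\<forall>\<phi>\<in>A. AE z in \<mu>. 0 < \<Gamma> \<phi> \<phi> z \<longrightarrow>
      0 \<le> (Gamma2 \<Gamma> L \<phi> \<phi> z - \<rho> * \<Gamma> \<phi> \<phi> z) * \<Gamma> \<phi> \<phi> z + \<kappa> * \<Gamma> (\<Gamma> \<phi> \<phi>) (\<Gamma> \<phi> \<phi>) z"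
  shows "AE z in \<mu>. \<Gamma> (\<Gamma> f f) (\<Gamma> f f) z \<le> 4 * \<Gamma> f f z * (Gamma2 \<Gamma> L f f z - \<rho> * \<Gamma> f f z)"
proof -
  let ?\<gamma> = "\<Gamma> f f"
  have \<gamma>: "?\<gamma> \<in> A" by (simp add: \<Gamma>_closed f)
  let ?g = "\<lambda>r z. 1 * ?\<gamma> z + r * f z"
  have g: "?g r \<in> A" for r by (rule A_lin[OF \<gamma> f])
  have "AE z in \<mu>. \<forall>r\<in>\<rat>. 0 < \<Gamma> f f z \<longrightarrow> (\<forall>a. 0 \<le> (Gamma2 \<Gamma> L f f z + 2 * a * (\<Gamma> ?\<gamma> ?\<gamma> z + r * \<Gamma> f ?\<gamma> z)
        + 2 * a\<^sup>2 * (?\<gamma> z * (\<Gamma> ?\<gamma> ?\<gamma> z + 2 * r * \<Gamma> f ?\<gamma> z + r\<^sup>2 * ?\<gamma> z) + (\<Gamma> f ?\<gamma> z + r * ?\<gamma> z)\<^sup>2)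
          - \<rho> * ?\<gamma> z) * ?\<gamma> z
      + \<kappa> * (\<Gamma> ?\<gamma> ?\<gamma> z + 4 * a * ((\<Gamma> f ?\<gamma> z + r * ?\<gamma> z) * \<Gamma> f ?\<gamma> z + ?\<gamma> z * (\<Gamma> ?\<gamma> ?\<gamma> z + r * \<Gamma> f ?\<gamma> z))
        + 4 * a\<^sup>2 * ?\<gamma> z * (3 * (\<Gamma> f ?\<gamma> z + r * ?\<gamma> z)\<^sup>2 + ?\<gamma> z * (\<Gamma> ?\<gamma> ?\<gamma> z + 2 * r * \<Gamma> f ?\<gamma> z
          + r\<^sup>2 * ?\<gamma> z))))"
  proof (rule AE_ball_countable'[OF _ countable_rat])
    fix r :: real
    have "AE z in \<mu>. \<Gamma> (?g r) ?\<gamma> z = \<Gamma> ?\<gamma> ?\<gamma> z + r * \<Gamma> f ?\<gamma> z" using \<Gamma>_lin[OF \<gamma> f \<gamma>, of 1 r] by simp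
    moreover have "AE z in \<mu>. \<Gamma> f (?g r) z = \<Gamma> f ?\<gamma> z + r * ?\<gamma> z" using \<Gamma>_lin_right[OF \<gamma> f f, of 1 r] by simp
    moreover have "AE z in \<mu>. \<Gamma> (?g r) (?g r) z = \<Gamma> ?\<gamma> ?\<gamma> z + 2 * r * \<Gamma> f ?\<gamma> z + r\<^sup>2 * ?\<gamma> z"
      using \<Gamma>_square_lin[OF \<gamma> f, of 1 r] \<Gamma>_sym[OF \<gamma> f] by eventually_elim simp
    ultimately show "AE z in \<mu>. 0 < \<Gamma> f f z \<longrightarrow> (\<forall>a. 0 \<le> (Gamma2 \<Gamma> L f f z + 2 * a * (\<Gamma> ?\<gamma> ?\<gamma> z + r * \<Gamma> f ?\<gamma> z)
        + 2 * a\<^sup>2 * (?\<gamma> z * (\<Gamma> ?\<gamma> ?\<gamma> z + 2 * r * \<Gamma> f ?\<gamma> z + r\<^sup>2 * ?\<gamma> z) + (\<Gamma> f ?\<gamma> z + r * ?\<gamma> z)\<^sup>2)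
          - \<rho> * ?\<gamma> z) * ?\<gamma> z
      + \<kappa> * (\<Gamma> ?\<gamma> ?\<gamma> z + 4 * a * ((\<Gamma> f ?\<gamma> z + r * ?\<gamma> z) * \<Gamma> f ?\<gamma> z + ?\<gamma> z * (\<Gamma> ?\<gamma> ?\<gamma> z + r * \<Gamma> f ?\<gamma> z))
        + 4 * a\<^sup>2 * ?\<gamma> z * (3 * (\<Gamma> f ?\<gamma> z + r * ?\<gamma> z)\<^sup>2 + ?\<gamma> z * (\<Gamma> ?\<gamma> ?\<gamma> z + 2 * r * \<Gamma> f ?\<gamma> z
          + r\<^sup>2 * ?\<gamma> z))))"
      using curvature_perturbation[OF f g hyp, of r]
    proof eventually_elim
      case (elim z)
      show ?case using elim(4) unfolding elim(1-3) .
    qed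
  qed
  with \<Gamma>_nonneg[OF f] \<Gamma>_zero_at_zero[OF \<gamma> \<Gamma>_nonneg[OF f]] \<Gamma>_Cauchy_Schwarz[OF f \<gamma>] show ?thesis
  proof eventually_elim
    case (elim z)
    show ?case
    proof (cases "?\<gamma> z = 0")
      case True
      \<comment> \<open>\<open>\<Gamma> f f\<close> is minimal where it vanishes, so both sides are
        0 there.\<close>
      then show ?thesis using elim(2) by simp
    next
      case False
      then have pos: "0 < ?\<gamma> z" using elim(1) by simp
      show ?thesis
        by (rule self_improvement_algebra[OF pos elim(3), where \<kappa> = \<kappa>]) (use elim(4) pos in blast)
    qed
  qed
qed

end

subsection \<open>Polynomials and their partial derivatives\<close>

text \<open>Polynomials carry their partial derivatives along, so that the rules for
  \<open>\<Gamma>\<close>, \<open>L\<close> and \<open>L1_deriv\<close> follow by induction from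
  sums and products alone.\<close>

inductive poly2 :: "(real \<Rightarrow> real \<Rightarrow> real) \<Rightarrow> (real \<Rightarrow> real \<Rightarrow> real) \<Rightarrow> (real \<Rightarrow> real \<Rightarrow> real) \<Rightarrow>
   (real \<Rightarrow> real \<Rightarrow> real) \<Rightarrow> (real \<Rightarrow> real \<Rightarrow> real) \<Rightarrow> (real \<Rightarrow> real \<Rightarrow> real) \<Rightarrow> bool" where
  const: "poly2 (\<lambda>x y. c) (\<lambda>x y. 0) (\<lambda>x y. 0) (\<lambda>x y. 0) (\<lambda>x y. 0) (\<lambda>x y. 0)"
| fst: "poly2 (\<lambda>x y. x) (\<lambda>x y. 1) (\<lambda>x y. 0) (\<lambda>x y. 0) (\<lambda>x y. 0) (\<lambda>x y. 0)"
| snd: "poly2 (\<lambda>x y. y) (\<lambda>x y. 0) (\<lambda>x y. 1) (\<lambda>x y. 0) (\<lambda>x y. 0) (\<lambda>x y. 0)"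
| add: "poly2 p px py pxx pxy pyy \<Longrightarrow> poly2 q qx qy qxx qxy qyy \<Longrightarrow>
    poly2 (\<lambda>x y. p x y + q x y) (\<lambda>x y. px x y + qx x y) (\<lambda>x y. py x y + qy x y)
      (\<lambda>x y. pxx x y + qxx x y) (\<lambda>x y. pxy x y + qxy x y) (\<lambda>x y. pyy x y + qyy x y)"
| mult: "poly2 p px py pxx pxy pyy \<Longrightarrow> poly2 q qx qy qxx qxy qyy \<Longrightarrow>
    poly2 (\<lambda>x y. p x y * q x y) (\<lambda>x y. px x y * q x y + p x y * qx x y) (\<lambda>x y. py x y * q x y + p x y * qy x
      y)
      (\<lambda>x y. pxx x y * q x y + 2 * px x y * qx x y + p x y * qxx x y)
      (\<lambda>x y. pxy x y * q x y + px x y * qy x y + py x y * qx x y + p x y * qxy x y)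
      (\<lambda>x y. pyy x y * q x y + 2 * py x y * qy x y + p x y * qyy x y)"

lemma poly2_derivs:
  assumes "poly2 p px py pxx pxy pyy"
  shows "((\<lambda>s. p s y) has_real_derivative px x y) (at x) \<and> ((\<lambda>s. p x s) has_real_derivative py x y) (at y) \<and>
    ((\<lambda>s. px s y) has_real_derivative pxx x y) (at x) \<and> ((\<lambda>s. px x s) has_real_derivative pxy x y) (at y) \<and>
    ((\<lambda>s. py s y) has_real_derivative pxy x y) (at x) \<and> ((\<lambda>s. py x s) has_real_derivative pyy x y) (at y)"
  using assms
proof (induction arbitrary: x y)
  case (add p px py pxx pxy pyy q qx qy qxx qxy qyy)
  show ?case using add.IH[of y x] by (intro conjI DERIV_add) simp_all
next
  case (mult p px py pxx pxy pyy q qx qy qxx qxy qyy)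
  from mult.IH(1)[of y x] have p: "((\<lambda>s. p s y) has_real_derivative px x y) (at x)"
    "((\<lambda>s. p x s) has_real_derivative py x y) (at y)"
    "((\<lambda>s. px s y) has_real_derivative pxx x y) (at x)" "((\<lambda>s. px x s) has_real_derivative pxy x y) (at y)"
    "((\<lambda>s. py s y) has_real_derivative pxy x y) (at x)" "((\<lambda>s. py x s) has_real_derivative pyy x y) (at y)"
      by blast+
  from mult.IH(2)[of y x] have q: "((\<lambda>s. q s y) has_real_derivative qx x y) (at x)"
    "((\<lambda>s. q x s) has_real_derivative qy x y) (at y)"
    "((\<lambda>s. qx s y) has_real_derivative qxx x y) (at x)" "((\<lambda>s. qx x s) has_real_derivative qxy x y) (at y)"
    "((\<lambda>s. qy s y) has_real_derivative qxy x y) (at x)" "((\<lambda>s. qy x s) has_real_derivative qyy x y) (at y)"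
      by blast+
  show ?case
    by (intro conjI;
      rule DERIV_cong[OF DERIV_mult[OF p(1) q(1)]] DERIV_cong[OF DERIV_mult[OF p(2) q(2)]]
       DERIV_cong[OF DERIV_add[OF DERIV_mult[OF p(3) q(1)] DERIV_mult[OF p(1) q(3)]]]
       DERIV_cong[OF DERIV_add[OF DERIV_mult[OF p(4) q(2)] DERIV_mult[OF p(2) q(4)]]]
       DERIV_cong[OF DERIV_add[OF DERIV_mult[OF p(5) q(1)] DERIV_mult[OF p(1) q(5)]]]
       DERIV_cong[OF DERIV_add[OF DERIV_mult[OF p(6) q(2)] DERIV_mult[OF p(2) q(6)]]]) (simp_all add:
         algebra_simps)
qed simp_all

text \<open>Forgets the derivatives while a polynomial is being built; uniqueness of derivatives
  recovers them afterwards.\<close>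

definition is_poly2 :: "(real \<Rightarrow> real \<Rightarrow> real) \<Rightarrow> bool" where
  "is_poly2 p \<longleftrightarrow> (\<exists>px py pxx pxy pyy. poly2 p px py pxx pxy pyy)"

lemma is_poly2_intros:
  "is_poly2 (\<lambda>x y. c)" "is_poly2 (\<lambda>x y. x)" "is_poly2 (\<lambda>x y. y)"
  "is_poly2 p \<Longrightarrow> is_poly2 q \<Longrightarrow> is_poly2 (\<lambda>x y. p x y + q x y)"
  "is_poly2 p \<Longrightarrow> is_poly2 q \<Longrightarrow> is_poly2 (\<lambda>x y. p x y * q x y)"
  unfolding is_poly2_def by (blast intro: poly2.intros)+

lemma is_poly2_diff: "is_poly2 p \<Longrightarrow> is_poly2 q \<Longrightarrow> is_poly2 (\<lambda>x y. p x y - q x y)"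
  using is_poly2_intros(4)[OF _ is_poly2_intros(5)[OF is_poly2_intros(1)[of "-1"]], of p q] by simp

lemma is_poly2_power: "is_poly2 p \<Longrightarrow> is_poly2 (\<lambda>x y. p x y ^ n)"
  by (induction n) (auto intro: is_poly2_intros)

lemma is_poly2_sum: "(\<And>i. i \<in> S \<Longrightarrow> is_poly2 (p i)) \<Longrightarrow> is_poly2 (\<lambda>x y. \<Sum>i\<in>S. p i x y)"
  by (induction S rule: infinite_finite_induct) (auto intro: is_poly2_intros)

subsection \<open>Bernstein polynomials on the unit square\<close>

text \<open>The coefficients are arbitrary rather than values of a function: differentiation
  replaces them by scaled differences and keeps the form.\<close>

definition bern2 :: "nat \<Rightarrow> nat \<Rightarrow> (nat \<Rightarrow> nat \<Rightarrow> real) \<Rightarrow> real \<Rightarrow> real \<Rightarrow> real" where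
  "bern2 m n c x y = (\<Sum>i\<le>m. (\<Sum>j\<le>n. c i j * Bernstein n j y) * Bernstein m i x)"

lemma bern2_swap: "bern2 m n c x y = bern2 n m (\<lambda>j i. c i j) y x"
  unfolding bern2_def sum_distrib_right by (subst sum.swap) (simp add: mult_ac)

text \<open>Polynomials take the place of the variables, to allow an affine change of
  coordinates.\<close>

lemma is_poly2_bern2:
  assumes "is_poly2 p" "is_poly2 q" shows "is_poly2 (\<lambda>x y. bern2 m n c (p x y) (q x y))"
  unfolding bern2_def Bernstein_def
  by (intro is_poly2_sum is_poly2_intros is_poly2_power is_poly2_diff assms)

lemma Bernstein_0_deriv: "((\<lambda>x. Bernstein (Suc m) 0 x) has_real_derivative - real (Suc m) * Bernstein m 0 x)
  (at x)"
proof -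
  have "((\<lambda>x. 1 - x) has_real_derivative - 1) (at x)" by (auto intro!: derivative_eq_intros)
  from DERIV_cong[OF DERIV_power_Suc[OF this, of m], of "- real (Suc m) * (1 - x) ^ m"]
  show ?thesis unfolding Bernstein_def by (simp add: algebra_simps del: power_Suc)
qed

lemma Bernstein_Suc_deriv:
  assumes "i \<le> m"
  shows "((\<lambda>x. Bernstein (Suc m) (Suc i) x) has_real_derivative real (Suc m) * (Bernstein m i x
    - Bernstein m (Suc i) x)) (at x)"
proof -
  have "(Suc i) * (Suc m choose Suc i) = Suc m * (m choose i)" by (rule Suc_times_binomial)
  then have 1: "real (Suc i) * real (Suc m choose Suc i) = real (Suc m) * real (m choose i)"
    by (metis of_nat_mult)
  have "(Suc m - Suc i) * (Suc m choose Suc i) = Suc m * ((Suc m - 1) choose Suc i)"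
    by (rule binomial_absorb_comp)
  then have 2: "real (m - i) * real (Suc m choose Suc i) = real (Suc m) * real (m choose Suc i)"
    by (metis of_nat_mult diff_Suc_Suc diff_Suc_1)
  \<comment> \<open>For \<open>i = m\<close> the truncated exponent \<open>m - i - 1\<close> is
    harmless, its factor \<open>real (m - i)\<close> being 0.\<close>
  have "((\<lambda>x. Bernstein (Suc m) (Suc i) x) has_real_derivative
      real (Suc m choose Suc i) * (real (Suc i) * x ^ i * (1 - x) ^ (m - i) - real (m - i) * x ^ Suc i * (1
        - x) ^ (m - i - 1))) (at x)"
  proof -
    have a: "((\<lambda>x. x ^ Suc i) has_real_derivative real (Suc i) * x ^ i) (at x)"
      using DERIV_pow[of "Suc i" x] by simp
    have "((\<lambda>x. 1 - x) has_real_derivative - 1) (at x)" by (auto intro!: derivative_eq_intros)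
    then have b: "((\<lambda>x. (1 - x) ^ (m - i)) has_real_derivative - (real (m - i) * (1 - x) ^ (m - i
      - 1))) (at x)"
      by (rule DERIV_cong[OF DERIV_power]) simp
    show ?thesis unfolding Bernstein_def mult.assoc diff_Suc_Suc
      by (rule DERIV_cong[OF DERIV_cmult[OF DERIV_mult[OF a b]]]) (simp add: algebra_simps)
  qed
  also have "real (Suc m choose Suc i) * (real (Suc i) * x ^ i * (1 - x) ^ (m - i) - real (m - i) * x ^ Suc
    i * (1 - x) ^ (m - i - 1))
    = (real (Suc i) * real (Suc m choose Suc i)) * (x ^ i * (1 - x) ^ (m - i))
      - (real (m - i) * real (Suc m choose Suc i)) * (x ^ Suc i * (1 - x) ^ (m - i - 1))"
    by (simp only: right_diff_distrib mult_ac)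
  also have "\<dots> = real (Suc m) * (Bernstein m i x - Bernstein m (Suc i) x)"
    unfolding 1 2 Bernstein_def by (simp add: right_diff_distrib mult_ac)
  finally show ?thesis .
qed

text \<open>Summation by parts; the top term of the shifted sum drops out because its binomial
  coefficient is 0.\<close>

lemma Bernstein_sum_deriv:
  "((\<lambda>x. \<Sum>i\<le>Suc m. c i * Bernstein (Suc m) i x) has_real_derivative
     (\<Sum>i\<le>m. (real (Suc m) * (c (Suc i) - c i)) * Bernstein m i x)) (at x)"
proof -
  have "((\<lambda>x. c 0 * Bernstein (Suc m) 0 x + (\<Sum>i\<le>m. c (Suc i) * Bernstein (Suc m) (Suc i) x))
    has_real_derivative
     c 0 * (- real (Suc m) * Bernstein m 0 x) + (\<Sum>i\<le>m. c (Suc i) * (real (Suc m) * (Bernstein m i x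
       - Bernstein m (Suc i) x)))) (at x)"
    by (intro DERIV_add DERIV_cmult Bernstein_0_deriv DERIV_sum Bernstein_Suc_deriv) simp
  also have "(\<lambda>x. c 0 * Bernstein (Suc m) 0 x + (\<Sum>i\<le>m. c (Suc i) * Bernstein (Suc m) (Suc i) x))
    = (\<lambda>x. \<Sum>i\<le>Suc m. c i * Bernstein (Suc m) i x)"
    by (subst sum.atMost_Suc_shift) simp
  also have "c 0 * (- real (Suc m) * Bernstein m 0 x) + (\<Sum>i\<le>m. c (Suc i) * (real (Suc m) * (Bernstein m i x
    - Bernstein m (Suc i) x)))
     = real (Suc m) * ((\<Sum>i\<le>m. c (Suc i) * Bernstein m i x) - (c 0 * Bernstein m 0 x + (\<Sum>i\<le>m. c (Suc i) *
       Bernstein m (Suc i) x)))"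
    by (simp add: sum_distrib_left sum_subtractf algebra_simps)
  also have "c 0 * Bernstein m 0 x + (\<Sum>i\<le>m. c (Suc i) * Bernstein m (Suc i) x) = (\<Sum>i\<le>Suc m. c i * Bernstein
    m i x)"
    by (subst sum.atMost_Suc_shift) simp
  also have "\<dots> = (\<Sum>i\<le>m. c i * Bernstein m i x)" by (simp add: Bernstein_def)
  also have "real (Suc m) * ((\<Sum>i\<le>m. c (Suc i) * Bernstein m i x) - (\<Sum>i\<le>m. c i * Bernstein m i x)) =
     (\<Sum>i\<le>m. (real (Suc m) * (c (Suc i) - c i)) * Bernstein m i x)"
    by (simp add: sum_distrib_left sum_subtractf[symmetric] algebra_simps)
  finally show ?thesis .
qed

lemma bern2_deriv_fst:
  "((\<lambda>s. bern2 (Suc m) n c s y) has_real_derivative bern2 m n (\<lambda>i j. real (Suc m) * (c (Suc i) j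
    - c i j)) x y) (at x)"
proof -
  have "(\<Sum>i\<le>m. (real (Suc m) * ((\<Sum>j\<le>n. c (Suc i) j * Bernstein n j y) - (\<Sum>j\<le>n. c i j * Bernstein n j y))) *
    Bernstein m i x)
    = bern2 m n (\<lambda>i j. real (Suc m) * (c (Suc i) j - c i j)) x y"
    unfolding bern2_def by (simp add: sum_distrib_left sum_subtractf[symmetric] algebra_simps)
  with Bernstein_sum_deriv[of "\<lambda>i. \<Sum>j\<le>n. c i j * Bernstein n j y" m x] show ?thesis
    unfolding bern2_def by simp
qed

lemma bern2_deriv_snd:
  "((\<lambda>s. bern2 m (Suc n) c x s) has_real_derivative bern2 m n (\<lambda>i j. real (Suc n) * (c i (Suc j)
    - c i j)) x y) (at y)"
  using bern2_deriv_fst[where m = n and n = m and c = "\<lambda>j i. c i j" and x = y and y = x]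
    by (simp add: bern2_swap[of m])

text \<open>The sum is the variance of a binomial mean, \<open>x * (1 - x) / m\<close>.\<close>

lemma Bernstein_variance:
  assumes "0 < m" "0 \<le> x" "x \<le> 1" shows "(\<Sum>i\<le>m. (real i / real m - x)\<^sup>2 * Bernstein m i x) \<le> 1 / real m"
proof -
  have "(real i / real m - x)\<^sup>2 * Bernstein m i x =
     (real i * (real i - 1) * Bernstein m i x + (1 - 2 * real m * x) * (real i * Bernstein m i x)
       + (real m)\<^sup>2 * x\<^sup>2 * Bernstein m i x) / (real m)\<^sup>2" for i
    using assms(1) by (simp add: power2_eq_square field_simps)
  then have "(\<Sum>i\<le>m. (real i / real m - x)\<^sup>2 * Bernstein m i x) =
     (real m * (real m - 1) * x\<^sup>2 + (1 - 2 * real m * x) * (real m * x) + (real m)\<^sup>2 * x\<^sup>2) / (real m)\<^sup>2"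
    by (simp add: sum_divide_distrib[symmetric] sum.distrib sum_distrib_left[symmetric])
  also have "\<dots> = x * (1 - x) / real m" using assms(1) by (simp add: power2_eq_square field_simps)
  also have "\<dots> \<le> 1 / real m"
    using assms by (intro divide_right_mono mult_le_one) auto
  finally show ?thesis .
qed

text \<open>Chebyshev's argument for the theorem of Bernstein. The coefficients need only be
  \<epsilon>-close to the sampled values, which admits the divided differences that occur as
  coefficients of derivatives. Of the \<open>3 * \<epsilon>\<close>, one part is this error, one the
  modulus of continuity and one the variance.\<close>

lemma bern2_approx:
  fixes G :: "real \<Rightarrow> real \<Rightarrow> real"
  assumes cont: "continuous_on ({0..1} \<times> {0..1}) (\<lambda>(x, y). G x y)" and \<epsilon>: "0 < \<epsilon>"
  shows "\<exists>N. \<forall>m\<ge>N. \<forall>n\<ge>N. \<forall>c. (\<forall>i\<le>m. \<forall>j\<le>n. \<bar>c i j - G (real i / real m) (real j / real n)\<bar> \<le> \<epsilon>) \<longrightarrow>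
     (\<forall>x\<in>{0..1}. \<forall>y\<in>{0..1}. \<bar>bern2 m n c x y - G x y\<bar> \<le> 3 * \<epsilon>)"
proof -
  let ?S = "{0..1::real} \<times> {0..1::real}"
  have S: "compact ?S" by (intro compact_Times compact_Icc)
  have "uniformly_continuous_on ?S (\<lambda>(x, y). G x y)" by (rule compact_uniformly_continuous[OF cont S])
  then obtain \<delta> where \<delta>: "0 < \<delta>" "\<And>u v. u \<in> ?S \<Longrightarrow> v \<in> ?S \<Longrightarrow> dist v u < \<delta> \<Longrightarrow> dist ((\<lambda>(x, y). G x y) v) ((\<lambda>(x,
    y). G x y) u) < \<epsilon>"
    unfolding uniformly_continuous_on_def using \<epsilon> by metis
  obtain K where K: "0 < K" "\<And>x y. x \<in> {0..1} \<Longrightarrow> y \<in> {0..1} \<Longrightarrow> \<bar>G x y\<bar> \<le> K"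
    using compact_imp_bounded[OF compact_continuous_image[OF cont S]] unfolding bounded_pos by force
  \<comment> \<open>Nearby points use uniform continuity; for distant ones, \<open>2 * K\<close> is
    at most \<open>2 * K / \<delta>\<^sup>2\<close> times the squared distance.\<close>
  have diff: "\<bar>G u v - G x y\<bar> \<le> \<epsilon> + 2 * K / \<delta>\<^sup>2 * ((u - x)\<^sup>2 + (v - y)\<^sup>2)"
    if "u \<in> {0..1}" "v \<in> {0..1}" "x \<in> {0..1}" "y \<in> {0..1}" for u v x y
  proof (cases "dist (u, v) (x, y) < \<delta>")
    case True
    then have "\<bar>G u v - G x y\<bar> < \<epsilon>" using \<delta>(2)[of "(x, y)" "(u, v)"] that by (auto simp: dist_real_def)
    moreover have "0 \<le> 2 * K / \<delta>\<^sup>2 * ((u - x)\<^sup>2 + (v - y)\<^sup>2)" using K(1) by simp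
    ultimately show ?thesis by linarith
  next
    case False
    then have "\<delta> \<le> sqrt ((u - x)\<^sup>2 + (v - y)\<^sup>2)" by (simp add: dist_prod_def dist_real_def)
    then have "\<delta>\<^sup>2 \<le> (u - x)\<^sup>2 + (v - y)\<^sup>2"
      using \<delta>(1) by (metis real_sqrt_le_iff real_sqrt_unique less_imp_le)
    then have "2 * K / \<delta>\<^sup>2 * \<delta>\<^sup>2 \<le> 2 * K / \<delta>\<^sup>2 * ((u - x)\<^sup>2 + (v - y)\<^sup>2)" using K(1)
      by (intro mult_left_mono) auto
    then have "2 * K \<le> 2 * K / \<delta>\<^sup>2 * ((u - x)\<^sup>2 + (v - y)\<^sup>2)" using \<delta>(1) by simp
    moreover have "\<bar>G u v\<bar> \<le> K" "\<bar>G x y\<bar> \<le> K" using K(2) that by auto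
    ultimately show ?thesis using \<epsilon> by linarith
  qed
  \<comment> \<open>Chosen to make \<open>2 * K / \<delta>\<^sup>2 * (2 / N)\<close> at most
    \<epsilon>.\<close>
  obtain N :: nat where N: "4 * K / (\<delta>\<^sup>2 * \<epsilon>) < real N" using reals_Archimedean2 by blast
  have N0: "0 < real N" by (rule le_less_trans[OF _ N]) (use K(1) \<delta>(1) \<epsilon> in auto)
  have bd: "2 * K / \<delta>\<^sup>2 * (1 / real m + 1 / real n) \<le> \<epsilon>" if "N \<le> m" "N \<le> n" for m n
  proof -
    have "1 / real m + 1 / real n \<le> 1 / real N + 1 / real N" using that N0
      by (intro add_mono divide_left_mono) auto
    then have "2 * K / \<delta>\<^sup>2 * (1 / real m + 1 / real n) \<le> 2 * K / \<delta>\<^sup>2 * (2 / real N)" using K(1)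
      by (intro mult_left_mono) auto
    also have "\<dots> \<le> \<epsilon>" using N N0 \<delta>(1) \<epsilon> by (simp add: field_simps)
    finally show ?thesis .
  qed
  show ?thesis
  proof (intro exI[of _ N] allI impI ballI)
    fix m n c and x y :: real
    assume mn: "N \<le> m" "N \<le> n" and c: "\<forall>i\<le>m. \<forall>j\<le>n. \<bar>c i j - G (real i / real m) (real j / real n)\<bar> \<le> \<epsilon>"
      and xy: "x \<in> {0..1}" "y \<in> {0..1}"
    have m0: "0 < m" "0 < n" using mn N0 by auto
    let ?b = "\<lambda>i j. Bernstein n j y * Bernstein m i x"
    have b0: "0 \<le> ?b i j" for i j using xy by (intro mult_nonneg_nonneg Bernstein_nonneg) auto
    let ?k = "2 * K / \<delta>\<^sup>2"
    have sb: "(\<Sum>i\<le>m. \<Sum>j\<le>n. ?b i j) = 1"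
      by (simp add: sum_distrib_right[symmetric])
    have "bern2 m n c x y - G x y = (\<Sum>i\<le>m. \<Sum>j\<le>n. c i j * ?b i j) - (\<Sum>i\<le>m. \<Sum>j\<le>n. G x y * ?b i j)"
      unfolding sum_distrib_left[symmetric] sb by (simp add: bern2_def sum_distrib_right mult.assoc)
    also have "\<dots> = (\<Sum>i\<le>m. \<Sum>j\<le>n. (c i j - G x y) * ?b i j)"
      by (simp add: sum_subtractf left_diff_distrib)
    also have "\<bar>\<dots>\<bar> \<le> (\<Sum>i\<le>m. \<Sum>j\<le>n. \<bar>(c i j - G x y) * ?b i j\<bar>)"
      by (intro order_trans[OF sum_abs] sum_mono sum_abs)
    also have "\<dots> \<le> (\<Sum>i\<le>m. \<Sum>j\<le>n. (2 * \<epsilon> + ?k * ((real i / real m - x)\<^sup>2 + (real j / real n - y)\<^sup>2)) * ?b i j)"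
    proof (intro sum_mono)
      fix i j assume ij: "i \<in> {..m}" "j \<in> {..n}"
      have "\<bar>c i j - G (real i / real m) (real j / real n)\<bar> \<le> \<epsilon>" using c ij by auto
      moreover have "\<bar>G (real i / real m) (real j / real n) - G x y\<bar> \<le> \<epsilon> + ?k * ((real i / real m - x)\<^sup>2
        + (real j / real n - y)\<^sup>2)"
        using ij m0 xy by (intro diff) auto
      ultimately have "\<bar>c i j - G x y\<bar> \<le> 2 * \<epsilon> + ?k * ((real i / real m - x)\<^sup>2 + (real j / real n - y)\<^sup>2)"
        by linarith
      then show "\<bar>(c i j - G x y) * ?b i j\<bar> \<le> (2 * \<epsilon> + ?k * ((real i / real m - x)\<^sup>2 + (real j / real n
        - y)\<^sup>2)) * ?b i j"
        using mult_right_mono[OF _ b0] by (simp only: abs_mult[of "c i j - G x y"] abs_of_nonneg[OF b0])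
    qed
    also have "\<dots> = 2 * \<epsilon> * (\<Sum>i\<le>m. \<Sum>j\<le>n. ?b i j) + ?k * ((\<Sum>i\<le>m. \<Sum>j\<le>n. (real i / real m - x)\<^sup>2 * ?b i j)
      + (\<Sum>i\<le>m. \<Sum>j\<le>n. (real j / real n - y)\<^sup>2 * ?b i j))"
      by (simp add: sum_distrib_left sum.distrib[symmetric] algebra_simps)
    also have "(\<Sum>i\<le>m. \<Sum>j\<le>n. (real i / real m - x)\<^sup>2 * ?b i j) = (\<Sum>i\<le>m. (real i / real m - x)\<^sup>2 * Bernstein m
      i x)"
    proof (rule sum.cong[OF refl])
      fix i
      have "(\<Sum>j\<le>n. (real i / real m - x)\<^sup>2 * ?b i j) = (\<Sum>j\<le>n. Bernstein n j y) * ((real i / real m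
        - x)\<^sup>2 * Bernstein m i x)"
        unfolding sum_distrib_right by (simp add: mult_ac)
      then show "(\<Sum>j\<le>n. (real i / real m - x)\<^sup>2 * ?b i j) = (real i / real m - x)\<^sup>2 * Bernstein m i x" by simp
    qed
    also have "(\<Sum>i\<le>m. \<Sum>j\<le>n. (real j / real n - y)\<^sup>2 * ?b i j) = (\<Sum>j\<le>n. (real j / real n - y)\<^sup>2 * Bernstein n
      j y)"
    proof -
      have "(\<Sum>i\<le>m. \<Sum>j\<le>n. (real j / real n - y)\<^sup>2 * ?b i j) = (\<Sum>i\<le>m. (\<Sum>j\<le>n. (real j / real n
        - y)\<^sup>2 * Bernstein n j y) * Bernstein m i x)"
        unfolding sum_distrib_right by (simp add: mult_ac)
      then show ?thesis by (simp add: sum_distrib_left[symmetric])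
    qed
    also have "2 * \<epsilon> * (\<Sum>i\<le>m. \<Sum>j\<le>n. ?b i j) + ?k * ((\<Sum>i\<le>m. (real i / real m - x)\<^sup>2 * Bernstein m i x)
      + (\<Sum>j\<le>n. (real j / real n - y)\<^sup>2 * Bernstein n j y))
      \<le> 2 * \<epsilon> * 1 + ?k * (1 / real m + 1 / real n)"
      unfolding sb using K(1) m0 xy by (intro add_left_mono mult_left_mono add_mono Bernstein_variance) auto
    also have "\<dots> \<le> 3 * \<epsilon>" using bd[OF mn] by simp
    finally show "\<bar>bern2 m n c x y - G x y\<bar> \<le> 3 * \<epsilon>" .
  qed
qed

section \<open>Polynomial approximation in C2\<close>

lemma mvt_within:
  fixes g g' :: "real \<Rightarrow> real"
  assumes "a < b" "{a..b} \<subseteq> S" "\<And>x. x \<in> {a..b} \<Longrightarrow> (g has_real_derivative g' x) (at x within S)"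
  shows "\<exists>\<xi>\<in>{a..b}. g b - g a = (b - a) * g' \<xi>"
proof -
  have "\<exists>x\<in>{a<..<b}. g b - g a = (\<lambda>h. h * g' x) (b - a)"
  proof (rule mvt_simple[OF assms(1)])
    fix x assume "a \<le> x" "x \<le> b"
    then have "(g has_real_derivative g' x) (at x within {a..b})"
      by (intro has_field_derivative_subset[OF assms(3) assms(2)]) auto
    then show "(g has_derivative (\<lambda>h. h * g' x)) (at x within {a..b})"
      by (simp add: has_field_derivative_def mult.commute[of _ "g' x"])
  qed
  then show ?thesis by fastforce
qed

definition C2_square :: "(real \<Rightarrow> real \<Rightarrow> real) \<Rightarrow> (real \<Rightarrow> real \<Rightarrow> real) \<Rightarrow> (real \<Rightarrow> real \<Rightarrow> real) \<Rightarrow>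
   (real \<Rightarrow> real \<Rightarrow> real) \<Rightarrow> (real \<Rightarrow> real \<Rightarrow> real) \<Rightarrow> (real \<Rightarrow> real \<Rightarrow> real) \<Rightarrow> bool" where
  "C2_square F Fx Fy Fxx Fxy Fyy \<longleftrightarrow>
     (\<forall>x\<in>{0..1}. \<forall>y\<in>{0..1}.
        ((\<lambda>s. F s y) has_real_derivative Fx x y) (at x within {0..1}) \<and>
        ((\<lambda>s. F x s) has_real_derivative Fy x y) (at y within {0..1}) \<and>
        ((\<lambda>s. Fx s y) has_real_derivative Fxx x y) (at x within {0..1}) \<and>
        ((\<lambda>s. Fx x s) has_real_derivative Fxy x y) (at y within {0..1}) \<and>
        ((\<lambda>s. Fy s y) has_real_derivative Fxy x y) (at x within {0..1}) \<and>
        ((\<lambda>s. Fy x s) has_real_derivative Fyy x y) (at y within {0..1})) \<and>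
     (\<forall>D\<in>{F, Fx, Fy, Fxx, Fxy, Fyy}. continuous_on ({0..1} \<times> {0..1}) (\<lambda>(x, y). D x y))"

lemma C2_square_swap:
  assumes "C2_square F Fx Fy Fxx Fxy Fyy"
  shows "C2_square (\<lambda>x y. F y x) (\<lambda>x y. Fy y x) (\<lambda>x y. Fx y x) (\<lambda>x y. Fyy y x) (\<lambda>x y. Fxy y x) (\<lambda>x y. Fxx y
    x)"
proof -
  have "continuous_on ({0..1} \<times> {0..1}) (\<lambda>(x, y). D y x)"
    if "continuous_on ({0..1} \<times> {0..1}) (\<lambda>(x, y). D x y)"
    for D :: "real \<Rightarrow> real \<Rightarrow> real"
  proof -
    have "continuous_on ({0..1} \<times> {0..1}) (\<lambda>z. (\<lambda>(x, y). D x y) (prod.swap z))"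
      by (rule continuous_on_compose2[OF that]) (auto intro!: continuous_intros simp: prod.swap_def)
    then show ?thesis by (simp add: case_prod_unfold prod.swap_def)
  qed
  then show ?thesis using assms unfolding C2_square_def by auto
qed

text \<open>The coefficients of the differentiated Bernstein polynomials are divided differences of
  \<open>F\<close> with step \<open>1 / (n + 2)\<close>. By the mean value theorem they are values
  of the derivatives at nearby points, up to a small relative error for \<open>Fxx\<close>. The
  grids of degrees \<open>n\<close> and \<open>n + 1\<close> differ from that of degree
  \<open>n + 2\<close> by at most two steps. So \<open>bern2_approx\<close> applies to each
  derivative.\<close>

lemma bern2_C2_approx_fst:
  assumes C2: "C2_square F Fx Fy Fxx Fxy Fyy" and \<epsilon>: "0 < \<epsilon>"
  shows "\<exists>N. \<forall>n\<ge>N. let h = real (n + 2); c = (\<lambda>i j. F (real i / h) (real j / h)) in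
     \<forall>x\<in>{0..1}. \<forall>y\<in>{0..1}. \<bar>bern2 (n + 2) (n + 2) c x y - F x y\<bar> \<le> 3 * \<epsilon> \<and>
       \<bar>bern2 (n + 1) (n + 2) (\<lambda>i j. h * (c (Suc i) j - c i j)) x y - Fx x y\<bar> \<le> 3 * \<epsilon> \<and>
       \<bar>bern2 n (n + 2) (\<lambda>i j. real (n + 1) * (h * (c (Suc (Suc i)) j - c (Suc i) j) - h * (c (Suc i) j
         - c i j))) x y - Fxx x y\<bar> \<le> 3 * \<epsilon> \<and>
       \<bar>bern2 (n + 1) (n + 1) (\<lambda>i j. h * (h * (c (Suc i) (Suc j) - c i (Suc j)) - h * (c (Suc i) j
         - c i j))) x y - Fxy x y\<bar> \<le> 3 * \<epsilon>"
proof -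
  have d: "((\<lambda>s. F s y) has_real_derivative Fx x y) (at x within {0..1})"
    "((\<lambda>s. Fx s y) has_real_derivative Fxx x y) (at x within {0..1})"
    "((\<lambda>s. Fx x s) has_real_derivative Fxy x y) (at y within {0..1})" if "x \<in> {0..1}" "y \<in> {0..1}" for x y
    using C2 that unfolding C2_square_def by blast+
  have c: "continuous_on ({0..1} \<times> {0..1}) (\<lambda>(x, y). F x y)" "continuous_on ({0..1} \<times> {0..1}) (\<lambda>(x, y). Fx x
    y)"
    "continuous_on ({0..1} \<times> {0..1}) (\<lambda>(x, y). Fxx x y)" "continuous_on ({0..1} \<times> {0..1}) (\<lambda>(x, y). Fxy x y)"
    using C2 unfolding C2_square_def by blast+
  have S: "compact ({0..1::real} \<times> {0..1::real})" by (intro compact_Times compact_Icc)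
  have unif: "\<exists>\<delta>>0. \<forall>x\<in>{0..1}. \<forall>y\<in>{0..1}. \<forall>u\<in>{0..1}. \<forall>v\<in>{0..1}. \<bar>u - x\<bar> < \<delta> \<longrightarrow> \<bar>v - y\<bar> < \<delta> \<longrightarrow> \<bar>G u v - G x y\<bar>
    \<le> \<epsilon> / 2"
    if G: "continuous_on ({0..1} \<times> {0..1}) (\<lambda>(x, y). G x y)" for G :: "real \<Rightarrow> real \<Rightarrow> real"
  proof -
    obtain \<delta> where \<delta>: "0 < \<delta>" "\<And>p q. p \<in> {0..1::real} \<times> {0..1::real} \<Longrightarrow> q \<in> {0..1} \<times> {0..1} \<Longrightarrow> dist q p < \<delta> \<Longrightarrow>
        dist ((\<lambda>(x, y). G x y) q) ((\<lambda>(x, y). G x y) p) < \<epsilon> / 2"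
      using compact_uniformly_continuous[OF G S] \<epsilon> unfolding uniformly_continuous_on_def
        by (metis half_gt_zero)
    show ?thesis
    proof (intro exI[of _ "\<delta> / 2"] conjI ballI impI)
      fix x y u v :: real assume h: "x \<in> {0..1}" "y \<in> {0..1}" "u \<in> {0..1}" "v \<in> {0..1}" "\<bar>u - x\<bar> < \<delta> / 2"
        "\<bar>v - y\<bar> < \<delta> / 2"
      have "dist (u, v) (x, y) \<le> \<bar>u - x\<bar> + \<bar>v - y\<bar>"
        using sqrt_sum_squares_le_sum_abs[of "u - x" "v - y"] by (simp add: dist_prod_def dist_real_def)
      then have "dist (u, v) (x, y) < \<delta>" using h by linarith
      from \<delta>(2)[OF _ _ this] h show "\<bar>G u v - G x y\<bar> \<le> \<epsilon> / 2" by (auto simp: dist_real_def)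
    qed (use \<delta>(1) in simp)
  qed
  obtain \<delta>1 where \<delta>1: "0 < \<delta>1" "\<And>x y u v. x \<in> {0..1} \<Longrightarrow> y \<in> {0..1} \<Longrightarrow> u \<in> {0..1} \<Longrightarrow> v \<in> {0..1} \<Longrightarrow> \<bar>u - x\<bar> < \<delta>1
    \<Longrightarrow> \<bar>v - y\<bar> < \<delta>1 \<Longrightarrow> \<bar>Fx u v - Fx x y\<bar> \<le> \<epsilon> / 2"
    using unif[OF c(2)] by blast
  obtain \<delta>2 where \<delta>2: "0 < \<delta>2" "\<And>x y u v. x \<in> {0..1} \<Longrightarrow> y \<in> {0..1} \<Longrightarrow> u \<in> {0..1} \<Longrightarrow> v \<in> {0..1} \<Longrightarrow> \<bar>u - x\<bar> < \<delta>2
    \<Longrightarrow> \<bar>v - y\<bar> < \<delta>2 \<Longrightarrow> \<bar>Fxx u v - Fxx x y\<bar> \<le> \<epsilon> / 2"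
    using unif[OF c(3)] by blast
  obtain \<delta>3 where \<delta>3: "0 < \<delta>3" "\<And>x y u v. x \<in> {0..1} \<Longrightarrow> y \<in> {0..1} \<Longrightarrow> u \<in> {0..1} \<Longrightarrow> v \<in> {0..1} \<Longrightarrow> \<bar>u - x\<bar> < \<delta>3
    \<Longrightarrow> \<bar>v - y\<bar> < \<delta>3 \<Longrightarrow> \<bar>Fxy u v - Fxy x y\<bar> \<le> \<epsilon> / 2"
    using unif[OF c(4)] by blast
  obtain K where K: "0 < K" "\<And>x y. x \<in> {0..1} \<Longrightarrow> y \<in> {0..1} \<Longrightarrow> \<bar>Fxx x y\<bar> \<le> K"
    using compact_imp_bounded[OF compact_continuous_image[OF c(3) S]] unfolding bounded_pos by force
  obtain N0 where N0: "\<forall>m\<ge>N0. \<forall>n\<ge>N0. \<forall>c. (\<forall>i\<le>m. \<forall>j\<le>n. \<bar>c i j - F (real i / real m) (real j / real n)\<bar> \<le> \<epsilon>) \<longrightarrow>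
     (\<forall>x\<in>{0..1}. \<forall>y\<in>{0..1}. \<bar>bern2 m n c x y - F x y\<bar> \<le> 3 * \<epsilon>)" using bern2_approx[OF c(1) \<epsilon>] by blast
  obtain N1 where N1: "\<forall>m\<ge>N1. \<forall>n\<ge>N1. \<forall>c. (\<forall>i\<le>m. \<forall>j\<le>n. \<bar>c i j - Fx (real i / real m) (real j / real n)\<bar> \<le> \<epsilon>) \<longrightarrow>
     (\<forall>x\<in>{0..1}. \<forall>y\<in>{0..1}. \<bar>bern2 m n c x y - Fx x y\<bar> \<le> 3 * \<epsilon>)" using bern2_approx[OF c(2) \<epsilon>] by blast
  obtain N2 where N2: "\<forall>m\<ge>N2. \<forall>n\<ge>N2. \<forall>c. (\<forall>i\<le>m. \<forall>j\<le>n. \<bar>c i j - Fxx (real i / real m) (real j / real n)\<bar> \<le> \<epsilon>) \<longrightarrow>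
     (\<forall>x\<in>{0..1}. \<forall>y\<in>{0..1}. \<bar>bern2 m n c x y - Fxx x y\<bar> \<le> 3 * \<epsilon>)" using bern2_approx[OF c(3) \<epsilon>] by blast
  obtain N3 where N3: "\<forall>m\<ge>N3. \<forall>n\<ge>N3. \<forall>c. (\<forall>i\<le>m. \<forall>j\<le>n. \<bar>c i j - Fxy (real i / real m) (real j / real n)\<bar> \<le> \<epsilon>) \<longrightarrow>
     (\<forall>x\<in>{0..1}. \<forall>y\<in>{0..1}. \<bar>bern2 m n c x y - Fxy x y\<bar> \<le> 3 * \<epsilon>)" using bern2_approx[OF c(4) \<epsilon>] by blast
  \<comment> \<open>Makes two steps of length \<open>1 / (n + 2)\<close> smaller than each of the
    three moduli, and \<open>K\<close> times one step at most \<open>\<epsilon> / 2\<close>.\<close>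
  obtain N4 :: nat where N4: "2 / \<delta>1 + 2 / \<delta>2 + 2 / \<delta>3 + 2 * K / \<epsilon> < real N4" using reals_Archimedean2
    by blast
  define N where "N = N0 + N1 + N2 + N3 + N4 + 1"
  show ?thesis
    unfolding Let_def
  proof (intro exI[of _ N] allI impI ballI)
    fix n and x y :: real assume n: "N \<le> n" and xy: "x \<in> {0..1}" "y \<in> {0..1}"
    define h where "h = real (n + 2)"
    define c where "c = (\<lambda>i j. F (real i / h) (real j / h))"
    define e where "e = 1 / h"
    have h: "0 < h" "real n + 2 = h" "real (n + 1) + 1 = h" by (simp_all add: h_def)
    have e0: "0 < e" and he: "h * e = 1" using h by (simp_all add: e_def)
    have nN: "N0 \<le> n" "N1 \<le> n" "N2 \<le> n" "N3 \<le> n" "real N4 < h" "0 < n" using n by (auto simp: N_def h_def)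
    have pos: "0 < 2 / \<delta>1" "0 < 2 / \<delta>2" "0 < 2 / \<delta>3" "0 < 2 * K / \<epsilon>" using \<delta>1(1) \<delta>2(1) \<delta>3(1) K(1) \<epsilon>
      by simp_all
    have e: "2 * e < \<delta>1" "2 * e < \<delta>2" "2 * e < \<delta>3" "K * e \<le> \<epsilon> / 2"
    proof -
      have "2 / \<delta>1 < h" "2 / \<delta>2 < h" "2 / \<delta>3 < h" "2 * K / \<epsilon> < h" using pos N4 nN(5) by linarith+
      then show "2 * e < \<delta>1" "2 * e < \<delta>2" "2 * e < \<delta>3" "K * e \<le> \<epsilon> / 2"
        using \<delta>1(1) \<delta>2(1) \<delta>3(1) \<epsilon> h by (simp_all add: e_def field_simps)
    qed
    have grid: "real i / h \<in> {0..1}" if "i \<le> n + 2" for i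
      using that h by (simp add: h_def)
    have step: "real (Suc i) / h = real i / h + e" for i by (simp add: e_def add_divide_distrib)
    have g1: "real i / h \<le> real i / real (n + 1)" "real i / real (n + 1) \<le> real i / h + e" if "i \<le> n + 1"
      for i
    proof -
      show "real i / h \<le> real i / real (n + 1)" unfolding h_def by (intro divide_left_mono) auto
      have "real i * h \<le> (real i + 1) * real (n + 1)" using that unfolding h_def by (simp add: algebra_simps)
      then show "real i / real (n + 1) \<le> real i / h + e" using h
        by (simp add: e_def add_divide_distrib[symmetric] pos_divide_le_eq pos_le_divide_eq)
    qed
    have g2: "real i / h \<le> real i / real n" "real i / real n \<le> real i / h + 2 * e" if "i \<le> n" for i
    proof -
      show "real i / h \<le> real i / real n" unfolding h_def using nN by (intro divide_left_mono) auto
      have "real i * h \<le> (real i + 2) * real n" using that unfolding h_def by (simp add: algebra_simps)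
      then show "real i / real n \<le> real i / h + 2 * e" using h nN(6)
        by (simp add: e_def add_divide_distrib[symmetric] pos_divide_le_eq pos_le_divide_eq)
    qed
    have q1: "real i / real (n + 1) \<in> {0..1}" if "i \<le> n + 1" for i using that by simp
    have q2: "real i / real n \<in> {0..1}" if "i \<le> n" for i using that nN by simp
    have c0: "real j / real (n + 2) = real j / h" for j by (simp add: h_def)
    have r0: "\<bar>bern2 (n + 2) (n + 2) c x y - F x y\<bar> \<le> 3 * \<epsilon>"
    proof -
      have "\<forall>i\<le>n + 2. \<forall>j\<le>n + 2. \<bar>c i j - F (real i / real (n + 2)) (real j / real (n + 2))\<bar> \<le> \<epsilon>"
        unfolding c0 c_def using \<epsilon> by simp
      then show ?thesis using N0 nN xy by simp
    qed
    have r1: "\<bar>bern2 (n + 1) (n + 2) (\<lambda>i j. h * (c (Suc i) j - c i j)) x y - Fx x y\<bar> \<le> 3 * \<epsilon>"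
    proof -
      have "\<bar>h * (c (Suc i) j - c i j) - Fx (real i / real (n + 1)) (real j / real (n + 2))\<bar> \<le> \<epsilon>"
        if ij: "i \<le> n + 1" "j \<le> n + 2" for i j
      proof -
        have sub: "{real i / h..real i / h + e} \<subseteq> {0..1}" using grid[of i] grid[of "Suc i"] ij
          unfolding step by auto
        obtain \<xi> where \<xi>: "\<xi> \<in> {real i / h..real i / h + e}" "F (real i / h + e) (real j / h) - F (real i /
          h) (real j / h) = e * Fx \<xi> (real j / h)"
          using mvt_within[OF _ sub, of "\<lambda>s. F s (real j / h)" "\<lambda>s. Fx s (real j / h)"] d(1) sub grid[OF
            ij(2)] e0 by fastforce
        have "h * (c (Suc i) j - c i j) = Fx \<xi> (real j / h)"
          unfolding c_def step \<xi>(2) using he by (simp add: mult.assoc[symmetric])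
        moreover have "\<bar>Fx \<xi> (real j / h) - Fx (real i / real (n + 1)) (real j / h)\<bar> \<le> \<epsilon> / 2"
          using \<xi>(1) sub g1[OF ij(1)] q1[OF ij(1)] grid[OF ij(2)] e e0 \<delta>1(1) by (intro \<delta>1(2)) auto
        ultimately show ?thesis unfolding c0 using \<epsilon> by simp
      qed
      then show ?thesis using N1 nN xy by simp
    qed
    have r2: "\<bar>bern2 n (n + 2) (\<lambda>i j. real (n + 1) * (h * (c (Suc (Suc i)) j - c (Suc i) j) - h * (c (Suc i)
      j - c i j))) x y - Fxx x y\<bar> \<le> 3 * \<epsilon>"
    proof -
      have "\<bar>real (n + 1) * (h * (c (Suc (Suc i)) j - c (Suc i) j) - h * (c (Suc i) j - c i j))
        - Fxx (real i / real n) (real j / real (n + 2))\<bar> \<le> \<epsilon>"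
        if ij: "i \<le> n" "j \<le> n + 2" for i j
      proof -
        let ?x = "real i / h" and ?y = "real j / h"
        have sub: "{?x..?x + 2 * e} \<subseteq> {0..1}" using grid[of i] grid[of "Suc (Suc i)"] ij unfolding step
          by auto
        have y: "?y \<in> {0..1}" by (rule grid[OF ij(2)])
        \<comment> \<open>The second difference of \<open>F\<close> is a first difference of
          \<open>?G\<close>; the mean value theorem is applied to \<open>?G\<close> and then to
          \<open>Fx\<close>.\<close>
        let ?G = "\<lambda>s. F (s + e) ?y - F s ?y" and ?G' = "\<lambda>s. Fx (s + e) ?y - Fx s ?y"
        have sub1: "{?x..?x + e} \<subseteq> {0..1}" using sub e0 by auto
        have G: "(?G has_real_derivative ?G' s) (at s within {?x..?x + e})" if s: "s \<in> {?x..?x + e}" for s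
        proof (rule DERIV_diff)
          show "((\<lambda>s. F s ?y) has_real_derivative Fx s ?y) (at s within {?x..?x + e})"
            using d(1)[of s ?y] s sub1 y has_field_derivative_subset by blast
          have "((\<lambda>s. F s ?y) has_real_derivative Fx (s + e) ?y) (at (s + e) within {0..1})"
            using d(1)[of "s + e" ?y] s sub y e0 by auto
          then have "((\<lambda>s. F s ?y) has_real_derivative Fx (s + e) ?y) (at (s + e) within (\<lambda>s. s
            + e) ` {?x..?x + e})"
            by (rule has_field_derivative_subset) (use sub e0 in auto)
          moreover have "((\<lambda>s. s + e) has_real_derivative 1) (at s within {?x..?x + e})"
            by (auto intro!: derivative_eq_intros)
          ultimately show "((\<lambda>s. F (s + e) ?y) has_real_derivative Fx (s + e) ?y) (at s within {?x..?x + e})"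
            using DERIV_image_chain[of "\<lambda>s. F s ?y" "Fx (s + e) ?y" "\<lambda>s. s + e" s "{?x..?x + e}" 1]
              by (simp add: o_def)
        qed
        obtain \<xi> where \<xi>: "\<xi> \<in> {?x..?x + e}" "?G (?x + e) - ?G ?x = e * ?G' \<xi>"
          using mvt_within[OF _ order_refl G] e0 by fastforce
        have sub2: "{\<xi>..\<xi> + e} \<subseteq> {0..1}" using \<xi>(1) sub by auto
        obtain \<zeta> where \<zeta>: "\<zeta> \<in> {\<xi>..\<xi> + e}" "Fx (\<xi> + e) ?y - Fx \<xi> ?y = e * Fxx \<zeta> ?y"
          using mvt_within[OF _ sub2, of "\<lambda>s. Fx s ?y" "\<lambda>s. Fxx s ?y"] d(2) sub2 y e0 by fastforce
        have "h * (c (Suc (Suc i)) j - c (Suc i) j) - h * (c (Suc i) j - c i j) = h * (?G (?x + e) - ?G ?x)"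
          unfolding c_def step by (simp add: algebra_simps)
        also have "\<dots> = (h * e) * (e * Fxx \<zeta> ?y)" unfolding \<xi>(2) \<zeta>(2) by simp
        finally have eq: "h * (c (Suc (Suc i)) j - c (Suc i) j) - h * (c (Suc i) j - c i j) = e * Fxx \<zeta> ?y"
          unfolding he by simp
        \<comment> \<open>The second differentiation contributes the factor \<open>n + 1\<close>,
          one less than \<open>1 / e\<close>. The defect \<open>e * Fxx\<close> is absorbed through
          the bound \<open>K\<close>.\<close>
        have ne: "real (n + 1) * e = 1 - e" using he unfolding h(3)[symmetric] by (simp add: algebra_simps)
        have "real (n + 1) * (e * Fxx \<zeta> ?y) = Fxx \<zeta> ?y - e * Fxx \<zeta> ?y"
          unfolding mult.assoc[symmetric] ne by (simp add: algebra_simps)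
        moreover have "\<bar>e * Fxx \<zeta> ?y\<bar> \<le> \<epsilon> / 2"
        proof -
          have "\<zeta> \<in> {0..1}" using \<zeta>(1) sub2 by auto
          then have "e * \<bar>Fxx \<zeta> ?y\<bar> \<le> e * K" using K(2)[of \<zeta> ?y] y e0 by (intro mult_left_mono) auto
          also have "e * K \<le> \<epsilon> / 2" using e(4) by (simp add: mult.commute)
          finally show ?thesis unfolding abs_mult abs_of_pos[OF e0] .
        qed
        moreover have "\<bar>Fxx \<zeta> ?y - Fxx (real i / real n) ?y\<bar> \<le> \<epsilon> / 2"
          using \<zeta>(1) \<xi>(1) sub2 g2[OF ij(1)] q2[OF ij(1)] y e e0 \<delta>2(1) by (intro \<delta>2(2)) auto
        ultimately show ?thesis unfolding c0 eq by linarith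
      qed
      then show ?thesis using N2 nN xy by simp
    qed
    have r3: "\<bar>bern2 (n + 1) (n + 1) (\<lambda>i j. h * (h * (c (Suc i) (Suc j) - c i (Suc j)) - h * (c (Suc i) j
      - c i j))) x y - Fxy x y\<bar> \<le> 3 * \<epsilon>"
    proof -
      have "\<bar>h * (h * (c (Suc i) (Suc j) - c i (Suc j)) - h * (c (Suc i) j - c i j)) - Fxy (real i / real (n
        + 1)) (real j / real (n + 1))\<bar> \<le> \<epsilon>"
        if ij: "i \<le> n + 1" "j \<le> n + 1" for i j
      proof -
        let ?x = "real i / h" and ?y = "real j / h"
        have subx: "{?x..?x + e} \<subseteq> {0..1}" using grid[of i] grid[of "Suc i"] ij unfolding step by auto
        have suby: "{?y..?y + e} \<subseteq> {0..1}" using grid[of j] grid[of "Suc j"] ij unfolding step by auto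
        let ?G = "\<lambda>s. F s (?y + e) - F s ?y" and ?G' = "\<lambda>s. Fx s (?y + e) - Fx s ?y"
        have yy: "?y \<in> {0..1}" "?y + e \<in> {0..1}" using suby e0 by auto
        have G: "(?G has_real_derivative ?G' s) (at s within {0..1})" if s: "s \<in> {?x..?x + e}" for s
          using s subx yy by (intro DERIV_diff d(1)) auto
        obtain \<xi> where \<xi>: "\<xi> \<in> {?x..?x + e}" "?G (?x + e) - ?G ?x = e * ?G' \<xi>"
          using mvt_within[OF _ subx G] e0 by fastforce
        have \<xi>1: "\<xi> \<in> {0..1}" using \<xi>(1) subx by auto
        obtain \<zeta> where \<zeta>: "\<zeta> \<in> {?y..?y + e}" "Fx \<xi> (?y + e) - Fx \<xi> ?y = e * Fxy \<xi> \<zeta>"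
          using mvt_within[OF _ suby, of "\<lambda>s. Fx \<xi> s" "\<lambda>s. Fxy \<xi> s"] d(3)[OF \<xi>1] suby e0 by fastforce
        have "h * (h * (c (Suc i) (Suc j) - c i (Suc j)) - h * (c (Suc i) j - c i j)) = h * (h * (?G (?x
          + e) - ?G ?x))"
          unfolding c_def step by (simp add: algebra_simps)
        also have "\<dots> = (h * e) * ((h * e) * Fxy \<xi> \<zeta>)" unfolding \<xi>(2) \<zeta>(2) by simp
        finally have eq: "h * (h * (c (Suc i) (Suc j) - c i (Suc j)) - h * (c (Suc i) j - c i j)) = Fxy \<xi> \<zeta>"
          unfolding he by simp
        have "\<bar>Fxy \<xi> \<zeta> - Fxy (real i / real (n + 1)) (real j / real (n + 1))\<bar> \<le> \<epsilon> / 2"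
          using \<xi>(1) \<zeta>(1) subx suby g1[OF ij(1)] q1[OF ij(1)] g1[OF ij(2)] q1[OF ij(2)] e e0 \<delta>3(1)
            by (intro \<delta>3(2)) auto
        then show ?thesis unfolding eq using \<epsilon> by simp
      qed
      then show ?thesis using N3 nN xy by simp
    qed
    show "\<bar>bern2 (n + 2) (n + 2) (\<lambda>i j. F (real i / real (n + 2)) (real j / real (n + 2))) x y - F x y\<bar>
      \<le> 3 * \<epsilon> \<and>
       \<bar>bern2 (n + 1) (n + 2) (\<lambda>i j. real (n + 2) * (F (real (Suc i) / real (n + 2)) (real j / real (n + 2))
         - F (real i / real (n + 2)) (real j / real (n + 2)))) x y - Fx x y\<bar> \<le> 3 * \<epsilon> \<and>
       \<bar>bern2 n (n + 2) (\<lambda>i j. real (n + 1) * (real (n + 2) * (F (real (Suc (Suc i)) / real (n + 2)) (real j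
         / real (n + 2)) - F (real (Suc i) / real (n + 2)) (real j / real (n + 2)))
            - real (n + 2) * (F (real (Suc i) / real (n + 2)) (real j / real (n + 2)) - F (real i / real (n
              + 2)) (real j / real (n + 2))))) x y - Fxx x y\<bar> \<le> 3 * \<epsilon> \<and>
       \<bar>bern2 (n + 1) (n + 1) (\<lambda>i j. real (n + 2) * (real (n + 2) * (F (real (Suc i) / real (n
         + 2)) (real (Suc j) / real (n + 2)) - F (real i / real (n + 2)) (real (Suc j) / real (n + 2)))
            - real (n + 2) * (F (real (Suc i) / real (n + 2)) (real j / real (n + 2)) - F (real i / real (n
              + 2)) (real j / real (n + 2))))) x y - Fxy x y\<bar> \<le> 3 * \<epsilon>"
      using r0 r1 r2 r3 unfolding c_def h_def by blast
  qed
qed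

text \<open>The derivatives in \<open>y\<close> come from the same estimate for the transposed
  function; \<open>bern2_swap\<close> shows that both constructions give one polynomial once the
  degree is common.\<close>

lemma C2_square_poly_approx:
  assumes C2: "C2_square F Fx Fy Fxx Fxy Fyy" and \<epsilon>: "0 < \<epsilon>"
  shows "\<exists>q qx qy qxx qxy qyy. (\<forall>u v. is_poly2 u \<longrightarrow> is_poly2 v \<longrightarrow> is_poly2 (\<lambda>x y. q (u x y) (v x y))) \<and>
     (\<forall>x y. ((\<lambda>s. q s y) has_real_derivative qx x y) (at x) \<and> ((\<lambda>s. q x s) has_real_derivative qy x y) (at
       y) \<and>
        ((\<lambda>s. qx s y) has_real_derivative qxx x y) (at x) \<and> ((\<lambda>s. qx x s) has_real_derivative qxy x y) (at
          y) \<and>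
        ((\<lambda>s. qy x s) has_real_derivative qyy x y) (at y)) \<and>
     (\<forall>x\<in>{0..1}. \<forall>y\<in>{0..1}. \<bar>q x y - F x y\<bar> \<le> \<epsilon> \<and> \<bar>qx x y - Fx x y\<bar> \<le> \<epsilon> \<and> \<bar>qy x y - Fy x y\<bar> \<le> \<epsilon> \<and>
        \<bar>qxx x y - Fxx x y\<bar> \<le> \<epsilon> \<and> \<bar>qxy x y - Fxy x y\<bar> \<le> \<epsilon> \<and> \<bar>qyy x y - Fyy x y\<bar> \<le> \<epsilon>)"
proof -
  have \<epsilon>3: "0 < \<epsilon> / 3" "3 * (\<epsilon> / 3) = \<epsilon>" using \<epsilon> by simp_all
  obtain N where N: "\<And>n x y. N \<le> n \<Longrightarrow> x \<in> {0..1} \<Longrightarrow> y \<in> {0..1} \<Longrightarrow>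
     (let h = real (n + 2); c = (\<lambda>i j. F (real i / h) (real j / h)) in
       \<bar>bern2 (n + 2) (n + 2) c x y - F x y\<bar> \<le> 3 * (\<epsilon> / 3) \<and>
       \<bar>bern2 (n + 1) (n + 2) (\<lambda>i j. h * (c (Suc i) j - c i j)) x y - Fx x y\<bar> \<le> 3 * (\<epsilon> / 3) \<and>
       \<bar>bern2 n (n + 2) (\<lambda>i j. real (n + 1) * (h * (c (Suc (Suc i)) j - c (Suc i) j) - h * (c (Suc i) j
         - c i j))) x y - Fxx x y\<bar> \<le> 3 * (\<epsilon> / 3) \<and>
       \<bar>bern2 (n + 1) (n + 1) (\<lambda>i j. h * (h * (c (Suc i) (Suc j) - c i (Suc j)) - h * (c (Suc i) j
         - c i j))) x y - Fxy x y\<bar> \<le> 3 * (\<epsilon> / 3))"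
    using bern2_C2_approx_fst[OF C2 \<epsilon>3(1)] unfolding Let_def by blast
  obtain N' where N': "\<And>n x y. N' \<le> n \<Longrightarrow> x \<in> {0..1} \<Longrightarrow> y \<in> {0..1} \<Longrightarrow>
     (let h = real (n + 2); c = (\<lambda>i j. F (real j / h) (real i / h)) in
       \<bar>bern2 (n + 2) (n + 2) c x y - F y x\<bar> \<le> 3 * (\<epsilon> / 3) \<and>
       \<bar>bern2 (n + 1) (n + 2) (\<lambda>i j. h * (c (Suc i) j - c i j)) x y - Fy y x\<bar> \<le> 3 * (\<epsilon> / 3) \<and>
       \<bar>bern2 n (n + 2) (\<lambda>i j. real (n + 1) * (h * (c (Suc (Suc i)) j - c (Suc i) j) - h * (c (Suc i) j
         - c i j))) x y - Fyy y x\<bar> \<le> 3 * (\<epsilon> / 3) \<and>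
       \<bar>bern2 (n + 1) (n + 1) (\<lambda>i j. h * (h * (c (Suc i) (Suc j) - c i (Suc j)) - h * (c (Suc i) j
         - c i j))) x y - Fxy y x\<bar> \<le> 3 * (\<epsilon> / 3))"
    using bern2_C2_approx_fst[OF C2_square_swap[OF C2] \<epsilon>3(1)] unfolding Let_def by blast
  define n where "n = max N N'"
  define h where "h = real (n + 2)"
  define c where "c = (\<lambda>i j. F (real i / h) (real j / h))"
  define c' where "c' = (\<lambda>i j. c j i)"
  define q where "q = bern2 (n + 2) (n + 2) c"
  define qx where "qx = bern2 (n + 1) (n + 2) (\<lambda>i j. h * (c (Suc i) j - c i j))"
  define qxx where "qxx = bern2 n (n + 2) (\<lambda>i j. real (n + 1) * (h * (c (Suc (Suc i)) j - c (Suc i) j)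
    - h * (c (Suc i) j - c i j)))"
  define qxy where "qxy = bern2 (n + 1) (n + 1) (\<lambda>i j. h * (h * (c (Suc i) (Suc j) - c i (Suc j))
    - h * (c (Suc i) j - c i j)))"
  define ry where "ry = bern2 (n + 1) (n + 2) (\<lambda>i j. h * (c' (Suc i) j - c' i j))"
  define ryy where "ryy = bern2 n (n + 2) (\<lambda>i j. real (n + 1) * (h * (c' (Suc (Suc i)) j - c' (Suc i) j)
    - h * (c' (Suc i) j - c' i j)))"
  have S: "n + 2 = Suc (n + 1)" "n + 1 = Suc n" by simp_all
  have h: "real (Suc (n + 1)) = h" by (simp add: h_def)
  have q': "q = (\<lambda>x y. bern2 (n + 2) (n + 2) c' y x)" unfolding q_def c'_def by (intro ext) (rule bern2_swap)
  have d1: "((\<lambda>s. q s y) has_real_derivative qx x y) (at x)" for x y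
    using bern2_deriv_fst[of "n + 1" "n + 2" c y x] unfolding q_def qx_def h by (simp add: S(1)[symmetric])
  have d2: "((\<lambda>s. q x s) has_real_derivative ry y x) (at y)" for x y
    using bern2_deriv_fst[of "n + 1" "n + 2" c' x y] unfolding q' ry_def h by (simp add: S(1)[symmetric])
  have d3: "((\<lambda>s. qx s y) has_real_derivative qxx x y) (at x)" for x y
    using bern2_deriv_fst[of n "n + 2" "\<lambda>i j. h * (c (Suc i) j - c i j)" y x] unfolding qx_def qxx_def by simp
  have d4: "((\<lambda>s. qx x s) has_real_derivative qxy x y) (at y)" for x y
    using bern2_deriv_snd[of "n + 1" "n + 1" "\<lambda>i j. h * (c (Suc i) j - c i j)" x y]
      unfolding qx_def qxy_def h by (simp add: S(1)[symmetric])
  have d5: "((\<lambda>s. ry s x) has_real_derivative ryy y x) (at y)" for x y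
    using bern2_deriv_fst[of n "n + 2" "\<lambda>i j. h * (c' (Suc i) j - c' i j)" x y] unfolding ry_def ryy_def
      by simp
  have a: "\<bar>q x y - F x y\<bar> \<le> \<epsilon> \<and> \<bar>qx x y - Fx x y\<bar> \<le> \<epsilon> \<and> \<bar>qxx x y - Fxx x y\<bar> \<le> \<epsilon> \<and> \<bar>qxy x y - Fxy x y\<bar> \<le> \<epsilon>"
    if "x \<in> {0..1}" "y \<in> {0..1}" for x y
    using N[of n, OF _ that] unfolding Let_def \<epsilon>3(2) h_def[symmetric] q_def qx_def qxx_def qxy_def c_def
      by (simp add: n_def)
  have b: "\<bar>ry y x - Fy x y\<bar> \<le> \<epsilon> \<and> \<bar>ryy y x - Fyy x y\<bar> \<le> \<epsilon>"
    if "x \<in> {0..1}" "y \<in> {0..1}" for x y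
    using N'[of n, OF _ that(2,1)] unfolding Let_def \<epsilon>3(2) h_def[symmetric] ry_def ryy_def c'_def c_def
      by (simp add: n_def)
  have P: "is_poly2 (\<lambda>x y. q (u x y) (v x y))" if "is_poly2 u" "is_poly2 v" for u v
    unfolding q_def by (rule is_poly2_bern2[OF that])
  show ?thesis
    by (rule exI[of _ q], rule exI[of _ qx], rule exI[of _ "\<lambda>x y. ry y x"], rule exI[of _ qxx], rule exI[of
      _ qxy], rule exI[of _ "\<lambda>x y. ryy y x"])
       (use P d1 d2 d3 d4 d5 a b in blast)
qed

text \<open>\<open>C2_partials\<close> records continuity of the derivatives only. That of
  \<open>M\<close> follows because the existence of \<open>Mx\<close> and the continuity of
  \<open>My\<close> make \<open>M\<close> differentiable.\<close>

lemma C2_partials_continuous: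
  assumes "C2_partials I M Mx My Mxx Mxy Myy"
  shows "continuous_on (I \<times> {0..}) (\<lambda>(x, y). M x y)"
proof -
  have C: "continuous_on (I \<times> {0..}) (\<lambda>(x, y). My x y)" using assms unfolding C2_partials_def by blast
  have "continuous (at (x, y) within I \<times> {0..}) (\<lambda>(x, y). M x y)" if xy: "x \<in> I" "y \<in> {0..}" for x y
  proof -
    have "((\<lambda>(x, y). M x y) has_derivative (\<lambda>(tx, ty). Mx x y * tx + blinfun_apply (blinfun_scaleR_left (My
      x y)) ty)) (at (x, y) within I \<times> {0..})"
    proof (rule has_derivative_partialsI)
      show "((\<lambda>x. M x y) has_derivative (*) (Mx x y)) (at x within I)"
        using assms xy unfolding C2_partials_def has_field_derivative_def by auto
      show "((\<lambda>y. M x y) has_derivative blinfun_apply (blinfun_scaleR_left (My x y))) (at y within {0..})"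
        if "x \<in> I" "y \<in> {0..}" for x y
        using assms that unfolding C2_partials_def has_field_derivative_def
        by (auto simp: blinfun_scaleR_left.rep_eq mult.commute[of _ "My x y"])
      have "continuous (at (x, y) within I \<times> {0..}) (\<lambda>(x, y). My x y)"
        using C xy by (auto simp: continuous_on_eq_continuous_within)
      then have "continuous (at (x, y) within I \<times> {0..}) (\<lambda>z. blinfun_scaleR_left ((\<lambda>(x, y). My x y) z))"
        by (rule bounded_linear.continuous[OF bounded_linear_blinfun_scaleR_left])
      then show "continuous (at (x, y) within I \<times> {0..}) (\<lambda>(x, y). blinfun_scaleR_left (My x y))"
        by (simp add: case_prod_unfold)
    qed (use xy in auto)
    then show ?thesis by (rule has_derivative_continuous)
  qed
  then show ?thesis by (auto simp: continuous_on_eq_continuous_within)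
qed

lemma C2_partials_rescale:
  assumes C2: "C2_partials I M Mx My Mxx Mxy Myy" and I: "{a..b} \<subseteq> I" and "a < b" "0 < d"
  defines "w \<equiv> b - a"
  shows "C2_square (\<lambda>x y. M (a + w * x) (d * y)) (\<lambda>x y. w * Mx (a + w * x) (d * y)) (\<lambda>x y. d * My (a
    + w * x) (d * y))
     (\<lambda>x y. w * (w * Mxx (a + w * x) (d * y))) (\<lambda>x y. w * (d * Mxy (a + w * x) (d * y))) (\<lambda>x y. d * (d * Myy
       (a + w * x) (d * y)))"
proof -
  have w: "0 < w" using assms by simp
  have in_I: "a + w * x \<in> I" if "x \<in> {0..1}" for x
  proof -
    have "w * x \<le> w * 1" using that w by (intro mult_left_mono) auto
    moreover have "a + w = b" by (simp add: w_def)
    moreover have "0 \<le> w * x" using that w by simp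
    ultimately have "a + w * x \<in> {a..b}" unfolding atLeastAtMost_iff by linarith
    then show ?thesis using I by blast
  qed
  have in_d: "d * y \<in> {0..}" if "y \<in> {0..1}" for y using that assms(4) by simp
  have chx: "((\<lambda>s. G (a + w * s)) has_real_derivative w * D) (at x within {0..1})"
    if x: "x \<in> {0..1}" and D: "(G has_real_derivative D) (at (a + w * x) within I)" for G :: "real \<Rightarrow> real"
      and D x
  proof -
    have "(G has_real_derivative D) (at (a + w * x) within (\<lambda>s. a + w * s) ` {0..1})"
      by (rule has_field_derivative_subset[OF D]) (use in_I in auto)
    moreover have "((\<lambda>s. a + w * s) has_real_derivative w) (at x within {0..1})"
      by (auto intro!: derivative_eq_intros)
    ultimately show ?thesis
      using DERIV_image_chain[of G D "\<lambda>s. a + w * s" x "{0..1}" w] by (simp add: o_def mult.commute)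
  qed
  have chy: "((\<lambda>s. G (d * s)) has_real_derivative d * D) (at y within {0..1})"
    if y: "y \<in> {0..1}" and D: "(G has_real_derivative D) (at (d * y) within {0..})" for G :: "real \<Rightarrow> real"
      and D y
  proof -
    have "(G has_real_derivative D) (at (d * y) within (\<lambda>s. d * s) ` {0..1})"
      by (rule has_field_derivative_subset[OF D]) (use in_d in auto)
    moreover have "((\<lambda>s. d * s) has_real_derivative d) (at y within {0..1})"
      by (auto intro!: derivative_eq_intros)
    ultimately show ?thesis
      using DERIV_image_chain[of G D "\<lambda>s. d * s" y "{0..1}" d] by (simp add: o_def mult.commute)
  qed
  have cont: "continuous_on ({0..1} \<times> {0..1}) (\<lambda>(x, y). G (a + w * x) (d * y))"
    if G: "continuous_on (I \<times> {0..}) (\<lambda>(x, y). G x y)" for G :: "real \<Rightarrow> real \<Rightarrow> real"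
  proof -
    have "continuous_on ({0..1} \<times> {0..1}) (\<lambda>z. (\<lambda>(x, y). G x y) (a + w * fst z, d * snd z))"
      by (rule continuous_on_compose2[OF G]) (use in_I in_d in \<open>auto intro!: continuous_intros\<close>)
    then show ?thesis by (simp add: case_prod_unfold)
  qed
  have cs: "continuous_on S (\<lambda>(x, y). k * G x y)" if "continuous_on S (\<lambda>(x, y). G x y)" for k
    and G :: "real \<Rightarrow> real \<Rightarrow> real" and S
    using continuous_on_mult_left[OF that, of k] by (simp add: case_prod_unfold)
  have c: "continuous_on (I \<times> {0..}) (\<lambda>(x, y). M x y)" "continuous_on (I \<times> {0..}) (\<lambda>(x, y). Mx x y)"
    "continuous_on (I \<times> {0..}) (\<lambda>(x, y). My x y)"
    "continuous_on (I \<times> {0..}) (\<lambda>(x, y). Mxx x y)" "continuous_on (I \<times> {0..}) (\<lambda>(x, y). Mxy x y)"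
      "continuous_on (I \<times> {0..}) (\<lambda>(x, y). Myy x y)"
    using C2 C2_partials_continuous[OF C2] unfolding C2_partials_def by blast+
  show ?thesis
    unfolding C2_square_def
  proof (intro conjI ballI)
    fix x y :: real assume xy: "x \<in> {0..1}" "y \<in> {0..1}"
    have d: "((\<lambda>s. M s (d * y)) has_real_derivative Mx (a + w * x) (d * y)) (at (a + w * x) within I)"
        "((\<lambda>s. M (a + w * x) s) has_real_derivative My (a + w * x) (d * y)) (at (d * y) within {0..})"
        "((\<lambda>s. Mx s (d * y)) has_real_derivative Mxx (a + w * x) (d * y)) (at (a + w * x) within I)"
        "((\<lambda>s. Mx (a + w * x) s) has_real_derivative Mxy (a + w * x) (d * y)) (at (d * y) within {0..})"
        "((\<lambda>s. My s (d * y)) has_real_derivative Mxy (a + w * x) (d * y)) (at (a + w * x) within I)"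
        "((\<lambda>s. My (a + w * x) s) has_real_derivative Myy (a + w * x) (d * y)) (at (d * y) within {0..})"
      using C2 in_I[OF xy(1)] in_d[OF xy(2)] unfolding C2_partials_def by auto
    show "((\<lambda>s. M (a + w * s) (d * y)) has_real_derivative w * Mx (a + w * x) (d * y)) (at x within {0..1})"
      by (rule chx[OF xy(1) d(1)])
    show "((\<lambda>s. M (a + w * x) (d * s)) has_real_derivative d * My (a + w * x) (d * y)) (at y within {0..1})"
      by (rule chy[OF xy(2) d(2)])
    show "((\<lambda>s. w * Mx (a + w * s) (d * y)) has_real_derivative w * (w * Mxx (a + w * x) (d * y))) (at x
      within {0..1})"
      by (rule DERIV_cmult[OF chx[OF xy(1) d(3)]])
    show "((\<lambda>s. w * Mx (a + w * x) (d * s)) has_real_derivative w * (d * Mxy (a + w * x) (d * y))) (at y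
      within {0..1})"
      by (rule DERIV_cmult[OF chy[OF xy(2) d(4)]])
    show "((\<lambda>s. d * My (a + w * s) (d * y)) has_real_derivative w * (d * Mxy (a + w * x) (d * y))) (at x
      within {0..1})"
      using DERIV_cmult[OF chx[OF xy(1) d(5)], of d] by (simp add: mult.left_commute)
    show "((\<lambda>s. d * My (a + w * x) (d * s)) has_real_derivative d * (d * Myy (a + w * x) (d * y))) (at y
      within {0..1})"
      by (rule DERIV_cmult[OF chy[OF xy(2) d(6)]])
  qed (use cont[OF c(1)] cs[OF cont[OF c(2)], of w] cs[OF cont[OF c(3)], of d] cs[OF cs[OF cont[OF c(4)], of
    w], of w]
      cs[OF cs[OF cont[OF c(5)], of d], of w] cs[OF cs[OF cont[OF c(6)], of d], of d] in auto)
qed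

lemma C2_poly_approx:
  assumes C2: "C2_partials I M Mx My Mxx Mxy Myy" and I: "{a..b} \<subseteq> I" and ab: "a < b" and d: "0 < d"
    and \<epsilon>: "0 < \<epsilon>"
  shows "\<exists>p px py pxx pxy pyy. poly2 p px py pxx pxy pyy \<and>
     (\<forall>x\<in>{a..b}. \<forall>y\<in>{0..d}. \<bar>p x y - M x y\<bar> \<le> \<epsilon> \<and> \<bar>px x y - Mx x y\<bar> \<le> \<epsilon> \<and> \<bar>py x y - My x y\<bar> \<le> \<epsilon> \<and>
        \<bar>pxx x y - Mxx x y\<bar> \<le> \<epsilon> \<and> \<bar>pxy x y - Mxy x y\<bar> \<le> \<epsilon> \<and> \<bar>pyy x y - Myy x y\<bar> \<le> \<epsilon>)"
proof -
  define w where "w = b - a"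
  have w: "0 < w" using ab by (simp add: w_def)
  \<comment> \<open>Scaling back from the unit square divides the derivatives by \<open>w\<close>,
    \<open>d\<close>, \<open>w * w\<close>, \<open>w * d\<close> and \<open>d * d\<close>;
    \<open>k\<close> is at most each of these.\<close>
  define k where "k = min 1 (min w (min d (min (w * w) (min (w * d) (d * d)))))"
  have k: "0 < k" "k \<le> 1" "k \<le> w" "k \<le> d" "k \<le> w * w" "k \<le> w * d" "k \<le> d * d" using w d by (auto simp: k_def)
  have \<epsilon>k: "0 < \<epsilon> * k" using \<epsilon> k by simp
  obtain q qx qy qxx qxy qyy where
    P: "\<And>u v. is_poly2 u \<Longrightarrow> is_poly2 v \<Longrightarrow> is_poly2 (\<lambda>x y. q (u x y) (v x y))" and
    D: "\<And>x y. ((\<lambda>s. q s y) has_real_derivative qx x y) (at x)" "\<And>x y. ((\<lambda>s. q x s) has_real_derivative qy x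
      y) (at y)"
        "\<And>x y. ((\<lambda>s. qx s y) has_real_derivative qxx x y) (at x)" "\<And>x y. ((\<lambda>s. qx x s) has_real_derivative
          qxy x y) (at y)"
        "\<And>x y. ((\<lambda>s. qy x s) has_real_derivative qyy x y) (at y)" and
    E: "\<And>x y. x \<in> {0..1} \<Longrightarrow> y \<in> {0..1} \<Longrightarrow> \<bar>q x y - M (a + w * x) (d * y)\<bar> \<le> \<epsilon> * k \<and> \<bar>qx x y - w * Mx (a
      + w * x) (d * y)\<bar> \<le> \<epsilon> * k \<and>
        \<bar>qy x y - d * My (a + w * x) (d * y)\<bar> \<le> \<epsilon> * k \<and> \<bar>qxx x y - w * (w * Mxx (a + w * x) (d * y))\<bar>
          \<le> \<epsilon> * k \<and>
        \<bar>qxy x y - w * (d * Mxy (a + w * x) (d * y))\<bar> \<le> \<epsilon> * k \<and> \<bar>qyy x y - d * (d * Myy (a + w * x) (d *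
          y))\<bar> \<le> \<epsilon> * k"
    using C2_square_poly_approx[OF C2_partials_rescale[OF C2 I ab d] \<epsilon>k] unfolding w_def[symmetric] by blast
  define u where "u x = 1 / w * x + - a / w" for x
  define v where "v y = 1 / d * y" for y
  have "is_poly2 (\<lambda>x y. u x)" "is_poly2 (\<lambda>x y. v y)" unfolding u_def v_def by (intro is_poly2_intros)+
  from P[OF this] obtain px py pxx pxy pyy where p: "poly2 (\<lambda>x y. q (u x) (v y)) px py pxx pxy pyy"
    unfolding is_poly2_def by blast
  have du: "((\<lambda>s. G (u s)) has_real_derivative 1 / w * D) (at x)" if "(G has_real_derivative D) (at (u x))"
    for G D x
  proof -
    have "(u has_real_derivative 1 / w) (at x)" unfolding u_def using w by (auto intro!: derivative_eq_intros)
    from DERIV_chain2[OF that this] show ?thesis by (simp add: mult.commute)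
  qed
  have dv: "((\<lambda>s. G (v s)) has_real_derivative 1 / d * D) (at y)" if "(G has_real_derivative D) (at (v y))"
    for G D y
  proof -
    have "(v has_real_derivative 1 / d) (at y)" unfolding v_def using d by (auto intro!: derivative_eq_intros)
    from DERIV_chain2[OF that this] show ?thesis by (simp add: mult.commute)
  qed
  note pd = poly2_derivs[OF p]
  \<comment> \<open>\<open>poly2\<close> provides some derivatives; uniqueness identifies them with
    the rescaled ones of \<open>q\<close>.\<close>
  have px: "px x y = 1 / w * qx (u x) (v y)" for x y
    using DERIV_unique[OF _ du[OF D(1)]] pd by blast
  have py: "py x y = 1 / d * qy (u x) (v y)" for x y
    using DERIV_unique[OF _ dv[OF D(2)]] pd by blast
  have pxx: "pxx x y = 1 / w * (1 / w * qxx (u x) (v y))" for x y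
    using DERIV_unique[OF _ DERIV_cmult[OF du[OF D(3)], of "1 / w"]] pd[of y x] unfolding px by blast
  have pxy: "pxy x y = 1 / w * (1 / d * qxy (u x) (v y))" for x y
    using DERIV_unique[OF _ DERIV_cmult[OF dv[OF D(4)], of "1 / w"]] pd[of y x] unfolding px by blast
  have pyy: "pyy x y = 1 / d * (1 / d * qyy (u x) (v y))" for x y
    using DERIV_unique[OF _ DERIV_cmult[OF dv[OF D(5)], of "1 / d"]] pd[of y x] unfolding py by blast
  have scale: "\<bar>1 / c * X - Y\<bar> \<le> \<epsilon>" if "\<bar>X - c * Y\<bar> \<le> \<epsilon> * k" "k \<le> c" "0 < c" for X Y c :: real
  proof -
    have "\<bar>1 / c * X - Y\<bar> = 1 / c * \<bar>X - c * Y\<bar>"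
    proof -
      have "1 / c * X - Y = 1 / c * (X - c * Y)" using that(3) by (simp add: right_diff_distrib)
      then show ?thesis using that(3) by (simp only: abs_mult) simp
    qed
    also have "\<dots> \<le> 1 / c * (\<epsilon> * c)" using that(1-3) \<epsilon> by (intro mult_left_mono order_trans[OF that(1)]) auto
    finally show ?thesis using that(3) by simp
  qed
  show ?thesis
  proof (intro exI conjI ballI)
    show "poly2 (\<lambda>x y. q (u x) (v y)) px py pxx pxy pyy" by (rule p)
    fix x y assume xy: "x \<in> {a..b}" "y \<in> {0..d}"
    have u1: "u x \<in> {0..1}" using xy w by (auto simp: u_def w_def diff_divide_distrib[symmetric])
    have v1: "v y \<in> {0..1}" using xy d by (auto simp: v_def)
    have e: "a + w * u x = x" "d * v y = y" using w d
      by (simp_all add: u_def v_def distrib_left right_diff_distrib)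
    note E = E[OF u1 v1, unfolded e]
    show "\<bar>q (u x) (v y) - M x y\<bar> \<le> \<epsilon>" using scale[of _ 1 "M x y"] E k(2) by simp
    show "\<bar>px x y - Mx x y\<bar> \<le> \<epsilon>" unfolding px using E k(3) w by (intro scale) auto
    show "\<bar>py x y - My x y\<bar> \<le> \<epsilon>" unfolding py using E k(4) d by (intro scale) auto
    show "\<bar>pxx x y - Mxx x y\<bar> \<le> \<epsilon>" unfolding pxx
      using scale[of "qxx (u x) (v y)" "w * w" "Mxx x y"] E k(5) w by (simp add: mult.assoc)
    show "\<bar>pxy x y - Mxy x y\<bar> \<le> \<epsilon>" unfolding pxy
      using scale[of "qxy (u x) (v y)" "w * d" "Mxy x y"] E k(6) w d by (simp add: mult.assoc)
    show "\<bar>pyy x y - Myy x y\<bar> \<le> \<epsilon>" unfolding pyy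
      using scale[of "qyy (u x) (v y)" "d * d" "Myy x y"] E k(7) d by (simp add: mult.assoc)
  qed
qed

subsection \<open>Monotonicity along the semigroup\<close>

context prob_space
begin

lemma poly2_ess_bdd:
  assumes "poly2 p px py pxx pxy pyy" and a: "ess_bdd a" and b: "ess_bdd b"
  shows "ess_bdd (\<lambda>z. p (a z) (b z)) \<and> ess_bdd (\<lambda>z. px (a z) (b z)) \<and> ess_bdd (\<lambda>z. py (a z) (b z)) \<and>
    ess_bdd (\<lambda>z. pxx (a z) (b z)) \<and> ess_bdd (\<lambda>z. pxy (a z) (b z)) \<and> ess_bdd (\<lambda>z. pyy (a z) (b z))"
  using assms(1) by induction (auto intro!: ess_bdd_intros a b)

text \<open>The uniform bound is part of the induction, because \<open>L1_deriv_mult\<close> asks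
  for one on its first factor.\<close>

lemma poly2_curve:
  assumes p: "poly2 p px py pxx pxy pyy" and s: "s \<in> T"
    and a: "L1_deriv T a a' s" "\<And>r. r \<in> T \<Longrightarrow> ess_bdd (a r)" "ess_bdd a'" "\<And>r. r \<in> T \<Longrightarrow> AE z in M. \<bar>a r z\<bar> \<le> K"
    and b: "L1_deriv T b b' s" "\<And>r. r \<in> T \<Longrightarrow> ess_bdd (b r)" "ess_bdd b'" "\<And>r. r \<in> T \<Longrightarrow> AE z in M. \<bar>b r z\<bar> \<le> K"
  shows "L1_deriv T (\<lambda>r z. p (a r z) (b r z)) (\<lambda>z. px (a s z) (b s z) * a' z + py (a s z) (b s z) * b' z) s
    \<and> (\<exists>K. \<forall>r\<in>T. AE z in M. \<bar>p (a r z) (b r z)\<bar> \<le> K)"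
  using p
proof induction
  case (const c)
  have "\<forall>r\<in>T. AE z in M. \<bar>c\<bar> \<le> \<bar>c\<bar>" by simp
  then show ?case using L1_deriv_const by auto
next
  case fst
  show ?case using a(1,4) by auto
next
  case snd
  show ?case using b(1,4) by auto
next
  case (add p px py pxx pxy pyy q qx qy qxx qxy qyy)
  let ?p' = "\<lambda>z. px (a s z) (b s z) * a' z + py (a s z) (b s z) * b' z"
    and ?q' = "\<lambda>z. qx (a s z) (b s z) * a' z + qy (a s z) (b s z) * b' z"
  note ep = poly2_ess_bdd[OF add.hyps(1) a(2) b(2)] and eq = poly2_ess_bdd[OF add.hyps(2) a(2) b(2)]
  have e': "ess_bdd ?p'" "ess_bdd ?q'" using ep[OF s s] eq[OF s s] a(3) b(3) by (auto intro!: ess_bdd_intros)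
  have "L1_deriv T (\<lambda>r z. p (a r z) (b r z) + q (a r z) (b r z)) (\<lambda>z. ?p' z + ?q' z) s"
    by (rule L1_deriv_add[OF conjunct1[OF add.IH(1)] conjunct1[OF add.IH(2)] s]) (use ep eq e' in \<open>auto
      intro: ess_bdd_integrable\<close>)
  moreover have "\<exists>K. \<forall>r\<in>T. AE z in M. \<bar>p (a r z) (b r z) + q (a r z) (b r z)\<bar> \<le> K"
  proof -
    obtain K1 K2 where K: "\<forall>r\<in>T. AE z in M. \<bar>p (a r z) (b r z)\<bar> \<le> K1" "\<forall>r\<in>T. AE z in M. \<bar>q (a r z) (b r z)\<bar>
      \<le> K2"
      using add.IH by blast
    have "AE z in M. \<bar>p (a r z) (b r z) + q (a r z) (b r z)\<bar> \<le> K1 + K2" if "r \<in> T" for r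
      using bspec[OF K(1) that] bspec[OF K(2) that] by eventually_elim linarith
    then show ?thesis by blast
  qed
  ultimately show ?case by (simp add: algebra_simps)
next
  case (mult p px py pxx pxy pyy q qx qy qxx qxy qyy)
  let ?p' = "\<lambda>z. px (a s z) (b s z) * a' z + py (a s z) (b s z) * b' z"
    and ?q' = "\<lambda>z. qx (a s z) (b s z) * a' z + qy (a s z) (b s z) * b' z"
  note ep = poly2_ess_bdd[OF mult.hyps(1) a(2) b(2)] and eq = poly2_ess_bdd[OF mult.hyps(2) a(2) b(2)]
  have e': "ess_bdd ?p'" "ess_bdd ?q'" using ep[OF s s] eq[OF s s] a(3) b(3) by (auto intro!: ess_bdd_intros)
  obtain K1 K2 where K: "\<forall>r\<in>T. AE z in M. \<bar>p (a r z) (b r z)\<bar> \<le> K1" "\<forall>r\<in>T. AE z in M. \<bar>q (a r z) (b r z)\<bar>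
    \<le> K2"
    using mult.IH by blast
  have "L1_deriv T (\<lambda>r z. p (a r z) (b r z) * q (a r z) (b r z)) (\<lambda>z. ?p' z * q (a s z) (b s z)
    + p (a s z) (b s z) * ?q' z) s"
    by (rule L1_deriv_mult[OF conjunct1[OF mult.IH(1)] conjunct1[OF mult.IH(2)] s _ _ e' bspec[OF K(1)]])
      (use ep eq in auto)
  moreover have "(\<lambda>z. ?p' z * q (a s z) (b s z) + p (a s z) (b s z) * ?q' z) =
     (\<lambda>z. (px (a s z) (b s z) * q (a s z) (b s z) + p (a s z) (b s z) * qx (a s z) (b s z)) * a' z +
        (py (a s z) (b s z) * q (a s z) (b s z) + p (a s z) (b s z) * qy (a s z) (b s z)) * b' z)"
    by (simp add: algebra_simps)
  moreover have "\<exists>K. \<forall>r\<in>T. AE z in M. \<bar>p (a r z) (b r z) * q (a r z) (b r z)\<bar> \<le> K"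
  proof -
    have "AE z in M. \<bar>p (a r z) (b r z) * q (a r z) (b r z)\<bar> \<le> K1 * K2" if "r \<in> T" for r
      using bspec[OF K(1) that] bspec[OF K(2) that]
    proof eventually_elim
      case (elim z)
      then show ?case unfolding abs_mult by (intro mult_mono) auto
    qed
    then show ?thesis by blast
  qed
  ultimately show ?case by simp
qed

end

context markov_triple
begin

lemma poly2_calculus:
  assumes p: "poly2 p px py pxx pxy pyy" and u: "u \<in> A" and v: "v \<in> A"
  shows "(\<lambda>z. p (u z) (v z)) \<in> A \<and>
    (\<forall>h\<in>A. AE z in \<mu>. \<Gamma> (\<lambda>z. p (u z) (v z)) h z = px (u z) (v z) * \<Gamma> u h z + py (u z) (v z) * \<Gamma> v h z) \<and>
    (AE z in \<mu>. L (\<lambda>z. p (u z) (v z)) z = px (u z) (v z) * L u z + py (u z) (v z) * L v z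
       + pxx (u z) (v z) * \<Gamma> u u z + 2 * pxy (u z) (v z) * \<Gamma> u v z + pyy (u z) (v z) * \<Gamma> v v z)"
  using p
proof induction
  case (const c)
  then show ?case using A_const \<Gamma>_const L_const by simp
next
  case (add p px py pxx pxy pyy q qx qy qxx qxy qyy)
  let ?p = "\<lambda>z. p (u z) (v z)" and ?q = "\<lambda>z. q (u z) (v z)"
  have pq: "?p \<in> A" "?q \<in> A" using add.IH by blast+
  show ?case
  proof (intro conjI ballI)
    show "(\<lambda>z. ?p z + ?q z) \<in> A" by (rule A_add[OF pq])
    fix h assume h: "h \<in> A"
    from add.IH h have "AE z in \<mu>. \<Gamma> ?p h z = px (u z) (v z) * \<Gamma> u h z + py (u z) (v z) * \<Gamma> v h z"
      "AE z in \<mu>. \<Gamma> ?q h z = qx (u z) (v z) * \<Gamma> u h z + qy (u z) (v z) * \<Gamma> v h z" by blast+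
    with \<Gamma>_add[OF pq h] show "AE z in \<mu>. \<Gamma> (\<lambda>z. ?p z + ?q z) h z =
        (px (u z) (v z) + qx (u z) (v z)) * \<Gamma> u h z + (py (u z) (v z) + qy (u z) (v z)) * \<Gamma> v h z"
      by eventually_elim (simp add: algebra_simps)
  next
    show "AE z in \<mu>. L (\<lambda>z. ?p z + ?q z) z = (px (u z) (v z) + qx (u z) (v z)) * L u z + (py (u z) (v z)
      + qy (u z) (v z)) * L v z
       + (pxx (u z) (v z) + qxx (u z) (v z)) * \<Gamma> u u z + 2 * (pxy (u z) (v z) + qxy (u z) (v z)) * \<Gamma> u v z
         + (pyy (u z) (v z) + qyy (u z) (v z)) * \<Gamma> v v z"
      using L_add[OF pq] conjunct2[OF conjunct2[OF add.IH(1)]] conjunct2[OF conjunct2[OF add.IH(2)]]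
      by eventually_elim (simp add: algebra_simps)
  qed
next
  case (mult p px py pxx pxy pyy q qx qy qxx qxy qyy)
  let ?p = "\<lambda>z. p (u z) (v z)" and ?q = "\<lambda>z. q (u z) (v z)"
  have pq: "?p \<in> A" "?q \<in> A" using mult.IH by blast+
  have \<Gamma>p: "AE z in \<mu>. \<Gamma> ?p h z = px (u z) (v z) * \<Gamma> u h z + py (u z) (v z) * \<Gamma> v h z" if "h \<in> A" for h
    using mult.IH that by blast
  have \<Gamma>q: "AE z in \<mu>. \<Gamma> ?q h z = qx (u z) (v z) * \<Gamma> u h z + qy (u z) (v z) * \<Gamma> v h z" if "h \<in> A" for h
    using mult.IH that by blast
  show ?case
  proof (intro conjI ballI)
    show "(\<lambda>z. ?p z * ?q z) \<in> A" by (rule A_mult[OF pq])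
    fix h assume h: "h \<in> A"
    show "AE z in \<mu>. \<Gamma> (\<lambda>z. ?p z * ?q z) h z =
        (px (u z) (v z) * ?q z + ?p z * qx (u z) (v z)) * \<Gamma> u h z + (py (u z) (v z) * ?q z + ?p z * qy (u z)
          (v z)) * \<Gamma> v h z"
      using \<Gamma>_mult[OF pq h] \<Gamma>p[OF h] \<Gamma>q[OF h] by eventually_elim (simp add: algebra_simps)
  next
    show "AE z in \<mu>. L (\<lambda>z. ?p z * ?q z) z = (px (u z) (v z) * ?q z + ?p z * qx (u z) (v z)) * L u z
      + (py (u z) (v z) * ?q z + ?p z * qy (u z) (v z)) * L v z
       + (pxx (u z) (v z) * ?q z + 2 * px (u z) (v z) * qx (u z) (v z) + ?p z * qxx (u z) (v z)) * \<Gamma> u u z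
       + 2 * (pxy (u z) (v z) * ?q z + px (u z) (v z) * qy (u z) (v z) + py (u z) (v z) * qx (u z) (v z)
         + ?p z * qxy (u z) (v z)) * \<Gamma> u v z
       + (pyy (u z) (v z) * ?q z + 2 * py (u z) (v z) * qy (u z) (v z) + ?p z * qyy (u z) (v z)) * \<Gamma> v v z"
      using L_mult[OF pq] conjunct2[OF conjunct2[OF mult.IH(1)]] conjunct2[OF conjunct2[OF mult.IH(2)]]
        \<Gamma>p[OF pq(2)] \<Gamma>q[OF u] \<Gamma>q[OF v]
        \<Gamma>_sym[OF u pq(2)] \<Gamma>_sym[OF v pq(2)] \<Gamma>_sym[OF u v]
    proof eventually_elim
      case (elim z)
      show ?case unfolding elim(1) unfolding elim(2,3,4) unfolding elim(7,8) unfolding elim(5,6)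
        unfolding elim(9)
        by (simp add: algebra_simps)
    qed
  qed
qed (use u v in auto)

text \<open>The derivative of \<open>P r g\<close> contributes \<open>P s (L g) = L (P s g)\<close>,
  and symmetry moves \<open>L\<close> to \<open>\<phi> s\<close>. Membership in \<open>A\<close> is
  asked of \<open>\<phi> s\<close> alone; the neighbouring values are bounded functions.\<close>

lemma dual_curve:
  assumes g: "g \<in> A" and s: "s \<in> {0..t}" and \<phi>: "L1_deriv {0..t} \<phi> \<phi>' s" "\<And>r. r \<in> {0..t} \<Longrightarrow> ess_bdd (\<phi> r)"
    "ess_bdd \<phi>'" "\<phi> s \<in> A"
  shows "((\<lambda>r. \<integral>z. P r g z * \<phi> r z \<partial>\<mu>) has_real_derivative (\<integral>z. P s g z * (L (\<phi> s) z + \<phi>' z) \<partial>\<mu>)) (at s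
    within {0..t})"
proof -
  obtain K where K: "AE z in \<mu>. \<bar>g z\<bar> \<le> K" using A_ess_bdd[OF g] by (rule ess_bddE)
  have s0: "0 \<le> s" using s by simp
  have m: "P s g \<in> A" "P s (L g) \<in> A" using g s0 by (auto intro: P_closed L_closed)
  have 1: "L1_deriv {0..t} (\<lambda>r. P r g) (P s (L g)) s"
    by (rule L1_deriv_subset[OF P_curve_L1[OF g s0]]) auto
  have 2: "L1_deriv {0..t} (\<lambda>r z. P r g z * \<phi> r z) (\<lambda>z. P s (L g) z * \<phi> s z + P s g z * \<phi>' z) s"
    by (rule L1_deriv_mult[OF 1 \<phi>(1) s])
       (use \<phi> s g m in \<open>auto intro: A_ess_bdd P_closed P_abs_bound[OF _ _ K] A_square_int\<close>)
  have "((\<lambda>r. \<integral>z. P r g z * \<phi> r z \<partial>\<mu>) has_real_derivative (\<integral>z. P s (L g) z * \<phi> s z + P s g z * \<phi>' z \<partial>\<mu>)) (at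
    s within {0..t})"
    by (rule L1_deriv_integral[OF 2 s])
       (use \<phi> m g s in \<open>auto intro!: ess_bdd_integrable ess_bdd_add ess_bdd_mult intro: A_ess_bdd P_closed\<close>)
  also have "(\<integral>z. P s (L g) z * \<phi> s z + P s g z * \<phi>' z \<partial>\<mu>) = (\<integral>z. P s (L g) z * \<phi> s z \<partial>\<mu>) + (\<integral>z. P s g z *
    \<phi>' z \<partial>\<mu>)"
    by (intro Bochner_Integration.integral_add ess_bdd_integrable ess_bdd_mult A_ess_bdd m \<phi>)
  also have "(\<integral>z. P s (L g) z * \<phi> s z \<partial>\<mu>) = (\<integral>z. \<phi> s z * L (P s g) z \<partial>\<mu>)"
  proof (rule integral_cong_AE)
    show "AE z in \<mu>. P s (L g) z * \<phi> s z = \<phi> s z * L (P s g) z" using L_P[OF g s0] by eventually_elim simp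
  qed (use m \<phi> in \<open>auto intro!: A_measurable A_mult L_closed\<close>)
  also have "\<dots> = (\<integral>z. P s g z * L (\<phi> s) z \<partial>\<mu>)" by (rule L_symmetric[OF m(1) \<phi>(4)])
  also have "(\<integral>z. P s g z * L (\<phi> s) z \<partial>\<mu>) + (\<integral>z. P s g z * \<phi>' z \<partial>\<mu>) = (\<integral>z. P s g z * (L (\<phi> s) z + \<phi>' z) \<partial>\<mu>)"
    unfolding distrib_left
    by (intro Bochner_Integration.integral_add[symmetric] ess_bdd_integrable ess_bdd_mult A_ess_bdd m \<phi>
      L_closed)
  finally show ?thesis .
qed

lemma P_curve_reverse:
  assumes "f \<in> A" "s \<in> {0..t}" shows "L1_deriv {0..t} (\<lambda>r. P (t - r) f) (\<lambda>z. - P (t - s) (L f) z) s"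
  by (rule L1_deriv_reflect[OF P_curve_L1]) (use assms in auto)

lemma \<Gamma>_curve_reverse:
  assumes f: "f \<in> A" and s: "s \<in> {0..t}"
    and h: "(h has_real_derivative h') (at s within {0..t})" "\<And>r. r \<in> {0..t} \<Longrightarrow> \<bar>h r\<bar> \<le> K"
  shows "L1_deriv {0..t} (\<lambda>r z. h r * \<Gamma> (P (t - r) f) (P (t - r) f) z)
    (\<lambda>z. h' * \<Gamma> (P (t - s) f) (P (t - s) f) z + h s * - (2 * \<Gamma> (P (t - s) f) (P (t - s) (L f)) z)) s"
proof -
  have 1: "L1_deriv {0..t} (\<lambda>r. \<Gamma> (P (t - r) f) (P (t - r) f)) (\<lambda>z. - (2 * \<Gamma> (P (t - s) f) (P (t
    - s) (L f)) z)) s"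
    using L1_deriv_reflect[OF \<Gamma>_curve[OF f, of "t - s"], of] s by auto
  have m: "\<Gamma> (P (t - r) f) (P (t - r) f) \<in> A" "\<Gamma> (P (t - r) f) (P (t - r) (L f)) \<in> A" if "r \<in> {0..t}" for r
    using f that by (auto intro!: \<Gamma>_closed P_closed L_closed)
  \<comment> \<open>The scalar \<open>h\<close> is taken as the first factor, the one that needs a
    uniform bound.\<close>
  show ?thesis
    by (rule L1_deriv_mult[OF L1_deriv_scalar[OF h(1)] 1 s])
       (use ess_bdd_uminus[OF ess_bdd_mult[OF ess_bdd_const A_ess_bdd[OF m(2)[OF s]]]] A_ess_bdd[OF m(1)] h(2)
         in \<open>auto intro: ess_bdd_const\<close>)
qed

text \<open>The argument for \<open>H\<close> in the simplest case, \<open>M x y = y\<close> with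
  weight \<open>exp (- 2 * \<rho> * s)\<close>: the derivative reduces to a positive multiple of
  \<open>Gamma2 \<Gamma> L u u - \<rho> * \<Gamma> u u\<close>, so no reinforced condition enters.
  The bound confines the arguments of \<open>M\<close> to a fixed rectangle at all times.\<close>

lemma gradient_bound:
  assumes CD: "\<forall>f\<in>A. AE z in \<mu>. \<rho> * \<Gamma> f f z \<le> Gamma2 \<Gamma> L f f z"
    and f: "f \<in> A" and t: "0 \<le> t" and c: "AE z in \<mu>. \<Gamma> f f z \<le> c"
  shows "AE z in \<mu>. \<Gamma> (P t f) (P t f) z \<le> exp (- 2 * \<rho> * t) * c"
proof -
  let ?u = "\<lambda>s. P (t - s) f"
  let ?\<phi> = "\<lambda>r z. exp (- 2 * \<rho> * r) * \<Gamma> (?u r) (?u r) z"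
  have uA: "?u r \<in> A" "\<Gamma> (?u r) (?u r) \<in> A" "?\<phi> r \<in> A" "P (t - r) (L f) \<in> A" if "r \<in> {0..t}" for r
    using f that by (auto intro!: \<Gamma>_closed P_closed L_closed A_scale)
  have main: "0 \<le> (\<integral>z. (k z * k z) * (exp (- 2 * \<rho> * t) * c - \<Gamma> (P t f) (P t f) z) \<partial>\<mu>)" if k: "k \<in> A" for k
  proof -
    let ?g = "\<lambda>z. k z * k z"
    have g: "?g \<in> A" by (rule A_mult[OF k k])
    let ?J = "\<lambda>s. \<integral>z. P s ?g z * ?\<phi> s z \<partial>\<mu>"
    let ?\<phi>' = "\<lambda>s z. (- 2 * \<rho> * exp (- 2 * \<rho> * s)) * \<Gamma> (?u s) (?u s) z + exp (- 2 * \<rho> * s) * - (2 * \<Gamma> (?u s)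
      (P (t - s) (L f)) z)"
    have J: "(?J has_real_derivative (\<integral>z. P s ?g z * (L (?\<phi> s) z + ?\<phi>' s z) \<partial>\<mu>)) (at s within {0..t})"
      if s: "s \<in> {0..t}" for s
    proof (rule dual_curve[OF g s])
      have h: "((\<lambda>r. exp (- 2 * \<rho> * r)) has_real_derivative - 2 * \<rho> * exp (- 2 * \<rho> * s)) (at s within {0..t})"
        by (auto intro!: derivative_eq_intros)
      have hb: "\<bar>exp (- 2 * \<rho> * r)\<bar> \<le> exp (2 * \<bar>\<rho>\<bar> * t)" if "r \<in> {0..t}" for r
      proof -
        have "- \<rho> * r \<le> \<bar>\<rho>\<bar> * r" using that by (intro mult_right_mono) auto
        also have "\<dots> \<le> \<bar>\<rho>\<bar> * t" using that by (intro mult_left_mono) auto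
        finally show ?thesis by (simp add: mult.commute)
      qed
      show "L1_deriv {0..t} ?\<phi> (?\<phi>' s) s" by (rule \<Gamma>_curve_reverse[OF f s h hb])
      show "ess_bdd (?\<phi>' s)" using uA[OF s] by (intro ess_bdd_intros A_ess_bdd \<Gamma>_closed) auto
    qed (use uA s in \<open>auto intro: A_ess_bdd\<close>)
    have "?J 0 \<le> ?J t"
    proof (rule DERIV_nonneg_imp_increasing_open[OF t])
      show "continuous_on {0..t} ?J" by (rule DERIV_continuous_on[OF J])
      fix s assume s: "0 < s" "s < t"
      then have sT: "s \<in> {0..t}" by simp
      have "at s within {0..t} = at s" using s by (simp add: at_within_Icc_at)
      then have "(?J has_real_derivative (\<integral>z. P s ?g z * (L (?\<phi> s) z + ?\<phi>' s z) \<partial>\<mu>)) (at s)" using J[OF sT]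
        by simp
      moreover have "0 \<le> (\<integral>z. P s ?g z * (L (?\<phi> s) z + ?\<phi>' s z) \<partial>\<mu>)"
      proof (rule integral_nonneg_AE)
        have g0: "AE z in \<mu>. 0 \<le> P s ?g z" by (rule P_positive) (use s g A_square_int in auto)
        have "AE z in \<mu>. \<Gamma> (?u s) (P (t - s) (L f)) z = \<Gamma> (?u s) (L (?u s)) z"
          by (rule \<Gamma>_cong[OF uA(1)[OF sT] uA(1)[OF sT] uA(4)[OF sT] L_closed[OF uA(1)[OF sT]]]) (use L_P[OF
            f, of "t - s"] s in \<open>auto elim: eventually_mono\<close>)
        with g0 L_scale[OF uA(2)[OF sT], of "exp (- 2 * \<rho> * s)"] Gamma2_eq[OF uA(1)[OF sT]] bspec[OF CD
          uA(1)[OF sT]]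
        show "AE z in \<mu>. 0 \<le> P s ?g z * (L (?\<phi> s) z + ?\<phi>' s z)"
        proof eventually_elim
          case (elim z)
          have "L (?\<phi> s) z + ?\<phi>' s z = 2 * exp (- 2 * \<rho> * s) * (Gamma2 \<Gamma> L (?u s) (?u s) z - \<rho> * \<Gamma> (?u s)
            (?u s) z)"
            unfolding elim(2,3,5) by (simp add: algebra_simps)
          then show ?case using elim(1,4) by simp
        qed
      qed
      ultimately show "\<exists>y. (?J has_real_derivative y) (at s) \<and> 0 \<le> y" by blast
    qed
    moreover have "?J 0 = (\<integral>z. ?g z * \<Gamma> (P t f) (P t f) z \<partial>\<mu>)"
    proof (rule integral_cong_AE)
      show "AE z in \<mu>. P 0 ?g z * ?\<phi> 0 z = ?g z * \<Gamma> (P t f) (P t f) z"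
        using P_zero[OF A_square_int[OF g]] by eventually_elim simp
      show "(\<lambda>z. P 0 ?g z * ?\<phi> 0 z) \<in> borel_measurable \<mu>"
        using A_measurable[OF A_mult[OF P_closed[OF order_refl g] uA(3)[of 0]]] t by simp
      show "(\<lambda>z. ?g z * \<Gamma> (P t f) (P t f) z) \<in> borel_measurable \<mu>"
        using A_measurable[OF A_mult[OF g uA(2)[of 0]]] t by simp
    qed
    moreover have "?J t \<le> (\<integral>z. exp (- 2 * \<rho> * t) * c * P t ?g z \<partial>\<mu>)"
    proof (rule integral_mono_AE)
      have g0: "AE z in \<mu>. 0 \<le> P t ?g z" by (rule P_positive) (use t g A_square_int in auto)
      have "AE z in \<mu>. \<Gamma> (P (t - t) f) (P (t - t) f) z = \<Gamma> f f z"
        by (rule \<Gamma>_cong) (use P_zero[OF A_square_int[OF f]] P_closed[OF _ f, of 0] f in auto)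
      with g0 c show "AE z in \<mu>. P t ?g z * ?\<phi> t z \<le> exp (- 2 * \<rho> * t) * c * P t ?g z"
      proof eventually_elim
        case (elim z)
        have "P t ?g z * (exp (- 2 * \<rho> * t) * \<Gamma> f f z) \<le> P t ?g z * (exp (- 2 * \<rho> * t) * c)"
          using elim by (intro mult_left_mono) auto
        then show ?case unfolding elim(3) by (simp add: mult_ac)
      qed
      show "integrable \<mu> (\<lambda>z. P t ?g z * ?\<phi> t z)" using integrable_A[OF A_mult[OF P_closed[OF t g] uA(3)[of
        t]]] t by simp
      show "integrable \<mu> (\<lambda>z. exp (- 2 * \<rho> * t) * c * P t ?g z)" using t
        by (intro integrable_A A_scale P_closed g)
    qed
    \<comment> \<open>Invariance of the measure, from symmetry and \<open>P t 1 = 1\<close>.\<close>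
    moreover have "(\<integral>z. P t ?g z \<partial>\<mu>) = (\<integral>z. ?g z \<partial>\<mu>)"
    proof -
      have "(\<integral>z. 1 * P t ?g z \<partial>\<mu>) = (\<integral>z. P t (\<lambda>_. 1) z * ?g z \<partial>\<mu>)"
        by (rule P_symmetric[OF t A_square_int[OF g] A_square_int[OF A_one]])
      also have "\<dots> = (\<integral>z. ?g z \<partial>\<mu>)"
      proof (rule integral_cong_AE)
        show "AE z in \<mu>. P t (\<lambda>_. 1) z * ?g z = ?g z" using P_one[OF t] by eventually_elim simp
      qed (use A_mult[OF P_closed[OF t A_one] g] g in \<open>auto intro: A_measurable\<close>)
      finally show ?thesis by simp
    qed
    moreover have "(\<integral>z. ?g z * (exp (- 2 * \<rho> * t) * c - \<Gamma> (P t f) (P t f) z) \<partial>\<mu>) =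
       exp (- 2 * \<rho> * t) * c * (\<integral>z. ?g z \<partial>\<mu>) - (\<integral>z. ?g z * \<Gamma> (P t f) (P t f) z \<partial>\<mu>)"
    proof -
      have "(\<integral>z. ?g z * (exp (- 2 * \<rho> * t) * c - \<Gamma> (P t f) (P t f) z) \<partial>\<mu>) =
        (\<integral>z. exp (- 2 * \<rho> * t) * c * ?g z - ?g z * \<Gamma> (P t f) (P t f) z \<partial>\<mu>)" by (simp add: algebra_simps)
      then show ?thesis using integrable_A[OF g] integrable_A[OF A_mult[OF g uA(2)[of 0]]] t by simp
    qed
    ultimately show ?thesis by simp
  qed
  have "AE z in \<mu>. 0 \<le> exp (- 2 * \<rho> * t) * c - \<Gamma> (P t f) (P t f) z"
    by (rule AE_nonneg_test[OF ess_bdd_diff[OF ess_bdd_const A_ess_bdd[OF \<Gamma>_closed[OF P_closed[OF t f]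
      P_closed[OF t f]]]] main])
  then show ?thesis by eventually_elim simp
qed

end

text \<open>The origin of \<open>h_fun\<close>: it solves \<open>h' = - 2 - 2 * \<rho> * h\<close>
  with value \<open>\<alpha>\<close> at \<open>t\<close>. This makes the terms in the derivative of
  \<open>H\<close> that carry \<open>My\<close> combine into \<open>2 * h * (Gamma2 \<Gamma> L u u -
  \<rho> * \<Gamma> u u) - 2 * \<Gamma> u u\<close>.\<close>

lemma h_fun_deriv: "(h_fun \<rho> t \<alpha> has_real_derivative - 2 - 2 * \<rho> * h_fun \<rho> t \<alpha> s) (at s within T)"
proof (cases "\<rho> = 0")
  case True
  then show ?thesis unfolding h_fun_def[abs_def] by (auto intro!: derivative_eq_intros)
next
  case False
  then show ?thesis unfolding h_fun_def[abs_def]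
    by (auto intro!: derivative_eq_intros simp: field_simps)
qed

lemma h_fun_pos: assumes "0 \<le> \<alpha>" "s < t" shows "0 < h_fun \<rho> t \<alpha> s"
proof (cases "\<rho> = 0")
  case True
  then show ?thesis using assms by (simp add: h_fun_def)
next
  case False
  have "0 < (exp (2 * \<rho> * (t - s)) - 1) / \<rho>"
  proof (cases "0 < \<rho>")
    case True
    then show ?thesis using assms by simp
  next
    case neg: False
    then have "2 * \<rho> * (t - s) < 0" using False assms by (simp add: mult_less_0_iff)
    then show ?thesis using neg False by (simp add: divide_neg_neg)
  qed
  then show ?thesis using False assms(1) by (simp add: h_fun_def add_pos_nonneg)
qed

lemma h_fun_end: "h_fun \<rho> t \<alpha> t = \<alpha>"
  by (simp add: h_fun_def)

lemma h_fun_nonneg: assumes "0 \<le> \<alpha>" "s \<le> t" shows "0 \<le> h_fun \<rho> t \<alpha> s"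
  using h_fun_pos[of \<alpha> s t \<rho>] h_fun_end[of \<rho> t \<alpha>] assms by (cases "s = t") auto

lemma h_fun_bounded: "\<exists>K. \<forall>s\<in>{0..t}. \<bar>h_fun \<rho> t \<alpha> s\<bar> \<le> K"
proof -
  have "continuous_on {0..t} (h_fun \<rho> t \<alpha>)" by (rule DERIV_continuous_on[OF h_fun_deriv])
  then have "bounded (h_fun \<rho> t \<alpha> ` {0..t})" by (intro compact_imp_bounded compact_continuous_image) auto
  then show ?thesis unfolding bounded_iff by auto
qed

lemma pos_semidef_2:
  assumes "pos_semidef (vector [vector [a, b], vector [b, c]] :: real^2^2)"
  shows "0 \<le> v * v * a + 2 * (v * w * b) + w * w * c"
proof -
  have "0 \<le> (vector [v, w] :: real^2) \<bullet> ((vector [vector [a, b], vector [b, c]] :: real^2^2) *v (vector [v,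
    w] :: real^2))"
    using assms unfolding pos_semidef_def by blast
  then show ?thesis by (simp add: inner_vec_def sum_2 matrix_vector_mult_def algebra_simps)
qed

text \<open>To be read with \<open>\<gamma> = \<Gamma> u u\<close>,
  \<open>p = \<Gamma> u \<gamma>\<close>, \<open>q = \<Gamma> \<gamma> \<gamma>\<close>,
  \<open>g2 = Gamma2 \<Gamma> L u u - \<rho> * \<gamma>\<close> and \<open>y = h * \<gamma>\<close>.
  The form of \<open>B\<close> at the vector \<open>(1, h * p / \<gamma>)\<close>, times
  \<open>\<gamma>\<close>, is nearly the claim, with \<open>p\<^sup>2 / \<gamma>\<close> in place of
  \<open>q\<close>. Cauchy-Schwarz replaces one by the other, and the surplus from
  \<open>My / (2 * y)\<close> is paid by the reinforced condition
  \<open>q \<le> 4 * \<gamma> * g2\<close>.\<close>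

lemma dissipation_nonneg:
  fixes \<gamma> h :: real
  assumes h: "0 < h" and \<gamma>: "0 \<le> \<gamma>" and q: "0 \<le> q" "q \<le> 4 * \<gamma> * g2" and p: "p\<^sup>2 \<le> \<gamma> * q" and g2: "0 \<le> g2"
    and My: "0 \<le> My"
    and B: "\<And>v w. 0 < \<gamma> \<Longrightarrow> 0 \<le> v * v * (Mxx - 2 * My) + 2 * (v * w * Mxy) + w * w * (Myy + My / (2 * (h * \<gamma>)))"
  shows "0 \<le> My * (2 * h * g2 - 2 * \<gamma>) + Mxx * \<gamma> + 2 * Mxy * (h * p) + Myy * (h\<^sup>2 * q)"
proof (cases "\<gamma> = 0")
  case True
  \<comment> \<open>With \<open>\<gamma> = 0\<close> the hypotheses force \<open>q\<close> and
    \<open>p\<close> to vanish as well.\<close>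
  then show ?thesis using assms by simp
next
  case False
  then have \<gamma>0: "0 < \<gamma>" using \<gamma> by simp
  let ?B22 = "Myy + My / (2 * (h * \<gamma>))"
  have B22: "0 \<le> ?B22" using B[OF \<gamma>0, of 0 1] by simp
  have "q / \<gamma> \<le> 4 * g2" using q(2) \<gamma>0 by (simp add: pos_divide_le_eq mult_ac)
  then have "My * h * (q / \<gamma>) \<le> My * h * (4 * g2)" using My h by (intro mult_left_mono) auto
  then have 1: "My * (h * q / (2 * \<gamma>)) \<le> My * (2 * h * g2)" by (simp add: algebra_simps)
  have "p\<^sup>2 / \<gamma> \<le> q" using p \<gamma>0 by (simp add: pos_divide_le_eq mult.commute)
  then have 2: "h\<^sup>2 * (p\<^sup>2 / \<gamma>) * ?B22 \<le> h\<^sup>2 * q * ?B22" using B22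
    by (intro mult_right_mono mult_left_mono) auto
  have "0 \<le> \<gamma> * (1 * 1 * (Mxx - 2 * My) + 2 * (1 * (h * p / \<gamma>) * Mxy) + (h * p / \<gamma>) * (h * p / \<gamma>) * ?B22)"
    using B[OF \<gamma>0, of 1 "h * p / \<gamma>"] \<gamma>0 by simp
  also have "\<dots> = (Mxx - 2 * My) * \<gamma> + 2 * Mxy * (\<gamma> * (h * p / \<gamma>)) + (\<gamma> * ((h * p / \<gamma>) * (h * p / \<gamma>))) * ?B22"
    by (simp only: distrib_left mult_1 mult_ac)
  also have "\<gamma> * (h * p / \<gamma>) = h * p" using \<gamma>0 by simp
  also have "\<gamma> * ((h * p / \<gamma>) * (h * p / \<gamma>)) = h\<^sup>2 * (p\<^sup>2 / \<gamma>)" using \<gamma>0 by (simp add: power2_eq_square)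
  finally have 3: "0 \<le> (Mxx - 2 * My) * \<gamma> + 2 * Mxy * (h * p) + h\<^sup>2 * (p\<^sup>2 / \<gamma>) * ?B22" .
  have 4: "h\<^sup>2 * q * ?B22 = Myy * (h\<^sup>2 * q) + My * (h * q / (2 * \<gamma>))"
    using \<gamma>0 h by (simp add: power2_eq_square distrib_left mult_ac)
  have "0 \<le> (Mxx - 2 * My) * \<gamma> + 2 * Mxy * (h * p) + (Myy * (h\<^sup>2 * q) + My * (2 * h * g2))"
    using 1 2 3 4 by linarith
  then show ?thesis by (simp add: algebra_simps)
qed

context markov_triple
begin

text \<open>The derivative of \<open>H\<close> tested against \<open>P s g\<close>, for a polynomial in place of \<open>M\<close>. The first-order
  terms in \<open>L u\<close> cancel because \<open>L\<close> commutes with the semigroup.\<close>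

lemma poly2_dissipation:
  assumes p: "poly2 p px py pxx pxy pyy" and f: "f \<in> A" and g: "g \<in> A" and s: "s \<in> {0..t}"
    and K: "\<And>r. r \<in> {0..t} \<Longrightarrow> AE z in \<mu>. \<bar>P (t - r) f z\<bar> \<le> K"
      "\<And>r. r \<in> {0..t} \<Longrightarrow> AE z in \<mu>. \<bar>h_fun \<rho> t \<alpha> r * \<Gamma> (P (t - r) f) (P (t - r) f) z\<bar> \<le> K"
  defines "u \<equiv> \<lambda>r. P (t - r) f" and "h \<equiv> h_fun \<rho> t \<alpha>"
  defines "v \<equiv> \<lambda>r z. h r * \<Gamma> (u r) (u r) z"
  shows "((\<lambda>r. \<integral>z. P r g z * p (u r z) (v r z) \<partial>\<mu>) has_real_derivative
     (\<integral>z. P s g z * (py (u s z) (v s z) * (2 * h s * (Gamma2 \<Gamma> L (u s) (u s) z - \<rho> * \<Gamma> (u s) (u s) z)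
       - 2 * \<Gamma> (u s) (u s) z)
        + pxx (u s z) (v s z) * \<Gamma> (u s) (u s) z + 2 * pxy (u s z) (v s z) * (h s * \<Gamma> (u s) (\<Gamma> (u s) (u s)) z)
        + pyy (u s z) (v s z) * ((h s)\<^sup>2 * \<Gamma> (\<Gamma> (u s) (u s)) (\<Gamma> (u s) (u s)) z)) \<partial>\<mu>)) (at s within
          {0..t})" (is "(_ has_real_derivative (\<integral>z. P s g z * ?Q z \<partial>\<mu>)) _")
proof -
  have uA: "u r \<in> A" "\<Gamma> (u r) (u r) \<in> A" "v r \<in> A" "P (t - r) (L f) \<in> A" if "r \<in> {0..t}" for r
    using f that unfolding u_def v_def by (auto intro!: \<Gamma>_closed P_closed L_closed A_scale)
  let ?u' = "\<lambda>z. - P (t - s) (L f) z"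
  let ?v' = "\<lambda>z. (- 2 - 2 * \<rho> * h s) * \<Gamma> (u s) (u s) z + h s * - (2 * \<Gamma> (u s) (P (t - s) (L f)) z)"
  obtain Kh where Kh: "\<And>r. r \<in> {0..t} \<Longrightarrow> \<bar>h_fun \<rho> t \<alpha> r\<bar> \<le> Kh" using h_fun_bounded[of t \<rho> \<alpha>] by blast
  have du: "L1_deriv {0..t} u ?u' s" unfolding u_def by (rule P_curve_reverse[OF f s])
  have dv: "L1_deriv {0..t} v ?v' s" unfolding v_def u_def h_def
    by (rule \<Gamma>_curve_reverse[OF f s h_fun_deriv Kh])
  have e': "ess_bdd ?u'" "ess_bdd ?v'" using uA[OF s]
    by (auto intro!: ess_bdd_intros intro: A_ess_bdd \<Gamma>_closed)
  have eu: "ess_bdd (u r)" "ess_bdd (v r)" if "r \<in> {0..t}" for r using uA[OF that] by (auto intro: A_ess_bdd)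
  let ?\<phi>' = "\<lambda>z. px (u s z) (v s z) * ?u' z + py (u s z) (v s z) * ?v' z"
  have Ku: "AE z in \<mu>. \<bar>u r z\<bar> \<le> K" if "r \<in> {0..t}" for r using K(1)[OF that] by (simp add: u_def)
  have Kv: "AE z in \<mu>. \<bar>v r z\<bar> \<le> K" if "r \<in> {0..t}" for r using K(2)[OF that] by (simp add: u_def v_def h_def)
  have d\<phi>: "L1_deriv {0..t} (\<lambda>r z. p (u r z) (v r z)) ?\<phi>' s"
    using poly2_curve[OF p s du eu(1) e'(1) Ku dv eu(2) e'(2) Kv] by blast
  note calc = poly2_calculus[OF p uA(1)[OF s] uA(3)[OF s]]
  have "((\<lambda>r. \<integral>z. P r g z * p (u r z) (v r z) \<partial>\<mu>) has_real_derivative (\<integral>z. P s g z * (L (\<lambda>z. p (u s z) (v s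
    z)) z + ?\<phi>' z) \<partial>\<mu>)) (at s within {0..t})"
  proof (rule dual_curve[OF g s d\<phi>])
    show "ess_bdd (\<lambda>z. p (u r z) (v r z))" if "r \<in> {0..t}" for r using poly2_ess_bdd[OF p eu[OF that]]
      by blast
    show "ess_bdd ?\<phi>'" using poly2_ess_bdd[OF p eu[OF s]] ess_bdd_add[OF ess_bdd_mult[OF _ e'(1)]
      ess_bdd_mult[OF _ e'(2)]] by blast
  qed (use calc in blast)
  also have "(\<integral>z. P s g z * (L (\<lambda>z. p (u s z) (v s z)) z + ?\<phi>' z) \<partial>\<mu>) = (\<integral>z. P s g z * ?Q z \<partial>\<mu>)"
  proof (rule integral_cong_AE)
    have s0: "0 \<le> s" "0 \<le> t - s" using s by auto
    have LP: "AE z in \<mu>. L (u s) z = P (t - s) (L f) z" unfolding u_def by (rule L_P[OF f s0(2)])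
    then have PL: "AE z in \<mu>. P (t - s) (L f) z = L (u s) z" by (auto elim: eventually_mono)
    have \<Gamma>PL: "AE z in \<mu>. \<Gamma> (u s) (P (t - s) (L f)) z = \<Gamma> (u s) (L (u s)) z"
      by (rule \<Gamma>_cong[OF uA(1)[OF s] uA(1)[OF s] uA(4)[OF s] L_closed[OF uA(1)[OF s]] _ PL]) simp
    have Lv: "AE z in \<mu>. L (v s) z = h s * L (\<Gamma> (u s) (u s)) z" unfolding v_def
      by (rule L_scale[OF uA(2)[OF s]])
    have \<Gamma>v: "AE z in \<mu>. \<Gamma> (v s) w z = h s * \<Gamma> (\<Gamma> (u s) (u s)) w z" if "w \<in> A" for w
      unfolding v_def by (rule \<Gamma>_scale[OF uA(2)[OF s] that])
    show "AE z in \<mu>. P s g z * (L (\<lambda>z. p (u s z) (v s z)) z + ?\<phi>' z) = P s g z * ?Q z"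
      using conjunct2[OF conjunct2[OF calc]] LP \<Gamma>PL Lv \<Gamma>v[OF uA(3)[OF s]] \<Gamma>v[OF uA(2)[OF s]] \<Gamma>v[OF uA(1)[OF
        s]]
        \<Gamma>_sym[OF uA(3)[OF s] uA(2)[OF s]] \<Gamma>_sym[OF uA(3)[OF s] uA(1)[OF s]] \<Gamma>_sym[OF uA(2)[OF s] uA(1)[OF
          s]] Gamma2_eq[OF uA(1)[OF s]]
    proof eventually_elim
      case (elim z)
      show ?case unfolding elim(1) unfolding elim(2-5,9)[symmetric] elim(11)
        unfolding elim(3,4) elim(8)[symmetric]  unfolding elim(5) elim(9)[symmetric] elim(8)[symmetric]
        elim(6,7) elim(10) unfolding elim(2)
        by (simp add: power2_eq_square algebra_simps)
    qed
    have m: "(\<lambda>z. p (u s z) (v s z)) \<in> A" using calc by blast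
    have e: "ess_bdd (\<lambda>z. px (u s z) (v s z))" "ess_bdd (\<lambda>z. py (u s z) (v s z))"
      "ess_bdd (\<lambda>z. pxx (u s z) (v s z))"
      "ess_bdd (\<lambda>z. pxy (u s z) (v s z))" "ess_bdd (\<lambda>z. pyy (u s z) (v s z))"
        using poly2_ess_bdd[OF p eu[OF s]] by blast+
    note b = A_ess_bdd[OF P_closed[OF s0(1) g]] A_ess_bdd[OF L_closed[OF m]] A_ess_bdd[OF Gamma2_closed[OF
      uA(1)[OF s]]]
      A_ess_bdd[OF uA(2)[OF s]] A_ess_bdd[OF \<Gamma>_closed[OF uA(1)[OF s] uA(2)[OF s]]] A_ess_bdd[OF \<Gamma>_closed[OF
        uA(2)[OF s] uA(2)[OF s]]]
    show "(\<lambda>z. P s g z * (L (\<lambda>z. p (u s z) (v s z)) z + ?\<phi>' z)) \<in> borel_measurable \<mu>"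
      by (intro ess_bdd_measurable ess_bdd_mult[OF b(1)] ess_bdd_add[OF b(2)] ess_bdd_add ess_bdd_mult[OF
        e(1)] ess_bdd_mult[OF e(2)] e')
    show "(\<lambda>z. P s g z * ?Q z) \<in> borel_measurable \<mu>"
      by (rule ess_bdd_measurable) (intro ess_bdd_intros b e)
  qed
  finally show ?thesis .
qed

end

lemma le_of_le_add_mult:
  fixes x y K :: real
  assumes "\<And>\<epsilon>. 0 < \<epsilon> \<Longrightarrow> x \<le> y + \<epsilon> * K" "0 \<le> K" shows "x \<le> y"
proof (rule field_le_epsilon)
  fix e :: real assume e: "0 < e"
  have "x \<le> y + e / (K + 1) * K" using e assms(2) by (intro assms(1)) simp
  also have "e / (K + 1) * K \<le> e" using e assms(2) by (simp add: pos_divide_le_eq algebra_simps)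
  finally show "x \<le> y + e" by simp
qed

text \<open>The price of replacing the derivatives of \<open>M\<close> by \<epsilon>-close ones. It
  has to be linear in \<open>g2\<close> and \<open>\<gamma>\<close>, whose integrals are controlled
  uniformly in time; hence the estimates
  \<open>2 * \<bar>h * p\<bar> \<le> \<gamma> + h\<^sup>2 * q\<close> and
  \<open>h\<^sup>2 * q \<le> 4 * Kh * d * g2\<close>.\<close>

lemma dissipation_perturb:
  fixes \<gamma> h :: real
  assumes h: "0 < h" "h \<le> Kh" and \<gamma>: "0 \<le> \<gamma>" "h * \<gamma> \<le> d" and q: "0 \<le> q" "q \<le> 4 * \<gamma> * g2"
    and p: "p\<^sup>2 \<le> \<gamma> * q" and g2: "0 \<le> g2"
    and \<epsilon>: "0 \<le> \<epsilon>" "\<bar>my - My\<bar> \<le> \<epsilon>" "\<bar>mxx - Mxx\<bar> \<le> \<epsilon>" "\<bar>mxy - Mxy\<bar> \<le> \<epsilon>" "\<bar>myy - Myy\<bar> \<le> \<epsilon>"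
    and Q: "0 \<le> My * (2 * h * g2 - 2 * \<gamma>) + Mxx * \<gamma> + 2 * Mxy * (h * p) + Myy * (h\<^sup>2 * q)"
  shows "- (\<epsilon> * ((2 * Kh + 8 * Kh * d) * g2 + 4 * \<gamma>)) \<le> my * (2 * h * g2 - 2 * \<gamma>) + mxx * \<gamma> + 2 * mxy * (h *
    p) + myy * (h\<^sup>2 * q)"
proof -
  have hp: "2 * \<bar>h * p\<bar> \<le> \<gamma> + h\<^sup>2 * q"
  proof (rule power2_le_imp_le)
    have "(2 * \<bar>h * p\<bar>)\<^sup>2 = 4 * h\<^sup>2 * p\<^sup>2" by (simp add: power_mult_distrib)
    also have "\<dots> \<le> 4 * h\<^sup>2 * (\<gamma> * q)" using p by (intro mult_left_mono) auto
    also have "\<dots> \<le> (\<gamma> + h\<^sup>2 * q)\<^sup>2" using sum_squares_bound[of \<gamma> "h\<^sup>2 * q"] by (simp add: power2_sum mult_ac)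
    finally show "(2 * \<bar>h * p\<bar>)\<^sup>2 \<le> (\<gamma> + h\<^sup>2 * q)\<^sup>2" .
  qed (use \<gamma> q in simp)
  have hq: "h\<^sup>2 * q \<le> 4 * Kh * d * g2"
  proof -
    have "h\<^sup>2 * q \<le> h\<^sup>2 * (4 * \<gamma> * g2)" using q by (intro mult_left_mono) auto
    also have "\<dots> = 4 * (h * (h * \<gamma>)) * g2" by (simp add: power2_eq_square)
    also have "\<dots> \<le> 4 * (Kh * d) * g2" using h \<gamma> g2 by (intro mult_right_mono mult_left_mono mult_mono) auto
    finally show ?thesis by simp
  qed
  have hg: "h * g2 \<le> Kh * g2" using h g2 by (intro mult_right_mono)
  have hg0: "0 \<le> h * g2" "0 \<le> h\<^sup>2 * q" using h g2 q by auto
  have b: "- (\<epsilon> * \<bar>X\<bar>) \<le> (m - N) * X" if "\<bar>m - N\<bar> \<le> \<epsilon>" for m N X :: real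
  proof -
    have "\<bar>(m - N) * X\<bar> \<le> \<epsilon> * \<bar>X\<bar>" unfolding abs_mult using that by (intro mult_right_mono) auto
    then show ?thesis by linarith
  qed
  have "\<bar>2 * h * g2 - 2 * \<gamma>\<bar> + \<gamma> + 2 * \<bar>h * p\<bar> + h\<^sup>2 * q \<le> (2 * Kh + 8 * Kh * d) * g2 + 4 * \<gamma>"
    using hp hq hg hg0 \<gamma>(1) by (simp add: algebra_simps)
  then have "\<epsilon> * (\<bar>2 * h * g2 - 2 * \<gamma>\<bar> + \<gamma> + 2 * \<bar>h * p\<bar> + h\<^sup>2 * q) \<le> \<epsilon> * ((2 * Kh + 8 * Kh * d) * g2
    + 4 * \<gamma>)"
    using \<epsilon>(1) by (rule mult_left_mono)
  then have 1: "- (\<epsilon> * ((2 * Kh + 8 * Kh * d) * g2 + 4 * \<gamma>)) \<le> - (\<epsilon> * \<bar>2 * h * g2 - 2 * \<gamma>\<bar>) - \<epsilon> * \<gamma>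
    - 2 * (\<epsilon> * \<bar>h * p\<bar>) - \<epsilon> * (h\<^sup>2 * q)"
    by (simp add: algebra_simps)
  have 2: "- (\<epsilon> * \<bar>2 * h * g2 - 2 * \<gamma>\<bar>) \<le> (my - My) * (2 * h * g2 - 2 * \<gamma>)" by (rule b[OF \<epsilon>(2)])
  have 3: "- (\<epsilon> * \<gamma>) \<le> (mxx - Mxx) * \<gamma>" using b[OF \<epsilon>(3), of \<gamma>] \<gamma> by simp
  have 4: "- (\<epsilon> * \<bar>h * p\<bar>) \<le> (mxy - Mxy) * (h * p)" by (rule b[OF \<epsilon>(4)])
  have 5: "- (\<epsilon> * (h\<^sup>2 * q)) \<le> (myy - Myy) * (h\<^sup>2 * q)" using b[OF \<epsilon>(5), of "h\<^sup>2 * q"] hg0 by simp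
  have "my * (2 * h * g2 - 2 * \<gamma>) + mxx * \<gamma> + 2 * mxy * (h * p) + myy * (h\<^sup>2 * q) =
    (My * (2 * h * g2 - 2 * \<gamma>) + Mxx * \<gamma> + 2 * Mxy * (h * p) + Myy * (h\<^sup>2 * q)) +
    ((my - My) * (2 * h * g2 - 2 * \<gamma>) + (mxx - Mxx) * \<gamma> + 2 * ((mxy - Mxy) * (h * p)) + (myy - Myy) * (h\<^sup>2 *
      q))"
    by (simp add: algebra_simps)
  then show ?thesis using 1 2 3 4 5 Q by linarith
qed

section \<open>Monotonicity for functions with values in a compact subinterval\<close>

context markov_triple
begin

lemma compose_on_measurable:
  assumes cont: "continuous_on (I \<times> {0..}) (\<lambda>(x, y). M x y)" and I: "is_interval I"
    and [measurable]: "u \<in> borel_measurable \<mu>" "v \<in> borel_measurable \<mu>"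
  shows "compose_on I M u v \<in> borel_measurable \<mu>"
proof -
  have "I \<in> sets borel" using I by (rule real_interval_borel_measurable)
  then have S: "I \<times> {0..} \<in> sets (borel :: (real \<times> real) measure)" by (intro borel_Times) auto
  have "(\<lambda>w. indicator (I \<times> {0..}) w *\<^sub>R (\<lambda>(x, y). M x y) w) \<in> borel_measurable (borel :: (real \<times> real)
    measure)"
    by (rule borel_measurable_continuous_on_indicator[OF S cont])
  then have "(\<lambda>z. indicator (I \<times> {0..}) (u z, v z) *\<^sub>R (\<lambda>(x, y). M x y) (u z, v z)) \<in> borel_measurable \<mu>"
    by (rule measurable_compose_rev) measurable
  also have "(\<lambda>z. indicator (I \<times> {0..}) (u z, v z) *\<^sub>R (\<lambda>(x, y). M x y) (u z, v z)) = compose_on I M u v"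
    by (auto simp: compose_on_def indicator_def)
  finally show ?thesis .
qed

lemma bounded_on_rectangle:
  fixes M :: "real \<Rightarrow> real \<Rightarrow> real"
  assumes cont: "continuous_on (I \<times> {0..}) (\<lambda>(x, y). M x y)" and I: "{a..b} \<subseteq> I"
  shows "\<exists>K. \<forall>x\<in>{a..b}. \<forall>y\<in>{0..d}. \<bar>M x y\<bar> \<le> K"
proof -
  have "continuous_on ({a..b} \<times> {0..d}) (\<lambda>(x, y). M x y)"
    by (rule continuous_on_subset[OF cont]) (use I in auto)
  then have "bounded ((\<lambda>(x, y). M x y) ` ({a..b} \<times> {0..d}))"
    by (intro compact_imp_bounded compact_continuous_image compact_Times compact_Icc)
  then show ?thesis unfolding bounded_iff by force
qed

lemma compose_on_ess_bdd:
  assumes cont: "continuous_on (I \<times> {0..}) (\<lambda>(x, y). M x y)" and I: "is_interval I" "{a..b} \<subseteq> I"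
    and m: "u \<in> borel_measurable \<mu>" "v \<in> borel_measurable \<mu>"
    and uv: "AE z in \<mu>. u z \<in> {a..b} \<and> v z \<in> {0..d}"
  shows "ess_bdd (compose_on I M u v)"
proof -
  obtain K where K: "\<forall>x\<in>{a..b}. \<forall>y\<in>{0..d}. \<bar>M x y\<bar> \<le> K" using bounded_on_rectangle[OF cont I(2)] by blast
  show ?thesis
  proof (rule ess_bddI[OF compose_on_measurable[OF cont I(1) m]])
    show "AE z in \<mu>. \<bar>compose_on I M u v z\<bar> \<le> K"
      using uv by eventually_elim (use K I(2) in \<open>auto simp: compose_on_def\<close>)
  qed
qed

lemma \<Gamma>_P_bound:
  assumes CD: "\<forall>f\<in>A. AE z in \<mu>. \<rho> * \<Gamma> f f z \<le> Gamma2 \<Gamma> L f f z" and f: "f \<in> A"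
  shows "\<exists>c\<ge>0. \<forall>r\<in>{0..t}. AE z in \<mu>. \<Gamma> (P r f) (P r f) z \<le> c"
proof -
  obtain c where c: "0 \<le> c" "AE z in \<mu>. \<bar>\<Gamma> f f z\<bar> \<le> c" using A_ess_bdd[OF \<Gamma>_closed[OF f f]] by (rule ess_bddE)
  have c': "AE z in \<mu>. \<Gamma> f f z \<le> c" using c(2) by eventually_elim simp
  have "AE z in \<mu>. \<Gamma> (P r f) (P r f) z \<le> exp (2 * \<bar>\<rho>\<bar> * t) * c" if r: "r \<in> {0..t}" for r
  proof -
    have "- \<rho> * r \<le> \<bar>\<rho>\<bar> * r" using r by (intro mult_right_mono) auto
    also have "\<dots> \<le> \<bar>\<rho>\<bar> * t" using r by (intro mult_left_mono) auto
    finally have "exp (- 2 * \<rho> * r) * c \<le> exp (2 * \<bar>\<rho>\<bar> * t) * c" using c(1)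
      by (intro mult_right_mono) (auto simp: mult_ac)
    with gradient_bound[OF CD f _ c', of r] r show ?thesis by (auto elim: eventually_mono)
  qed
  then show ?thesis using c(1) by (intro exI[of _ "exp (2 * \<bar>\<rho>\<bar> * t) * c"]) auto
qed

text \<open>For a polynomial \<epsilon>-close to \<open>M\<close> in C2 on a rectangle, the tested
  curve has derivative at least \<open>- (\<epsilon> * (Kg * CR))\<close>, with constants
  independent of time and of \<epsilon>. Integrating and letting \<epsilon> tend to 0 gives the
  claim for \<open>M\<close>, whose own curve is never differentiated.\<close>

lemma H_mono_compact:
  assumes CD: "\<forall>f\<in>A. AE z in \<mu>. \<rho> * \<Gamma> f f z \<le> Gamma2 \<Gamma> L f f z"
    and C2: "C2_partials I M Mx My Mxx Mxy Myy" and I: "is_interval I"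
    and My: "\<forall>x\<in>I. \<forall>y\<ge>0. 0 \<le> My x y"
    and B: "\<And>x y v w. x \<in> I \<Longrightarrow> 0 < y \<Longrightarrow> 0 \<le> v * v * (Mxx x y - 2 * My x y) + 2 * (v * w * Mxy x y)
      + w * w * (Myy x y + My x y / (2 * y))"
    and ab: "{a..b} \<subseteq> I" "a < b" and f: "f \<in> A" and fab: "AE z in \<mu>. f z \<in> {a..b}"
    and \<alpha>: "0 \<le> \<alpha>" and st: "0 \<le> s" "s \<le> s'" "s' \<le> t"
  defines "m \<equiv> \<lambda>r. compose_on I M (P (t - r) f) (\<lambda>z. h_fun \<rho> t \<alpha> r * \<Gamma> (P (t - r) f) (P (t - r) f) z)"
  shows "r \<in> {0..t} \<Longrightarrow> ess_bdd (m r)" and "AE z in \<mu>. P s (m s) z \<le> P s' (m s') z"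
proof -
  let ?u = "\<lambda>r. P (t - r) f" and ?h = "h_fun \<rho> t \<alpha>"
  let ?v = "\<lambda>r z. ?h r * \<Gamma> (?u r) (?u r) z"
  have uA: "?u r \<in> A" "\<Gamma> (?u r) (?u r) \<in> A" "?v r \<in> A" "L (?u r) \<in> A" if "r \<in> {0..t}" for r
    using f that by (auto intro!: \<Gamma>_closed P_closed L_closed A_scale)
  obtain c where c: "0 \<le> c" "\<And>r. r \<in> {0..t} \<Longrightarrow> AE z in \<mu>. \<Gamma> (P r f) (P r f) z \<le> c"
    using \<Gamma>_P_bound[OF CD f] by blast
  have \<Gamma>c: "AE z in \<mu>. \<Gamma> (?u r) (?u r) z \<le> c" if "r \<in> {0..t}" for r using that by (intro c) auto
  obtain Kh where Kh: "\<And>r. r \<in> {0..t} \<Longrightarrow> \<bar>?h r\<bar> \<le> Kh" using h_fun_bounded[of t \<rho> \<alpha>] by blast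
  have Kh0: "0 \<le> Kh" using Kh[of 0] st by auto
  \<comment> \<open>The summand 1 keeps the rectangle nondegenerate.\<close>
  define d where "d = Kh * c + 1"
  have d: "0 < d" using Kh0 c(1) by (simp add: d_def add_nonneg_pos)
  have h0: "0 \<le> ?h r" if "r \<in> {0..t}" for r using that \<alpha> by (intro h_fun_nonneg) auto
  have uab: "AE z in \<mu>. ?u r z \<in> {a..b}" if r: "r \<in> {0..t}" for r
  proof -
    have "AE z in \<mu>. a \<le> f z" "AE z in \<mu>. f z \<le> b" using fab by (auto elim: eventually_mono)
    with P_ge_const[OF _ A_square_int[OF f], of "t - r" a] P_le_const[OF _ A_square_int[OF f], of "t - r" b] r
    have "AE z in \<mu>. a \<le> ?u r z" "AE z in \<mu>. ?u r z \<le> b" by auto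
    then show ?thesis by eventually_elim simp
  qed
  have vd: "AE z in \<mu>. ?v r z \<in> {0..d}" if r: "r \<in> {0..t}" for r
    using \<Gamma>c[OF r] \<Gamma>_nonneg[OF uA(1)[OF r]]
  proof eventually_elim
    case (elim z)
    have "?v r z \<le> Kh * c" using elim h0[OF r] Kh[OF r] by (intro mult_mono) auto
    then show ?case using elim h0[OF r] by (simp add: d_def)
  qed
  have rect: "AE z in \<mu>. ?u r z \<in> {a..b} \<and> ?v r z \<in> {0..d}" if r: "r \<in> {0..t}" for r
    using uab[OF r] vd[OF r] by eventually_elim simp
  show em: "ess_bdd (m r)" if r: "r \<in> {0..t}" for r
    unfolding m_def by (rule compose_on_ess_bdd[OF C2_partials_continuous[OF C2] I ab(1) A_measurable[OF
      uA(1)[OF r]] A_measurable[OF uA(3)[OF r]] rect[OF r]])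
  define C1 where "C1 = 2 * Kh + 8 * Kh * d"
  have C1: "0 \<le> C1" using Kh0 d by (simp add: C1_def)
  \<comment> \<open>A bound for the integral of \<open>?R r\<close> that does not depend on
    \<open>r\<close>: the integral of \<open>Gamma2\<close> is that of the square of
    \<open>P (t - r) (L f)\<close>, at most that of the square of \<open>L f\<close>.\<close>
  define CR where "CR = C1 * (\<integral>z. (L f z)\<^sup>2 \<partial>\<mu>) + \<bar>4 - C1 * \<rho>\<bar> * c"
  have CR: "0 \<le> CR" using C1 c(1) by (simp add: CR_def)
  let ?g2 = "\<lambda>r z. Gamma2 \<Gamma> L (?u r) (?u r) z - \<rho> * \<Gamma> (?u r) (?u r) z"
  let ?R = "\<lambda>r z. C1 * ?g2 r z + 4 * \<Gamma> (?u r) (?u r) z"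
  have RA: "?R r \<in> A" if "r \<in> {0..t}" for r
    by (intro A_add A_scale A_diff Gamma2_closed uA that)
  have intR: "(\<integral>z. ?R r z \<partial>\<mu>) \<le> CR" if r: "r \<in> {0..t}" for r
  proof -
    note i = integrable_A[OF Gamma2_closed[OF uA(1)[OF r]]] integrable_A[OF uA(2)[OF r]]
    have "(\<integral>z. ?R r z \<partial>\<mu>) = C1 * (\<integral>z. Gamma2 \<Gamma> L (?u r) (?u r) z \<partial>\<mu>) + (4 - C1 * \<rho>) * (\<integral>z. \<Gamma> (?u r) (?u r) z
      \<partial>\<mu>)"
      using i by (simp add: algebra_simps)
    also have "(\<integral>z. Gamma2 \<Gamma> L (?u r) (?u r) z \<partial>\<mu>) = (\<integral>z. (P (t - r) (L f) z)\<^sup>2 \<partial>\<mu>)"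
      unfolding integral_Gamma2[OF uA(1)[OF r]]
    proof (rule integral_cong_AE)
      show "AE z in \<mu>. (L (?u r) z)\<^sup>2 = (P (t - r) (L f) z)\<^sup>2" using L_P[OF f, of "t - r"] r
        by (auto elim: eventually_mono)
    qed (use A_measurable[OF uA(4)[OF r]] A_measurable[OF P_closed[OF _ L_closed[OF f]], of
      "t - r"] r in auto)
    also have "\<dots> \<le> (\<integral>z. (L f z)\<^sup>2 \<partial>\<mu>)" by (rule P_sq_contraction) (use r A_square_int[OF L_closed[OF f]] in
      auto)
    finally have 1: "(\<integral>z. ?R r z \<partial>\<mu>) \<le> C1 * (\<integral>z. (L f z)\<^sup>2 \<partial>\<mu>) + (4 - C1 * \<rho>) * (\<integral>z. \<Gamma> (?u r) (?u r) z \<partial>\<mu>)"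
      using C1 by (simp add: mult_left_mono)
    have "0 \<le> (\<integral>z. \<Gamma> (?u r) (?u r) z \<partial>\<mu>)" by (rule integral_nonneg_AE[OF \<Gamma>_nonneg[OF uA(1)[OF r]]])
    moreover have "(\<integral>z. \<Gamma> (?u r) (?u r) z \<partial>\<mu>) \<le> (\<integral>z. c \<partial>\<mu>)"
      by (rule integral_mono_AE[OF i(2) _ \<Gamma>c[OF r]]) simp
    ultimately have "(4 - C1 * \<rho>) * (\<integral>z. \<Gamma> (?u r) (?u r) z \<partial>\<mu>) \<le> \<bar>4 - C1 * \<rho>\<bar> * c"
      by (intro mult_mono) (auto simp: prob_space)
    with 1 show ?thesis by (simp add: CR_def)
  qed
  have improved: "AE z in \<mu>. \<Gamma> (\<Gamma> (?u r) (?u r)) (\<Gamma> (?u r) (?u r)) z \<le> 4 * \<Gamma> (?u r) (?u r) z * ?g2 r z"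
    if r: "r \<in> {0..t}" for r
    by (rule self_improvement[OF uA(1)[OF r], where \<kappa> = 0]) (use CD in \<open>auto elim!: eventually_mono\<close>)
  have main: "(\<integral>z. P s (\<lambda>z. k z * k z) z * m s z \<partial>\<mu>) \<le> (\<integral>z. P s' (\<lambda>z. k z * k z) z * m s' z \<partial>\<mu>)"
    if k: "k \<in> A" for k
  proof -
    let ?g = "\<lambda>z. k z * k z"
    have g: "?g \<in> A" by (rule A_mult[OF k k])
    obtain Kg where Kg: "0 \<le> Kg" "AE z in \<mu>. \<bar>?g z\<bar> \<le> Kg" using A_ess_bdd[OF g] by (rule ess_bddE)
    have wg: "AE z in \<mu>. 0 \<le> P r ?g z \<and> P r ?g z \<le> Kg" if r: "r \<in> {0..t}" for r
    proof -
      have "AE z in \<mu>. 0 \<le> P r ?g z" by (rule P_positive) (use r A_square_int[OF g] in auto)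
      moreover have "AE z in \<mu>. \<bar>P r ?g z\<bar> \<le> Kg" by (rule P_abs_bound[OF _ A_square_int[OF g] Kg(2)]) (use r
        in auto)
      ultimately show ?thesis by eventually_elim simp
    qed
    have wA: "P r ?g \<in> A" if "r \<in> {0..t}" for r using that g by (intro P_closed) auto
    let ?Jm = "\<lambda>r. \<integral>z. P r ?g z * m r z \<partial>\<mu>"
    show "?Jm s \<le> ?Jm s'"
    proof (rule le_of_le_add_mult)
      show "0 \<le> Kg * CR * t + 2 * Kg" using Kg(1) CR st by simp
      fix \<epsilon> :: real assume \<epsilon>: "0 < \<epsilon>"
      obtain p px py pxx pxy pyy where p: "poly2 p px py pxx pxy pyy" and
        ap: "\<And>x y. x \<in> {a..b} \<Longrightarrow> y \<in> {0..d} \<Longrightarrow> \<bar>p x y - M x y\<bar> \<le> \<epsilon> \<and> \<bar>px x y - Mx x y\<bar> \<le> \<epsilon> \<and> \<bar>py x y - My x y\<bar>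
          \<le> \<epsilon> \<and>
          \<bar>pxx x y - Mxx x y\<bar> \<le> \<epsilon> \<and> \<bar>pxy x y - Mxy x y\<bar> \<le> \<epsilon> \<and> \<bar>pyy x y - Myy x y\<bar> \<le> \<epsilon>"
        using C2_poly_approx[OF C2 ab d \<epsilon>] by blast
      let ?J = "\<lambda>r. \<integral>z. P r ?g z * p (?u r z) (?v r z) \<partial>\<mu>"
      have close: "\<bar>?J r - ?Jm r\<bar> \<le> \<epsilon> * Kg" if r: "r \<in> {0..t}" for r
      proof -
        have ep: "ess_bdd (\<lambda>z. p (?u r z) (?v r z))"
          using poly2_ess_bdd[OF p A_ess_bdd[OF uA(1)[OF r]] A_ess_bdd[OF uA(3)[OF r]]] by blast
        note e1 = ess_bdd_mult[OF A_ess_bdd[OF wA[OF r]] ep] ess_bdd_mult[OF A_ess_bdd[OF wA[OF r]] em[OF r]]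
        have eq: "?J r - ?Jm r = (\<integral>z. P r ?g z * p (?u r z) (?v r z) - P r ?g z * m r z \<partial>\<mu>)"
          by (rule Bochner_Integration.integral_diff[symmetric]) (use e1 in \<open>auto intro: ess_bdd_integrable\<close>)
        have "\<bar>?J r - ?Jm r\<bar> \<le> (\<integral>z. \<bar>P r ?g z * p (?u r z) (?v r z) - P r ?g z * m r z\<bar> \<partial>\<mu>)" unfolding eq
          by (rule integral_abs_bound)
        also have "\<dots> \<le> (\<integral>z. \<epsilon> * Kg \<partial>\<mu>)"
        proof (rule integral_mono_AE)
          show "AE z in \<mu>. \<bar>P r ?g z * p (?u r z) (?v r z) - P r ?g z * m r z\<bar> \<le> \<epsilon> * Kg"
            using rect[OF r] wg[OF r]
          proof eventually_elim
            case (elim z)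
            have "m r z = M (?u r z) (?v r z)" using elim ab(1) by (auto simp: m_def compose_on_def)
            then have "\<bar>p (?u r z) (?v r z) - m r z\<bar> \<le> \<epsilon>" using ap[of "?u r z" "?v r z"] elim by simp
            then have "P r ?g z * \<bar>p (?u r z) (?v r z) - m r z\<bar> \<le> Kg * \<epsilon>" using elim Kg
              by (intro mult_mono) auto
            moreover have "\<bar>P r ?g z * p (?u r z) (?v r z) - P r ?g z * m r z\<bar> = P r ?g z * \<bar>p (?u r z) (?v
              r z) - m r z\<bar>"
              using elim by (simp only: right_diff_distrib[symmetric] abs_mult) simp
            ultimately show ?case by (simp only: mult.commute[of \<epsilon>])
          qed
        qed (use e1 in \<open>auto intro!: ess_bdd_integrable ess_bdd_abs ess_bdd_diff\<close>)
        finally show ?thesis by (simp add: prob_space)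
      qed
      let ?Q = "\<lambda>r z. py (?u r z) (?v r z) * (2 * ?h r * ?g2 r z - 2 * \<Gamma> (?u r) (?u r) z)
        + pxx (?u r z) (?v r z) * \<Gamma> (?u r) (?u r) z + 2 * pxy (?u r z) (?v r z) * (?h r * \<Gamma> (?u r) (\<Gamma> (?u r)
          (?u r)) z)
        + pyy (?u r z) (?v r z) * ((?h r)\<^sup>2 * \<Gamma> (\<Gamma> (?u r) (?u r)) (\<Gamma> (?u r) (?u r)) z)"
      have J: "(?J has_real_derivative (\<integral>z. P r ?g z * ?Q r z \<partial>\<mu>)) (at r within {0..t})" if r: "r \<in> {0..t}"
        for r
      proof (rule poly2_dissipation[OF p f g r])
        fix r assume r: "r \<in> {0..t}"
        show "AE z in \<mu>. \<bar>?u r z\<bar> \<le> \<bar>a\<bar> + \<bar>b\<bar> + d" using uab[OF r] by eventually_elim (use d in auto)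
        show "AE z in \<mu>. \<bar>?v r z\<bar> \<le> \<bar>a\<bar> + \<bar>b\<bar> + d" using vd[OF r] by eventually_elim (use d in auto)
      qed
      have lower: "- (\<epsilon> * (Kg * CR)) \<le> (\<integral>z. P r ?g z * ?Q r z \<partial>\<mu>)" if r: "0 < r" "r < t" for r
      proof -
        have rT: "r \<in> {0..t}" using r by simp
        have pw: "AE z in \<mu>. - (\<epsilon> * Kg) * ?R r z \<le> P r ?g z * ?Q r z"
          using rect[OF rT] wg[OF rT] \<Gamma>_nonneg[OF uA(1)[OF rT]] \<Gamma>_nonneg[OF uA(2)[OF rT]] improved[OF rT]
            \<Gamma>_Cauchy_Schwarz[OF uA(1)[OF rT] uA(2)[OF rT]] bspec[OF CD uA(1)[OF rT]]
        proof eventually_elim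
          case (elim z)
          \<comment> \<open>For \<open>\<alpha> = 0\<close> the function \<open>?h\<close> vanishes
            at \<open>t\<close>, so the sign of the derivative is examined at interior times
            only.\<close>
          have hr: "0 < ?h r" using \<alpha> r by (intro h_fun_pos)
          have hK: "?h r \<le> Kh" using Kh[OF rT] by simp
          have xI: "?u r z \<in> I" using elim ab by auto
          have y0: "0 \<le> ?v r z" "?v r z \<le> d" using elim by auto
          have g2: "0 \<le> ?g2 r z" using elim(7) by simp
          note app = ap[of "?u r z" "?v r z"]
          have "- (\<epsilon> * ?R r z) \<le> ?Q r z"
            unfolding C1_def
          proof (rule dissipation_perturb[OF hr hK elim(3) y0(2) elim(4,5,6) g2,
            where My = "My (?u r z) (?v r z)" and Mxx = "Mxx (?u r z) (?v r z)"
            and Mxy = "Mxy (?u r z) (?v r z)" and Myy = "Myy (?u r z) (?v r z)"])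
            show "0 \<le> My (?u r z) (?v r z) * (2 * ?h r * ?g2 r z - 2 * \<Gamma> (?u r) (?u r) z) + Mxx (?u r z) (?v
              r z) * \<Gamma> (?u r) (?u r) z
              + 2 * Mxy (?u r z) (?v r z) * (?h r * \<Gamma> (?u r) (\<Gamma> (?u r) (?u r)) z) + Myy (?u r z) (?v r z) *
                ((?h r)\<^sup>2 * \<Gamma> (\<Gamma> (?u r) (?u r)) (\<Gamma> (?u r) (?u r)) z)"
            proof (rule dissipation_nonneg[OF hr elim(3-6) g2])
              show "0 \<le> My (?u r z) (?v r z)" using My xI y0 by blast
              show "0 \<le> v * v * (Mxx (?u r z) (?v r z) - 2 * My (?u r z) (?v r z)) + 2 * (v * w * Mxy (?u r
                z) (?v r z)) + w * w * (Myy (?u r z) (?v r z) + My (?u r z) (?v r z) / (2 * ?v r z))"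
                if "0 < \<Gamma> (?u r) (?u r) z" for v w
                by (rule B[OF xI]) (use that hr in simp)
            qed
          qed (use app elim \<epsilon> in auto)
          then have "P r ?g z * - (\<epsilon> * ?R r z) \<le> P r ?g z * ?Q r z" using elim(2)
            by (intro mult_left_mono) auto
          moreover have "P r ?g z * (\<epsilon> * ?R r z) \<le> Kg * (\<epsilon> * ?R r z)"
            using elim(2,3) g2 C1 \<epsilon> by (intro mult_right_mono) auto
          ultimately show ?case by (simp add: algebra_simps)
        qed
        have eu: "ess_bdd (?u r)" "ess_bdd (?v r)" using uA[OF rT] by (auto intro: A_ess_bdd)
        have e: "ess_bdd (\<lambda>z. py (?u r z) (?v r z))" "ess_bdd (\<lambda>z. pxx (?u r z) (?v r z))"
          "ess_bdd (\<lambda>z. pxy (?u r z) (?v r z))" "ess_bdd (\<lambda>z. pyy (?u r z) (?v r z))"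
            using poly2_ess_bdd[OF p eu] by blast+
        note b = A_ess_bdd[OF wA[OF rT]] A_ess_bdd[OF Gamma2_closed[OF uA(1)[OF rT]]]
          A_ess_bdd[OF uA(2)[OF rT]] A_ess_bdd[OF \<Gamma>_closed[OF uA(1)[OF rT] uA(2)[OF rT]]] A_ess_bdd[OF
            \<Gamma>_closed[OF uA(2)[OF rT] uA(2)[OF rT]]]
        have iQ: "integrable \<mu> (\<lambda>z. P r ?g z * ?Q r z)"
          by (rule ess_bdd_integrable) (intro ess_bdd_mult[OF b(1)] ess_bdd_intros b e)
        have "(\<integral>z. - (\<epsilon> * Kg) * ?R r z \<partial>\<mu>) \<le> (\<integral>z. P r ?g z * ?Q r z \<partial>\<mu>)"
          by (rule integral_mono_AE[OF integrable_A[OF A_scale[OF RA[OF rT]]] iQ pw])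
        moreover have "(\<integral>z. - (\<epsilon> * Kg) * ?R r z \<partial>\<mu>) = - (\<epsilon> * Kg) * (\<integral>z. ?R r z \<partial>\<mu>)"
          by (rule integral_mult_right_zero)
        moreover have "\<epsilon> * Kg * (\<integral>z. ?R r z \<partial>\<mu>) \<le> \<epsilon> * Kg * CR" using intR[OF rT] \<epsilon> Kg
          by (intro mult_left_mono) auto
        ultimately show ?thesis by (simp add: mult.assoc)
      qed
      \<comment> \<open>A linear term makes up for the negative lower bound on the
        derivative.\<close>
      have "?J s + \<epsilon> * (Kg * CR) * s \<le> ?J s' + \<epsilon> * (Kg * CR) * s'"
      proof (rule DERIV_nonneg_imp_increasing_open[OF st(2)])
        have "continuous_on {0..t} (\<lambda>r. ?J r + \<epsilon> * (Kg * CR) * r)"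
          by (intro continuous_intros DERIV_continuous_on[OF J])
        then show "continuous_on {s..s'} (\<lambda>r. ?J r + \<epsilon> * (Kg * CR) * r)"
          by (rule continuous_on_subset) (use st in auto)
        fix r assume r: "s < r" "r < s'"
        then have r': "0 < r" "r < t" "r \<in> {0..t}" using st by auto
        have "at r within {0..t} = at r" using r' by (simp add: at_within_Icc_at)
        then have "(?J has_real_derivative (\<integral>z. P r ?g z * ?Q r z \<partial>\<mu>)) (at r)" using J[OF r'(3)] by simp
        then have "((\<lambda>r. ?J r + \<epsilon> * (Kg * CR) * r) has_real_derivative (\<integral>z. P r ?g z * ?Q r z \<partial>\<mu>)
          + \<epsilon> * (Kg * CR)) (at r)"
          by (intro DERIV_add) (auto intro!: derivative_eq_intros)
        then show "\<exists>y. ((\<lambda>r. ?J r + \<epsilon> * (Kg * CR) * r) has_real_derivative y) (at r) \<and> 0 \<le> y"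
          using lower[OF r'(1,2)] by (intro exI conjI) auto
      qed
      moreover have "\<epsilon> * (Kg * CR) * s' - \<epsilon> * (Kg * CR) * s \<le> \<epsilon> * (Kg * CR) * t"
      proof -
        have "\<epsilon> * (Kg * CR) * (s' - s) \<le> \<epsilon> * (Kg * CR) * t" using \<epsilon> Kg CR st by (intro mult_left_mono) auto
        then show ?thesis by (simp add: right_diff_distrib)
      qed
      moreover have "\<bar>?J s - ?Jm s\<bar> \<le> \<epsilon> * Kg" "\<bar>?J s' - ?Jm s'\<bar> \<le> \<epsilon> * Kg" using st by (auto intro!: close)
      ultimately have "?Jm s \<le> ?Jm s' + \<epsilon> * (Kg * CR) * t + 2 * (\<epsilon> * Kg)" by linarith
      then show "?Jm s \<le> ?Jm s' + \<epsilon> * (Kg * CR * t + 2 * Kg)" by (simp add: algebra_simps)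
    qed
  qed
  have sT: "s \<in> {0..t}" "s' \<in> {0..t}" using st by auto
  note eP = P_ess_bdd[OF st(1) em[OF sT(1)]] P_ess_bdd[OF _ em[OF sT(2)], of s']
  have s'0: "0 \<le> s'" using st by simp
  have "AE z in \<mu>. 0 \<le> P s' (m s') z - P s (m s) z"
  proof (rule AE_nonneg_test)
    show "ess_bdd (\<lambda>z. P s' (m s') z - P s (m s) z)" using eP s'0 by (intro ess_bdd_diff) auto
    fix k assume k: "k \<in> A"
    let ?g = "\<lambda>z. k z * k z"
    have g: "?g \<in> A" by (rule A_mult[OF k k])
    have "(\<integral>z. ?g z * (P s' (m s') z - P s (m s) z) \<partial>\<mu>) = (\<integral>z. ?g z * P s' (m s') z - ?g z * P s (m s) z
      \<partial>\<mu>)" by (simp add: right_diff_distrib)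
    also have "\<dots> = (\<integral>z. ?g z * P s' (m s') z \<partial>\<mu>) - (\<integral>z. ?g z * P s (m s) z \<partial>\<mu>)"
      by (intro Bochner_Integration.integral_diff ess_bdd_integrable ess_bdd_mult[OF A_ess_bdd[OF g]] eP s'0)
    also have "(\<integral>z. ?g z * P s' (m s') z \<partial>\<mu>) = (\<integral>z. P s' ?g z * m s' z \<partial>\<mu>)"
      by (rule P_symmetric[OF s'0 square_int_ess_bdd[OF em[OF sT(2)]] A_square_int[OF g]])
    also have "(\<integral>z. ?g z * P s (m s) z \<partial>\<mu>) = (\<integral>z. P s ?g z * m s z \<partial>\<mu>)"
      by (rule P_symmetric[OF st(1) square_int_ess_bdd[OF em[OF sT(1)]] A_square_int[OF g]])
    finally show "0 \<le> (\<integral>z. ?g z * (P s' (m s') z - P s (m s) z) \<partial>\<mu>)" using main[OF k] by simp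
  qed
  then show "AE z in \<mu>. P s (m s) z \<le> P s' (m s') z" by eventually_elim simp
qed

end

section \<open>Monotonicity and convexity of \<open>M\<close>\<close>

lemma C2_mono_snd:
  assumes C2: "C2_partials I M Mx My Mxx Mxy Myy" and My: "\<forall>x\<in>I. \<forall>y\<ge>0. 0 \<le> My x y"
    and "x \<in> I" "0 \<le> y" "y \<le> y'"
  shows "M x y \<le> M x y'"
proof (cases "y = y'")
  case False
  have sub: "{y..y'} \<subseteq> {0..}" using assms by auto
  have "\<exists>\<xi>\<in>{y..y'}. M x y' - M x y = (y' - y) * My x \<xi>"
    by (rule mvt_within[OF _ sub, of "M x" "My x"]) (use C2 assms False in \<open>auto simp: C2_partials_def\<close>)
  then obtain \<xi> where "\<xi> \<in> {y..y'}" "M x y' - M x y = (y' - y) * My x \<xi>" by blast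
  moreover have "0 \<le> (y' - y) * My x \<xi>" using My assms \<open>\<xi> \<in> {y..y'}\<close> by simp
  ultimately show ?thesis by simp
qed simp

text \<open>Supporting lines serve twice: for convexity in the first argument, and for a lower bound
  on \<open>M\<close> that persists near end points missing from \<open>I\<close>.\<close>

lemma C2_tangent:
  assumes C2: "C2_partials I M Mx My Mxx Mxy Myy" and I: "is_interval I" and Mxx: "\<forall>x\<in>I. \<forall>y\<ge>0. 0 \<le> Mxx x y"
    and xI: "x \<in> I" "x' \<in> I" and y: "0 \<le> y"
  shows "M x y + Mx x y * (x' - x) \<le> M x' y"
proof -
  have sub: "{a..b} \<subseteq> I" if "a \<in> I" "b \<in> I" for a b
    using mem_is_interval_1_I[OF I that] by auto
  have D: "((\<lambda>s. M s y) has_real_derivative Mx a y) (at a within I)" "((\<lambda>s. Mx s y) has_real_derivative Mxx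
    a y) (at a within I)"
    if "a \<in> I" for a using C2 that y by (auto simp: C2_partials_def)
  have mono: "Mx a y \<le> Mx b y" if ab: "a \<in> I" "b \<in> I" "a \<le> b" for a b
  proof (cases "a = b")
    case False
    have "\<exists>\<xi>\<in>{a..b}. Mx b y - Mx a y = (b - a) * Mxx \<xi> y"
      by (rule mvt_within[OF _ sub[OF ab(1,2)]]) (use ab False D sub[OF ab(1,2)] in auto)
    then obtain \<xi> where \<xi>: "\<xi> \<in> {a..b}" "Mx b y - Mx a y = (b - a) * Mxx \<xi> y" by blast
    have "0 \<le> Mxx \<xi> y" using \<xi>(1) sub[OF ab(1,2)] Mxx y by blast
    then have "0 \<le> (b - a) * Mxx \<xi> y" using ab(3) by simp
    then show ?thesis using \<xi>(2) by simp
  qed simp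
  consider "x = x'" | "x < x'" | "x' < x" by linarith
  then show ?thesis
  proof cases
    case 2
    have "\<exists>\<xi>\<in>{x..x'}. M x' y - M x y = (x' - x) * Mx \<xi> y"
      by (rule mvt_within[OF 2 sub[OF xI]]) (use D sub[OF xI] in auto)
    then obtain \<xi> where \<xi>: "\<xi> \<in> {x..x'}" "M x' y - M x y = (x' - x) * Mx \<xi> y" by blast
    have "Mx x y \<le> Mx \<xi> y" using \<xi>(1) sub[OF xI] xI by (intro mono) auto
    then have "(x' - x) * Mx x y \<le> (x' - x) * Mx \<xi> y" using 2 by (intro mult_left_mono) auto
    then show ?thesis using \<xi>(2) by (simp add: mult.commute)
  next
    case 3
    have "\<exists>\<xi>\<in>{x'..x}. M x y - M x' y = (x - x') * Mx \<xi> y"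
      by (rule mvt_within[OF 3 sub[OF xI(2,1)]]) (use D sub[OF xI(2,1)] in auto)
    then obtain \<xi> where \<xi>: "\<xi> \<in> {x'..x}" "M x y - M x' y = (x - x') * Mx \<xi> y" by blast
    have "Mx \<xi> y \<le> Mx x y" using \<xi>(1) sub[OF xI(2,1)] xI by (intro mono) auto
    then have "(x - x') * Mx \<xi> y \<le> (x - x') * Mx x y" using 3 by (intro mult_left_mono) auto
    then show ?thesis using \<xi>(2) by (simp add: algebra_simps)
  qed simp
qed

lemma C2_convex_combination:
  assumes C2: "C2_partials I M Mx My Mxx Mxy Myy" and I: "is_interval I" and Mxx: "\<forall>x\<in>I. \<forall>y\<ge>0. 0 \<le> Mxx x y"
    and x: "x \<in> I" "x' \<in> I" and y: "0 \<le> y" and e: "0 \<le> e" "e \<le> 1"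
  shows "(1 - e) * x + e * x' \<in> I" "M ((1 - e) * x + e * x') y \<le> (1 - e) * M x y + e * M x' y"
proof -
  let ?w = "(1 - e) * x + e * x'"
  have "convex I" using I by (simp add: is_interval_convex_1)
  then have "(1 - e) *\<^sub>R x + e *\<^sub>R x' \<in> I" by (rule convexD_alt) (use x e in auto)
  then show w: "?w \<in> I" by simp
  have 1: "(1 - e) * (M ?w y + Mx ?w y * (x - ?w)) \<le> (1 - e) * M x y"
    using C2_tangent[OF C2 I Mxx w x(1) y] e by (intro mult_left_mono) auto
  have 2: "e * (M ?w y + Mx ?w y * (x' - ?w)) \<le> e * M x' y"
    using C2_tangent[OF C2 I Mxx w x(2) y] e by (intro mult_left_mono) auto
  have "(1 - e) * (M ?w y + Mx ?w y * (x - ?w)) + e * (M ?w y + Mx ?w y * (x' - ?w)) = M ?w y"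
    by (simp add: algebra_simps)
  with 1 2 show "M ?w y \<le> (1 - e) * M x y + e * M x' y" by linarith
qed

text \<open>The upper left entry of \<open>B\<close> gives \<open>Mxx \<ge> 2 * My \<ge> 0\<close>
  for positive \<open>y\<close>; the boundary \<open>y = 0\<close> follows by continuity.\<close>

lemma C2_Mxx_nonneg:
  assumes C2: "C2_partials I M Mx My Mxx Mxy Myy" and My: "\<forall>x\<in>I. \<forall>y\<ge>0. 0 \<le> My x y"
    and B: "\<And>x y. x \<in> I \<Longrightarrow> 0 < y \<Longrightarrow> 0 \<le> Mxx x y - 2 * My x y"
  shows "\<forall>x\<in>I. \<forall>y\<ge>0. 0 \<le> Mxx x y"
proof (intro ballI allI impI)
  fix x y :: real assume x: "x \<in> I" and y: "0 \<le> y"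
  have pos: "0 \<le> Mxx x y'" if "0 < y'" for y'
  proof -
    have "0 \<le> My x y'" using My x that by simp
    then show ?thesis using B[OF x that] by linarith
  qed
  have cont: "continuous_on (I \<times> {0..}) (\<lambda>(x, y). Mxx x y)" using C2 unfolding C2_partials_def by blast
  have "(\<lambda>n. y + 1 / real (Suc n)) \<longlonglongrightarrow> y + 0" by (intro tendsto_intros lim_1_over_n[THEN LIMSEQ_Suc])
  then have "(\<lambda>n. (x, y + 1 / real (Suc n))) \<longlonglongrightarrow> (x, y)" by (intro tendsto_Pair) auto
  from continuous_on_tendsto_compose[OF cont this] have "(\<lambda>n. Mxx x (y + 1 / real (Suc n))) \<longlonglongrightarrow> Mxx x y"
    using x y by simp
  then show "0 \<le> Mxx x y"
    by (rule LIMSEQ_le_const) (intro exI[of _ 0] allI impI pos add_nonneg_pos y, simp)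
qed

lemma abs_min_diff_le:
  fixes a b K N :: real
  assumes "- K \<le> a" "- K \<le> b" "0 \<le> N" shows "\<bar>min N a - min N b\<bar> \<le> 2 * (N + \<bar>K\<bar>)"
  using assms by (auto simp: min_def abs_if)

section \<open>End points missing from the interval\<close>

context markov_triple
begin

text \<open>Let \<open>i\<close> be the indicator of the set where \<open>P t f\<close> is not
  positive. By symmetry \<open>P t i * f\<close> has nonpositive integral, so \<open>P t i\<close>
  vanishes because \<open>f\<close> is positive. As \<open>P t 1 = 1\<close>, the integral of
  \<open>i\<close> equals that of \<open>P t i\<close>, which is 0.\<close>

lemma P_strictly_positive:
  assumes t: "0 \<le> t" and f: "ess_bdd f" and pos: "AE z in \<mu>. 0 < f z"
  shows "AE z in \<mu>. 0 < P t f z"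
proof -
  have sf: "square_int \<mu> f" by (rule square_int_ess_bdd[OF f])
  note [measurable] = P_measurable[OF t sf]
  let ?i = "\<lambda>z. indicator {z \<in> space \<mu>. P t f z \<le> 0} z :: real"
  have i: "ess_bdd ?i" by (rule ess_bddI[of _ 1]) auto
  note si = square_int_ess_bdd[OF i]
  have Pi: "AE z in \<mu>. 0 \<le> P t ?i z" by (rule P_positive[OF t si]) auto
  have int: "integrable \<mu> (\<lambda>z. P t ?i z * f z)" by (rule square_int_mult[OF P_L2[OF t si] sf])
  have "(\<integral>z. P t ?i z * f z \<partial>\<mu>) = (\<integral>z. ?i z * P t f z \<partial>\<mu>)" by (rule P_symmetric[OF t sf si, symmetric])
  also have "\<dots> \<le> (\<integral>z. 0 \<partial>\<mu>)"
    by (rule integral_mono[OF square_int_mult[OF si P_L2[OF t sf]]]) (auto simp: indicator_def)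
  finally have le: "(\<integral>z. P t ?i z * f z \<partial>\<mu>) \<le> 0" by simp
  have nn: "AE z in \<mu>. 0 \<le> P t ?i z * f z" using Pi pos by eventually_elim simp
  have "(\<integral>z. P t ?i z * f z \<partial>\<mu>) = 0" using le integral_nonneg_AE[OF nn] by simp
  then have "AE z in \<mu>. P t ?i z * f z = 0" using integral_nonneg_eq_0_iff_AE[OF int nn] by blast
  with pos have P0: "AE z in \<mu>. P t ?i z = 0" by eventually_elim simp
  have "(\<integral>z. ?i z * P t (\<lambda>_. 1) z \<partial>\<mu>) = (\<integral>z. P t ?i z * 1 \<partial>\<mu>)"
    by (rule P_symmetric[OF t A_square_int[OF A_one] si])
  also have "\<dots> = (\<integral>z. 0 \<partial>\<mu>)" using P0 P_measurable[OF t si] by (intro integral_cong_AE) auto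
  also have "(\<integral>z. ?i z * P t (\<lambda>_. 1) z \<partial>\<mu>) = (\<integral>z. ?i z \<partial>\<mu>)"
  proof (rule integral_cong_AE)
    show "AE z in \<mu>. ?i z * P t (\<lambda>_. 1) z = ?i z" using P_one[OF t] by eventually_elim simp
  qed (use P_measurable[OF t A_square_int[OF A_one]] in measurable)
  finally have "(\<integral>z. ?i z \<partial>\<mu>) = 0" by simp
  then have "AE z in \<mu>. ?i z = 0"
    by (subst (asm) integral_nonneg_eq_0_iff_AE) (use ess_bdd_integrable[OF i] in auto)
  then show ?thesis by (rule AE_mp) (auto intro!: AE_I2 simp: indicator_def split: if_splits)
qed

text \<open>If the infimum of \<open>f\<close> is missing from \<open>I\<close>, then
  \<open>f\<close> stays strictly above it, hence so does \<open>P t f\<close>, and some value of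
  \<open>f\<close> lies below \<open>P t f z\<close>. The same holds from above, and an interval
  contains what lies between two of its points.\<close>

lemma P_in_interval:
  assumes t: "0 \<le> t" and f: "f \<in> A" and fI: "f ` space \<mu> \<subseteq> I" and I: "is_interval I"
  shows "AE z in \<mu>. P t f z \<in> I"
proof -
  let ?S = "f ` space \<mu>"
  obtain K where K: "\<forall>z\<in>space \<mu>. \<bar>f z\<bar> \<le> K" using A_bounded[OF f] by blast
  have ne: "?S \<noteq> {}" using not_empty by simp
  have bb: "bdd_below ?S" using K by (intro bdd_belowI[of _ "- K"]) (auto simp: abs_le_iff)
  have ba: "bdd_above ?S" using K by (intro bdd_aboveI[of _ K]) (auto simp: abs_le_iff)
  note sf = A_square_int[OF f]
  have lo: "AE z in \<mu>. \<exists>x\<in>I. x \<le> P t f z"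
  proof (cases "Inf ?S \<in> I")
    case True
    have "AE z in \<mu>. Inf ?S \<le> P t f z" by (rule P_ge_const[OF t sf]) (use bb in \<open>auto intro!: AE_I2
      cInf_lower\<close>)
    then show ?thesis using True by (auto elim: eventually_mono)
  next
    case False
    have pos: "AE z in \<mu>. 0 < f z - Inf ?S"
    proof (rule AE_I2)
      fix z assume z: "z \<in> space \<mu>"
      then have "f z \<noteq> Inf ?S" using False fI by auto
      moreover have "Inf ?S \<le> f z" using z bb by (auto intro: cInf_lower)
      ultimately show "0 < f z - Inf ?S" by simp
    qed
    have "AE z in \<mu>. 0 < P t (\<lambda>z. f z - Inf ?S) z"
      by (rule P_strictly_positive[OF t A_ess_bdd[OF A_diff[OF f A_const]] pos])
    with P_diff[OF t sf A_square_int[OF A_const], of "Inf ?S"] P_const[OF t, of "Inf ?S"]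
    show ?thesis
    proof eventually_elim
      case (elim z)
      then have "Inf ?S < P t f z" by simp
      from cInf_lessD[OF ne this] show ?case using fI by (auto intro: less_imp_le)
    qed
  qed
  have hi: "AE z in \<mu>. \<exists>x\<in>I. P t f z \<le> x"
  proof (cases "Sup ?S \<in> I")
    case True
    have "AE z in \<mu>. P t f z \<le> Sup ?S" by (rule P_le_const[OF t sf]) (use ba in \<open>auto intro!: AE_I2
      cSup_upper\<close>)
    then show ?thesis using True by (auto elim: eventually_mono)
  next
    case False
    have pos: "AE z in \<mu>. 0 < Sup ?S - f z"
    proof (rule AE_I2)
      fix z assume z: "z \<in> space \<mu>"
      then have "f z \<noteq> Sup ?S" using False fI by auto
      moreover have "f z \<le> Sup ?S" using z ba by (auto intro: cSup_upper)
      ultimately show "0 < Sup ?S - f z" by simp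
    qed
    have "AE z in \<mu>. 0 < P t (\<lambda>z. Sup ?S - f z) z"
      by (rule P_strictly_positive[OF t A_ess_bdd[OF A_diff[OF A_const f]] pos])
    with P_diff[OF t A_square_int[OF A_const] sf, of "Sup ?S"] P_const[OF t, of "Sup ?S"]
    show ?thesis
    proof eventually_elim
      case (elim z)
      then have "P t f z < Sup ?S" by simp
      from less_cSupD[OF ne this] show ?case using fI by (auto intro: less_imp_le)
    qed
  qed
  show ?thesis using lo hi by eventually_elim (use mem_is_interval_1_I[OF I] in blast)
qed

text \<open>As left end point either \<open>x0 - \<delta>\<close> or a value of \<open>f\<close> is
  taken. In the second case \<open>?l\<close> lies strictly between the infimum of \<open>f\<close>
  and \<open>x0\<close>, so some value of \<open>f\<close> lies below \<open>?l\<close>. The right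
  end point is symmetric.\<close>

lemma shrink_into_compact:
  assumes f: "f \<in> A" and fI: "f ` space \<mu> \<subseteq> I" and x0: "x0 \<in> interior I" and e: "0 < e" "e \<le> 1"
    and I: "is_interval I"
  shows "\<exists>a b. {a..b} \<subseteq> I \<and> a < b \<and> (\<forall>z\<in>space \<mu>. (1 - e) * f z + e * x0 \<in> {a..b})"
proof -
  let ?S = "f ` space \<mu>"
  obtain K where K: "\<forall>z\<in>space \<mu>. \<bar>f z\<bar> \<le> K" using A_bounded[OF f] by blast
  have ne: "?S \<noteq> {}" using not_empty by simp
  have bb: "bdd_below ?S" using K by (intro bdd_belowI[of _ "- K"]) (auto simp: abs_le_iff)
  have ba: "bdd_above ?S" using K by (intro bdd_aboveI[of _ K]) (auto simp: abs_le_iff)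
  obtain \<delta> where \<delta>: "0 < \<delta>" "cball x0 \<delta> \<subseteq> I" using x0 unfolding mem_interior_cball by blast
  have \<delta>I: "x0 - \<delta> \<in> I" "x0 + \<delta> \<in> I" using \<delta> by (auto simp: dist_real_def)
  let ?l = "(1 - e) * Inf ?S + e * x0" and ?u = "(1 - e) * Sup ?S + e * x0"
  have l: "?l \<le> (1 - e) * f z + e * x0" if "z \<in> space \<mu>" for z
    using e cInf_lower[OF imageI[OF that] bb] by (intro add_right_mono mult_left_mono) auto
  have u: "(1 - e) * f z + e * x0 \<le> ?u" if "z \<in> space \<mu>" for z
    using e cSup_upper[OF imageI[OF that] ba] by (intro add_right_mono mult_left_mono) auto
  have "\<exists>a\<in>I. a < x0 \<and> a \<le> ?l"
  proof (cases "x0 - \<delta> \<le> ?l")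
    case True
    then show ?thesis using \<delta> \<delta>I by (intro bexI[of _ "x0 - \<delta>"]) auto
  next
    case False
    then have lx: "?l < x0" using \<delta> by simp
    then have "(1 - e) * (Inf ?S - x0) < 0" by (simp add: algebra_simps)
    then have "Inf ?S < x0" using e by (simp add: mult_less_0_iff)
    then have "0 < e * (x0 - Inf ?S)" using e by simp
    then have "Inf ?S < ?l" by (simp add: algebra_simps)
    from cInf_lessD[OF ne this] obtain z where "z \<in> space \<mu>" "f z < ?l" by auto
    then show ?thesis using fI lx by (intro bexI[of _ "f z"]) auto
  qed
  then obtain a where a: "a \<in> I" "a < x0" "a \<le> ?l" by blast
  have "\<exists>b\<in>I. x0 < b \<and> ?u \<le> b"
  proof (cases "?u \<le> x0 + \<delta>")
    case True
    then show ?thesis using \<delta> \<delta>I by (intro bexI[of _ "x0 + \<delta>"]) auto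
  next
    case False
    then have lx: "x0 < ?u" using \<delta> by simp
    then have "0 < (1 - e) * (Sup ?S - x0)" by (simp add: algebra_simps)
    then have "x0 < Sup ?S" using e by (simp add: zero_less_mult_iff)
    then have "0 < e * (Sup ?S - x0)" using e by simp
    then have "?u < Sup ?S" by (simp add: algebra_simps)
    from less_cSupD[OF ne this] obtain z where "z \<in> space \<mu>" "?u < f z" by auto
    then show ?thesis using fI lx by (intro bexI[of _ "f z"]) auto
  qed
  then obtain b where b: "b \<in> I" "x0 < b" "?u \<le> b" by blast
  have "(1 - e) * f z + e * x0 \<in> {a..b}" if "z \<in> space \<mu>" for z using l[OF that] u[OF that] a b by auto
  then show ?thesis using a b mem_is_interval_1_I[OF I a(1) b(1)] by (intro exI[of _ a] exI[of _ b]) auto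
qed

lemma P_affine:
  assumes "f \<in> A" "0 \<le> r"
  shows "AE z in \<mu>. P r (\<lambda>z. a * f z + b) z = a * P r f z + b"
    and "AE z in \<mu>. \<Gamma> (P r (\<lambda>z. a * f z + b)) (P r (\<lambda>z. a * f z + b)) z = a\<^sup>2 * \<Gamma> (P r f) (P r f) z"
proof -
  have 1: "AE z in \<mu>. P r (\<lambda>z. a * f z + b * 1) z = a * P r f z + b * P r (\<lambda>_. 1) z"
    by (rule P_lin[OF assms(2) A_square_int[OF assms(1)] A_square_int[OF A_one]])
  with P_one[OF assms(2)] show 2: "AE z in \<mu>. P r (\<lambda>z. a * f z + b) z = a * P r f z + b"
    by eventually_elim simp
  let ?F = "\<lambda>z. a * f z + b" and ?G = "\<lambda>z. a * P r f z + b * 1"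
  have F: "?F \<in> A" using A_lin[OF assms(1) A_one, of a b] by simp
  have Pf: "P r f \<in> A" using assms by (intro P_closed)
  have G: "?G \<in> A" by (rule A_lin[OF Pf A_one])
  have PF: "P r ?F \<in> A" using F assms(2) by (intro P_closed)
  have 3: "AE z in \<mu>. P r ?F z = ?G z" using 2 by simp
  show "AE z in \<mu>. \<Gamma> (P r ?F) (P r ?F) z = a\<^sup>2 * \<Gamma> (P r f) (P r f) z"
    using \<Gamma>_cong[OF PF G PF G 3 3] \<Gamma>_square_lin[OF Pf A_one, of a b] \<Gamma>_const[OF Pf, of 1] \<Gamma>_sym[OF Pf A_one]
      \<Gamma>_const[OF A_one, of 1]
    by eventually_elim simp
qed

text \<open>Shrinking \<open>f\<close> towards \<open>x0\<close> leads to the compact case. On the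
  left the limit is taken for the truncations by \<open>min N\<close>, which are dominated. On the
  right \<open>M\<close> may be unbounded and domination is lacking; there convexity bounds the
  composition for the shrunk function by that for \<open>f\<close>, up to
  \<open>e n * K2\<close>.\<close>

lemma H_mono:
  assumes CD: "\<forall>f\<in>A. AE z in \<mu>. \<rho> * \<Gamma> f f z \<le> Gamma2 \<Gamma> L f f z"
    and C2: "C2_partials I M Mx My Mxx Mxy Myy" and I: "is_interval I" "interior I \<noteq> {}"
    and My: "\<forall>x\<in>I. \<forall>y\<ge>0. 0 \<le> My x y"
    and B: "\<And>x y v w. x \<in> I \<Longrightarrow> 0 < y \<Longrightarrow> 0 \<le> v * v * (Mxx x y - 2 * My x y) + 2 * (v * w * Mxy x y)
      + w * w * (Myy x y + My x y / (2 * y))"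
    and f: "f \<in> A" and fI: "f ` space \<mu> \<subseteq> I"
    and \<alpha>: "0 \<le> \<alpha>" and st: "0 \<le> s" "s \<le> s'" "s' \<le> t"
  shows "AE z in \<mu>. H_fun \<Gamma> P I M \<rho> t \<alpha> f s z \<le> H_fun \<Gamma> P I M \<rho> t \<alpha> f s' z"
proof -
  let ?u = "\<lambda>r. P (t - r) f" and ?h = "h_fun \<rho> t \<alpha>"
  let ?v = "\<lambda>r z. ?h r * \<Gamma> (?u r) (?u r) z"
  let ?m = "\<lambda>r. compose_on I M (?u r) (?v r)"
  obtain x0 where x0: "x0 \<in> interior I" using I(2) by blast
  then have x0I: "x0 \<in> I" using interior_subset by blast
  have Mxx: "\<forall>x\<in>I. \<forall>y\<ge>0. 0 \<le> Mxx x y" by (rule C2_Mxx_nonneg[OF C2 My]) (use B[of _ _ 1 0] in simp)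
  define e where "e n = 1 / (real n + 2)" for n :: nat
  have e: "0 < e n" "e n < 1" for n by (simp_all add: e_def)
  have e_lim: "e \<longlonglongrightarrow> 0" unfolding e_def using LIMSEQ_ignore_initial_segment[OF lim_1_over_n[where 'a
    = real], of 2] by (simp add: add.commute)
  let ?F = "\<lambda>n z. (1 - e n) * f z + e n * x0"
  have F: "?F n \<in> A" for n using A_lin[OF f A_one, of "1 - e n" "e n * x0"] by simp
  let ?mn = "\<lambda>n r. compose_on I M (P (t - r) (?F n)) (\<lambda>z. ?h r * \<Gamma> (P (t - r) (?F n)) (P (t - r) (?F n)) z)"
  have sT: "s \<in> {0..t}" "s' \<in> {0..t}" using st by auto
  have h0: "0 \<le> ?h r" if "r \<in> {0..t}" for r using that \<alpha> by (intro h_fun_nonneg) auto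
  have uA: "?u r \<in> A" "?v r \<in> A" if "r \<in> {0..t}" for r
    using f that by (auto intro!: \<Gamma>_closed P_closed A_scale)
  have uI: "AE z in \<mu>. ?u r z \<in> I" if "r \<in> {0..t}" for r
    by (rule P_in_interval[OF _ f fI I(1)]) (use that in auto)
  have v0: "AE z in \<mu>. 0 \<le> ?v r z" if "r \<in> {0..t}" for r
    using \<Gamma>_nonneg[OF uA(1)[OF that]] by eventually_elim (use h0[OF that] in simp)
  have mm: "?m r \<in> borel_measurable \<mu>" if "r \<in> {0..t}" for r
    by (rule compose_on_measurable[OF C2_partials_continuous[OF C2] I(1) A_measurable[OF uA(1)[OF that]]
      A_measurable[OF uA(2)[OF that]]])
  have mv: "AE z in \<mu>. ?m r z = M (?u r z) (?v r z)" if "r \<in> {0..t}" for r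
    using uI[OF that] v0[OF that] by eventually_elim (simp add: compose_on_def)
  have mnv: "AE z in \<mu>. \<forall>n. ?mn n r z = M ((1 - e n) * ?u r z + e n * x0) ((1 - e n)\<^sup>2 * ?v r z)"
    if r: "r \<in> {0..t}" for r
    unfolding AE_all_countable
  proof
    fix n
    have tr: "0 \<le> t - r" using r by simp
    show "AE z in \<mu>. ?mn n r z = M ((1 - e n) * ?u r z + e n * x0) ((1 - e n)\<^sup>2 * ?v r z)"
      using P_affine(1)[OF f tr, of "1 - e n" "e n * x0"] P_affine(2)[OF f tr, of "1 - e n"
        "e n * x0"] uI[OF r] v0[OF r]
    proof eventually_elim
      case (elim z)
      have "(1 - e n) * ?u r z + e n * x0 \<in> I" by (rule C2_convex_combination(1)[OF C2 I(1) Mxx elim(3) x0I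
        order_refl]) (use e[of n] in auto)
      moreover have eq: "?h r * ((1 - e n)\<^sup>2 * \<Gamma> (?u r) (?u r) z) = (1 - e n)\<^sup>2 * ?v r z" by simp
      moreover have "0 \<le> (1 - e n)\<^sup>2 * ?v r z" using elim(4) by simp
      ultimately show ?case unfolding compose_on_def elim(1,2) eq by simp
    qed
  qed
  have cpt: "\<exists>a b. {a..b} \<subseteq> I \<and> a < b \<and> (AE z in \<mu>. ?F n z \<in> {a..b})" for n
  proof -
    obtain a b where "{a..b} \<subseteq> I" "a < b" "\<forall>z\<in>space \<mu>. ?F n z \<in> {a..b}"
      using shrink_into_compact[OF f fI x0 e(1)[of n] _ I(1)] e(2)[of n] by auto
    then show ?thesis by (intro exI[of _ a] exI[of _ b]) (auto intro!: AE_I2)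
  qed
  have emn: "ess_bdd (?mn n r)" if "r \<in> {0..t}" for n r
    using cpt[of n] H_mono_compact(1)[OF CD C2 I(1) My B _ _ F _ \<alpha> st that] by blast
  have mono: "AE z in \<mu>. P s (?mn n s) z \<le> P s' (?mn n s') z" for n
    using cpt[of n] H_mono_compact(2)[OF CD C2 I(1) My B _ _ F _ \<alpha> st] by blast
  obtain c where c: "0 \<le> c" "AE z in \<mu>. \<bar>f z\<bar> \<le> c" using A_ess_bdd[OF f] by (rule ess_bddE)
  have uc: "AE z in \<mu>. \<bar>?u r z\<bar> \<le> c" if "r \<in> {0..t}" for r
    by (rule P_abs_bound[OF _ A_square_int[OF f] c(2)]) (use that in auto)
  \<comment> \<open>From the supporting line at \<open>(x0, 0)\<close> and monotonicity in
    \<open>y\<close>: a lower bound for \<open>M\<close> over all arguments that occur.\<close>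
  define K where "K = \<bar>M x0 0\<bar> + \<bar>Mx x0 0\<bar> * (c + \<bar>x0\<bar>)"
  have below: "- K \<le> M x y" if "x \<in> I" "0 \<le> y" "\<bar>x - x0\<bar> \<le> c + \<bar>x0\<bar>" for x y
  proof -
    have "\<bar>Mx x0 0 * (x - x0)\<bar> \<le> \<bar>Mx x0 0\<bar> * (c + \<bar>x0\<bar>)" unfolding abs_mult using that
      by (intro mult_left_mono) auto
    moreover have "M x0 0 + Mx x0 0 * (x - x0) \<le> M x 0" by (rule C2_tangent[OF C2 I(1) Mxx x0I that(1)]) simp
    moreover have "M x 0 \<le> M x y" by (rule C2_mono_snd[OF C2 My that(1) _ that(2)]) simp
    ultimately show ?thesis unfolding K_def by linarith
  qed
  have mK: "AE z in \<mu>. - K \<le> ?m r z" if r: "r \<in> {0..t}" for r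
    using mv[OF r] uI[OF r] v0[OF r] uc[OF r]
  proof eventually_elim
    case (elim z)
    have "\<bar>?u r z - x0\<bar> \<le> c + \<bar>x0\<bar>"
      by (rule order_trans[OF abs_triangle_ineq4]) (use elim(4) in simp)
    then show ?case unfolding elim(1) using elim(2,3) by (intro below)
  qed
  have mnK: "AE z in \<mu>. \<forall>n. - K \<le> ?mn n r z" if r: "r \<in> {0..t}" for r
    using mnv[OF r] uI[OF r] v0[OF r] uc[OF r]
  proof eventually_elim
    case (elim z)
    show ?case
    proof
      fix n
      have "(1 - e n) * ?u r z + e n * x0 \<in> I" by (rule C2_convex_combination(1)[OF C2 I(1) Mxx elim(2) x0I
        order_refl]) (use e[of n] in auto)
      moreover have "\<bar>(1 - e n) * ?u r z + e n * x0 - x0\<bar> \<le> c + \<bar>x0\<bar>"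
      proof -
        have "(1 - e n) * ?u r z + e n * x0 - x0 = (1 - e n) * (?u r z - x0)" by (simp add: algebra_simps)
        also have "\<bar>(1 - e n) * (?u r z - x0)\<bar> \<le> 1 * \<bar>?u r z - x0\<bar>" unfolding abs_mult using e[of n]
          by (intro mult_right_mono) auto
        also have "1 * \<bar>?u r z - x0\<bar> \<le> c + \<bar>x0\<bar>"
          unfolding mult_1 by (rule order_trans[OF abs_triangle_ineq4]) (use elim(4) in simp)
        finally show ?thesis .
      qed
      ultimately show "- K \<le> ?mn n r z" unfolding elim(1)[rule_format] using elim(3) e[of n]
        by (intro below) auto
    qed
  qed
  obtain d where d: "0 \<le> d" "AE z in \<mu>. \<bar>?v s' z\<bar> \<le> d" using A_ess_bdd[OF uA(2)[OF sT(2)]] by (rule ess_bddE)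
  \<comment> \<open>Bounds the contribution of \<open>x0\<close> to the convex combination, with
    \<open>y\<close> replaced by its upper bound \<open>d\<close>.\<close>
  define K2 where "K2 = M x0 d"
  have upper: "AE z in \<mu>. \<forall>n. ?mn n s' z \<le> (1 - e n) * ?m s' z + e n * K2"
    using mnv[OF sT(2)] mv[OF sT(2)] uI[OF sT(2)] v0[OF sT(2)] d(2)
  proof eventually_elim
    case (elim z)
    show ?case
    proof
      fix n
      let ?x = "(1 - e n) * ?u s' z + e n * x0" and ?y = "?v s' z"
      have e01: "0 \<le> e n" "e n \<le> 1" using e[of n] by simp_all
      have x: "?x \<in> I" by (rule C2_convex_combination(1)[OF C2 I(1) Mxx elim(3) x0I order_refl e01])
      have "(1 - e n)\<^sup>2 \<le> 1" using e01 by (intro power_le_one) auto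
      then have "(1 - e n)\<^sup>2 * ?y \<le> 1 * ?y" using elim(4) by (rule mult_right_mono)
      then have "M ?x ((1 - e n)\<^sup>2 * ?y) \<le> M ?x ?y" using elim(4) by (intro C2_mono_snd[OF C2 My x]) auto
      also have "\<dots> \<le> (1 - e n) * M (?u s' z) ?y + e n * M x0 ?y"
        by (rule C2_convex_combination(2)[OF C2 I(1) Mxx elim(3) x0I elim(4) e01])
      also have "M x0 ?y \<le> K2" unfolding K2_def using elim(4,5) by (intro C2_mono_snd[OF C2 My x0I]) auto
      finally show "?mn n s' z \<le> (1 - e n) * ?m s' z + e n * K2"
        unfolding elim(1)[rule_format] elim(2) using e01 by (simp add: mult_left_mono)
    qed
  qed
  let ?\<phi> = "\<lambda>N z. min (real N) (?m s z)" and ?\<phi>n = "\<lambda>N n z. min (real N) (?mn n s z)"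
    and ?\<psi> = "\<lambda>j z. min (real j) (?m s' z)"
  have min_bdd: "ess_bdd (\<lambda>z. min (real N) (?m r z))" if r: "r \<in> {0..t}" for N :: nat and r
  proof (rule ess_bddI[of _ "real N + \<bar>K\<bar>"])
    show "(\<lambda>z. min (real N) (?m r z)) \<in> borel_measurable \<mu>" using mm[OF r] by measurable
    show "AE z in \<mu>. \<bar>min (real N) (?m r z)\<bar> \<le> real N + \<bar>K\<bar>" using mK[OF r] by eventually_elim auto
  qed
  have \<phi>n: "ess_bdd (?\<phi>n N n)" for N n by (intro ess_bdd_min ess_bdd_const emn sT)
  have s'0: "0 \<le> s'" using st by simp
  have right: "AE z in \<mu>. \<exists>j::nat. P s' (?mn n s') z \<le> (1 - e n) * P s' (?\<psi> j) z + e n * K2" for n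
  proof -
    obtain Bn where Bn: "0 \<le> Bn" "AE z in \<mu>. \<bar>?mn n s' z\<bar> \<le> Bn" using emn[OF sT(2), of n] by (rule ess_bddE)
    \<comment> \<open>For fixed \<open>n\<close> the shrunk composition is bounded, so the estimate
      \<open>upper\<close> survives truncation of \<open>?m s'\<close> at a sufficiently high
      level.\<close>
    obtain j :: nat where j: "(Bn + \<bar>K2\<bar>) / (1 - e n) < real j" using reals_Archimedean2 by blast
    then have j': "Bn + \<bar>K2\<bar> \<le> (1 - e n) * real j" using e[of n]
      by (simp add: pos_divide_less_eq mult.commute)
    note ej = min_bdd[OF sT(2), of j]
    have "AE z in \<mu>. ?mn n s' z \<le> (1 - e n) * ?\<psi> j z + e n * K2 * 1"
      using upper Bn(2)
    proof eventually_elim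
      case (elim z)
      show ?case
      proof (cases "?m s' z \<le> real j")
        case True
        then show ?thesis using spec[OF elim(1), of n] by (simp add: min_def)
      next
        case False
        have "\<bar>e n * K2\<bar> \<le> 1 * \<bar>K2\<bar>" unfolding abs_mult using e[of n] by (intro mult_right_mono) auto
        then show ?thesis using False j' elim(2) by (simp add: min_def)
      qed
    qed
    from P_mono[OF s'0 square_int_ess_bdd[OF emn[OF sT(2)]] square_int_lin[OF square_int_ess_bdd[OF ej]
      A_square_int[OF A_one]] this]
      P_lin[OF s'0 square_int_ess_bdd[OF ej] A_square_int[OF A_one], of "1 - e n" "e n * K2"] P_one[OF s'0]
    show ?thesis by eventually_elim (auto intro!: exI[of _ j])
  qed
  have left: "AE z in \<mu>. P s (?\<phi>n N n) z \<le> P s (?mn n s) z" for N n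
    by (rule P_mono[OF st(1) square_int_ess_bdd[OF \<phi>n] square_int_ess_bdd[OF emn[OF sT(1)]]]) simp
  have ptw: "AE z in \<mu>. (\<lambda>n. ?\<phi>n N n z) \<longlonglongrightarrow> ?\<phi> N z" for N
    using mnv[OF sT(1)] mv[OF sT(1)] uI[OF sT(1)] v0[OF sT(1)]
  proof eventually_elim
    case (elim z)
    have "(\<lambda>n. (1 - e n) * ?u s z + e n * x0) \<longlonglongrightarrow> (1 - 0) * ?u s z + 0 * x0" by (intro tendsto_intros e_lim)
    moreover have "(\<lambda>n. (1 - e n)\<^sup>2 * ?v s z) \<longlonglongrightarrow> (1 - 0)\<^sup>2 * ?v s z" by (intro tendsto_intros e_lim)
    ultimately have lim: "(\<lambda>n. ((1 - e n) * ?u s z + e n * x0, (1 - e n)\<^sup>2 * ?v s z)) \<longlonglongrightarrow> (?u s z, ?v s z)"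
      by (intro tendsto_Pair) simp_all
    have "(1 - e n) * ?u s z + e n * x0 \<in> I" for n
      by (rule C2_convex_combination(1)[OF C2 I(1) Mxx elim(3) x0I order_refl]) (use e[of n] in auto)
    then have ev: "\<forall>\<^sub>F n in sequentially. ((1 - e n) * ?u s z + e n * x0, (1 - e n)\<^sup>2 * ?v s z) \<in> I \<times> {0..}"
      using elim(4) by (intro always_eventually) simp
    have "(\<lambda>n. M ((1 - e n) * ?u s z + e n * x0) ((1 - e n)\<^sup>2 * ?v s z)) \<longlonglongrightarrow> M (?u s z) (?v s z)"
      using continuous_on_tendsto_compose[OF C2_partials_continuous[OF C2] lim _ ev] elim(3,4) by simp
    then have "(\<lambda>n. min (real N) (M ((1 - e n) * ?u s z + e n * x0) ((1 - e n)\<^sup>2 * ?v s z)))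
      \<longlonglongrightarrow> min (real N) (M (?u s z) (?v s z))"
      by (intro tendsto_min tendsto_const)
    then show ?case unfolding elim(1)[rule_format] elim(2) .
  qed
  have L2lim: "(\<lambda>n. \<integral>z. (?\<phi>n N n z - ?\<phi> N z)\<^sup>2 \<partial>\<mu>) \<longlonglongrightarrow> (\<integral>z. 0 \<partial>\<mu>)" for N
  proof (rule integral_dominated_convergence[of _ _ _ "\<lambda>_. (2 * (real N + \<bar>K\<bar>))\<^sup>2"])
    show "(\<lambda>z. (?\<phi>n N n z - ?\<phi> N z)\<^sup>2) \<in> borel_measurable \<mu>" for n
      using ess_bdd_measurable[OF \<phi>n] ess_bdd_measurable[OF min_bdd[OF sT(1)]] by measurable
    show "AE z in \<mu>. (\<lambda>n. (?\<phi>n N n z - ?\<phi> N z)\<^sup>2) \<longlonglongrightarrow> 0"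
      using ptw[of N]
    proof eventually_elim
      case (elim z)
      have "(\<lambda>n. (?\<phi>n N n z - ?\<phi> N z)\<^sup>2) \<longlonglongrightarrow> (?\<phi> N z - ?\<phi> N z)\<^sup>2" by (intro tendsto_intros elim)
      then show ?case by simp
    qed
    show "AE z in \<mu>. norm ((?\<phi>n N n z - ?\<phi> N z)\<^sup>2) \<le> (2 * (real N + \<bar>K\<bar>))\<^sup>2" for n
      using mK[OF sT(1)] mnK[OF sT(1)]
    proof eventually_elim
      case (elim z)
      have "\<bar>?\<phi>n N n z - ?\<phi> N z\<bar> \<le> 2 * (real N + \<bar>K\<bar>)"
        by (rule abs_min_diff_le[OF spec[OF elim(2), of n] elim(1)]) simp
      then have "\<bar>?\<phi>n N n z - ?\<phi> N z\<bar>\<^sup>2 \<le> (2 * (real N + \<bar>K\<bar>))\<^sup>2" by (rule power_mono) simp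
      then show ?case by simp
    qed
  qed simp_all
  have ext: "AE z in \<mu>. semigroup_ext P r (?m r) z = (SUP n::nat. ereal (P r (\<lambda>z. min (real n) (?m r z))
    z))" if r: "r \<in> {0..t}" for r
    by (rule semigroup_ext_bdd_below[OF _ mm[OF r] mK[OF r]]) (use r in auto)
  have "AE z in \<mu>. \<forall>N::nat. ereal (P s (?\<phi> N) z) \<le> semigroup_ext P s' (?m s') z"
    unfolding AE_all_countable
  proof
    fix N :: nat
    \<comment> \<open>L2 convergence of the truncations survives \<open>P s\<close> by contraction;
      a subsequence of the images then converges almost everywhere.\<close>
    have PL1: "(\<lambda>n. \<integral>z. norm (P s (\<lambda>z. ?\<phi>n N n z - ?\<phi> N z) z) \<partial>\<mu>) \<longlonglongrightarrow> 0"
    proof -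
      have sd: "square_int \<mu> (\<lambda>z. ?\<phi>n N n z - ?\<phi> N z)" for n
        by (intro square_int_ess_bdd ess_bdd_diff \<phi>n min_bdd sT)
      have "(\<lambda>n. \<integral>z. (P s (\<lambda>z. ?\<phi>n N n z - ?\<phi> N z) z)\<^sup>2 \<partial>\<mu>) \<longlonglongrightarrow> 0"
      proof (rule tendsto_sandwich[OF _ _ tendsto_const])
        show "\<forall>\<^sub>F n in sequentially. (\<integral>z. (P s (\<lambda>z. ?\<phi>n N n z - ?\<phi> N z) z)\<^sup>2 \<partial>\<mu>) \<le> (\<integral>z. (?\<phi>n N n z
          - ?\<phi> N z)\<^sup>2 \<partial>\<mu>)"
          using P_sq_contraction[OF st(1) sd] by simp
        show "(\<lambda>n. \<integral>z. (?\<phi>n N n z - ?\<phi> N z)\<^sup>2 \<partial>\<mu>) \<longlonglongrightarrow> 0" using L2lim[of N] by simp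
      qed simp
      then show ?thesis unfolding real_norm_def
        by (intro L1_of_L2_tendsto always_eventually allI P_L2[OF st(1)] sd)
    qed
    have Pint: "integrable \<mu> (P s (\<lambda>z. ?\<phi>n N n z - ?\<phi> N z))" for n
      by (intro square_int_integrable P_L2[OF st(1)] square_int_ess_bdd ess_bdd_diff \<phi>n min_bdd sT)
    obtain q :: "nat \<Rightarrow> nat" where q: "strict_mono q" "AE z in \<mu>. (\<lambda>n. P s (\<lambda>z. ?\<phi>n N (q n) z - ?\<phi> N z) z) \<longlonglongrightarrow> 0"
      using tendsto_L1_AE_subseq[OF Pint PL1] by blast
    have a1: "AE z in \<mu>. \<forall>n. P s (\<lambda>z. ?\<phi>n N n z - ?\<phi> N z) z = P s (?\<phi>n N n) z - P s (?\<phi> N) z"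
      unfolding AE_all_countable
      by (intro allI P_diff[OF st(1)] square_int_ess_bdd \<phi>n min_bdd sT)
    have a2: "AE z in \<mu>. \<forall>n. \<exists>j::nat. P s (?\<phi>n N n) z \<le> (1 - e n) * P s' (?\<psi> j) z + e n * K2"
      unfolding AE_all_countable
    proof
      fix n
      show "AE z in \<mu>. \<exists>j::nat. P s (?\<phi>n N n) z \<le> (1 - e n) * P s' (?\<psi> j) z + e n * K2"
        using left[of N n] mono[of n] right[of n]
      proof eventually_elim
        case (elim z)
        then obtain j :: nat where "P s' (?mn n s') z \<le> (1 - e n) * P s' (?\<psi> j) z + e n * K2" by blast
        then show ?case using elim(1,2) by (intro exI[of _ j]) linarith
      qed
    qed
    show "AE z in \<mu>. ereal (P s (?\<phi> N) z) \<le> semigroup_ext P s' (?m s') z"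
      using q(2) a1 a2 ext[OF sT(2)]
    proof eventually_elim
      case (elim z)
      let ?Y = "SUP n::nat. ereal (P s' (?\<psi> n) z)"
      have le: "ereal (P s' (?\<psi> n) z) \<le> ?Y" for n by (rule SUP_upper) simp
      show ?case
      \<comment> \<open>\<open>?Y\<close> is the value of the extended semigroup and may be
        infinite, in which case the claim is trivial.\<close>
      proof (cases ?Y)
        case (real y)
        have yj: "P s' (?\<psi> j) z \<le> y" for j using le[of j] unfolding real by simp
        have bound: "P s (?\<phi>n N n) z \<le> (1 - e n) * y + e n * K2" for n
        proof -
          obtain j :: nat where "P s (?\<phi>n N n) z \<le> (1 - e n) * P s' (?\<psi> j) z + e n * K2"
            using spec[OF elim(3), of n] by blast
          moreover have "(1 - e n) * P s' (?\<psi> j) z \<le> (1 - e n) * y" using yj e[of n]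
            by (intro mult_left_mono) auto
          ultimately show ?thesis by linarith
        qed
        have "(\<lambda>n. P s (?\<phi>n N (q n)) z - P s (?\<phi> N) z) \<longlonglongrightarrow> 0" using elim(1) unfolding elim(2)[rule_format] .
        from tendsto_add[OF this tendsto_const[of "P s (?\<phi> N) z"]] have l1: "(\<lambda>n. P s (?\<phi>n N (q n)) z)
          \<longlonglongrightarrow> P s (?\<phi> N) z" by simp
        have eq: "(\<lambda>n. e (q n)) \<longlonglongrightarrow> 0" using LIMSEQ_subseq_LIMSEQ[OF e_lim q(1)] by (simp add: o_def)
        have "(\<lambda>n. (1 - e (q n)) * y + e (q n) * K2) \<longlonglongrightarrow> (1 - 0) * y + 0 * K2" by (intro tendsto_intros eq)
        then have l2: "(\<lambda>n. (1 - e (q n)) * y + e (q n) * K2) \<longlonglongrightarrow> y" by simp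
        have "P s (?\<phi> N) z \<le> y" by (rule LIMSEQ_le[OF l1 l2]) (use bound in auto)
        then show ?thesis unfolding elim(4) real by simp
      next
        case MInf
        then show ?thesis using le[of 0] by simp
      qed (use elim(4) in simp)
    qed
  qed
  with ext[OF sT(1)] show ?thesis
    unfolding H_fun_def by eventually_elim (auto intro: SUP_least)
qed

text \<open>The two sides of the inequality are the values of \<open>H_fun\<close> at the times 0
  and \<open>t\<close>, since \<open>P 0\<close> is the identity almost everywhere and
  \<open>h_fun \<rho> t \<alpha> t = \<alpha>\<close>.\<close>

lemma star_ineq_of_H_mono:
  assumes C2: "C2_partials I M Mx My Mxx Mxy Myy" and I: "is_interval I" and t: "0 \<le> t" and \<alpha>: "0 \<le> \<alpha>"
    and mono: "\<And>f. f \<in> A \<Longrightarrow> f ` space \<mu> \<subseteq> I \<Longrightarrow> AE z in \<mu>. H_fun \<Gamma> P I M \<rho> t \<alpha> f 0 z \<le> H_fun \<Gamma> P I M \<rho> t \<alpha> f t z"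
  shows "star_ineq \<mu> A \<Gamma> P I M \<rho> t \<alpha>"
  unfolding star_ineq_def
proof (intro ballI impI)
  fix f assume f: "f \<in> A" and fI: "f ` space \<mu> \<subseteq> I"
  let ?h = "h_fun \<rho> t \<alpha>"
  let ?ms = "compose_on I M (P t f) (\<lambda>z. ?h 0 * \<Gamma> (P t f) (P t f) z)"
  let ?mt = "compose_on I M (P 0 f) (\<lambda>z. \<alpha> * \<Gamma> (P 0 f) (P 0 f) z)"
  let ?m = "compose_on I M f (\<lambda>z. \<alpha> * \<Gamma> f f z)"
  have A0: "P 0 f \<in> A" "P t f \<in> A" using f t by (auto intro: P_closed)
  have P0: "AE z in \<mu>. P 0 f z = f z" by (rule P_zero[OF A_square_int[OF f]])
  have meas: "?ms \<in> borel_measurable \<mu>" "?mt \<in> borel_measurable \<mu>" "?m \<in> borel_measurable \<mu>"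
    using A0 f by (intro compose_on_measurable[OF C2_partials_continuous[OF C2] I] A_measurable A_scale
      \<Gamma>_closed; simp)+
  have eq: "AE z in \<mu>. ?mt z = ?m z"
    using P0 \<Gamma>_cong[OF A0(1) f A0(1) f P0 P0] by eventually_elim (simp add: compose_on_def)
  have h0: "0 \<le> ?h 0" using t \<alpha> by (intro h_fun_nonneg) auto
  have v0: "AE z in \<mu>. ?ms z = M (P t f z) (?h 0 * \<Gamma> (P t f) (P t f) z)"
    using P_in_interval[OF t f fI I] \<Gamma>_nonneg[OF A0(2)]
      by eventually_elim (use h0 in \<open>simp add: compose_on_def\<close>)
  show "AE z in \<mu>. ereal (M (P t f z) (?h 0 * \<Gamma> (P t f) (P t f) z)) \<le> semigroup_ext P t ?m z"
    using mono[OF f fI] semigroup_ext_zero[OF meas(1)] semigroup_ext_cong[OF t meas(2,3) eq] v0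
    unfolding H_fun_def h_fun_end by eventually_elim simp
qed

end

subsection \<open>The inequality for small times\<close>

text \<open>Division by a small time would turn a uniform error \<epsilon> into an unbounded one.
  What gets divided is a difference of two values of \<open>p - M\<close>, and closeness of the
  first derivatives bounds it by \<epsilon> times the increments of the arguments.\<close>

lemma C2_lipschitz_difference:
  assumes C2: "C2_partials I M Mx My Mxx Mxy Myy" and I: "{a..b} \<subseteq> I" and p: "poly2 p px py pxx pxy pyy"
    and \<epsilon>: "\<And>x y. x \<in> {a..b} \<Longrightarrow> y \<in> {0..d} \<Longrightarrow> \<bar>px x y - Mx x y\<bar> \<le> \<epsilon> \<and> \<bar>py x y - My x y\<bar> \<le> \<epsilon>"
    and x: "x \<in> {a..b}" "x' \<in> {a..b}" and y: "y \<in> {0..d}" "y' \<in> {0..d}"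
  shows "\<bar>(p x y - M x y) - (p x' y' - M x' y')\<bar> \<le> \<epsilon> * (\<bar>x - x'\<bar> + \<bar>y - y'\<bar>)"
proof -
  have "norm ((p x y - M x y) - (p x' y - M x' y)) \<le> \<epsilon> * norm (x - x')"
  proof (rule field_differentiable_bound[where S = "{a..b}" and f = "\<lambda>s. p s y - M s y"
    and f' = "\<lambda>s. px s y - Mx s y"])
    fix s assume s: "s \<in> {a..b}"
    have "((\<lambda>s. M s y) has_real_derivative Mx s y) (at s within I)" using C2 I s y unfolding C2_partials_def
      by auto
    then have "((\<lambda>s. M s y) has_real_derivative Mx s y) (at s within {a..b})" using I
      by (rule has_field_derivative_subset)
    moreover have "((\<lambda>s. p s y) has_real_derivative px s y) (at s within {a..b})"
      using poly2_derivs[OF p] has_field_derivative_at_within by blast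
    ultimately show "((\<lambda>s. p s y - M s y) has_field_derivative px s y - Mx s y) (at s within {a..b})"
      by (rule DERIV_diff[rotated])
    show "norm (px s y - Mx s y) \<le> \<epsilon>" using \<epsilon>[OF s y(1)] by simp
  qed (use x in auto)
  moreover have "norm ((p x' y - M x' y) - (p x' y' - M x' y')) \<le> \<epsilon> * norm (y - y')"
  proof (rule field_differentiable_bound[where S = "{0..d}" and f = "\<lambda>s. p x' s - M x' s"
    and f' = "\<lambda>s. py x' s - My x' s"])
    fix s assume s: "s \<in> {0..d}"
    have "(M x' has_real_derivative My x' s) (at s within {0..})" using C2 I s x unfolding C2_partials_def
      by auto
    then have "(M x' has_real_derivative My x' s) (at s within {0..d})"
      by (rule has_field_derivative_subset) auto
    moreover have "(p x' has_real_derivative py x' s) (at s within {0..d})"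
      using poly2_derivs[OF p] has_field_derivative_at_within by blast
    ultimately show "((\<lambda>s. p x' s - M x' s) has_field_derivative py x' s - My x' s) (at s within {0..d})"
      by (rule DERIV_diff[rotated])
    show "norm (py x' s - My x' s) \<le> \<epsilon>" using \<epsilon>[OF x(2) s] by simp
  qed (use y in auto)
  ultimately show ?thesis by (simp add: distrib_left)
qed

lemma h_fun_deriv_time: "((\<lambda>r. h_fun \<rho> r \<alpha> 0) has_real_derivative 2 + 2 * \<rho> * \<alpha>) (at 0 within T)"
proof (cases "\<rho> = 0")
  case True
  then show ?thesis unfolding h_fun_def by (auto intro!: derivative_eq_intros)
next
  case False
  then show ?thesis unfolding h_fun_def
    by (auto intro!: derivative_eq_intros)
qed

lemma h_fun_time_bounded: "\<exists>K. \<forall>r\<in>{0..t}. \<bar>h_fun \<rho> r \<alpha> 0\<bar> \<le> K"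
proof -
  have "h_fun \<rho> r \<alpha> 0 = h_fun \<rho> t \<alpha> (t - r)" for r by (simp add: h_fun_def)
  moreover obtain K where "\<forall>s\<in>{0..t}. \<bar>h_fun \<rho> t \<alpha> s\<bar> \<le> K" using h_fun_bounded by blast
  ultimately show ?thesis by (intro exI[of _ K]) auto
qed

context prob_space
begin

text \<open>Truncation at a level at least 1 above \<open>a s\<close> is invisible to first order:
  where \<open>a r\<close> exceeds \<open>D\<close>, its increment is at least 1, so the additional
  error there is at most \<open>B\<close> times the increment, which tends to 0 in L1.\<close>

lemma L1_deriv_min:
  assumes a: "L1_deriv T a a' s" "s \<in> T" "\<And>r. r \<in> T \<Longrightarrow> ess_bdd (a r)" "ess_bdd a'"
    and D: "AE z in M. a s z \<le> D - 1"
  shows "L1_deriv T (\<lambda>r z. min (a r z) D) a' s"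
proof -
  obtain B where B: "0 \<le> B" "AE z in M. \<bar>a' z\<bar> \<le> B" using a(4) by (rule ess_bddE)
  let ?d = "\<lambda>r z. (a r z - a s z) / (r - s) - a' z"
  let ?U = "\<lambda>r. 2 * (\<integral>z. \<bar>?d r z\<bar> \<partial>M) + B * (\<integral>z. \<bar>a r z - a s z\<bar> \<partial>M)"
  show ?thesis
    unfolding L1_deriv_def
  proof (rule tendsto_sandwich[of "\<lambda>_. 0" _ _ ?U])
    have "(?U \<longlongrightarrow> 2 * 0 + B * 0) (at s within T)"
      using a(1) L1_deriv_continuous[OF a(1,2) ess_bdd_integrable[OF a(3)] ess_bdd_integrable[OF a(4)]]
      unfolding L1_deriv_def by (intro tendsto_intros)
    then show "(?U \<longlongrightarrow> 0) (at s within T)" by simp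
    show "\<forall>\<^sub>F r in at s within T. (\<integral>z. \<bar>(min (a r z) D - min (a s z) D) / (r - s) - a' z\<bar> \<partial>M) \<le> ?U r"
      unfolding eventually_at_filter
    proof (rule always_eventually, intro allI impI)
      fix r assume r: "r \<noteq> s" "r \<in> T"
      note e = a(3)[OF r(2)] a(3)[OF a(2)] a(4)
      have ed: "ess_bdd (?d r)" "ess_bdd (\<lambda>z. a r z - a s z)" using e by (auto intro!: ess_bdd_intros)
      have "(\<integral>z. \<bar>(min (a r z) D - min (a s z) D) / (r - s) - a' z\<bar> \<partial>M) \<le> (\<integral>z. 2 * \<bar>?d r z\<bar> + B * \<bar>a r z
        - a s z\<bar> \<partial>M)"
      proof (rule integral_mono_AE)
        show "AE z in M. \<bar>(min (a r z) D - min (a s z) D) / (r - s) - a' z\<bar> \<le> 2 * \<bar>?d r z\<bar> + B * \<bar>a r z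
          - a s z\<bar>"
          using D B(2)
        proof eventually_elim
          case (elim z)
          have s: "min (a s z) D = a s z" using elim(1) by simp
          show ?case
          proof (cases "a r z \<le> D")
            case True
            then have eq: "(min (a r z) D - min (a s z) D) / (r - s) - a' z = ?d r z" using s by simp
            have "x \<le> 2 * x + y" if "0 \<le> x" "0 \<le> y" for x y :: real using that by linarith
            from this[of "\<bar>?d r z\<bar>" "B * \<bar>a r z - a s z\<bar>"] show ?thesis unfolding eq using B(1) by simp
          next
            case False
            then have m: "min (a r z) D = D" by simp
            have big: "1 \<le> \<bar>a r z - a s z\<bar>" using False elim(1) by linarith
            define q where "q = (a r z - a s z) / (r - s)"
            \<comment> \<open>The fraction of the increment that truncation leaves, so that the
              truncated quotient is \<open>w * q\<close>.\<close>
            define w where "w = (D - a s z) / (a r z - a s z)"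
            have w: "0 \<le> w" "w \<le> 1" using False elim(1) by (auto simp: w_def divide_le_eq)
            have "w * q = (D - a s z) / (r - s)" using False elim(1) unfolding w_def q_def by simp
            then have "(min (a r z) D - min (a s z) D) / (r - s) - a' z = w * (q - a' z) - (1 - w) * a' z"
              unfolding m s by (simp add: algebra_simps)
            also have "\<bar>w * (q - a' z) - (1 - w) * a' z\<bar> \<le> \<bar>w * (q - a' z)\<bar> + \<bar>(1 - w) * a' z\<bar>"
              by (rule abs_triangle_ineq4)
            also have "\<dots> \<le> 1 * \<bar>q - a' z\<bar> + 1 * B" unfolding abs_mult using w elim(2) B
              by (intro add_mono mult_mono) auto
            also have "\<dots> \<le> 2 * \<bar>q - a' z\<bar> + B * \<bar>a r z - a s z\<bar>"
            proof (rule add_mono)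
              show "1 * B \<le> B * \<bar>a r z - a s z\<bar>" using mult_left_mono[OF big B(1)] by simp
            qed simp
            finally show ?thesis unfolding q_def .
          qed
        qed
        show "integrable M (\<lambda>z. \<bar>(min (a r z) D - min (a s z) D) / (r - s) - a' z\<bar>)"
          by (intro ess_bdd_integrable ess_bdd_intros e)
        show "integrable M (\<lambda>z. 2 * \<bar>?d r z\<bar> + B * \<bar>a r z - a s z\<bar>)"
          by (intro ess_bdd_integrable ess_bdd_intros e)
      qed
      also have "\<dots> = ?U r" using ed[THEN ess_bdd_integrable] by simp
      finally show "(\<integral>z. \<bar>(min (a r z) D - min (a s z) D) / (r - s) - a' z\<bar> \<partial>M) \<le> ?U r" .
    qed
  qed auto
qed

text \<open>A local Lipschitz bound in L1; the summand 1 absorbs the error of the difference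
  quotient.\<close>

lemma L1_deriv_increment:
  assumes a: "L1_deriv T a a' s" "s \<in> T" "\<And>r. r \<in> T \<Longrightarrow> integrable M (a r)" "integrable M a'"
  shows "\<forall>\<^sub>F r in at s within T. (\<integral>z. \<bar>a r z - a s z\<bar> \<partial>M) \<le> \<bar>r - s\<bar> * (1 + (\<integral>z. \<bar>a' z\<bar> \<partial>M))"
proof -
  have "\<forall>\<^sub>F r in at s within T. (\<integral>z. \<bar>(a r z - a s z) / (r - s) - a' z\<bar> \<partial>M) < 1"
    by (rule order_tendstoD(2)[OF a(1)[unfolded L1_deriv_def]]) simp
  moreover have "\<forall>\<^sub>F r in at s within T. r \<in> T \<and> r \<noteq> s" by (auto simp: eventually_at_filter)
  ultimately show ?thesis
  proof eventually_elim
    case (elim r)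
    then have i: "integrable M (a r)" "integrable M (a s)" "integrable M a'" using a by auto
    have "(\<integral>z. \<bar>a r z - a s z\<bar> \<partial>M) \<le> (\<integral>z. \<bar>r - s\<bar> * (\<bar>(a r z - a s z) / (r - s) - a' z\<bar> + \<bar>a' z\<bar>) \<partial>M)"
    proof (rule integral_mono)
      fix z
      have "a r z - a s z = (r - s) * (((a r z - a s z) / (r - s) - a' z) + a' z)" using elim by simp
      then have "\<bar>a r z - a s z\<bar> = \<bar>r - s\<bar> * \<bar>((a r z - a s z) / (r - s) - a' z) + a' z\<bar>" by (metis abs_mult)
      then show "\<bar>a r z - a s z\<bar> \<le> \<bar>r - s\<bar> * (\<bar>(a r z - a s z) / (r - s) - a' z\<bar> + \<bar>a' z\<bar>)"
        using mult_left_mono[OF abs_triangle_ineq[of "(a r z - a s z) / (r - s) - a' z" "a' z"], of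
          "\<bar>r - s\<bar>"] by simp
    qed (use i in auto)
    also have "\<dots> = \<bar>r - s\<bar> * ((\<integral>z. \<bar>(a r z - a s z) / (r - s) - a' z\<bar> \<partial>M) + (\<integral>z. \<bar>a' z\<bar> \<partial>M))" using i by simp
    also have "\<dots> \<le> \<bar>r - s\<bar> * (1 + (\<integral>z. \<bar>a' z\<bar> \<partial>M))" using elim by (intro mult_left_mono) auto
    finally show ?case .
  qed
qed

end

context markov_triple
begin

text \<open>The derivative of \<open>(\<ast>)\<close> at \<open>t = 0\<close>. Since \<open>\<Gamma> (P t f)\<close> need not be bounded uniformly in \<open>t\<close> here, it is
  first truncated, which only decreases the left-hand side because \<open>M\<close> is nondecreasing in \<open>y\<close>.\<close>

lemma star_ineq_derivative:
  assumes C2: "C2_partials I M Mx My Mxx Mxy Myy" and I: "is_interval I"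
    and My: "\<forall>x\<in>I. \<forall>y\<ge>0. 0 \<le> My x y"
    and ab: "{a..b} \<subseteq> I" "a < b" and f: "f \<in> A" and fab: "f ` space \<mu> \<subseteq> {a..b}"
    and \<alpha>: "0 \<le> \<alpha>" and t0: "0 < t0" and star: "\<And>t. t \<in> {0..t0} \<Longrightarrow> star_ineq \<mu> A \<Gamma> P I M \<rho> t \<alpha>"
  shows "AE z in \<mu>. 0 \<le> My (f z) (\<alpha> * \<Gamma> f f z) * (2 * \<alpha> * (Gamma2 \<Gamma> L f f z - \<rho> * \<Gamma> f f z) - 2 * \<Gamma> f f z)
     + Mxx (f z) (\<alpha> * \<Gamma> f f z) * \<Gamma> f f z + 2 * Mxy (f z) (\<alpha> * \<Gamma> f f z) * (\<alpha> * \<Gamma> f (\<Gamma> f f) z)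
     + Myy (f z) (\<alpha> * \<Gamma> f f z) * (\<alpha>\<^sup>2 * \<Gamma> (\<Gamma> f f) (\<Gamma> f f) z)"
proof -
  let ?T = "{0..t0}" and ?\<gamma> = "\<Gamma> f f"
  let ?v = "\<lambda>z. \<alpha> * ?\<gamma> z"
  have T0: "0 \<in> ?T" using t0 by simp
  have \<gamma>: "?\<gamma> \<in> A" by (rule \<Gamma>_closed[OF f f])
  have v: "?v \<in> A" by (rule A_scale[OF \<gamma>])
  have P0: "AE z in \<mu>. P 0 f z = f z" by (rule P_zero[OF A_square_int[OF f]])
  have P0A: "P 0 f \<in> A" "P 0 (L f) \<in> A" using f by (auto intro: P_closed L_closed)
  have \<Gamma>0: "AE z in \<mu>. \<Gamma> (P 0 f) (P 0 f) z = ?\<gamma> z" by (rule \<Gamma>_cong[OF P0A(1) f P0A(1) f P0 P0])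
  obtain c where c: "0 \<le> c" "AE z in \<mu>. \<bar>?\<gamma> z\<bar> \<le> c" using A_ess_bdd[OF \<gamma>] by (rule ess_bddE)
  \<comment> \<open>Leaves the room of 1 above \<open>\<alpha> * \<Gamma> f f\<close> that
    \<open>L1_deriv_min\<close> requires.\<close>
  define D where "D = \<alpha> * c + 1"
  have D: "0 < D" using \<alpha> c(1) by (simp add: D_def add_nonneg_pos)
  let ?h = "\<lambda>r. h_fun \<rho> r \<alpha> 0"
  obtain Kh where Kh: "\<And>r. r \<in> ?T \<Longrightarrow> \<bar>?h r\<bar> \<le> Kh" using h_fun_time_bounded[of t0 \<rho> \<alpha>] by blast
  have h0: "0 \<le> ?h r" if "r \<in> ?T" for r using that \<alpha> by (intro h_fun_nonneg) auto
  let ?U = "\<lambda>r. P r f" and ?W = "\<lambda>r z. ?h r * \<Gamma> (P r f) (P r f) z"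
  let ?V = "\<lambda>r z. min (?W r z) D"
  have UA: "?U r \<in> A" "\<Gamma> (?U r) (?U r) \<in> A" "?W r \<in> A" if "r \<in> ?T" for r
    using f that by (auto intro!: \<Gamma>_closed P_closed A_scale)
  let ?W' = "\<lambda>z. (2 + 2 * \<rho> * \<alpha>) * \<Gamma> (P 0 f) (P 0 f) z + ?h 0 * (2 * \<Gamma> (P 0 f) (P 0 (L f)) z)"
  have dU: "L1_deriv ?T ?U (P 0 (L f)) 0" by (rule L1_deriv_subset[OF P_curve_L1[OF f]]) auto
  have eG: "ess_bdd (\<lambda>z. 2 * \<Gamma> (P 0 f) (P 0 (L f)) z)" by (intro A_ess_bdd A_scale \<Gamma>_closed P0A)
  \<comment> \<open>The scalar comes first because \<open>\<Gamma> (P r f) (P r f)\<close> is not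
    known to be bounded uniformly in \<open>r\<close>.\<close>
  have dW: "L1_deriv ?T ?W ?W' 0"
    by (rule L1_deriv_mult[OF L1_deriv_scalar[OF h_fun_deriv_time] L1_deriv_subset[OF \<Gamma>_curve[OF f
      order_refl]] T0])
       (use A_ess_bdd[OF UA(2)] Kh eG in \<open>auto intro: ess_bdd_const\<close>)
  have eW': "ess_bdd ?W'" by (rule ess_bdd_add[OF ess_bdd_mult[OF ess_bdd_const A_ess_bdd[OF UA(2)[OF T0]]]
    ess_bdd_mult[OF ess_bdd_const eG]])
  have dV: "L1_deriv ?T ?V ?W' 0"
  proof (rule L1_deriv_min[OF dW T0 A_ess_bdd[OF UA(3)] eW'])
    show "AE z in \<mu>. ?W 0 z \<le> D - 1" using \<Gamma>0 c(2)
    proof eventually_elim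
      case (elim z)
      have "\<alpha> * ?\<gamma> z \<le> \<alpha> * c" using elim(2) \<alpha> by (intro mult_left_mono) auto
      then show ?case unfolding elim(1) h_fun_end by (simp add: D_def)
    qed
  qed
  have eU: "ess_bdd (?U r)" "ess_bdd (?V r)" if "r \<in> ?T" for r
    using A_ess_bdd[OF UA(1)[OF that]] A_ess_bdd[OF UA(3)[OF that]] by (auto intro: ess_bdd_min ess_bdd_const)
  have W0: "AE z in \<mu>. 0 \<le> ?W r z" if "r \<in> ?T" for r
    using \<Gamma>_nonneg[OF UA(1)[OF that]] by eventually_elim (use h0[OF that] in simp)
  have Uab: "AE z in \<mu>. ?U r z \<in> {a..b}" if r: "r \<in> ?T" for r
  proof -
    have "AE z in \<mu>. a \<le> f z" "AE z in \<mu>. f z \<le> b" using fab by (auto intro!: AE_I2)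
    with P_ge_const[OF _ A_square_int[OF f], of r a] P_le_const[OF _ A_square_int[OF f], of r b] r
    have "AE z in \<mu>. a \<le> ?U r z" "AE z in \<mu>. ?U r z \<le> b" by auto
    then show ?thesis by eventually_elim simp
  qed
  have rect: "AE z in \<mu>. ?U r z \<in> {a..b} \<and> ?V r z \<in> {0..D}" if r: "r \<in> ?T" for r
    using Uab[OF r] W0[OF r] by eventually_elim (use D in auto)
  have fv: "AE z in \<mu>. f z \<in> {a..b} \<and> ?v z \<in> {0..D}"
  proof -
    have "AE z in \<mu>. f z \<in> {a..b}" using fab by (auto intro!: AE_I2)
    with c(2) \<Gamma>_nonneg[OF f] show ?thesis
    proof eventually_elim
      case (elim z)
      have "\<alpha> * ?\<gamma> z \<le> \<alpha> * c" using elim(1) \<alpha> by (intro mult_left_mono) auto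
      then show ?case using elim \<alpha> by (simp add: D_def)
    qed
  qed
  have V0: "AE z in \<mu>. ?U 0 z = f z \<and> ?V 0 z = ?v z"
    using P0 \<Gamma>0 fv by eventually_elim (simp add: h_fun_end)
  note cont = C2_partials_continuous[OF C2]
  have conts: "continuous_on (I \<times> {0..}) (\<lambda>(x, y). My x y)" "continuous_on (I \<times> {0..}) (\<lambda>(x, y). Mxx x y)"
    "continuous_on (I \<times> {0..}) (\<lambda>(x, y). Mxy x y)" "continuous_on (I \<times> {0..}) (\<lambda>(x, y). Myy x y)"
    using C2 unfolding C2_partials_def by blast+
  let ?m = "compose_on I M f ?v" and ?N = "\<lambda>r. compose_on I M (?U r) (?V r)"
  have em: "ess_bdd ?m" by (rule compose_on_ess_bdd[OF cont I ab(1) A_measurable[OF f] A_measurable[OF v] fv])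
  have eN: "ess_bdd (?N r)" if r: "r \<in> ?T" for r
    by (rule compose_on_ess_bdd[OF cont I ab(1) ess_bdd_measurable[OF eU(1)[OF r]] ess_bdd_measurable[OF
      eU(2)[OF r]] rect[OF r]])
  have e2: "ess_bdd (compose_on I G f ?v)" if "continuous_on (I \<times> {0..}) (\<lambda>(x, y). G x y)"
    for G :: "real \<Rightarrow> real \<Rightarrow> real"
    by (rule compose_on_ess_bdd[OF that I ab(1) A_measurable[OF f] A_measurable[OF v] fv])
  have NleP: "AE z in \<mu>. ?N r z \<le> P r ?m z" if r: "r \<in> ?T" for r
  proof -
    have r0: "0 \<le> r" using r by simp
    have fI: "f ` space \<mu> \<subseteq> I" using fab ab(1) by blast
    have "AE z in \<mu>. ereal (M (?U r z) (?W r z)) \<le> semigroup_ext P r ?m z"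
      using star[OF r] f fI unfolding star_ineq_def by blast
    with semigroup_ext_ess_bdd[OF r0 em] rect[OF r] W0[OF r] show ?thesis
    proof eventually_elim
      case (elim z)
      have x: "?U r z \<in> I" using elim(2) ab(1) by blast
      have "?N r z = M (?U r z) (?V r z)" using x elim(2) by (simp add: compose_on_def)
      also have "\<dots> \<le> M (?U r z) (?W r z)" using elim(2) by (intro C2_mono_snd[OF C2 My x]) auto
      finally show ?case using elim(1,4) by simp
    qed
  qed
  define Q where "Q G1 G2 G3 G4 z = G1 * (2 * \<alpha> * (Gamma2 \<Gamma> L f f z - \<rho> * ?\<gamma> z) - 2 * ?\<gamma> z)
     + G2 * ?\<gamma> z + 2 * G3 * (\<alpha> * \<Gamma> f ?\<gamma> z) + G4 * (\<alpha>\<^sup>2 * \<Gamma> ?\<gamma> ?\<gamma> z)" for G1 G2 G3 G4 z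
  let ?Q = "\<lambda>z. Q (compose_on I My f ?v z) (compose_on I Mxx f ?v z) (compose_on I Mxy f ?v z) (compose_on I
    Myy f ?v z) z"
  let ?S = "\<lambda>z. \<bar>2 * \<alpha> * (Gamma2 \<Gamma> L f f z - \<rho> * ?\<gamma> z) - 2 * ?\<gamma> z\<bar> + \<bar>?\<gamma> z\<bar> + 2 * \<bar>\<alpha> * \<Gamma> f ?\<gamma> z\<bar>
    + \<bar>\<alpha>\<^sup>2 * \<Gamma> ?\<gamma> ?\<gamma> z\<bar>"
  note eA = A_ess_bdd[OF Gamma2_closed[OF f]] A_ess_bdd[OF \<gamma>] A_ess_bdd[OF \<Gamma>_closed[OF f \<gamma>]] A_ess_bdd[OF
    \<Gamma>_closed[OF \<gamma> \<gamma>]]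
  have eQ: "ess_bdd ?Q" unfolding Q_def by (intro ess_bdd_intros eA e2 conts)
  have eS: "ess_bdd ?S" by (intro ess_bdd_intros eA)
  have "AE z in \<mu>. 0 \<le> ?Q z"
  proof (rule AE_nonneg_test[OF eQ])
    fix k assume k: "k \<in> A"
    let ?g = "\<lambda>z. k z * k z"
    have g: "?g \<in> A" by (rule A_mult[OF k k])
    obtain Kg where Kg: "0 \<le> Kg" "AE z in \<mu>. \<bar>?g z\<bar> \<le> Kg" using A_ess_bdd[OF g] by (rule ess_bddE)
    have Pg0: "AE z in \<mu>. P 0 ?g z = ?g z" by (rule P_zero[OF A_square_int[OF g]])
    have dg: "L1_deriv ?T (\<lambda>r. P r ?g) (P 0 (L ?g)) 0" by (rule L1_deriv_subset[OF P_curve_L1[OF g]]) auto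
    have PgA: "P r ?g \<in> A" "P 0 (L ?g) \<in> A" if "r \<in> ?T" for r using that g by (auto intro: P_closed L_closed)
    \<comment> \<open>Collects the L1 Lipschitz constants at time 0 of \<open>P r ?g\<close>,
      \<open>?U\<close> and \<open>?V\<close>, the last two weighted by the bound \<open>Kg\<close>
      of the test function.\<close>
    define C where "C = (1 + (\<integral>z. \<bar>P 0 (L ?g) z\<bar> \<partial>\<mu>)) + Kg * ((1 + (\<integral>z. \<bar>P 0 (L f) z\<bar> \<partial>\<mu>)) + (1
      + (\<integral>z. \<bar>?W' z\<bar> \<partial>\<mu>)))"
    have i0: "0 \<le> (\<integral>z. \<bar>P 0 (L ?g) z\<bar> \<partial>\<mu>)" "0 \<le> (\<integral>z. \<bar>P 0 (L f) z\<bar> \<partial>\<mu>)" "0 \<le> (\<integral>z. \<bar>?W' z\<bar> \<partial>\<mu>)"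
      by (simp_all add: integral_nonneg_AE)
    have C0: "0 \<le> C" unfolding C_def using i0 Kg by (intro add_nonneg_nonneg mult_nonneg_nonneg) auto
    have S0: "0 \<le> (\<integral>z. ?g z * ?S z \<partial>\<mu>)" by (intro integral_nonneg_AE AE_I2) auto
    have "- (\<integral>z. ?g z * ?Q z \<partial>\<mu>) \<le> 0"
    proof (rule le_of_le_add_mult)
      show "0 \<le> C + (\<integral>z. ?g z * ?S z \<partial>\<mu>)" using C0 S0 by simp
      fix \<epsilon> :: real assume \<epsilon>: "0 < \<epsilon>"
      obtain p px py pxx pxy pyy where p: "poly2 p px py pxx pxy pyy" and
        ap: "\<And>x y. x \<in> {a..b} \<Longrightarrow> y \<in> {0..D} \<Longrightarrow> \<bar>p x y - M x y\<bar> \<le> \<epsilon> \<and> \<bar>px x y - Mx x y\<bar> \<le> \<epsilon> \<and> \<bar>py x y - My x y\<bar>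
          \<le> \<epsilon> \<and>
          \<bar>pxx x y - Mxx x y\<bar> \<le> \<epsilon> \<and> \<bar>pxy x y - Mxy x y\<bar> \<le> \<epsilon> \<and> \<bar>pyy x y - Myy x y\<bar> \<le> \<epsilon>"
        using C2_poly_approx[OF C2 ab D \<epsilon>] by blast
      let ?p = "\<lambda>z. p (f z) (?v z)" and ?q = "\<lambda>r z. p (?U r z) (?V r z)"
      note calc = poly2_calculus[OF p f v]
      have pA: "?p \<in> A" using calc by blast
      have eq: "ess_bdd (?q r)" if "r \<in> ?T" for r using poly2_ess_bdd[OF p eU[OF that]] by blast
      let ?q' = "\<lambda>z. px (?U 0 z) (?V 0 z) * P 0 (L f) z + py (?U 0 z) (?V 0 z) * ?W' z"
      have eq': "ess_bdd ?q'"
        using poly2_ess_bdd[OF p eU[OF T0]] ess_bdd_add[OF ess_bdd_mult[OF _ A_ess_bdd[OF P0A(2)]]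
          ess_bdd_mult[OF _ eW']] by blast
      have KU: "AE z in \<mu>. \<bar>?U r z\<bar> \<le> \<bar>a\<bar> + \<bar>b\<bar> + D" if "r \<in> ?T" for r
        using rect[OF that] by eventually_elim (use D in auto)
      have KV: "AE z in \<mu>. \<bar>?V r z\<bar> \<le> \<bar>a\<bar> + \<bar>b\<bar> + D" if "r \<in> ?T" for r
        using rect[OF that] by eventually_elim (use D in auto)
      have dq: "L1_deriv ?T ?q ?q' 0"
        using poly2_curve[OF p T0 dU eU(1) A_ess_bdd[OF P0A(2)] KU dV eU(2) eW' KV] by blast
      \<comment> \<open>The tested gap between the two sides of the inequality, with
        \<open>p\<close> for \<open>M\<close>. For \<open>M\<close> itself the gap is nonnegative,
        and \<open>\<Lambda>\<close> vanishes at 0, so its derivative there will be at least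
        \<open>- (\<epsilon> * C)\<close>.\<close>
      define \<Lambda> where "\<Lambda> r = (\<integral>z. P r ?g z * ?p z \<partial>\<mu>) - (\<integral>z. ?g z * ?q r z \<partial>\<mu>)" for r
      define \<Lambda>' where "\<Lambda>' = (\<integral>z. ?g z * L ?p z \<partial>\<mu>) - (\<integral>z. ?g z * ?q' z \<partial>\<mu>)"
      have d\<Lambda>: "(\<Lambda> has_real_derivative \<Lambda>') (at 0 within ?T)"
        unfolding \<Lambda>_def \<Lambda>'_def
      proof (rule DERIV_diff)
        have "((\<lambda>r. \<integral>z. P r ?g z * ?p z \<partial>\<mu>) has_real_derivative (\<integral>z. P 0 ?g z * (L ?p z + 0) \<partial>\<mu>)) (at 0
          within ?T)"
          by (rule dual_curve[OF g T0 L1_deriv_const]) (use pA in \<open>auto intro: A_ess_bdd ess_bdd_const\<close>)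
        also have "(\<integral>z. P 0 ?g z * (L ?p z + 0) \<partial>\<mu>) = (\<integral>z. ?g z * L ?p z \<partial>\<mu>)"
        proof (rule integral_cong_AE)
          show "AE z in \<mu>. P 0 ?g z * (L ?p z + 0) = ?g z * L ?p z" using Pg0 by eventually_elim simp
        qed (use A_measurable[OF A_mult[OF PgA(1)[OF T0] L_closed[OF pA]]] A_measurable[OF A_mult[OF g
          L_closed[OF pA]]] in simp_all)
        finally show "((\<lambda>r. \<integral>z. P r ?g z * ?p z \<partial>\<mu>) has_real_derivative (\<integral>z. ?g z * L ?p z \<partial>\<mu>)) (at 0 within
          ?T)" .
        have "L1_deriv ?T (\<lambda>r z. ?g z * ?q r z) (\<lambda>z. 0 * ?q 0 z + ?g z * ?q' z) 0"
          by (rule L1_deriv_mult[OF L1_deriv_const dq T0 A_ess_bdd[OF g] eq ess_bdd_const eq' Kg(2)])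
        then have "L1_deriv ?T (\<lambda>r z. ?g z * ?q r z) (\<lambda>z. ?g z * ?q' z) 0" by simp
        then show "((\<lambda>r. \<integral>z. ?g z * ?q r z \<partial>\<mu>) has_real_derivative (\<integral>z. ?g z * ?q' z \<partial>\<mu>)) (at 0 within ?T)"
          by (rule L1_deriv_integral[OF _ T0]) (intro ess_bdd_integrable ess_bdd_mult A_ess_bdd[OF g] eq
            eq'; assumption)+
      qed
      have \<Lambda>0: "\<Lambda> 0 = 0"
      proof -
        have "(\<integral>z. P 0 ?g z * ?p z \<partial>\<mu>) = (\<integral>z. ?g z * ?q 0 z \<partial>\<mu>)"
        proof (rule integral_cong_AE)
          show "AE z in \<mu>. P 0 ?g z * ?p z = ?g z * ?q 0 z" using Pg0 V0 by eventually_elim simp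
          show "(\<lambda>z. P 0 ?g z * ?p z) \<in> borel_measurable \<mu>"
            by (rule A_measurable[OF A_mult[OF PgA(1)[OF T0] pA]])
          show "(\<lambda>z. ?g z * ?q 0 z) \<in> borel_measurable \<mu>"
            by (rule ess_bdd_measurable[OF ess_bdd_mult[OF A_ess_bdd[OF g] eq[OF T0]]])
        qed
        then show ?thesis by (simp add: \<Lambda>_def)
      qed
      have in_T: "\<forall>\<^sub>F r in at 0 within ?T. r \<in> ?T \<and> r \<noteq> 0" by (auto simp: eventually_at_filter)
      have inc1: "\<forall>\<^sub>F r in at 0 within ?T. (\<integral>z. \<bar>P r ?g z - P 0 ?g z\<bar> \<partial>\<mu>) \<le> \<bar>r - 0\<bar> * (1 + (\<integral>z. \<bar>P 0 (L ?g)
        z\<bar> \<partial>\<mu>))"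
        by (rule L1_deriv_increment[OF dg T0 integrable_A[OF PgA(1)] integrable_A[OF PgA(2)[OF T0]]])
      have inc2: "\<forall>\<^sub>F r in at 0 within ?T. (\<integral>z. \<bar>?U r z - ?U 0 z\<bar> \<partial>\<mu>) \<le> \<bar>r - 0\<bar> * (1 + (\<integral>z. \<bar>P 0 (L f) z\<bar>
        \<partial>\<mu>))"
        by (rule L1_deriv_increment[OF dU T0 integrable_A[OF UA(1)] integrable_A[OF P0A(2)]])
      have inc3: "\<forall>\<^sub>F r in at 0 within ?T. (\<integral>z. \<bar>?V r z - ?V 0 z\<bar> \<partial>\<mu>) \<le> \<bar>r - 0\<bar> * (1 + (\<integral>z. \<bar>?W' z\<bar> \<partial>\<mu>))"
        by (rule L1_deriv_increment[OF dV T0 ess_bdd_integrable[OF eU(2)] ess_bdd_integrable[OF eW']])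
      have inc: "\<forall>\<^sub>F r in at 0 within ?T. - (\<epsilon> * C) \<le> (\<Lambda> r - \<Lambda> 0) / (r - 0)"
        using inc1 inc2 inc3 in_T
      proof eventually_elim
        case (elim r)
        then have r: "r \<in> ?T" "0 < r" "0 \<le> r" by auto
        let ?dg = "\<lambda>z. P r ?g z - P 0 ?g z" and ?dU = "\<lambda>z. ?U r z - ?U 0 z" and ?dV = "\<lambda>z. ?V r z - ?V 0 z"
        note eb = A_ess_bdd[OF PgA(1)[OF r(1)]] A_ess_bdd[OF PgA(1)[OF T0]] A_ess_bdd[OF pA] A_ess_bdd[OF g]
          eq[OF r(1)] em eN[OF r(1)]
          eU[OF r(1)] eU[OF T0]
        have ed: "ess_bdd ?dg" "ess_bdd ?dU" "ess_bdd ?dV"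
          by (rule ess_bdd_diff[OF eb(1,2)] ess_bdd_diff[OF eb(8,10)] ess_bdd_diff[OF eb(9,11)])+
        note i1 = ess_bdd_integrable[OF ess_bdd_mult[OF eb(1,3)]]
          and i2 = ess_bdd_integrable[OF ess_bdd_mult[OF eb(4,5)]]
        note i3 = ess_bdd_integrable[OF ess_bdd_mult[OF eb(1,6)]]
          and i4 = ess_bdd_integrable[OF ess_bdd_mult[OF eb(4,7)]]
        note i5 = ed[THEN ess_bdd_integrable]
        have "(\<integral>z. ?g z * ?N r z \<partial>\<mu>) \<le> (\<integral>z. ?g z * P r ?m z \<partial>\<mu>)"
        proof (rule integral_mono_AE)
          show "AE z in \<mu>. ?g z * ?N r z \<le> ?g z * P r ?m z" using NleP[OF r(1)]
            by eventually_elim (intro mult_left_mono, auto)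
        qed (use i4 ess_bdd_integrable[OF ess_bdd_mult[OF eb(4) P_ess_bdd[OF r(3) em]]] in simp_all)
        also have "\<dots> = (\<integral>z. P r ?g z * ?m z \<partial>\<mu>)" by (rule P_symmetric[OF r(3) square_int_ess_bdd[OF em]
          A_square_int[OF g]])
        finally have pos: "0 \<le> (\<integral>z. P r ?g z * ?m z \<partial>\<mu>) - (\<integral>z. ?g z * ?N r z \<partial>\<mu>)" by simp
        \<comment> \<open>The error \<open>p - M\<close> enters as \<open>?dg z * ?\<delta>\<close>,
          small because the weight changes little, and as
          \<open>?g z * (?\<eta> - ?\<delta>)\<close>, small because the error varies slowly. Its
          undifferenced part cancels between the two sides.\<close>
        have "AE z in \<mu>. P r ?g z * ?m z - ?g z * ?N r z - (\<epsilon> * \<bar>?dg z\<bar> + Kg * \<epsilon> * (\<bar>?dU z\<bar> + \<bar>?dV z\<bar>))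
          \<le> P r ?g z * ?p z - ?g z * ?q r z"
          using rect[OF r(1)] fv V0 Pg0 Kg(2)
        proof eventually_elim
          case (elim z)
          have I': "?U r z \<in> I" "f z \<in> I" using elim(1,2) ab(1) by blast+
          have mN: "?m z = M (f z) (?v z)" "?N r z = M (?U r z) (?V r z)" using I' elim(1,2)
            by (auto simp: compose_on_def)
          let ?\<delta> = "p (f z) (?v z) - M (f z) (?v z)" and ?\<eta> = "p (?U r z) (?V r z) - M (?U r z) (?V r z)"
          have \<delta>: "\<bar>?\<delta>\<bar> \<le> \<epsilon>" using ap elim(2) by blast
          have "\<bar>?\<eta> - ?\<delta>\<bar> \<le> \<epsilon> * (\<bar>?U r z - f z\<bar> + \<bar>?V r z - ?v z\<bar>)"
            by (rule C2_lipschitz_difference[OF C2 ab(1) p, where d = D]) (use ap elim(1,2) in auto)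
          then have \<eta>: "\<bar>?\<eta> - ?\<delta>\<bar> \<le> \<epsilon> * (\<bar>?dU z\<bar> + \<bar>?dV z\<bar>)" using elim(3) by simp
          have "\<bar>?dg z * ?\<delta>\<bar> \<le> \<bar>?dg z\<bar> * \<epsilon>" unfolding abs_mult using \<delta> by (intro mult_left_mono) auto
          moreover have "\<bar>?g z * (?\<eta> - ?\<delta>)\<bar> \<le> Kg * (\<epsilon> * (\<bar>?dU z\<bar> + \<bar>?dV z\<bar>))"
            unfolding abs_mult[of "?g z"] using \<eta> elim(5) Kg(1) by (intro mult_mono) auto
          moreover have "P r ?g z * ?p z - ?g z * ?q r z = P r ?g z * ?m z - ?g z * ?N r z + ?dg z * ?\<delta>
            - ?g z * (?\<eta> - ?\<delta>)"
            unfolding mN elim(4) by (simp add: algebra_simps)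
          moreover have "\<epsilon> * \<bar>?dg z\<bar> + Kg * \<epsilon> * (\<bar>?dU z\<bar> + \<bar>?dV z\<bar>) = \<bar>?dg z\<bar> * \<epsilon> + Kg * (\<epsilon> * (\<bar>?dU z\<bar>
            + \<bar>?dV z\<bar>))"
            by (simp add: mult_ac)
          ultimately show ?case by linarith
        qed
        then have "(\<integral>z. P r ?g z * ?m z - ?g z * ?N r z - (\<epsilon> * \<bar>?dg z\<bar> + Kg * \<epsilon> * (\<bar>?dU z\<bar> + \<bar>?dV z\<bar>)) \<partial>\<mu>)
          \<le> (\<integral>z. P r ?g z * ?p z - ?g z * ?q r z \<partial>\<mu>)"
          using i1 i2 i3 i4 i5 by (intro integral_mono_AE) auto
        also have "\<dots> = \<Lambda> r" using i1 i2 by (simp add: \<Lambda>_def)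
        also have "(\<integral>z. P r ?g z * ?m z - ?g z * ?N r z - (\<epsilon> * \<bar>?dg z\<bar> + Kg * \<epsilon> * (\<bar>?dU z\<bar> + \<bar>?dV z\<bar>)) \<partial>\<mu>) =
            (\<integral>z. P r ?g z * ?m z \<partial>\<mu>) - (\<integral>z. ?g z * ?N r z \<partial>\<mu>) - (\<epsilon> * (\<integral>z. \<bar>?dg z\<bar> \<partial>\<mu>) + Kg * \<epsilon> * ((\<integral>z. \<bar>?dU
              z\<bar> \<partial>\<mu>) + (\<integral>z. \<bar>?dV z\<bar> \<partial>\<mu>)))"
          using i3 i4 i5 by simp
        finally have 1: "- (\<epsilon> * (\<integral>z. \<bar>?dg z\<bar> \<partial>\<mu>) + Kg * \<epsilon> * ((\<integral>z. \<bar>?dU z\<bar> \<partial>\<mu>) + (\<integral>z. \<bar>?dV z\<bar> \<partial>\<mu>))) \<le> \<Lambda> r"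
          using pos by linarith
        have "\<epsilon> * (\<integral>z. \<bar>?dg z\<bar> \<partial>\<mu>) + Kg * \<epsilon> * ((\<integral>z. \<bar>?dU z\<bar> \<partial>\<mu>) + (\<integral>z. \<bar>?dV z\<bar> \<partial>\<mu>)) \<le>
          \<epsilon> * (r * (1 + (\<integral>z. \<bar>P 0 (L ?g) z\<bar> \<partial>\<mu>))) + Kg * \<epsilon> * (r * (1 + (\<integral>z. \<bar>P 0 (L f) z\<bar> \<partial>\<mu>)) + r * (1
            + (\<integral>z. \<bar>?W' z\<bar> \<partial>\<mu>)))"
          using elim(1-3) r \<epsilon> Kg by (intro add_mono mult_left_mono) auto
        also have "\<dots> = r * (\<epsilon> * C)" unfolding C_def by (simp add: algebra_simps)
        finally have "- (r * (\<epsilon> * C)) \<le> \<Lambda> r" using 1 by linarith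
        then show ?case unfolding \<Lambda>0 using r by (simp add: pos_le_divide_eq mult_ac)
      qed
      have "- (\<epsilon> * C) \<le> \<Lambda>'"
        by (rule tendsto_lowerbound[OF d\<Lambda>[unfolded has_field_derivative_iff] inc])
           (use t0 in \<open>simp add: at_within_Icc_at_right trivial_limit_at_right_real\<close>)
      also have "\<Lambda>' \<le> (\<integral>z. ?g z * ?Q z \<partial>\<mu>) + \<epsilon> * (\<integral>z. ?g z * ?S z \<partial>\<mu>)"
      proof -
        note i1 = integrable_A[OF A_mult[OF g L_closed[OF pA]]]
          and i2 = ess_bdd_integrable[OF ess_bdd_mult[OF A_ess_bdd[OF g] eq']]
        note i3 = ess_bdd_integrable[OF ess_bdd_mult[OF A_ess_bdd[OF g] eQ]]
          and i4 = ess_bdd_integrable[OF ess_bdd_mult[OF A_ess_bdd[OF g] eS]]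
        have PL: "AE z in \<mu>. P 0 (L f) z = L f z" by (rule P_zero[OF A_square_int[OF L_closed[OF f]]])
        have \<Gamma>L: "AE z in \<mu>. \<Gamma> (P 0 f) (P 0 (L f)) z = \<Gamma> f (L f) z"
          by (rule \<Gamma>_cong[OF P0A(1) f P0A(2) L_closed[OF f] P0 PL])
        have "AE z in \<mu>. ?g z * L ?p z - ?g z * ?q' z \<le> ?g z * ?Q z + \<epsilon> * (?g z * ?S z)"
          using fv V0 PL \<Gamma>L \<Gamma>0 conjunct2[OF conjunct2[OF calc]] L_scale[OF \<gamma>, of \<alpha>] \<Gamma>_scale[OF \<gamma> f, of \<alpha>]
            \<Gamma>_sym[OF f v]
            \<Gamma>_scale[OF \<gamma> v, of \<alpha>] \<Gamma>_sym[OF \<gamma> v] \<Gamma>_scale[OF \<gamma> \<gamma>, of \<alpha>] \<Gamma>_sym[OF f \<gamma>] Gamma2_eq[OF f]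
        proof eventually_elim
          case (elim z)
          have fI: "f z \<in> I" using elim(1) ab(1) by blast
          have cm: "compose_on I G f ?v z = G (f z) (?v z)" for G using fI elim(1)
            by (simp add: compose_on_def)
          have U0: "P 0 f z = f z" and V0: "?V 0 z = ?v z" using elim(2) by blast+
          \<comment> \<open>The first-order terms in \<open>L f\<close> cancel. The derivative
            \<open>2 + 2 * \<rho> * \<alpha>\<close> of \<open>h_fun\<close> at time 0 supplies the
            terms with \<open>\<rho>\<close> and with \<open>- 2 * ?\<gamma> z\<close>.\<close>
          have 1: "L ?p z - ?q' z = Q (py (f z) (?v z)) (pxx (f z) (?v z)) (pxy (f z) (?v z)) (pyy (f z) (?v
            z)) z"
            unfolding V0 unfolding U0 elim(3-7) elim(9) unfolding elim(8,10) unfolding elim(11)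
              unfolding elim(12,13) Q_def elim(14) h_fun_end
            by (simp add: power2_eq_square algebra_simps)
          have b: "(m - N) * X \<le> \<epsilon> * \<bar>X\<bar>" if "\<bar>m - N\<bar> \<le> \<epsilon>" for m N X :: real
          proof -
            have "\<bar>(m - N) * X\<bar> \<le> \<epsilon> * \<bar>X\<bar>" unfolding abs_mult using that by (intro mult_right_mono) auto
            then show ?thesis by linarith
          qed
          have ap': "\<bar>py (f z) (?v z) - My (f z) (?v z)\<bar> \<le> \<epsilon>" "\<bar>pxx (f z) (?v z) - Mxx (f z) (?v z)\<bar> \<le> \<epsilon>"
            "\<bar>pxy (f z) (?v z) - Mxy (f z) (?v z)\<bar> \<le> \<epsilon>" "\<bar>pyy (f z) (?v z) - Myy (f z) (?v z)\<bar> \<le> \<epsilon>"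
            using ap elim(1) by blast+
          have "Q (py (f z) (?v z)) (pxx (f z) (?v z)) (pxy (f z) (?v z)) (pyy (f z) (?v z)) z - ?Q z
            \<le> \<epsilon> * ?S z"
            using b[OF ap'(1), of "2 * \<alpha> * (Gamma2 \<Gamma> L f f z - \<rho> * ?\<gamma> z) - 2 * ?\<gamma> z"] b[OF ap'(2), of "?\<gamma> z"]
              b[OF ap'(3), of "\<alpha> * \<Gamma> f ?\<gamma> z"] b[OF ap'(4), of "\<alpha>\<^sup>2 * \<Gamma> ?\<gamma> ?\<gamma> z"]
            unfolding Q_def cm by (simp add: algebra_simps)
          then have "L ?p z - ?q' z \<le> ?Q z + \<epsilon> * ?S z" unfolding 1 by linarith
          then have "?g z * (L ?p z - ?q' z) \<le> ?g z * (?Q z + \<epsilon> * ?S z)" by (intro mult_left_mono) auto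
          then show ?case by (simp only: right_diff_distrib distrib_left mult.left_commute[of "?g z" \<epsilon>])
        qed
        then have "(\<integral>z. ?g z * L ?p z - ?g z * ?q' z \<partial>\<mu>) \<le> (\<integral>z. ?g z * ?Q z + \<epsilon> * (?g z * ?S z) \<partial>\<mu>)"
          using i1 i2 i3 i4 by (intro integral_mono_AE) auto
        then show ?thesis unfolding \<Lambda>'_def using i1 i2 i3 i4 by simp
      qed
      finally show "- (\<integral>z. ?g z * ?Q z \<partial>\<mu>) \<le> 0 + \<epsilon> * (C + (\<integral>z. ?g z * ?S z \<partial>\<mu>))" by (simp add: algebra_simps)
    qed
    then show "0 \<le> (\<integral>z. ?g z * ?Q z \<partial>\<mu>)" by simp
  qed
  with fv show ?thesis
  proof eventually_elim
    case (elim z)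
    have "f z \<in> I" using elim(1) ab(1) by blast
    then show ?case using elim unfolding Q_def by (simp add: compose_on_def)
  qed
qed

text \<open>The degrees of homogeneity explain the scaling: with
  \<open>\<alpha> = \<beta> / e\<^sup>2\<close>, the argument \<open>\<alpha> * \<Gamma> f f\<close>
  and the terms with \<open>Gamma2\<close> and \<open>\<Gamma> (\<Gamma> f f) (\<Gamma> f f)\<close>
  keep their size for small \<open>e\<close>, while \<open>\<Gamma> f f\<close> and
  \<open>\<alpha> * \<Gamma> f (\<Gamma> f f)\<close> tend to 0. So only \<open>My\<close> and
  \<open>Myy\<close> survive.\<close>

lemma Gamma2_affine:
  fixes e x :: real
  assumes "\<phi> \<in> A"
  defines "f \<equiv> \<lambda>z. e * \<phi> z + x"
  shows "f \<in> A" "AE z in \<mu>. \<Gamma> f f z = e\<^sup>2 * \<Gamma> \<phi> \<phi> z" "AE z in \<mu>. Gamma2 \<Gamma> L f f z = e\<^sup>2 * Gamma2 \<Gamma> L \<phi> \<phi> z"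
    "AE z in \<mu>. \<Gamma> f (\<Gamma> f f) z = e * (e\<^sup>2 * \<Gamma> \<phi> (\<Gamma> \<phi> \<phi>) z)"
    "AE z in \<mu>. \<Gamma> (\<Gamma> f f) (\<Gamma> f f) z = e\<^sup>2 * (e\<^sup>2 * \<Gamma> (\<Gamma> \<phi> \<phi>) (\<Gamma> \<phi> \<phi>) z)"
proof -
  have ep: "(\<lambda>z. e * \<phi> z) \<in> A" using assms(1) by (rule A_scale)
  show f: "f \<in> A" unfolding f_def by (rule A_add[OF ep A_const])
  note \<gamma> = \<Gamma>_closed[OF assms(1,1)] and \<gamma>f = \<Gamma>_closed[OF f f] and L\<phi> = L_closed[OF assms(1)]
  have \<Gamma>f: "AE z in \<mu>. \<Gamma> f h z = e * \<Gamma> \<phi> h z" if h: "h \<in> A" for h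
    unfolding f_def using \<Gamma>_add[OF ep A_const h, of x] \<Gamma>_scale[OF assms(1) h, of e] \<Gamma>_const[OF h, of x]
    by eventually_elim simp
  have Lf: "AE z in \<mu>. L f z = e * L \<phi> z"
    unfolding f_def using L_add[OF ep A_const, of x] L_scale[OF assms(1), of e] L_const[of x]
      by eventually_elim simp
  show 1: "AE z in \<mu>. \<Gamma> f f z = e\<^sup>2 * \<Gamma> \<phi> \<phi> z"
    using \<Gamma>f[OF f] \<Gamma>f[OF assms(1)] \<Gamma>_sym[OF f assms(1)] by eventually_elim (simp add: power2_eq_square)
  have eg: "(\<lambda>z. e\<^sup>2 * \<Gamma> \<phi> \<phi> z) \<in> A" using \<gamma> by (rule A_scale)
  have eL: "(\<lambda>z. e * L \<phi> z) \<in> A" using L\<phi> by (rule A_scale)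
  have \<Gamma>ff: "AE z in \<mu>. \<Gamma> (\<Gamma> f f) h z = e\<^sup>2 * \<Gamma> (\<Gamma> \<phi> \<phi>) h z" if h: "h \<in> A" for h
    using \<Gamma>_cong[OF \<gamma>f eg h h 1 AE_I2[OF refl]] \<Gamma>_scale[OF \<gamma> h, of "e\<^sup>2"] by eventually_elim simp
  have \<Gamma>Lf: "AE z in \<mu>. \<Gamma> f (L f) z = e * \<Gamma> f (L \<phi>) z"
    using \<Gamma>_cong[OF f f L_closed[OF f] eL AE_I2[OF refl] Lf] \<Gamma>_scale[OF L\<phi> f, of e] \<Gamma>_sym[OF f eL] \<Gamma>_sym[OF
      f L\<phi>] by eventually_elim simp
  show "AE z in \<mu>. Gamma2 \<Gamma> L f f z = e\<^sup>2 * Gamma2 \<Gamma> L \<phi> \<phi> z"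
    using Gamma2_eq[OF f] Gamma2_eq[OF assms(1)] L_cong[OF \<gamma>f eg 1] L_scale[OF \<gamma>, of "e\<^sup>2"] \<Gamma>Lf \<Gamma>f[OF L\<phi>]
    by eventually_elim algebra
  show "AE z in \<mu>. \<Gamma> f (\<Gamma> f f) z = e * (e\<^sup>2 * \<Gamma> \<phi> (\<Gamma> \<phi> \<phi>) z)"
    using \<Gamma>f[OF \<gamma>f] \<Gamma>_sym[OF assms(1) \<gamma>f] \<Gamma>ff[OF assms(1)] \<Gamma>_sym[OF assms(1) \<gamma>] by eventually_elim simp
  show "AE z in \<mu>. \<Gamma> (\<Gamma> f f) (\<Gamma> f f) z = e\<^sup>2 * (e\<^sup>2 * \<Gamma> (\<Gamma> \<phi> \<phi>) (\<Gamma> \<phi> \<phi>) z)"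
    using \<Gamma>ff[OF \<gamma>f] \<Gamma>_sym[OF \<gamma> \<gamma>f] \<Gamma>ff[OF \<gamma>] by eventually_elim simp
qed

text \<open>Blow-up of \<open>star_ineq_derivative\<close>: it is applied to \<open>x + e \<phi>\<close> with \<open>\<alpha> = \<beta> / e\<^sup>2\<close> as \<open>e \<rightarrow> 0\<close>, and then
  \<open>\<beta>\<close> is chosen at each point so that \<open>\<beta> \<Gamma> \<phi> = y\<close>.\<close>

lemma curvature_of_star:
  assumes C2: "C2_partials I M Mx My Mxx Mxy Myy" and I: "is_interval I"
    and My: "\<forall>x\<in>I. \<forall>y\<ge>0. 0 \<le> My x y"
    and x: "x \<in> interior I" and y: "0 < y" and pos: "0 < My x y" and \<phi>: "\<phi> \<in> A"
    and t0: "0 < t0" and star: "\<And>\<alpha> t. C \<le> \<alpha> \<Longrightarrow> t \<in> {0..t0} \<Longrightarrow> star_ineq \<mu> A \<Gamma> P I M \<rho> t \<alpha>"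
  shows "AE z in \<mu>. 0 < \<Gamma> \<phi> \<phi> z \<longrightarrow> 0 \<le> (Gamma2 \<Gamma> L \<phi> \<phi> z - \<rho> * \<Gamma> \<phi> \<phi> z) * \<Gamma> \<phi> \<phi> z
      + y * Myy x y / (2 * My x y) * \<Gamma> (\<Gamma> \<phi> \<phi>) (\<Gamma> \<phi> \<phi>) z"
proof -
  let ?g2 = "\<lambda>z. Gamma2 \<Gamma> L \<phi> \<phi> z - \<rho> * \<Gamma> \<phi> \<phi> z" and ?\<gamma> = "\<Gamma> \<phi> \<phi>"
  define e where "e n = 1 / (real n + 1)" for n :: nat
  have e0: "0 < e n" for n by (simp add: e_def)
  have e_lim: "e \<longlonglongrightarrow> 0" unfolding e_def using LIMSEQ_ignore_initial_segment[OF lim_1_over_n[where 'a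
    = real], of 1] by (simp add: add.commute)
  obtain \<delta> where \<delta>: "0 < \<delta>" "cball x \<delta> \<subseteq> I" using x unfolding mem_interior_cball by blast
  have sub: "{x - \<delta>..x + \<delta>} \<subseteq> I" using \<delta>(2) by (auto simp: cball_eq_atLeastAtMost)
  have xI: "x \<in> I" using sub \<delta>(1) by auto
  obtain K where K: "\<forall>z\<in>space \<mu>. \<bar>\<phi> z\<bar> \<le> K" using A_bounded[OF \<phi>] by blast
  have "(\<lambda>n. e n * \<bar>K\<bar>) \<longlonglongrightarrow> 0 * \<bar>K\<bar>" by (intro tendsto_intros e_lim)
  then have "\<forall>\<^sub>F n in sequentially. e n * \<bar>K\<bar> < \<delta>" using \<delta>(1) by (auto dest: order_tendstoD(2))
  \<comment> \<open>From \<open>N0\<close> on, the values of \<open>x + e n * \<phi>\<close> stay in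
    a compact neighbourhood of \<open>x\<close> inside \<open>I\<close>, for which \<open>x\<close>
    has to be interior.\<close>
  then obtain N0 where N0: "\<And>n. N0 \<le> n \<Longrightarrow> e n * \<bar>K\<bar> < \<delta>" unfolding eventually_sequentially by blast
  let ?R = "\<lambda>\<beta> n z. My (x + e n * \<phi> z) (\<beta> * ?\<gamma> z) * (2 * \<beta> * ?g2 z - 2 * ((e n)\<^sup>2 * ?\<gamma> z))
     + Mxx (x + e n * \<phi> z) (\<beta> * ?\<gamma> z) * ((e n)\<^sup>2 * ?\<gamma> z) + 2 * Mxy (x + e n * \<phi> z) (\<beta> * ?\<gamma> z) * (\<beta> * (e n *
       \<Gamma> \<phi> ?\<gamma> z))
     + Myy (x + e n * \<phi> z) (\<beta> * ?\<gamma> z) * (\<beta>\<^sup>2 * \<Gamma> ?\<gamma> ?\<gamma> z)"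
  have R: "AE z in \<mu>. 0 \<le> ?R \<beta> n z" if \<beta>: "0 < \<beta>" and n: "N0 \<le> n" "C \<le> \<beta> / (e n)\<^sup>2" for \<beta> n
  proof -
    let ?f = "\<lambda>z. e n * \<phi> z + x" and ?\<alpha> = "\<beta> / (e n)\<^sup>2"
    note aff = Gamma2_affine[OF \<phi>, of "e n" x]
    have range: "?f ` space \<mu> \<subseteq> {x - \<delta>..x + \<delta>}"
    proof safe
      fix z assume z: "z \<in> space \<mu>"
      have "\<bar>e n * \<phi> z\<bar> \<le> e n * \<bar>K\<bar>" unfolding abs_mult using e0[of n] bspec[OF K z] by (intro mult_mono) auto
      then have "\<bar>e n * \<phi> z\<bar> < \<delta>" using N0[OF n(1)] by linarith
      then show "?f z \<in> {x - \<delta>..x + \<delta>}" by auto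
    qed
    have \<alpha>0: "0 \<le> ?\<alpha>" using \<beta> by simp
    have "AE z in \<mu>. 0 \<le> My (?f z) (?\<alpha> * \<Gamma> ?f ?f z) * (2 * ?\<alpha> * (Gamma2 \<Gamma> L ?f ?f z - \<rho> * \<Gamma> ?f ?f z)
      - 2 * \<Gamma> ?f ?f z)
     + Mxx (?f z) (?\<alpha> * \<Gamma> ?f ?f z) * \<Gamma> ?f ?f z + 2 * Mxy (?f z) (?\<alpha> * \<Gamma> ?f ?f z) * (?\<alpha> * \<Gamma> ?f (\<Gamma> ?f ?f) z)
     + Myy (?f z) (?\<alpha> * \<Gamma> ?f ?f z) * (?\<alpha>\<^sup>2 * \<Gamma> (\<Gamma> ?f ?f) (\<Gamma> ?f ?f) z)"
      by (rule star_ineq_derivative[OF C2 I My sub _ aff(1) range \<alpha>0 t0 star[OF n(2)]]) (use \<delta>(1) in auto)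
    with aff(2-5) show ?thesis
    proof eventually_elim
      case (elim z)
      have ee: "e n \<noteq> 0" using e0[of n] by simp
      have 1: "?\<alpha> * ((e n)\<^sup>2 * ?\<gamma> z) = \<beta> * ?\<gamma> z" using ee by simp
      have 2: "2 * ?\<alpha> * ((e n)\<^sup>2 * Gamma2 \<Gamma> L \<phi> \<phi> z - \<rho> * ((e n)\<^sup>2 * ?\<gamma> z)) = 2 * \<beta> * ?g2 z" using ee
        by (simp add: field_simps)
      have 3: "?\<alpha> * (e n * ((e n)\<^sup>2 * \<Gamma> \<phi> ?\<gamma> z)) = \<beta> * (e n * \<Gamma> \<phi> ?\<gamma> z)" using ee by simp
      have 4: "?\<alpha>\<^sup>2 * ((e n)\<^sup>2 * ((e n)\<^sup>2 * \<Gamma> ?\<gamma> ?\<gamma> z)) = \<beta>\<^sup>2 * \<Gamma> ?\<gamma> ?\<gamma> z" using ee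
        by (simp add: power2_eq_square)
      show ?case using elim(5) unfolding elim(1-4) 1 2 3 4 by (simp add: add.commute)
    qed
  qed
  \<comment> \<open>\<beta> will depend on the point through
    \<open>\<beta> * ?\<gamma> z = y\<close>, so a common null set is fixed first, for rational
    \<beta>.\<close>
  have "AE z in \<mu>. \<forall>\<beta>\<in>\<rat>. \<forall>n. 0 < \<beta> \<longrightarrow> N0 \<le> n \<longrightarrow> C \<le> \<beta> / (e n)\<^sup>2 \<longrightarrow> 0 \<le> ?R \<beta> n z"
  proof (rule AE_ball_countable'[OF _ countable_rat])
    fix \<beta> :: real
    show "AE z in \<mu>. \<forall>n. 0 < \<beta> \<longrightarrow> N0 \<le> n \<longrightarrow> C \<le> \<beta> / (e n)\<^sup>2 \<longrightarrow> 0 \<le> ?R \<beta> n z"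
      unfolding AE_all_countable
    proof
      fix n
      show "AE z in \<mu>. 0 < \<beta> \<longrightarrow> N0 \<le> n \<longrightarrow> C \<le> \<beta> / (e n)\<^sup>2 \<longrightarrow> 0 \<le> ?R \<beta> n z"
        by (cases "0 < \<beta> \<and> N0 \<le> n \<and> C \<le> \<beta> / (e n)\<^sup>2") (use R[of \<beta> n] in auto)
    qed
  qed
  with \<Gamma>_nonneg[OF \<phi>] show ?thesis
  proof eventually_elim
    case (elim z)
    have conts: "continuous_on (I \<times> {0..}) (\<lambda>(x, y). My x y)" "continuous_on (I \<times> {0..}) (\<lambda>(x, y). Mxx x y)"
      "continuous_on (I \<times> {0..}) (\<lambda>(x, y). Mxy x y)" "continuous_on (I \<times> {0..}) (\<lambda>(x, y). Myy x y)"
      using C2 unfolding C2_partials_def by blast+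
    have lim_rat: "0 \<le> My x (\<beta> * ?\<gamma> z) * (2 * \<beta> * ?g2 z) + Myy x (\<beta> * ?\<gamma> z) * (\<beta>\<^sup>2 * \<Gamma> ?\<gamma> ?\<gamma> z)"
      if \<beta>: "\<beta> \<in> \<rat>" "0 < \<beta>" for \<beta>
    proof -
      have y0: "0 \<le> \<beta> * ?\<gamma> z" using \<beta> elim(1) by simp
      have xl: "(\<lambda>n. x + e n * \<phi> z) \<longlonglongrightarrow> x"
        using tendsto_add[OF tendsto_const[of x] tendsto_mult[OF e_lim tendsto_const[of "\<phi> z"]]] by simp
      have "\<forall>\<^sub>F n in sequentially. x + e n * \<phi> z \<in> {x - \<delta><..<x + \<delta>}"
        by (rule topological_tendstoD[OF xl]) (use \<delta>(1) in auto)
      then have xin: "\<forall>\<^sub>F n in sequentially. (x + e n * \<phi> z, \<beta> * ?\<gamma> z) \<in> I \<times> {0..}"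
        by eventually_elim (use sub y0 in auto)
      have Gl: "(\<lambda>n. G (x + e n * \<phi> z) (\<beta> * ?\<gamma> z)) \<longlonglongrightarrow> G x (\<beta> * ?\<gamma> z)"
        if "continuous_on (I \<times> {0..}) (\<lambda>(x, y). G x y)" for G :: "real \<Rightarrow> real \<Rightarrow> real"
        using continuous_on_tendsto_compose[OF that tendsto_Pair[OF xl tendsto_const[of "\<beta> * ?\<gamma> z"]] _ xin]
          xI y0 by simp
      have lim: "(\<lambda>n. ?R \<beta> n z) \<longlonglongrightarrow> My x (\<beta> * ?\<gamma> z) * (2 * \<beta> * ?g2 z - 2 * (0\<^sup>2 * ?\<gamma> z))
        + Mxx x (\<beta> * ?\<gamma> z) * (0\<^sup>2 * ?\<gamma> z) + 2 * Mxy x (\<beta> * ?\<gamma> z) * (\<beta> * (0 * \<Gamma> \<phi> ?\<gamma> z)) + Myy x (\<beta> * ?\<gamma> z) *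
          (\<beta>\<^sup>2 * \<Gamma> ?\<gamma> ?\<gamma> z)"
        by (intro tendsto_add tendsto_mult tendsto_diff tendsto_power tendsto_const e_lim Gl conts)
      have "(\<lambda>n. C * (e n)\<^sup>2) \<longlonglongrightarrow> C * 0\<^sup>2" by (intro tendsto_intros e_lim)
      then have "\<forall>\<^sub>F n in sequentially. C * (e n)\<^sup>2 < \<beta>" using \<beta>(2) by (auto dest: order_tendstoD(2))
      then have "\<forall>\<^sub>F n in sequentially. C \<le> \<beta> / (e n)\<^sup>2"
        by eventually_elim (subst pos_le_divide_eq[OF zero_less_power[OF e0]], simp)
      with eventually_ge_at_top[of N0] have "\<forall>\<^sub>F n in sequentially. 0 \<le> ?R \<beta> n z"
        by eventually_elim (use elim(2) \<beta> in blast)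
      from tendsto_lowerbound[OF lim this] show ?thesis by simp
    qed
    show ?case
    proof
      assume \<gamma>: "0 < ?\<gamma> z"
      define b where "b = y / ?\<gamma> z"
      have b: "0 < b" "b * ?\<gamma> z = y" using \<gamma> y by (simp_all add: b_def)
      obtain q where q: "\<And>n. q n \<in> \<rat>" "q \<longlonglongrightarrow> b"
        using Rats_closure_real closure_sequential[of b "\<rat> :: real set"] by auto
      have ql: "(\<lambda>n. q n * ?\<gamma> z) \<longlonglongrightarrow> y" using tendsto_mult[OF q(2) tendsto_const[of "?\<gamma> z"]] b(2) by simp
      have qpos: "\<forall>\<^sub>F n in sequentially. 0 < q n" by (rule order_tendstoD(1)[OF q(2) b(1)])
      then have xin: "\<forall>\<^sub>F n in sequentially. (x, q n * ?\<gamma> z) \<in> I \<times> {0..}"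
        by eventually_elim (use xI \<gamma> in auto)
      have Gl: "(\<lambda>n. G x (q n * ?\<gamma> z)) \<longlonglongrightarrow> G x y" if "continuous_on (I \<times> {0..}) (\<lambda>(x, y). G x y)"
        for G :: "real \<Rightarrow> real \<Rightarrow> real"
        using continuous_on_tendsto_compose[OF that tendsto_Pair[OF tendsto_const[of x] ql] _ xin] xI y
          by simp
      have lim: "(\<lambda>n. My x (q n * ?\<gamma> z) * (2 * q n * ?g2 z) + Myy x (q n * ?\<gamma> z) * ((q n)\<^sup>2 * \<Gamma> ?\<gamma> ?\<gamma> z))
         \<longlonglongrightarrow> My x y * (2 * b * ?g2 z) + Myy x y * (b\<^sup>2 * \<Gamma> ?\<gamma> ?\<gamma> z)"
        by (intro tendsto_add tendsto_mult tendsto_power tendsto_const q(2) Gl conts)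
      have "\<forall>\<^sub>F n in sequentially. 0 \<le> My x (q n * ?\<gamma> z) * (2 * q n * ?g2 z) + Myy x (q n * ?\<gamma> z) * ((q n)\<^sup>2
        * \<Gamma> ?\<gamma> ?\<gamma> z)"
        using qpos by eventually_elim (use lim_rat q(1) in blast)
      from tendsto_lowerbound[OF lim this] have "0 \<le> My x y * (2 * b * ?g2 z) + Myy x y * (b\<^sup>2 * \<Gamma> ?\<gamma> ?\<gamma> z)"
        by simp
      \<comment> \<open>The positive factor is dropped. The remaining coefficient depends on neither
        \<open>\<phi>\<close> nor \<open>z\<close>, as \<open>self_improvement\<close> demands of
        \<kappa>.\<close>
      also have "\<dots> = (2 * My x y * b / ?\<gamma> z) * (?g2 z * ?\<gamma> z + y * Myy x y / (2 * My x y) * \<Gamma> ?\<gamma> ?\<gamma> z)"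
        using \<gamma> pos unfolding b_def by (simp add: power2_eq_square field_simps)
      finally show "0 \<le> ?g2 z * ?\<gamma> z + y * Myy x y / (2 * My x y) * \<Gamma> ?\<gamma> ?\<gamma> z"
        using mult_pos_neg[of "2 * My x y * b / ?\<gamma> z"] pos b(1) \<gamma>
          by (meson divide_pos_pos leD leI mult_pos_pos zero_less_numeral)
    qed
  qed
qed

end

text \<open>The given point may lie on the boundary. Continuity of \<open>My\<close> moves it to an
  interior \<open>x\<close>, which leaves room for perturbations, and to a positive
  \<open>y\<close>, so that \<beta> can be chosen positive with
  \<open>\<beta> * \<Gamma> \<phi> \<phi>\<close> equal to \<open>y\<close>.\<close>

lemma C2_positive_interior_point:
  assumes C2: "C2_partials I M Mx My Mxx Mxy Myy" and I: "is_interval I" "interior I \<noteq> {}"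
    and My: "\<forall>x\<in>I. \<forall>y\<ge>0. 0 \<le> My x y" and ne: "x1 \<in> I" "0 \<le> y1" "My x1 y1 \<noteq> 0"
  shows "\<exists>x\<in>interior I. \<exists>y>0. 0 < My x y"
proof -
  have pos: "0 < My x1 y1" using My ne by (simp add: less_le)
  have cont: "continuous_on (I \<times> {0..}) (\<lambda>(x, y). My x y)" using C2 unfolding C2_partials_def by blast
  have "convex I" using I(1) by (simp add: is_interval_convex_1)
  then have "x1 \<in> closure (interior I)" using convex_closure_interior[OF _ I(2)] ne(1) closure_subset by blast
  then obtain q where q: "\<And>n. q n \<in> interior I" "q \<longlonglongrightarrow> x1" unfolding closure_sequential by blast
  have "(\<lambda>n. y1 + 1 / real (Suc n)) \<longlonglongrightarrow> y1 + 0" by (intro tendsto_intros lim_1_over_n[THEN LIMSEQ_Suc])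
  then have l: "(\<lambda>n. (q n, y1 + 1 / real (Suc n))) \<longlonglongrightarrow> (x1, y1)" by (intro tendsto_Pair q) simp
  have qI: "q n \<in> I" for n using q(1) interior_subset by blast
  have yp: "0 < y1 + 1 / real (Suc n)" for n by (rule add_nonneg_pos[OF ne(2)]) simp
  have "\<forall>\<^sub>F n in sequentially. (q n, y1 + 1 / real (Suc n)) \<in> I \<times> {0..}"
    using qI yp by (intro always_eventually) (simp add: less_imp_le)
  from continuous_on_tendsto_compose[OF cont l _ this] have "(\<lambda>n. My (q n) (y1 + 1 / real (Suc n)))
    \<longlonglongrightarrow> My x1 y1"
    using ne by simp
  from order_tendstoD(1)[OF this pos] obtain n where "0 < My (q n) (y1 + 1 / real (Suc n))"
    unfolding eventually_sequentially by blast
  then show ?thesis using q(1) yp by blast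
qed

theorem theorem3p3:
  fixes \<mu> :: "'a measure"
    and A :: "('a \<Rightarrow> real) set"
    and \<Gamma> :: "('a \<Rightarrow> real) \<Rightarrow> ('a \<Rightarrow> real) \<Rightarrow> 'a \<Rightarrow> real"
    and L :: "('a \<Rightarrow> real) \<Rightarrow> 'a \<Rightarrow> real"
    and P :: "real \<Rightarrow> ('a \<Rightarrow> real) \<Rightarrow> 'a \<Rightarrow> real"
    and \<rho> :: real
    and I :: "real set"
    and M Mx My Mxx Mxy Myy :: "real \<Rightarrow> real \<Rightarrow> real"
  assumes "markov_triple \<mu> A \<Gamma> L P"
    and "is_interval I" and "interior I \<noteq> {}"
    and "C2_partials I M Mx My Mxx Mxy Myy"
    and "\<forall>x\<in>I. \<forall>y\<ge>0. 0 \<le> My x y"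
  shows
    "((\<forall>f\<in>A. AE z in \<mu>. \<rho> * \<Gamma> f f z \<le> Gamma2 \<Gamma> L f f z) \<and>
      (\<forall>x\<in>I. \<forall>y>0. pos_semidef
         (vector [vector [Mxx x y - 2 * My x y, Mxy x y],
                  vector [Mxy x y, Myy x y + My x y / (2 * y)]] :: real^2^2))
      \<longrightarrow>
      (\<forall>t\<ge>0. \<forall>\<alpha>\<ge>0. \<forall>f\<in>A. f ` space \<mu> \<subseteq> I \<longrightarrow>
         (\<forall>s s'. 0 \<le> s \<and> s \<le> s' \<and> s' \<le> t \<longrightarrow>
            (AE z in \<mu>. H_fun \<Gamma> P I M \<rho> t \<alpha> f s z \<le> H_fun \<Gamma> P I M \<rho> t \<alpha> f s' z))) \<and>
      (\<forall>t\<ge>0. \<forall>\<alpha>\<ge>0. star_ineq \<mu> A \<Gamma> P I M \<rho> t \<alpha>))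
     \<and>
     ((\<exists>t\<^sub>o>0. \<exists>C\<ge>0. \<forall>\<alpha>\<ge>C. \<forall>t\<in>{0..t\<^sub>o}. star_ineq \<mu> A \<Gamma> P I M \<rho> t \<alpha>) \<and>
      (\<exists>x\<in>I. \<exists>y\<ge>0. My x y \<noteq> 0)
      \<longrightarrow>
      (\<forall>f\<in>A. AE z in \<mu>. \<rho> * \<Gamma> f f z \<le> Gamma2 \<Gamma> L f f z))"
proof -
  interpret markov_triple \<mu> A \<Gamma> L P by (rule assms(1))
  note I = assms(2,3) and C2 = assms(4) and My = assms(5)
  show ?thesis
  proof (intro conjI impI, goal_cases)
    case 1
    then have CD: "\<forall>f\<in>A. AE z in \<mu>. \<rho> * \<Gamma> f f z \<le> Gamma2 \<Gamma> L f f z" by blast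
    have B: "0 \<le> v * v * (Mxx x y - 2 * My x y) + 2 * (v * w * Mxy x y) + w * w * (Myy x y + My x y / (2 *
      y))"
      if "x \<in> I" "0 < y" for x y v w
      by (rule pos_semidef_2) (use 1 that in blast)
    have "AE z in \<mu>. H_fun \<Gamma> P I M \<rho> t \<alpha> f s z \<le> H_fun \<Gamma> P I M \<rho> t \<alpha> f s' z"
      if "0 \<le> \<alpha>" "f \<in> A" "f ` space \<mu> \<subseteq> I" "0 \<le> s" "s \<le> s'" "s' \<le> t" for t \<alpha> f s s'
      by (rule H_mono[OF CD C2 I My B that(2,3,1,4-6)])
    then show ?case by blast
  next
    case 2
    then have CD: "\<forall>f\<in>A. AE z in \<mu>. \<rho> * \<Gamma> f f z \<le> Gamma2 \<Gamma> L f f z" by blast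
    have B: "0 \<le> v * v * (Mxx x y - 2 * My x y) + 2 * (v * w * Mxy x y) + w * w * (Myy x y + My x y / (2 *
      y))"
      if "x \<in> I" "0 < y" for x y v w
      by (rule pos_semidef_2) (use 2 that in blast)
    show ?case
    proof (intro allI impI)
      fix t \<alpha> :: real assume "0 \<le> t" "0 \<le> \<alpha>"
      then show "star_ineq \<mu> A \<Gamma> P I M \<rho> t \<alpha>"
        by (intro star_ineq_of_H_mono[OF C2 I(1)] H_mono[OF CD C2 I My B]) auto
    qed
  next
    case 3
    then obtain t0 C x1 y1 where star: "0 < t0" "\<And>\<alpha> t. C \<le> \<alpha> \<Longrightarrow> t \<in> {0..t0} \<Longrightarrow> star_ineq \<mu> A \<Gamma> P I M \<rho> t \<alpha>"
      and ne: "x1 \<in> I" "0 \<le> y1" "My x1 y1 \<noteq> 0" by blast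
    \<comment> \<open>Fixed before any function is considered, since \<kappa> must be the same for
      all elements of \<open>A\<close>.\<close>
    obtain x y where xy: "x \<in> interior I" "0 < y" "0 < My x y"
      using C2_positive_interior_point[OF C2 I My ne] by blast
    show ?case
    proof
      fix f assume f: "f \<in> A"
      have "AE z in \<mu>. \<Gamma> (\<Gamma> f f) (\<Gamma> f f) z \<le> 4 * \<Gamma> f f z * (Gamma2 \<Gamma> L f f z - \<rho> * \<Gamma> f f z)"
        by (rule self_improvement[OF f]) (use curvature_of_star[OF C2 I(1) My xy _ star] in blast)
      with \<Gamma>_nonneg[OF f] \<Gamma>_nonneg[OF \<Gamma>_closed[OF f f]] Gamma2_nonneg_at_zero[OF f]
      show "AE z in \<mu>. \<rho> * \<Gamma> f f z \<le> Gamma2 \<Gamma> L f f z"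
      proof eventually_elim
        case (elim z)
        show ?case
        proof (cases "\<Gamma> f f z = 0")
          case False
          then have "0 < 4 * \<Gamma> f f z" using elim(1) by simp
          moreover have "0 \<le> 4 * \<Gamma> f f z * (Gamma2 \<Gamma> L f f z - \<rho> * \<Gamma> f f z)" using elim(2,4) by linarith
          ultimately show ?thesis by (simp add: zero_le_mult_iff)
        qed (use elim(3) in simp)
      qed
    qed
  qed
qed

end
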